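(* If $\exists$Equality-OMv can be solved in time $O(n^{3-\varepsilon})$ for some $\varepsilon>0$, then Bounded Monotone Min-Plus-OMv can be solved in time $O(n^{3-\varepsilon/3}\log n)$ by a randomized algorithm that succeeds with probability at least $1-1/n$.
   Context: Both problems are online: an $n\times n$ matrix $M$ is given for preprocessing, then $n$ query column vectors $v_1,\dots,v_n$ arrive one at a time and the answer to query $j$ must be output before $v_{j+1}$ is received; running time counts preprocessing and all queries. $\exists$Equality-OMv: $M\in\mathbb{Z}^{n\times n}$, $v_j\in\mathbb{Z}^n$, output $u\in\{0,1\}^n$ with $u[i]=1$ iff $\exists k\in[n]$: $M[i,k]=v_j[k]$. Bounded Monotone Min-Plus-OMv: $M\in[n]^{n\times n}$, $v_j\in[n]^n$ (where $[n]=\{1,\dots,n\}$), output $u\in\mathbb{Z}^n$ with $u[i]=\min_{k\in[n]}(M[i,k]+v_j[k])$, under the guarantee that at least one of the following holds: (a) each row of $M$ is nondecreasing; (b) each column of $M$ is nondecreasing; (c) each $v_j$ is nondecreasing ($v_j[k]\le v_j[k+1]$); (d) for every $k$, $v_j[k]\le v_{j+1}[k]$ for all $j$. *)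

theory Defs
  imports
    "HOL-Probability.Probability_Mass_Function"
    "HOL-Library.Landau_Symbols"
    "Jordan_Normal_Form.Matrix"
begin

no_notation Finite_Cartesian_Product.vec_nth (infixl "$" 90)

section \<open>A randomised word RAM\<close>

text \<open>
  The machine model is the usual word RAM, with programs written in a structured language.
  A machine has integer registers and finitely many arrays (the ones named in the program), all
  initially zero. Words are integers \<open>x\<close> with \<open>\<bar>x\<bar> \<le> W\<close>; a computation producing any other
  value faults, and so does an access at a negative index. Every elementary command and every
  test takes one step; expressions have constant size, since a program is a fixed finite object
  that does not depend on the input.
\<close>

datatype binop = Add | Sub | Mul | Div | Mod | And | Or | Xor | Shl | Shr

datatype aexp =
    N int
  | R nat                  (* register *)
  | Rd nat aexp            (* array cell *)
  | Bin binop aexp aexp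

datatype bexp = Less aexp aexp | Equal aexp aexp | Neg bexp | Conj bexp bexp

datatype com =
    SKIP
  | Assign nat aexp
  | Store nat aexp aexp
  | Rand nat aexp          (* uniformly random element of {0..<m}, m the value of the expression *)
  | Seq com com
  | If bexp com com
  | While bexp com

record state =
  regs :: "nat \<Rightarrow> int"
  arrs :: "nat \<Rightarrow> nat \<Rightarrow> int"

fun binop_val :: "binop \<Rightarrow> int \<Rightarrow> int \<Rightarrow> int" where
  "binop_val Add x y = x + y"
| "binop_val Sub x y = x - y"
| "binop_val Mul x y = x * y"
| "binop_val Div x y = x div y"
| "binop_val Mod x y = x mod y"
| "binop_val And x y = Bit_Operations.and x y"
| "binop_val Or x y = Bit_Operations.or x y"
| "binop_val Xor x y = Bit_Operations.xor x y"
| "binop_val Shl x y = push_bit (nat y) x"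
| "binop_val Shr x y = drop_bit (nat y) x"

definition word :: "int \<Rightarrow> int \<Rightarrow> int option" where
  "word W x = (if \<bar>x\<bar> \<le> W then Some x else None)"

fun aval :: "int \<Rightarrow> state \<Rightarrow> aexp \<Rightarrow> int option" where
  "aval W s (N x) = word W x"
| "aval W s (R x) = word W (regs s x)"
| "aval W s (Rd a e) =
     (case aval W s e of None \<Rightarrow> None
      | Some i \<Rightarrow> if i < 0 then None else word W (arrs s a (nat i)))"
| "aval W s (Bin f e1 e2) =
     (case (aval W s e1, aval W s e2) of
        (Some x, Some y) \<Rightarrow> word W (binop_val f x y)
      | _ \<Rightarrow> None)"

fun bval :: "int \<Rightarrow> state \<Rightarrow> bexp \<Rightarrow> bool option" where
  "bval W s (Less e1 e2) =
     (case (aval W s e1, aval W s e2) of (Some x, Some y) \<Rightarrow> Some (x < y) | _ \<Rightarrow> None)"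
| "bval W s (Equal e1 e2) =
     (case (aval W s e1, aval W s e2) of (Some x, Some y) \<Rightarrow> Some (x = y) | _ \<Rightarrow> None)"
| "bval W s (Neg b) = map_option HOL.Not (bval W s b)"
| "bval W s (Conj b1 b2) =
     (case (bval W s b1, bval W s b2) of (Some p, Some q) \<Rightarrow> Some (p \<and> q) | _ \<Rightarrow> None)"

text \<open>
  One step on the command \<open>c\<close> with the commands \<open>cs\<close> still to be executed after it; the outcome
  \<open>None\<close> is a fault.
\<close>

fun step :: "int \<Rightarrow> com \<Rightarrow> com list \<Rightarrow> state \<Rightarrow> (com list \<times> state) option pmf" where
  "step W SKIP cs s = return_pmf (Some (cs, s))"
| "step W (Assign x e) cs s = return_pmf
     (case aval W s e of None \<Rightarrow> None
      | Some y \<Rightarrow> Some (cs, s\<lparr>regs := (regs s)(x := y)\<rparr>))"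
| "step W (Store a e1 e2) cs s = return_pmf
     (case (aval W s e1, aval W s e2) of
        (Some i, Some y) \<Rightarrow>
          if i < 0 then None
          else Some (cs, s\<lparr>arrs := (arrs s)(a := (arrs s a)(nat i := y))\<rparr>)
      | _ \<Rightarrow> None)"
| "step W (Rand x e) cs s =
     (case aval W s e of None \<Rightarrow> return_pmf None
      | Some m \<Rightarrow>
          if m \<le> 0 then return_pmf None
          else map_pmf (\<lambda>y. Some (cs, s\<lparr>regs := (regs s)(x := y)\<rparr>)) (pmf_of_set {0..<m}))"
| "step W (Seq c1 c2) cs s = return_pmf (Some (c1 # c2 # cs, s))"
| "step W (If b c1 c2) cs s = return_pmf
     (case bval W s b of None \<Rightarrow> None
      | Some p \<Rightarrow> Some ((if p then c1 else c2) # cs, s))"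
| "step W (While b c) cs s = return_pmf
     (case bval W s b of None \<Rightarrow> None
      | Some p \<Rightarrow> Some (if p then c # While b c # cs else cs, s))"

text \<open>
  Run with a budget of \<open>t\<close> steps: the outcome is the final state together with the unused part of
  the budget, or \<open>None\<close> if the machine faults or does not halt within the budget.
\<close>

fun exec :: "int \<Rightarrow> nat \<Rightarrow> com list \<Rightarrow> state \<Rightarrow> (state \<times> nat) option pmf" where
  "exec W t [] s = return_pmf (Some (s, t))"
| "exec W 0 (c # cs) s = return_pmf None"
| "exec W (Suc t) (c # cs) s = bind_pmf (step W c cs s)
     (\<lambda>r. case r of None \<Rightarrow> return_pmf None | Some (cs', s') \<Rightarrow> exec W t cs' s')"

fun deterministic :: "com \<Rightarrow> bool" where
  "deterministic (Rand x e) = False"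
| "deterministic (Seq c1 c2) = (deterministic c1 \<and> deterministic c2)"
| "deterministic (If b c1 c2) = (deterministic c1 \<and> deterministic c2)"
| "deterministic (While b c) = deterministic c"
| "deterministic _ = True"


section \<open>Online matrix-vector problems\<close>

text \<open>
  An online algorithm consists of a preprocessing program and a query program, sharing one memory.
  Before preprocessing, register 0 holds \<open>n\<close> and array 0 the matrix in row-major order. Then, for
  each query in turn, the query vector is placed in array 1, the query program is run, and the
  answer is taken from array 2; only after that is the next query vector supplied.
\<close>

record online_alg =
  prep :: com
  query :: com

definition init_state :: "nat \<Rightarrow> int mat \<Rightarrow> state" where
  "init_state n M =
     \<lparr>regs = (\<lambda>_. 0)(0 := int n),
      arrs = (\<lambda>_ _. 0)(0 := (\<lambda>p. if p < n * n then M $$ (p div n, p mod n) else 0))\<rparr>"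

definition put_query :: "nat \<Rightarrow> int vec \<Rightarrow> state \<Rightarrow> state" where
  "put_query n v s =
     s\<lparr>arrs := (arrs s)(1 := (\<lambda>p. if p < n then v $ p else arrs s 1 p))\<rparr>"

definition get_answer :: "nat \<Rightarrow> state \<Rightarrow> int vec" where
  "get_answer n s = vec n (arrs s 2)"

fun serve :: "int \<Rightarrow> com \<Rightarrow> nat \<Rightarrow> nat \<Rightarrow> state \<Rightarrow> int vec list \<Rightarrow> int vec list option pmf" where
  "serve W q n t s [] = return_pmf (Some [])"
| "serve W q n t s (v # vs) = bind_pmf (exec W t [q] (put_query n v s))
     (\<lambda>r. case r of None \<Rightarrow> return_pmf None
       | Some (s', t') \<Rightarrow> map_pmf (map_option ((#) (get_answer n s'))) (serve W q n t' s' vs))"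

text \<open>
  The answers given to the queries \<open>vs\<close>, or \<open>None\<close> if the machine faults or if preprocessing and
  all queries together take more than \<open>t\<close> steps.
\<close>

definition run_online ::
  "int \<Rightarrow> online_alg \<Rightarrow> nat \<Rightarrow> nat \<Rightarrow> int mat \<Rightarrow> int vec list \<Rightarrow> int vec list option pmf" where
  "run_online W A n t M vs = bind_pmf (exec W t [prep A] (init_state n M))
     (\<lambda>r. case r of None \<Rightarrow> return_pmf None
       | Some (s, t') \<Rightarrow> serve W (query A) n t' s vs)"

text \<open>
  The word length is \<open>\<Theta>(log N)\<close>, where \<open>N\<close> bounds \<open>n\<close> and the absolute values of all input numbers,
  so that each input number fits into a word.
\<close>

definition word_bound :: "nat \<Rightarrow> nat \<Rightarrow> int mat \<Rightarrow> int vec list \<Rightarrow> int" where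
  "word_bound c n M vs =
     (Max ({int n} \<union> {\<bar>M $$ (i, k)\<bar> | i k. i < n \<and> k < n}
                   \<union> {\<bar>vs ! j $ k\<bar> | j k. j < length vs \<and> k < n}) + 2) ^ c"

record online_problem =
  instances :: "nat \<Rightarrow> int mat \<Rightarrow> int vec list \<Rightarrow> bool"
  answer :: "nat \<Rightarrow> int mat \<Rightarrow> int vec \<Rightarrow> int vec"

definition solvable_in_time :: "online_problem \<Rightarrow> (nat \<Rightarrow> real) \<Rightarrow> bool" where
  "solvable_in_time P f \<longleftrightarrow>
     (\<exists>A c t. deterministic (prep A) \<and> deterministic (query A) \<and>
        (\<lambda>n. real (t n)) \<in> O(f) \<and>
        (\<forall>n>0. \<forall>M vs. instances P n M vs \<longrightarrow>
           run_online (word_bound c n M vs) A n (t n) M vs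
             = return_pmf (Some (map (answer P n M) vs))))"

text \<open>
  Monte Carlo algorithms: the time bound holds for all random choices, and all answers are correct
  with probability at least \<open>p n\<close>.
\<close>

definition solvable_in_time_with_prob ::
  "online_problem \<Rightarrow> (nat \<Rightarrow> real) \<Rightarrow> (nat \<Rightarrow> real) \<Rightarrow> bool" where
  "solvable_in_time_with_prob P f p \<longleftrightarrow>
     (\<exists>A c t. (\<lambda>n. real (t n)) \<in> O(f) \<and>
        (\<forall>n>0. \<forall>M vs. instances P n M vs \<longrightarrow>
           (let D = run_online (word_bound c n M vs) A n (t n) M vs
            in None \<notin> set_pmf D \<and>
               measure_pmf.prob D {Some (map (answer P n M) vs)} \<ge> p n)))"


section \<open>The two problems\<close>

text \<open>Rows, columns and queries are numbered from 0, so the index set \<open>[n]\<close> becomes \<open>{0..<n}\<close>.\<close>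

definition omv_instance :: "nat \<Rightarrow> int mat \<Rightarrow> int vec list \<Rightarrow> bool" where
  "omv_instance n M vs \<longleftrightarrow>
     M \<in> carrier_mat n n \<and> length vs = n \<and> set vs \<subseteq> carrier_vec n"

definition ex_equality_OMv :: online_problem where
  "ex_equality_OMv =
     \<lparr>instances = omv_instance,
      answer = (\<lambda>n M v. vec n (\<lambda>i. if \<exists>k<n. M $$ (i, k) = v $ k then 1 else 0))\<rparr>"

definition rows_nondecreasing :: "nat \<Rightarrow> int mat \<Rightarrow> bool" where
  "rows_nondecreasing n M \<longleftrightarrow> (\<forall>i<n. \<forall>k. k + 1 < n \<longrightarrow> M $$ (i, k) \<le> M $$ (i, k + 1))"

definition cols_nondecreasing :: "nat \<Rightarrow> int mat \<Rightarrow> bool" where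
  "cols_nondecreasing n M \<longleftrightarrow> (\<forall>k<n. \<forall>i. i + 1 < n \<longrightarrow> M $$ (i, k) \<le> M $$ (i + 1, k))"

definition queries_nondecreasing :: "nat \<Rightarrow> int vec list \<Rightarrow> bool" where
  "queries_nondecreasing n vs \<longleftrightarrow>
     (\<forall>j<n. \<forall>k. k + 1 < n \<longrightarrow> vs ! j $ k \<le> vs ! j $ (k + 1))"

definition queries_nondecreasing_in_time :: "nat \<Rightarrow> int vec list \<Rightarrow> bool" where
  "queries_nondecreasing_in_time n vs \<longleftrightarrow>
     (\<forall>k<n. \<forall>j. j + 1 < n \<longrightarrow> vs ! j $ k \<le> vs ! (j + 1) $ k)"

definition bounded_monotone_instance :: "nat \<Rightarrow> int mat \<Rightarrow> int vec list \<Rightarrow> bool" where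
  "bounded_monotone_instance n M vs \<longleftrightarrow>
     omv_instance n M vs \<and>
     (\<forall>i<n. \<forall>k<n. M $$ (i, k) \<in> {1..int n}) \<and>
     (\<forall>j<n. \<forall>k<n. vs ! j $ k \<in> {1..int n}) \<and>
     (rows_nondecreasing n M \<or> cols_nondecreasing n M \<or>
      queries_nondecreasing n vs \<or> queries_nondecreasing_in_time n vs)"

definition bounded_monotone_min_plus_OMv :: online_problem where
  "bounded_monotone_min_plus_OMv =
     \<lparr>instances = bounded_monotone_instance,
      answer = (\<lambda>n M v. vec n (\<lambda>i. Min {M $$ (i, k) + v $ k | k. k < n}))\<rparr>"

end

theory Submission
  imports Defs "HOL-Real_Asymp.Real_Asymp"
begin

text \<open>
  Pad the columns to a power of two \<open>N\<close> and fix a radius \<open>D\<close>. Call \<open>k\<close> near-optimal for row \<open>i\<close> and query \<open>v\<close> if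
  \<open>M[i,k] + v[k]\<close> exceeds the minimum \<open>u\<close> by at most \<open>2D\<close>. If more than \<open>N / D\<close> columns are near-optimal, then one of
  \<open>O(D log n)\<close> random columns \<open>c\<close> is, with high probability, and \<open>u = M[i,c] + v[c] - d\<close> for some \<open>d \<le> 2D\<close>. This is
  detected by the equality instance with matrix \<open>M[i,k] - M[i,c]\<close> and query \<open>v[c] - v[k] - d\<close>. Otherwise a capped
  branch and bound search over a binary tree of columns lists the near-optimal columns; its lower bounds are
  accurate up to \<open>D\<close> at all but \<open>O(N / D)\<close> nodes by monotonicity, or because they come from an outdated copy of the
  sums that is refreshed only when an entry has moved by more than \<open>D\<close>.

  The best radius depends on \<open>\<epsilon>\<close>, which the program cannot know: it starts from \<open>D\<close> near the cube root of \<open>n\<close> and halves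
  \<open>D\<close> whenever the simulated equality algorithms have used up their share of the time. Writing the answers
  takes time \<open>n\<^sup>2 - n\<close>, so \<open>\<epsilon> \<le> 1\<close> and the starting radius is large enough.
\<close>

abbreviation set_reg :: "state \<Rightarrow> nat \<Rightarrow> int \<Rightarrow> state" where
  "set_reg s x v \<equiv> s\<lparr>regs := (regs s)(x := v)\<rparr>"

abbreviation set_cell :: "state \<Rightarrow> nat \<Rightarrow> nat \<Rightarrow> int \<Rightarrow> state" where
  "set_cell s a p v \<equiv> s\<lparr>arrs := (arrs s)(a := (arrs s a)(p := v))\<rparr>"

section \<open>Big-step semantics with step counts\<close>

inductive big_step :: "int \<Rightarrow> com \<Rightarrow> state \<Rightarrow> state \<Rightarrow> nat \<Rightarrow> bool" for W where
  Skip: "big_step W SKIP s s 1"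
| Assign: "aval W s e = Some y \<Longrightarrow> big_step W (Assign x e) s (set_reg s x y) 1"
| Store: "aval W s e1 = Some i \<Longrightarrow> aval W s e2 = Some y \<Longrightarrow> 0 \<le> i \<Longrightarrow>
    big_step W (Store a e1 e2) s (set_cell s a (nat i) y) 1"
| Seq: "big_step W c1 s s1 t1 \<Longrightarrow> big_step W c2 s1 s2 t2 \<Longrightarrow>
    big_step W (Seq c1 c2) s s2 (Suc (t1 + t2))"
| IfTrue: "bval W s b = Some True \<Longrightarrow> big_step W c1 s s' t \<Longrightarrow> big_step W (If b c1 c2) s s' (Suc t)"
| IfFalse: "bval W s b = Some False \<Longrightarrow> big_step W c2 s s' t \<Longrightarrow> big_step W (If b c1 c2) s s' (Suc t)"
| WhileFalse: "bval W s b = Some False \<Longrightarrow> big_step W (While b c) s s 1"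
| WhileTrue: "bval W s b = Some True \<Longrightarrow> big_step W c s s1 t1 \<Longrightarrow>
    big_step W (While b c) s1 s2 t2 \<Longrightarrow> big_step W (While b c) s s2 (Suc (t1 + t2))"

inductive_cases SeqE: "big_step W (Seq c1 c2) s s' t"
inductive_cases AssignE: "big_step W (Assign x e) s s' t"

lemma exec_big_step: "big_step W c s s' t \<Longrightarrow> exec W (t + r) (c # cs) s = exec W r cs s'"
proof (induction arbitrary: r cs rule: big_step.induct)
  case (Seq c1 s s1 t1 c2 s2 t2)
  have "exec W (Suc (t1 + t2) + r) (Seq c1 c2 # cs) s = exec W (t1 + (t2 + r)) (c1 # c2 # cs) s"
    by (simp add: bind_return_pmf add.assoc)
  then show ?case using Seq.IH by simp
next
  case (WhileTrue s b c s1 t1 s2 t2)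
  have "exec W (Suc (t1 + t2) + r) (While b c # cs) s
      = exec W (t1 + (t2 + r)) (c # While b c # cs) s"
    using WhileTrue.hyps by (simp add: bind_return_pmf add.assoc)
  then show ?case using WhileTrue.IH by simp
qed (simp_all add: bind_return_pmf)

lemma exec_big_step_le:
  "big_step W c s s' t \<Longrightarrow> t \<le> T \<Longrightarrow> exec W T (c # cs) s = exec W (T - t) cs s'"
  using exec_big_step[of W c s s' t "T - t" cs] by simp

inductive big_steps :: "int \<Rightarrow> com list \<Rightarrow> state \<Rightarrow> state \<Rightarrow> nat \<Rightarrow> bool" for W where
  Nil: "big_steps W [] s s 0"
| Cons: "big_step W c s s1 t1 \<Longrightarrow> big_steps W cs s1 s2 t2 \<Longrightarrow> big_steps W (c # cs) s s2 (t1 + t2)"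

inductive_cases big_steps_ConsE: "big_steps W (c # cs) s s' t"

lemma big_steps_of_exec:
  "list_all deterministic cs \<Longrightarrow> None \<notin> set_pmf (exec W T cs s) \<Longrightarrow>
   \<exists>s' t. big_steps W cs s s' t \<and> t \<le> T"
proof (induction W T cs s rule: exec.induct)
  case (1 W t s)
  then show ?case using big_steps.Nil by blast
next
  case (3 W t c cs s)
  have rest: "\<exists>s' t'. big_steps W cs' s1 s' t' \<and> t' \<le> t"
    if "step W c cs s = return_pmf (Some (cs', s1))" "list_all deterministic cs'" for cs' s1
    using 3(1)[of "Some (cs', s1)" "(cs', s1)" cs' s1] 3(3) that by (auto simp: bind_return_pmf)
  show ?case
  proof (cases c)
    case SKIP
    then show ?thesis using rest[of cs s] 3(2) big_steps.Cons[OF big_step.Skip] by fastforce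
  next
    case (Assign x e)
    then obtain y where "aval W s e = Some y"
      using 3(3) by (cases "aval W s e") (auto simp: bind_return_pmf)
    then show ?thesis using Assign rest[of cs] 3(2) big_steps.Cons[OF big_step.Assign] by fastforce
  next
    case (Store a e1 e2)
    then obtain i y where "aval W s e1 = Some i" "aval W s e2 = Some y" "0 \<le> i"
      using 3(3) by (cases "aval W s e1"; cases "aval W s e2")
        (auto simp: bind_return_pmf split: if_splits)
    then show ?thesis using Store rest[of cs] 3(2) big_steps.Cons[OF big_step.Store] by fastforce
  next
    case (Rand x e)
    then show ?thesis using 3(2) by simp
  next
    case (Seq c1 c2)
    then obtain s' t' where "big_steps W (c1 # c2 # cs) s s' t'" "t' \<le> t"
      using rest[of "c1 # c2 # cs" s] 3(2) by auto
    then obtain s1 s2 t1 t2 t3 where "big_step W c1 s s1 t1" "big_step W c2 s1 s2 t2"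
      "big_steps W cs s2 s' t3" "t1 + t2 + t3 \<le> t"
      by (auto elim!: big_steps_ConsE simp: add.assoc)
    then have "big_steps W (Seq c1 c2 # cs) s s' (Suc (t1 + t2) + t3)"
      by (blast intro: big_step.Seq big_steps.Cons)
    then show ?thesis using Seq \<open>t1 + t2 + t3 \<le> t\<close> by fastforce
  next
    case (If b c1 c2)
    obtain p where p: "bval W s b = Some p"
      using If 3(3) by (cases "bval W s b") (auto simp: bind_return_pmf)
    then obtain s' t' where "big_steps W ((if p then c1 else c2) # cs) s s' t'" "t' \<le> t"
      using If rest[of "(if p then c1 else c2) # cs" s] 3(2) by (cases p) auto
    then show ?thesis using If p
      by (fastforce elim!: big_steps_ConsE split: if_splits
        dest: big_step.IfTrue big_step.IfFalse intro: big_steps.Cons)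
  next
    case (While b d)
    obtain p where p: "bval W s b = Some p"
      using While 3(3) by (cases "bval W s b") (auto simp: bind_return_pmf)
    show ?thesis
    proof (cases p)
      case False
      then show ?thesis
        using While p rest[of cs s] 3(2) big_steps.Cons[OF big_step.WhileFalse] by fastforce
    next
      case True
      then obtain s' t' where "big_steps W (d # While b d # cs) s s' t'" "t' \<le> t"
        using While p rest[of "d # While b d # cs" s] 3(2) by auto
      then obtain s1 s2 t1 t2 t3 where "big_step W d s s1 t1" "big_step W (While b d) s1 s2 t2"
        "big_steps W cs s2 s' t3" "t1 + t2 + t3 \<le> t"
        by (auto elim!: big_steps_ConsE simp: add.assoc)
      moreover have "bval W s b = Some True" using p True by simp
      ultimately have "big_steps W (While b d # cs) s s' (Suc (t1 + t2) + t3)"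
        by (blast intro: big_step.WhileTrue big_steps.Cons)
      then show ?thesis using While \<open>t1 + t2 + t3 \<le> t\<close> by fastforce
    qed
  qed
qed simp

lemma big_step_of_exec:
  assumes "deterministic c" "None \<notin> set_pmf (exec W T [c] s)"
  obtains s' t where "big_step W c s s' t" "t \<le> T"
  using big_steps_of_exec[of "[c]" W T s] assms by (fastforce elim: big_steps_ConsE)

lemma map_pmf_eq_return_pmfD:
  assumes "map_pmf f p = return_pmf y" "inj f"
  obtains x where "p = return_pmf x" "f x = y"
proof -
  have "f ` set_pmf p = {y}"
    using arg_cong[OF assms(1), of set_pmf] by simp
  then obtain x where "f x = y" "set_pmf p \<subseteq> {x}"
    using assms(2) by (metis (no_types, lifting) image_eqI imageE insertI1 inj_image_subset_iff
        image_insert image_empty subsetI)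
  then show thesis using that by (simp add: set_pmf_subset_singleton)
qed

definition query_trace ::
  "int \<Rightarrow> com \<Rightarrow> nat \<Rightarrow> int vec list \<Rightarrow> (nat \<Rightarrow> state) \<Rightarrow> (nat \<Rightarrow> nat) \<Rightarrow> int vec list \<Rightarrow> bool" where
  "query_trace W q n vs st \<tau> as \<longleftrightarrow> length as = length vs \<and>
     (\<forall>j<length vs. big_step W q (put_query n (vs ! j) (st j)) (st (Suc j)) (\<tau> j) \<and>
        get_answer n (st (Suc j)) = as ! j)"

lemma query_trace_Cons:
  assumes "big_step W q (put_query n v s) (st 0) t" "query_trace W q n vs st \<tau> as"
  shows "query_trace W q n (v # vs) (case_nat s st) (case_nat t \<tau>) (get_answer n (st 0) # as)"
  using assms by (auto simp: query_trace_def less_Suc_eq_0_disj)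

lemma serve_trace:
  assumes "deterministic q" "serve W q n T s vs = return_pmf (Some as)"
  shows "\<exists>st \<tau>. st 0 = s \<and> query_trace W q n vs st \<tau> as \<and> (\<Sum>j<length vs. \<tau> j) \<le> T"
  using assms(2)
proof (induction vs arbitrary: T s as)
  case Nil
  then show ?case by (auto simp: query_trace_def return_pmf_inj intro!: exI[of _ "\<lambda>_. s"])
next
  case (Cons v vs)
  have "None \<notin> set_pmf (serve W q n T s (v # vs))"
    unfolding Cons.prems by simp
  then have "None \<notin> set_pmf (exec W T [q] (put_query n v s))"
    by force
  then obtain s' t where first: "big_step W q (put_query n v s) s' t" "t \<le> T"
    using big_step_of_exec assms(1) by blast
  have "map_pmf (map_option ((#) (get_answer n s'))) (serve W q n (T - t) s' vs)
      = return_pmf (Some as)"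
    using Cons.prems exec_big_step_le[OF first] by (simp add: bind_return_pmf)
  then obtain r where "serve W q n (T - t) s' vs = return_pmf r"
    "map_option ((#) (get_answer n s')) r = Some as"
    using map_pmf_eq_return_pmfD[of "map_option ((#) (get_answer n s'))"]
    by (metis (mono_tags, lifting) injI list.inject option.inj_map)
  then obtain as' where rest: "serve W q n (T - t) s' vs = return_pmf (Some as')"
    and as: "as = get_answer n s' # as'"
    by auto
  obtain st \<tau> where trace: "st 0 = s'" "query_trace W q n vs st \<tau> as'"
    "(\<Sum>j<length vs. \<tau> j) \<le> T - t"
    using Cons.IH[OF rest] by blast
  have "query_trace W q n (v # vs) (case_nat s st) (case_nat t \<tau>) as"
    using query_trace_Cons[OF _ trace(2), of v s t] first trace(1) as by simp
  moreover have "(\<Sum>j<length (v # vs). case_nat t \<tau> j) = t + (\<Sum>j<length vs. \<tau> j)"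
    by (simp only: length_Cons sum.lessThan_Suc_shift) simp
  ultimately show ?case
    using trace(3) first(2) by (intro exI[of _ "case_nat s st"] exI[of _ "case_nat t \<tau>"]) simp
qed

lemma run_online_trace:
  assumes "deterministic (prep A)" "deterministic (query A)"
    and run: "run_online W A n T M vs = return_pmf (Some as)"
  obtains st \<tau> t where "big_step W (prep A) (init_state n M) (st 0) t"
    "query_trace W (query A) n vs st \<tau> as" "t + (\<Sum>j<length vs. \<tau> j) \<le> T"
proof -
  have "None \<notin> set_pmf (run_online W A n T M vs)"
    unfolding run by simp
  then have "None \<notin> set_pmf (exec W T [prep A] (init_state n M))"
    unfolding run_online_def by force
  then obtain s t where pre: "big_step W (prep A) (init_state n M) s t" "t \<le> T"
    using big_step_of_exec assms(1) by blast
  have "serve W (query A) n (T - t) s vs = return_pmf (Some as)"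
    using run exec_big_step_le[OF pre] by (simp add: run_online_def bind_return_pmf)
  from serve_trace[OF assms(2) this] obtain st \<tau> where "st 0 = s"
    "query_trace W (query A) n vs st \<tau> as" "(\<Sum>j<length vs. \<tau> j) \<le> T - t" by blast
  then show thesis using that[of st t \<tau>] pre by simp
qed

lemma card_changed_cells:
  "big_step W c s s' t \<Longrightarrow>
   finite {p. arrs s' a p \<noteq> arrs s a p} \<and> card {p. arrs s' a p \<noteq> arrs s a p} \<le> t"
proof (induction rule: big_step.induct)
  have comp: "finite {p. arrs s2 a p \<noteq> arrs s a p} \<and>
      card {p. arrs s2 a p \<noteq> arrs s a p} \<le> Suc (t1 + t2)"
    if "finite {p. arrs s1 a p \<noteq> arrs s a p} \<and> card {p. arrs s1 a p \<noteq> arrs s a p} \<le> t1"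
      "finite {p. arrs s2 a p \<noteq> arrs s1 a p} \<and> card {p. arrs s2 a p \<noteq> arrs s1 a p} \<le> t2"
    for s s1 s2 t1 t2
  proof -
    have sub: "{p. arrs s2 a p \<noteq> arrs s a p} \<subseteq>
        {p. arrs s1 a p \<noteq> arrs s a p} \<union> {p. arrs s2 a p \<noteq> arrs s1 a p}" by auto
    have "card {p. arrs s2 a p \<noteq> arrs s a p} \<le>
        card {p. arrs s1 a p \<noteq> arrs s a p} + card {p. arrs s2 a p \<noteq> arrs s1 a p}"
      using sub that by (meson card_Un_le card_mono finite_UnI le_trans)
    then show ?thesis using that sub finite_subset by fastforce
  qed
  {
    case (Seq c1 s s1 t1 c2 s2 t2)
    then show ?case by (intro comp)
  next
    case (WhileTrue s b c s1 t1 s2 t2)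
    then show ?case by (intro comp)
  next
    case (Store s e1 i e2 y b)
    have "{p. arrs (set_cell s b (nat i) y) a p \<noteq> arrs s a p} \<subseteq> {nat i}"
      by (auto split: if_splits)
    from finite_subset[OF this] card_mono[OF _ this] show ?case by simp
  }
qed auto

lemma aval_mono: "aval W s e = Some v \<Longrightarrow> W \<le> W' \<Longrightarrow> aval W' s e = Some v"
  by (induction e arbitrary: v) (auto simp: word_def split: option.splits if_splits)

lemma bval_mono: "bval W s b = Some v \<Longrightarrow> W \<le> W' \<Longrightarrow> bval W' s b = Some v"
proof (induction b arbitrary: v)
  case (Less e1 e2)
  then obtain x y where "aval W s e1 = Some x" "aval W s e2 = Some y" by (auto split: option.splits)
  then show ?case using Less aval_mono[of W s _ _ W'] by simp
next
  case (Equal e1 e2)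
  then obtain x y where "aval W s e1 = Some x" "aval W s e2 = Some y" by (auto split: option.splits)
  then show ?case using Equal aval_mono[of W s _ _ W'] by simp
qed (auto split: option.splits)

lemma big_step_mono: "big_step W c s s' t \<Longrightarrow> W \<le> W' \<Longrightarrow> big_step W' c s s' t"
  by (induction rule: big_step.induct) (blast intro: big_step.intros aval_mono bval_mono)+

lemma aval_le: "aval W s e = Some x \<Longrightarrow> \<bar>x\<bar> \<le> W"
  by (cases e) (auto simp: word_def split: option.splits if_splits)

section \<open>Total correctness for states with bounded entries\<close>

fun aeval :: "state \<Rightarrow> aexp \<Rightarrow> int" where
  "aeval s (N x) = x"
| "aeval s (R x) = regs s x"
| "aeval s (Rd a e) = arrs s a (nat (aeval s e))"
| "aeval s (Bin f e1 e2) = binop_val f (aeval s e1) (aeval s e2)"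

fun beval :: "state \<Rightarrow> bexp \<Rightarrow> bool" where
  "beval s (Less e1 e2) = (aeval s e1 < aeval s e2)"
| "beval s (Equal e1 e2) = (aeval s e1 = aeval s e2)"
| "beval s (Neg b) = (\<not> beval s b)"
| "beval s (Conj b1 b2) = (beval s b1 \<and> beval s b2)"

fun leaves :: "aexp \<Rightarrow> nat" where
  "leaves (N x) = 1"
| "leaves (R x) = 1"
| "leaves (Rd a e) = leaves e"
| "leaves (Bin f e1 e2) = leaves e1 + leaves e2"

fun asafe :: "int \<Rightarrow> state \<Rightarrow> aexp \<Rightarrow> bool" where
  "asafe B s (N x) = (\<bar>x\<bar> \<le> B)"
| "asafe B s (R x) = True"
| "asafe B s (Rd a e) = (asafe B s e \<and> 0 \<le> aeval s e)"
| "asafe B s (Bin f e1 e2) =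
     ((f \<in> {Add, Sub, Mul} \<or> f \<in> {Div, Mod} \<and> 0 < aeval s e2) \<and> asafe B s e1 \<and> asafe B s e2)"

text \<open>
  If all entries of the state are at most \<open>B\<close> in absolute value, then the value of an expression
  with \<open>m\<close> leaves is at most \<open>B ^ m\<close>; so word length \<open>B ^ 16\<close> suffices for 16 leaves.
\<close>

fun bsafe :: "int \<Rightarrow> state \<Rightarrow> bexp \<Rightarrow> bool" where
  "bsafe B s (Less e1 e2) = (asafe B s e1 \<and> asafe B s e2 \<and> leaves e1 \<le> 16 \<and> leaves e2 \<le> 16)"
| "bsafe B s (Equal e1 e2) = (asafe B s e1 \<and> asafe B s e2 \<and> leaves e1 \<le> 16 \<and> leaves e2 \<le> 16)"
| "bsafe B s (Neg b) = bsafe B s b"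
| "bsafe B s (Conj b1 b2) = (bsafe B s b1 \<and> bsafe B s b2)"

definition fits :: "int \<Rightarrow> state \<Rightarrow> bool" where
  "fits B s \<longleftrightarrow> (\<forall>r. \<bar>regs s r\<bar> \<le> B) \<and> (\<forall>a p. \<bar>arrs s a p\<bar> \<le> B)"

lemma fits_regs: "fits B s \<Longrightarrow> \<bar>regs s r\<bar> \<le> B"
  and fits_arrs: "fits B s \<Longrightarrow> \<bar>arrs s a p\<bar> \<le> B"
  by (auto simp: fits_def)

lemma fits_set_reg: "fits B s \<Longrightarrow> \<bar>y\<bar> \<le> B \<Longrightarrow> fits B (set_reg s x y)"
  and fits_set_cell: "fits B s \<Longrightarrow> \<bar>y\<bar> \<le> B \<Longrightarrow> fits B (set_cell s a p y)"
  by (auto simp: fits_def)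

lemma leaves_pos: "1 \<le> leaves e"
  by (induction e) auto

lemma power_add_bound:
  fixes B :: int
  assumes "2 \<le> B" "1 \<le> a" "1 \<le> b"
  shows "B ^ a + B ^ b \<le> B ^ (a + b)"
proof -
  have "B ^ 1 \<le> B ^ a" "B ^ 1 \<le> B ^ b"
    using assms by (intro power_increasing; simp)+
  then have "1 * 1 \<le> (B ^ a - 1) * (B ^ b - 1)"
    using assms by (intro mult_mono) auto
  then show ?thesis unfolding power_add by (simp add: left_diff_distrib right_diff_distrib)
qed

lemma abs_div_le: "0 < y \<Longrightarrow> \<bar>x div y\<bar> \<le> \<bar>x :: int\<bar>"
  using zdiv_mono2[of x 1 y] zdiv_mono2_neg[of x 1 y] pos_imp_zdiv_nonneg_iff[of y x]
  by (cases "0 \<le> x") auto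

lemma abs_mod_le: "0 < y \<Longrightarrow> \<bar>x mod y\<bar> \<le> \<bar>x\<bar> + \<bar>y :: int\<bar>"
  using pos_mod_bound[of y x] pos_mod_sign[of y x] by linarith

lemma abs_binop_val_le:
  assumes "f \<in> {Add, Sub, Mul} \<or> f \<in> {Div, Mod} \<and> 0 < y" "\<bar>x\<bar> \<le> a" "\<bar>y\<bar> \<le> b" "1 \<le> a" "1 \<le> b"
    and "a + b \<le> c" "a * b \<le> c"
  shows "\<bar>binop_val f x y\<bar> \<le> c"
proof -
  have "\<bar>x * y\<bar> \<le> c"
    using mult_mono[of "\<bar>x\<bar>" a "\<bar>y\<bar>" b] assms by (simp add: abs_mult)
  then show ?thesis
    using assms abs_div_le[of y x] abs_mod_le[of y x] by auto
qed

lemma aval_eq_aeval: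
  assumes "fits B s" "2 \<le> B"
  shows "asafe B s e \<Longrightarrow> B ^ leaves e \<le> W \<Longrightarrow>
    aval W s e = Some (aeval s e) \<and> \<bar>aeval s e\<bar> \<le> B ^ leaves e"
proof (induction e)
  case (Rd a e)
  have "B ^ 1 \<le> B ^ leaves e" using leaves_pos[of e] assms by (intro power_increasing) auto
  then show ?case using Rd fits_arrs[OF assms(1), of a "nat (aeval s e)"] by (auto simp: word_def)
next
  case (Bin f e1 e2)
  have sum: "B ^ leaves e1 + B ^ leaves e2 \<le> B ^ (leaves e1 + leaves e2)"
    using power_add_bound assms leaves_pos by blast
  have pos: "1 \<le> B ^ leaves e1" "1 \<le> B ^ leaves e2" using assms by auto
  have IH: "aval W s e1 = Some (aeval s e1)" "\<bar>aeval s e1\<bar> \<le> B ^ leaves e1"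
    "aval W s e2 = Some (aeval s e2)" "\<bar>aeval s e2\<bar> \<le> B ^ leaves e2"
    using Bin sum pos by auto
  have "\<bar>binop_val f (aeval s e1) (aeval s e2)\<bar> \<le> B ^ (leaves e1 + leaves e2)"
    by (rule abs_binop_val_le[OF _ IH(2,4) pos sum]) (use Bin.prems in \<open>auto simp: power_add\<close>)
  then show ?case using IH Bin.prems by (simp add: word_def)
next
  case (R x)
  then show ?case using fits_regs[OF assms(1), of x] by (simp add: word_def)
qed (use assms in \<open>auto simp: word_def\<close>)

definition frame :: "nat set \<Rightarrow> nat set \<Rightarrow> state \<Rightarrow> state \<Rightarrow> bool" where
  "frame X Y s s' \<longleftrightarrow> (\<forall>r. r \<notin> X \<longrightarrow> regs s' r = regs s r) \<and> (\<forall>a. a \<notin> Y \<longrightarrow> arrs s' a = arrs s a)"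

lemma frame_refl [simp]: "frame X Y s s"
  by (simp add: frame_def)

lemma frame_trans: "frame X Y s s1 \<Longrightarrow> frame X Y s1 s2 \<Longrightarrow> frame X Y s s2"
  by (simp add: frame_def)

lemma frame_mono: "frame X Y s s' \<Longrightarrow> X \<subseteq> X' \<Longrightarrow> Y \<subseteq> Y' \<Longrightarrow> frame X' Y' s s'"
  by (auto simp: frame_def)

lemma frame_regs: "frame X Y s s' \<Longrightarrow> r \<notin> X \<Longrightarrow> regs s' r = regs s r"
  and frame_arrs: "frame X Y s s' \<Longrightarrow> a \<notin> Y \<Longrightarrow> arrs s' a = arrs s a"
  by (auto simp: frame_def)

fun mod_regs :: "com \<Rightarrow> nat set" where
  "mod_regs (Assign x e) = {x}"
| "mod_regs (Rand x e) = {x}"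
| "mod_regs (Seq c1 c2) = mod_regs c1 \<union> mod_regs c2"
| "mod_regs (If b c1 c2) = mod_regs c1 \<union> mod_regs c2"
| "mod_regs (While b c) = mod_regs c"
| "mod_regs _ = {}"

fun mod_arrs :: "com \<Rightarrow> nat set" where
  "mod_arrs (Store a e1 e2) = {a}"
| "mod_arrs (Seq c1 c2) = mod_arrs c1 \<union> mod_arrs c2"
| "mod_arrs (If b c1 c2) = mod_arrs c1 \<union> mod_arrs c2"
| "mod_arrs (While b c) = mod_arrs c"
| "mod_arrs _ = {}"

abbreviation framed :: "com \<Rightarrow> state \<Rightarrow> state \<Rightarrow> bool" where
  "framed c \<equiv> frame (mod_regs c) (mod_arrs c)"

lemma big_step_framed: "big_step W c s s' t \<Longrightarrow> framed c s s'"
  by (induction rule: big_step.induct) (auto simp: frame_def)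

text \<open>Loop-free deterministic programs are executed symbolically by simplification.\<close>

fun effect :: "com \<Rightarrow> state \<Rightarrow> state" where
  "effect (Assign x e) s = set_reg s x (aeval s e)"
| "effect (Store a e1 e2) s = set_cell s a (nat (aeval s e1)) (aeval s e2)"
| "effect (Seq c1 c2) s = effect c2 (effect c1 s)"
| "effect (If b c1 c2) s = (if beval s b then effect c1 s else effect c2 s)"
| "effect _ s = s"

fun cost :: "com \<Rightarrow> state \<Rightarrow> nat" where
  "cost (Seq c1 c2) s = Suc (cost c1 s + cost c2 (effect c1 s))"
| "cost (If b c1 c2) s = Suc (if beval s b then cost c1 s else cost c2 s)"
| "cost _ s = 1"

fun safe :: "int \<Rightarrow> com \<Rightarrow> state \<Rightarrow> bool" where
  "safe B SKIP s = True"
| "safe B (Assign x e) s = (asafe B s e \<and> leaves e \<le> 16 \<and> \<bar>aeval s e\<bar> \<le> B)"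
| "safe B (Store a e1 e2) s =
     (asafe B s e1 \<and> leaves e1 \<le> 16 \<and> 0 \<le> aeval s e1 \<and>
      asafe B s e2 \<and> leaves e2 \<le> 16 \<and> \<bar>aeval s e2\<bar> \<le> B)"
| "safe B (Seq c1 c2) s = (safe B c1 s \<and> safe B c2 (effect c1 s))"
| "safe B (If b c1 c2) s = (bsafe B s b \<and> (if beval s b then safe B c1 s else safe B c2 s))"
| "safe B _ s = False"

locale word_ram =
  fixes W B :: int
  assumes B_ge_2: "2 \<le> B" and B_power_le_W: "B ^ 16 \<le> W"
begin

definition wp :: "com \<Rightarrow> state \<Rightarrow> (state \<Rightarrow> nat \<Rightarrow> bool) \<Rightarrow> bool" where
  "wp c s Q \<longleftrightarrow> (fits B s \<longrightarrow> (\<exists>s' t. big_step W c s s' t \<and> fits B s' \<and> Q s' t))"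

lemma aval_safe:
  assumes "fits B s" "asafe B s e" "leaves e \<le> 16"
  shows "aval W s e = Some (aeval s e)"
proof -
  have "B ^ leaves e \<le> W"
    using power_increasing[of "leaves e" 16 B] assms(3) B_ge_2 B_power_le_W by linarith
  then show ?thesis using aval_eq_aeval[OF assms(1) B_ge_2 assms(2)] by blast
qed

lemma bval_safe: "fits B s \<Longrightarrow> bsafe B s b \<Longrightarrow> bval W s b = Some (beval s b)"
  by (induction b) (simp_all add: aval_safe)

lemma big_step_safe:
  "fits B s \<Longrightarrow> safe B c s \<Longrightarrow> big_step W c s (effect c s) (cost c s) \<and> fits B (effect c s)"
proof (induction c arbitrary: s)
  case (Assign x e)
  then show ?case using big_step.Assign[of W s e] by (simp add: aval_safe fits_set_reg)
next
  case (Store a e1 e2)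
  then show ?case using big_step.Store[of W s e1 _ e2] by (simp add: aval_safe fits_set_cell)
next
  case (If b c1 c2)
  then show ?case
    using bval_safe[of s b] by (cases "beval s b") (auto intro: big_step.IfTrue big_step.IfFalse)
qed (auto intro: big_step.intros[simplified])

lemma wp_fits: "(fits B s \<Longrightarrow> wp c s Q) \<Longrightarrow> wp c s Q"
  by (auto simp: wp_def)

lemma wp_straight: "safe B c s \<Longrightarrow> Q (effect c s) (cost c s) \<Longrightarrow> wp c s Q"
  unfolding wp_def using big_step_safe by blast

lemma wp_Seq:
  "wp c1 s (\<lambda>s1 t1. wp c2 s1 (\<lambda>s2 t2. Q s2 (Suc (t1 + t2)))) \<Longrightarrow> wp (Seq c1 c2) s Q"
  unfolding wp_def using big_step.Seq by blast

lemma wp_straightI: "safe B c s \<Longrightarrow> effect c s = s' \<Longrightarrow> cost c s = t \<Longrightarrow> Q s' t \<Longrightarrow> wp c s Q"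
  using wp_straight by blast

lemma wp_straight_Seq:
  assumes "safe B c1 s" "effect c1 s = s1" "cost c1 s = t1" "wp c2 s1 (\<lambda>s' t. Q s' (Suc (t1 + t)))"
  shows "wp (Seq c1 c2) s Q"
  by (rule wp_Seq, rule wp_straightI[OF assms(1-3)], rule assms(4))

lemma wp_conseq:
  "wp c s Q \<Longrightarrow> (\<And>s' t. Q s' t \<Longrightarrow> framed c s s' \<Longrightarrow> fits B s' \<Longrightarrow> Q' s' t) \<Longrightarrow> wp c s Q'"
  unfolding wp_def using big_step_framed by blast

lemma wp_Seq_conseq:
  assumes "wp c1 s Q1"
    and "\<And>s1 t1. Q1 s1 t1 \<Longrightarrow> framed c1 s s1 \<Longrightarrow> fits B s1 \<Longrightarrow>
           wp c2 s1 (\<lambda>s2 t2. Q s2 (Suc (t1 + t2)))"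
  shows "wp (Seq c1 c2) s Q"
  by (rule wp_Seq, rule wp_conseq[OF assms])

lemma wp_If:
  assumes "bsafe B s b" "beval s b \<Longrightarrow> wp c1 s (\<lambda>s' t. Q s' (Suc t))"
    "\<not> beval s b \<Longrightarrow> wp c2 s (\<lambda>s' t. Q s' (Suc t))"
  shows "wp (If b c1 c2) s Q"
proof (rule wp_fits)
  assume "fits B s"
  then have "bval W s b = Some (beval s b)" using bval_safe assms(1) by blast
  then show ?thesis
    using assms(2,3) big_step.IfTrue[of W s b] big_step.IfFalse[of W s b]
    unfolding wp_def by (cases "beval s b"; simp; meson)
qed

lemma wp_While:
  fixes \<mu> :: "state \<Rightarrow> nat"
  assumes init: "I s 0"
    and guard: "\<And>s' k. I s' k \<Longrightarrow> fits B s' \<Longrightarrow> framed c s s' \<Longrightarrow> bsafe B s' b"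
    and body: "\<And>s' k. I s' k \<Longrightarrow> fits B s' \<Longrightarrow> framed c s s' \<Longrightarrow> beval s' b \<Longrightarrow>
      wp c s' (\<lambda>s'' t. I s'' (Suc (k + t)) \<and> \<mu> s'' < \<mu> s')"
    and final: "\<And>s' k. I s' k \<Longrightarrow> fits B s' \<Longrightarrow> framed c s s' \<Longrightarrow> \<not> beval s' b \<Longrightarrow> Q s' (Suc k)"
  shows "wp (While b c) s Q"
proof -
  have "\<exists>s'' t. big_step W (While b c) s' s'' t \<and> fits B s'' \<and> Q s'' (k + t)"
    if "I s' k" "fits B s'" "framed c s s'" for s' k
    using that
  proof (induction "\<mu> s'" arbitrary: s' k rule: less_induct)
    case less
    have bval: "bval W s' b = Some (beval s' b)"
      using bval_safe less.prems guard by blast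
    show ?case
    proof (cases "beval s' b")
      case True
      then obtain s1 t1 where first: "big_step W c s' s1 t1" "fits B s1" "I s1 (Suc (k + t1))"
        "\<mu> s1 < \<mu> s'"
        using body less.prems unfolding wp_def by blast
      have "framed c s s1"
        using frame_trans[OF less.prems(3) big_step_framed[OF first(1)]] .
      then obtain s'' t where rest: "big_step W (While b c) s1 s'' t" "fits B s''"
        "Q s'' (Suc (k + t1) + t)"
        using less.hyps[OF first(4,3,2)] by blast
      have "big_step W (While b c) s' s'' (Suc (t1 + t))"
        using big_step.WhileTrue[OF _ first(1) rest(1)] bval True by simp
      then show ?thesis
        using rest by (intro exI[of _ s''] exI[of _ "Suc (t1 + t)"]) (auto simp: add_ac)
    next
      case False
      then show ?thesis using bval final[OF less.prems] less.prems(2)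
        by (intro exI[of _ s'] exI[of _ 1]) (auto intro: big_step.WhileFalse[simplified])
    qed
  qed
  from this[OF init] show ?thesis unfolding wp_def by simp
qed

end

abbreviation plus_aexp (infixl "\<boxplus>" 65) where "e1 \<boxplus> e2 \<equiv> Bin Add e1 e2"
abbreviation minus_aexp (infixl "\<boxminus>" 65) where "e1 \<boxminus> e2 \<equiv> Bin Sub e1 e2"
abbreviation times_aexp (infixl "\<boxtimes>" 70) where "e1 \<boxtimes> e2 \<equiv> Bin Mul e1 e2"
abbreviation seq_com (infixr ";;" 60) where "c1 ;; c2 \<equiv> Seq c1 c2"

definition for_loop :: "nat \<Rightarrow> aexp \<Rightarrow> com \<Rightarrow> com" where
  "for_loop x e c = Assign x (N 0) ;; While (Less (R x) e) (c ;; Assign x (R x \<boxplus> N 1))"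

lemma mod_for_loop [simp]:
  "mod_regs (for_loop x e c) = insert x (mod_regs c)" "mod_arrs (for_loop x e c) = mod_arrs c"
  by (auto simp: for_loop_def)

context word_ram
begin

lemma wp_for:
  assumes x: "x \<notin> mod_regs c" and m: "int m \<le> B"
    and bound: "\<And>s'. framed (for_loop x e c) s s' \<Longrightarrow>
      asafe B s' e \<and> leaves e \<le> 16 \<and> aeval s' e = int m"
    and init: "I 0 (set_reg s x 0) 0"
    and step: "\<And>i s' k. i < m \<Longrightarrow> I i s' k \<Longrightarrow> regs s' x = int i \<Longrightarrow> fits B s' \<Longrightarrow>
      framed (for_loop x e c) s s' \<Longrightarrow>
      wp c s' (\<lambda>s'' t. I (Suc i) (set_reg s'' x (int (Suc i))) (k + t + 3))"
    and final: "\<And>s' k. I m s' k \<Longrightarrow> fits B s' \<Longrightarrow> framed (for_loop x e c) s s' \<Longrightarrow> Q s' (k + 3)"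
  shows "wp (for_loop x e c) s Q"
  unfolding for_loop_def
proof (rule wp_straight_Seq)
  let ?body = "c ;; Assign x (R x \<boxplus> N 1)" and ?s = "set_reg s x 0"
  let ?J = "\<lambda>s' k. \<exists>i\<le>m. I i s' k \<and> regs s' x = int i"
  have framed: "framed (for_loop x e c) s s'" if "framed ?body ?s s'" for s'
    using that by (auto simp: frame_def)
  show "safe B (Assign x (N 0)) s" using B_ge_2 by simp
  have "wp (While (Less (R x) e) ?body) ?s (\<lambda>s' t. Q s' (Suc (1 + t)))"
  proof (rule wp_While[where I = ?J and \<mu> = "\<lambda>s'. m - nat (regs s' x)"])
    show "?J ?s 0" using init by (intro exI[of _ 0]) simp
  next
    fix s' k assume "?J s' k" "framed ?body ?s s'"
    then show "bsafe B s' (Less (R x) e)" using bound framed by auto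
  next
    fix s' k assume "?J s' k" and fits: "fits B s'" and fr: "framed ?body ?s s'"
      and "beval s' (Less (R x) e)"
    then obtain i where i: "i < m" "I i s' k" "regs s' x = int i"
      using bound[OF framed[OF fr]] by auto
    show "wp ?body s' (\<lambda>s'' t. ?J s'' (Suc (k + t)) \<and> m - nat (regs s'' x) < m - nat (regs s' x))"
    proof (rule wp_Seq_conseq[OF step[OF i fits framed[OF fr]]])
      fix s1 t assume "I (Suc i) (set_reg s1 x (int (Suc i))) (k + t + 3)" "framed c s' s1"
      moreover have "regs s1 x = int i" using calculation(2) x i(3) by (simp add: frame_regs)
      ultimately show "wp (Assign x (R x \<boxplus> N 1)) s1 (\<lambda>s2 t2. ?J s2 (Suc (k + Suc (t + t2))) \<and>
          m - nat (regs s2 x) < m - nat (regs s' x))"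
        using i m B_ge_2
        by (intro wp_straight) (auto intro!: exI[of _ "Suc i"] simp: eval_nat_numeral add.commute)
    qed
  next
    fix s' k assume "?J s' k" "fits B s'" and fr: "framed ?body ?s s'"
      and "\<not> beval s' (Less (R x) e)"
    then have "Q s' (k + 3)" using final[of s' k] bound framed by auto
    then show "Q s' (Suc (1 + Suc k))" by (simp add: eval_nat_numeral)
  qed
  then show "wp (While (Less (R x) e) ?body) ?s (\<lambda>s' t. Q s' (Suc (1 + t)))" .
qed simp_all

lemma wp_for_const:
  assumes "x \<notin> mod_regs c" "int m \<le> B"
    and "\<And>s'. framed (for_loop x e c) s s' \<Longrightarrow> asafe B s' e \<and> leaves e \<le> 16 \<and> aeval s' e = int m"
    and init: "I 0 (set_reg s x 0)"
    and step: "\<And>i s'. i < m \<Longrightarrow> I i s' \<Longrightarrow> regs s' x = int i \<Longrightarrow> fits B s' \<Longrightarrow>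
      framed (for_loop x e c) s s' \<Longrightarrow>
      wp c s' (\<lambda>s'' t. t \<le> K \<and> I (Suc i) (set_reg s'' x (int (Suc i))))"
    and final: "\<And>s' t. I m s' \<Longrightarrow> fits B s' \<Longrightarrow> framed (for_loop x e c) s s' \<Longrightarrow>
      t \<le> m * (K + 3) + 3 \<Longrightarrow> Q s' t"
  shows "wp (for_loop x e c) s Q"
proof (rule wp_for[where I = "\<lambda>i s' k. I i s' \<and> k \<le> i * (K + 3)", OF assms(1-3)])
  fix i s' k
  assume "i < m" "I i s' \<and> k \<le> i * (K + 3)" "regs s' x = int i" "fits B s'"
    "framed (for_loop x e c) s s'"
  then have "wp c s' (\<lambda>s'' t. t \<le> K \<and> I (Suc i) (set_reg s'' x (int (Suc i))))"
    and "k \<le> i * (K + 3)" using step by blast+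
  then show "wp c s' (\<lambda>s'' t. I (Suc i) (set_reg s'' x (int (Suc i))) \<and>
      k + t + 3 \<le> Suc i * (K + 3))"
    by (elim wp_conseq) simp
qed (use init final in auto)

lemma wp_for_Store:
  assumes m: "int m \<le> B" "inj_on idx {..<m}"
    and bound: "\<And>s'. frame {x} {a} s s' \<Longrightarrow> asafe B s' e \<and> leaves e \<le> 16 \<and> aeval s' e = int m"
    and cell: "\<And>s' i. i < m \<Longrightarrow> frame {x} {a} s s' \<Longrightarrow> regs s' x = int i \<Longrightarrow> fits B s' \<Longrightarrow>
      (\<And>j. i \<le> j \<Longrightarrow> j < m \<Longrightarrow> arrs s' a (idx j) = arrs s a (idx j)) \<Longrightarrow>
      asafe B s' e1 \<and> leaves e1 \<le> 16 \<and> aeval s' e1 = int (idx i) \<and>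
      asafe B s' e2 \<and> leaves e2 \<le> 16 \<and> aeval s' e2 = f i \<and> \<bar>f i\<bar> \<le> B"
    and final: "\<And>s' t. t \<le> m * 4 + 3 \<Longrightarrow> frame {x} {a} s s' \<Longrightarrow> (\<And>i. i < m \<Longrightarrow> arrs s' a (idx i) = f i) \<Longrightarrow>
      (\<And>p. p \<notin> idx ` {..<m} \<Longrightarrow> arrs s' a p = arrs s a p) \<Longrightarrow> Q s' t"
  shows "wp (for_loop x e (Store a e1 e2)) s Q"
proof (rule wp_for_const[where m = m and K = 1 and
      I = "\<lambda>i s'. (\<forall>j<i. arrs s' a (idx j) = f j) \<and> (\<forall>p. p \<notin> idx ` {..<i} \<longrightarrow> arrs s' a p = arrs s a p)"])
  fix i s'
  assume i: "i < m" "regs s' x = int i" "fits B s'" and "framed (for_loop x e (Store a e1 e2)) s s'"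
    and I: "(\<forall>j<i. arrs s' a (idx j) = f j) \<and> (\<forall>p. p \<notin> idx ` {..<i} \<longrightarrow> arrs s' a p = arrs s a p)"
  then have fr: "frame {x} {a} s s'" by simp
  have fresh: "idx j \<notin> idx ` {..<i}" if "i \<le> j" "j < m" for j
    using that i(1) inj_onD[OF m(2), of j] by fastforce
  then have "arrs s' a (idx j) = arrs s a (idx j)" if "i \<le> j" "j < m" for j
    using I that by blast
  from cell[OF i(1) fr i(2,3) this] show "wp (Store a e1 e2) s' (\<lambda>s'' t. t \<le> 1 \<and>
      (\<forall>j<Suc i. arrs (set_reg s'' x (int (Suc i))) a (idx j) = f j) \<and>
      (\<forall>p. p \<notin> idx ` {..<Suc i} \<longrightarrow> arrs (set_reg s'' x (int (Suc i))) a p = arrs s a p))"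
    using I fresh[of i] i(1)
    by (intro wp_straight) (auto simp: less_Suc_eq lessThan_Suc image_iff dest: sym[of "idx _"])
qed (use m bound final in auto)

end

section \<open>Memory layout\<close>

abbreviation (input) "r_dim \<equiv> 0 :: nat"
abbreviation (input) "r_cols \<equiv> 1 :: nat"
abbreviation (input) "r_levels \<equiv> 2 :: nat"
abbreviation (input) "r_radius \<equiv> 3 :: nat"
abbreviation (input) "r_steps \<equiv> 4 :: nat"
abbreviation (input) "r_copies \<equiv> 5 :: nat"
abbreviation (input) "r_copy \<equiv> 6 :: nat"
abbreviation (input) "r_shifts \<equiv> 7 :: nat"
abbreviation (input) "r_rows_mono \<equiv> 8 :: nat"
abbreviation (input) "r_cols_mono \<equiv> 9 :: nat"
abbreviation (input) "r_query_mono \<equiv> 10 :: nat"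
abbreviation (input) "r_end \<equiv> 11 :: nat"
abbreviation (input) "r_mode \<equiv> 12 :: nat"
abbreviation (input) "r_row \<equiv> 13 :: nat"
abbreviation (input) "r_idx \<equiv> 14 :: nat"
abbreviation (input) "r_tree \<equiv> 15 :: nat"
abbreviation (input) "r_leaf \<equiv> 16 :: nat"
abbreviation (input) "r_val \<equiv> 17 :: nat"
abbreviation (input) "r_path \<equiv> 18 :: nat"
abbreviation (input) "r_head \<equiv> 19 :: nat"
abbreviation (input) "r_tail \<equiv> 20 :: nat"
abbreviation (input) "r_node \<equiv> 21 :: nat"
abbreviation (input) "r_low1 \<equiv> 22 :: nat"
abbreviation (input) "r_low2 \<equiv> 23 :: nat"
abbreviation (input) "r_gap1 \<equiv> 24 :: nat"
abbreviation (input) "r_gap2 \<equiv> 25 :: nat"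
abbreviation (input) "r_bound \<equiv> 26 :: nat"
abbreviation (input) "r_best \<equiv> 27 :: nat"
abbreviation (input) "r_from \<equiv> 28 :: nat"
abbreviation (input) "r_to \<equiv> 29 :: nat"
abbreviation (input) "r_pos \<equiv> 31 :: nat"
abbreviation (input) "r_tmp \<equiv> 32 :: nat"
abbreviation (input) "r_cap \<equiv> 33 :: nat"
abbreviation (input) "r_col \<equiv> 34 :: nat"
abbreviation (input) "r_shift \<equiv> 35 :: nat"
abbreviation (input) "r_cell \<equiv> 36 :: nat"
abbreviation (input) "r_last \<equiv> 37 :: nat"

abbreviation (input) "a_input \<equiv> 0 :: nat"
abbreviation (input) "a_query \<equiv> 1 :: nat"
abbreviation (input) "a_answer \<equiv> 2 :: nat"
abbreviation (input) "a_matrix \<equiv> 3 :: nat"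
abbreviation (input) "a_vec \<equiv> 4 :: nat"
abbreviation (input) "a_trees \<equiv> 5 :: nat"
abbreviation (input) "a_queue \<equiv> 6 :: nat"
abbreviation (input) "a_refresh \<equiv> 7 :: nat"
abbreviation (input) "a_offsets \<equiv> 8 :: nat"
abbreviation (input) "a_stale \<equiv> 9 :: nat"
abbreviation (input) "a_sample \<equiv> 10 :: nat"
abbreviation (input) "a_current \<equiv> 11 :: nat"
abbreviation (input) "a_copy_regs \<equiv> 12 :: nat"
abbreviation (input) a_copy :: "nat \<Rightarrow> nat" where "a_copy a \<equiv> a + 13"

section \<open>Simulating many copies of a program in interleaved memory\<close>

definition view :: "nat \<Rightarrow> nat \<Rightarrow> state \<Rightarrow> state" where
  "view K i s =
     \<lparr>regs = (\<lambda>x. arrs s a_copy_regs (x * K + i)), arrs = (\<lambda>a p. arrs s (a_copy a) (p * K + i))\<rparr>"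

abbreviation copy_index :: "aexp \<Rightarrow> aexp" where
  "copy_index e \<equiv> e \<boxtimes> R r_copies \<boxplus> R r_copy"

fun sim_aexp :: "aexp \<Rightarrow> aexp" where
  "sim_aexp (N x) = N x"
| "sim_aexp (R x) = Rd a_copy_regs (copy_index (N (int x)))"
| "sim_aexp (Rd a e) = Rd (a_copy a) (copy_index (sim_aexp e))"
| "sim_aexp (Bin f e1 e2) = Bin f (sim_aexp e1) (sim_aexp e2)"

fun sim_bexp :: "bexp \<Rightarrow> bexp" where
  "sim_bexp (Less e1 e2) = Less (sim_aexp e1) (sim_aexp e2)"
| "sim_bexp (Equal e1 e2) = Equal (sim_aexp e1) (sim_aexp e2)"
| "sim_bexp (Neg b) = Neg (sim_bexp b)"
| "sim_bexp (Conj b1 b2) = Conj (sim_bexp b1) (sim_bexp b2)"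

abbreviation tick :: com where
  "tick \<equiv> Assign r_steps (R r_steps \<boxplus> N 1)"

fun sim_com :: "com \<Rightarrow> com" where
  "sim_com SKIP = tick ;; SKIP"
| "sim_com (Assign x e) = tick ;; Store a_copy_regs (copy_index (N (int x))) (sim_aexp e)"
| "sim_com (Store a e1 e2) = tick ;; Store (a_copy a) (copy_index (sim_aexp e1)) (sim_aexp e2)"
| "sim_com (Rand x e) = SKIP"
| "sim_com (Seq c1 c2) = tick ;; sim_com c1 ;; sim_com c2"
| "sim_com (If b c1 c2) = tick ;; If (sim_bexp b) (sim_com c1) (sim_com c2)"
| "sim_com (While b c) = tick ;; While (sim_bexp b) (sim_com c ;; tick)"

fun areg_sum :: "aexp \<Rightarrow> nat" where
  "areg_sum (N x) = 0"
| "areg_sum (R x) = x"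
| "areg_sum (Rd a e) = areg_sum e"
| "areg_sum (Bin f e1 e2) = areg_sum e1 + areg_sum e2"

fun breg_sum :: "bexp \<Rightarrow> nat" where
  "breg_sum (Less e1 e2) = areg_sum e1 + areg_sum e2"
| "breg_sum (Equal e1 e2) = areg_sum e1 + areg_sum e2"
| "breg_sum (Neg b) = breg_sum b"
| "breg_sum (Conj b1 b2) = breg_sum b1 + breg_sum b2"

fun reg_sum :: "com \<Rightarrow> nat" where
  "reg_sum (Assign x e) = x + areg_sum e"
| "reg_sum (Store a e1 e2) = areg_sum e1 + areg_sum e2"
| "reg_sum (Seq c1 c2) = reg_sum c1 + reg_sum c2"
| "reg_sum (If b c1 c2) = breg_sum b + reg_sum c1 + reg_sum c2"
| "reg_sum (While b c) = breg_sum b + reg_sum c"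
| "reg_sum _ = 0"

lemma mod_sim_com: "mod_regs (sim_com c) \<subseteq> {r_steps}" "mod_arrs (sim_com c) \<subseteq> {a_copy_regs..}"
  by (induction c) auto

lemma interleave_inj:
  fixes K :: nat
  assumes "i < K" "i' < K"
  shows "x * K + i = y * K + i' \<longleftrightarrow> x = y \<and> i = i'"
proof
  assume eq: "x * K + i = y * K + i'"
  have "(x * K + i) div K = x" "(y * K + i') div K = y" using assms by auto
  then have "x = y" using eq by simp
  then show "x = y \<and> i = i'" using eq by simp
qed simp

lemma view_set_reg [simp]: "view K i (s\<lparr>regs := f\<rparr>) = view K i s"
  by (simp add: view_def)

lemma view_set_cell:
  assumes "i < K" "j < K"
  shows "view K j (set_cell s (a_copy a) (x * K + i) y) =
      (if j = i then set_cell (view K i s) a x y else view K j s)"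
    and "view K j (set_cell s a_copy_regs (x * K + i) y) =
      (if j = i then set_reg (view K i s) x y else view K j s)"
  using assms by (auto simp: view_def interleave_inj fun_eq_iff)

lemma view_cong: "(\<And>a. a_copy_regs \<le> a \<Longrightarrow> arrs s' a = arrs s a) \<Longrightarrow> view K j s' = view K j s"
  by (simp add: view_def)

context word_ram
begin

lemma index_bound:
  assumes "\<bar>x\<bar> \<le> B" "\<bar>y\<bar> \<le> B" "\<bar>z\<bar> \<le> B"
  shows "\<bar>x * y\<bar> \<le> W" "\<bar>x * y + z\<bar> \<le> W"
proof -
  have "\<bar>x * y\<bar> \<le> B * B" unfolding abs_mult using assms B_ge_2 by (intro mult_mono) auto
  moreover have "B ^ 2 + B ^ 1 \<le> B ^ (2 + 1)" using B_ge_2 by (intro power_add_bound) auto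
  moreover have "B ^ 3 \<le> W"
    using power_increasing[of 3 16 B] B_ge_2 B_power_le_W by linarith
  ultimately show "\<bar>x * y\<bar> \<le> W" "\<bar>x * y + z\<bar> \<le> W"
    using assms B_ge_2 by (auto simp: power2_eq_square)
qed

lemma B_le_W: "B \<le> W"
  using index_bound(2)[of 0 0 B] B_ge_2 by simp

definition sim_context :: "nat \<Rightarrow> nat \<Rightarrow> state \<Rightarrow> nat \<Rightarrow> bool" where
  "sim_context K i s t \<longleftrightarrow> fits B s \<and> regs s r_copies = int K \<and> regs s r_copy = int i \<and> i < K \<and>
     int K \<le> B \<and> 0 \<le> regs s r_steps \<and> regs s r_steps + int t \<le> B"

definition sim_result :: "nat \<Rightarrow> nat \<Rightarrow> state \<Rightarrow> state \<Rightarrow> nat \<Rightarrow> state \<Rightarrow> bool" where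
  "sim_result K i s s' t v \<longleftrightarrow>
     view K i s' = v \<and> (\<forall>j<K. j \<noteq> i \<longrightarrow> view K j s' = view K j s) \<and>
     regs s' = (regs s)(r_steps := regs s r_steps + int t) \<and>
     (\<forall>a<a_copy_regs. arrs s' a = arrs s a) \<and> fits B s'"

lemma sim_result_trans:
  "sim_result K i s s1 t1 v1 \<Longrightarrow> sim_result K i s1 s2 t2 v2 \<Longrightarrow> sim_result K i s s2 (t1 + t2) v2"
  by (simp add: sim_result_def fun_eq_iff)

lemma sim_context_result:
  "sim_context K i s (t1 + t2) \<Longrightarrow> sim_result K i s s' t1 v \<Longrightarrow> sim_context K i s' t2"
  by (simp add: sim_context_def sim_result_def)

lemma aval_copy_index:
  assumes "sim_context K i s t" "aval W s e = Some x" "0 \<le> x" "x \<le> B"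
  shows "aval W s (copy_index e) = Some (int (nat x * K + i))"
proof -
  have "\<bar>x * int K\<bar> \<le> W" "\<bar>x * int K + int i\<bar> \<le> W"
    using index_bound[of x "int K" "int i"] assms by (auto simp: sim_context_def)
  moreover have "int K \<le> W" "int i \<le> W" using assms B_le_W by (auto simp: sim_context_def)
  ultimately show ?thesis using assms by (simp add: word_def sim_context_def)
qed

lemma aval_Rd: "aval W s e = Some (int p) \<Longrightarrow> aval W s (Rd a e) = word W (arrs s a p)"
  by simp

lemma aval_sim_aexp:
  assumes ctx: "sim_context K i s t" and W': "W' \<le> B"
  shows "aval W' (view K i s) e = Some x \<Longrightarrow> int (areg_sum e) \<le> B \<Longrightarrow> aval W s (sim_aexp e) = Some x"
proof (induction e arbitrary: x)
  case (N y)
  then show ?case using B_le_W W' by (auto simp: word_def split: if_splits)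
next
  case (R y)
  have "aval W s (N (int y)) = Some (int y)" using R.prems(2) B_le_W by (simp add: word_def)
  from aval_Rd[OF aval_copy_index[OF ctx this]] show ?case
    using R.prems W' B_le_W
    by (auto simp: word_def view_def simp del: aval.simps(3,4) split: if_splits)
next
  case (Rd a e)
  then obtain j where j: "aval W' (view K i s) e = Some j" "0 \<le> j"
    and x: "x = arrs s (a_copy a) (nat j * K + i)" "\<bar>x\<bar> \<le> W'"
    by (auto simp: view_def word_def split: option.splits if_splits)
  have "aval W s (sim_aexp e) = Some j" using Rd.IH[OF j(1)] Rd.prems by simp
  from aval_Rd[OF aval_copy_index[OF ctx this j(2)]] show ?case
    using aval_le[OF j(1)] x W' B_le_W by (simp add: word_def del: aval.simps(3,4))
next
  case (Bin f e1 e2)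
  then obtain y z where "aval W' (view K i s) e1 = Some y" "aval W' (view K i s) e2 = Some z"
    "x = binop_val f y z" "\<bar>x\<bar> \<le> W'"
    by (auto simp: word_def split: option.splits if_splits)
  then show ?case using Bin W' B_le_W by (simp add: word_def)
qed

lemma bval_sim_bexp:
  assumes "sim_context K i s t" "W' \<le> B"
  shows "bval W' (view K i s) b = Some p \<Longrightarrow> int (breg_sum b) \<le> B \<Longrightarrow> bval W s (sim_bexp b) = Some p"
  by (induction b arbitrary: p)
    (auto simp: aval_sim_aexp[OF assms] split: option.splits)

abbreviation ticked :: "state \<Rightarrow> state" where
  "ticked s \<equiv> set_reg s r_steps (regs s r_steps + 1)"

definition simulates :: "nat \<Rightarrow> nat \<Rightarrow> com \<Rightarrow> state \<Rightarrow> nat \<Rightarrow> state \<Rightarrow> bool" where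
  "simulates K i c s t v \<longleftrightarrow> (\<exists>s' t'. big_step W c s s' t' \<and> t' \<le> 5 * t \<and> sim_result K i s s' t v)"

lemma simulates_tick:
  assumes ctx: "sim_context K i s (Suc t)"
    and run: "big_step W c (ticked s) s' t'" "t' \<le> 5 * t + 3" "sim_result K i (ticked s) s' t v"
  shows "simulates K i (tick ;; c) s (Suc t) v"
proof -
  have "big_step W tick s (ticked s) 1"
    using ctx B_le_W B_ge_2 by (intro big_step.Assign) (auto simp: word_def sim_context_def)
  then have "big_step W (tick ;; c) s s' (Suc (1 + t'))"
    using run(1) by (rule big_step.Seq)
  moreover have "sim_result K i s s' (Suc t) v"
    using run(3) by (simp add: sim_result_def fun_eq_iff)
  ultimately show ?thesis
    using run(2) by (auto simp: simulates_def intro!: exI[of _ s'] exI[of _ "Suc (1 + t')"])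
qed

lemma sim_context_ticked: "sim_context K i s (Suc t) \<Longrightarrow> sim_context K i (ticked s) t"
  by (auto simp: sim_context_def fits_set_reg)

lemma simulates_Store:
  assumes ctx: "sim_context K i s 1"
    and "aval W (ticked s) (copy_index e1) = Some (int (p * K + i))"
      "aval W (ticked s) e2 = Some y" "\<bar>y\<bar> \<le> B"
    and a: "a_copy_regs \<le> a" "view K i (set_cell s a (p * K + i) y) = v"
      "\<And>j. j < K \<Longrightarrow> j \<noteq> i \<Longrightarrow> view K j (set_cell s a (p * K + i) y) = view K j s"
  shows "simulates K i (tick ;; Store a (copy_index e1) e2) s 1 v"
proof -
  let ?s' = "set_cell (ticked s) a (p * K + i) y"
  have "big_step W (Store a (copy_index e1) e2) (ticked s) ?s' 1"
    using big_step.Store[OF assms(2,3)] by (simp only: nat_int of_nat_0_le_iff)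
  moreover have "fits B ?s'"
    using sim_context_ticked[of K i s 0] ctx assms(4) by (auto simp: sim_context_def fits_def)
  then have "sim_result K i (ticked s) ?s' 0 v"
    using a by (auto simp: sim_result_def view_def)
  ultimately show ?thesis
    using simulates_tick[of K i s 0] ctx by simp
qed

lemma simulates_sim_com:
  assumes "big_step W' c v v' t" "W' \<le> B" "deterministic c"
    and "view K i s = v" "sim_context K i s t" "int (reg_sum c) \<le> B"
  shows "simulates K i (sim_com c) s t v'"
  using assms
proof (induction arbitrary: s rule: big_step.induct)
  case (Skip v)
  have "sim_result K i (ticked s) (ticked s) 0 v"
    using sim_context_ticked[of K i s 0] Skip.prems by (simp add: sim_result_def sim_context_def)
  then show ?case
    using simulates_tick[OF _ big_step.Skip] Skip.prems by simp
next
  case (Assign v e y x)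
  have ctx: "sim_context K i s 1" using Assign.prems by simp
  have ctx': "sim_context K i (ticked s) 0"
    using sim_context_ticked[of K i s 0] ctx by simp
  have "aval W (ticked s) (N (int x)) = Some (int x)"
    using Assign.prems B_le_W by (simp add: word_def)
  note index = aval_copy_index[OF ctx' this, simplified nat_int]
  have "aval W (ticked s) (sim_aexp e) = Some y"
    using aval_sim_aexp[OF ctx'] Assign by simp
  from simulates_Store[OF ctx index this, of a_copy_regs] show ?case
    using aval_le[OF Assign.hyps] Assign.prems ctx
    by (simp add: sim_context_def view_set_cell)
next
  case (Store v e1 p e2 y a)
  have ctx: "sim_context K i s 1" using Store.prems by simp
  have ctx': "sim_context K i (ticked s) 0"
    using sim_context_ticked[of K i s 0] ctx by simp
  have "aval W (ticked s) (sim_aexp e1) = Some p"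
    using aval_sim_aexp[OF ctx'] Store by simp
  note index = aval_copy_index[OF ctx' this]
  have "aval W (ticked s) (sim_aexp e2) = Some y"
    using aval_sim_aexp[OF ctx'] Store by simp
  from simulates_Store[OF ctx index this, of "a_copy a"] show ?case
    using aval_le[OF Store.hyps(1)] aval_le[OF Store.hyps(2)] Store.prems Store.hyps(3) ctx
    by (simp add: sim_context_def view_set_cell)
next
  case (Seq c1 v v1 t1 c2 v2 t2)
  have ctx: "sim_context K i (ticked s) (t1 + t2)"
    using sim_context_ticked Seq.prems by simp
  obtain s1 t1' where first: "big_step W (sim_com c1) (ticked s) s1 t1'" "t1' \<le> 5 * t1"
    "sim_result K i (ticked s) s1 t1 v1"
    using Seq.IH(1)[of "ticked s"] Seq.prems ctx by (auto simp: simulates_def sim_context_def)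
  moreover obtain s2 t2' where second: "big_step W (sim_com c2) s1 s2 t2'" "t2' \<le> 5 * t2"
    "sim_result K i s1 s2 t2 v2"
    using Seq.IH(2)[of s1] Seq.prems sim_context_result[OF ctx first(3)] first(3)
    by (auto simp: simulates_def sim_result_def)
  ultimately show ?case
    using simulates_tick[OF Seq.prems(4) big_step.Seq[OF first(1) second(1)]] sim_result_trans
    by simp
next
  case (IfTrue v b c1 v' t c2)
  note ctx = sim_context_ticked[OF IfTrue.prems(4)]
  obtain s1 t1 where branch: "big_step W (sim_com c1) (ticked s) s1 t1" "t1 \<le> 5 * t"
    "sim_result K i (ticked s) s1 t v'"
    using IfTrue.IH[of "ticked s"] IfTrue.prems ctx by (auto simp: simulates_def)
  have "bval W (ticked s) (sim_bexp b) = Some True"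
    using bval_sim_bexp[OF ctx] IfTrue by simp
  then show ?case
    using simulates_tick[OF IfTrue.prems(4) big_step.IfTrue[OF _ branch(1)]] branch by simp
next
  case (IfFalse v b c2 v' t c1)
  note ctx = sim_context_ticked[OF IfFalse.prems(4)]
  obtain s1 t1 where branch: "big_step W (sim_com c2) (ticked s) s1 t1" "t1 \<le> 5 * t"
    "sim_result K i (ticked s) s1 t v'"
    using IfFalse.IH[of "ticked s"] IfFalse.prems ctx by (auto simp: simulates_def)
  have "bval W (ticked s) (sim_bexp b) = Some False"
    using bval_sim_bexp[OF ctx] IfFalse by simp
  then show ?case
    using simulates_tick[OF IfFalse.prems(4) big_step.IfFalse[OF _ branch(1)]] branch by simp
next
  case (WhileFalse v b d)
  note ctx = sim_context_ticked[of K i s 0]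
  have "bval W (ticked s) (sim_bexp b) = Some False"
    using bval_sim_bexp[OF ctx] WhileFalse by simp
  moreover have "sim_result K i (ticked s) (ticked s) 0 v"
    using ctx WhileFalse.prems by (simp add: sim_result_def sim_context_def)
  ultimately show ?case
    using simulates_tick[OF _ big_step.WhileFalse] WhileFalse.prems by simp
next
  case (WhileTrue v b d v1 t1 v2 t2)
  have ctx: "sim_context K i (ticked s) (t1 + t2)"
    using sim_context_ticked WhileTrue.prems by simp
  obtain s1 t1' where first: "big_step W (sim_com d) (ticked s) s1 t1'" "t1' \<le> 5 * t1"
    "sim_result K i (ticked s) s1 t1 v1"
    using WhileTrue.IH(1)[of "ticked s"] WhileTrue.prems ctx
    by (auto simp: simulates_def sim_context_def)
  obtain s2 t2' where rest: "big_step W (sim_com (While b d)) s1 s2 t2'" "t2' \<le> 5 * t2"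
    "sim_result K i s1 s2 t2 v2"
    using WhileTrue.IH(2)[of s1] WhileTrue.prems sim_context_result[OF ctx first(3)] first(3)
    by (auto simp: simulates_def sim_result_def simp del: sim_com.simps)
  from rest(1) obtain s1' t t3 where tick: "big_step W tick s1 s1' t"
    and loop: "big_step W (While (sim_bexp b) (sim_com d ;; tick)) s1' s2 t3" "t2' = Suc (t + t3)"
    unfolding sim_com.simps by (elim SeqE)
  have "t = 1" using tick by (elim AssignE) simp
  have "bval W (ticked s) (sim_bexp b) = Some True"
    using bval_sim_bexp[OF ctx] WhileTrue by simp
  from big_step.WhileTrue[OF this big_step.Seq[OF first(1) tick] loop(1)] show ?case
    using simulates_tick[OF WhileTrue.prems(4)] sim_result_trans[OF first(3) rest(3)] first(2)
      rest(2) loop(2) \<open>t = 1\<close>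
    by simp
qed

lemma wp_sim_com:
  assumes "big_step W' c (view K i s) v' t" "W' \<le> B" "deterministic c" "int (reg_sum c) \<le> B"
    and "regs s r_copies = int K" "regs s r_copy = int i" "i < K" "int K \<le> B"
    and "0 \<le> regs s r_steps" "regs s r_steps + int t \<le> B"
  shows "wp (sim_com c) s (\<lambda>s' t'. t' \<le> 5 * t \<and> sim_result K i s s' t v')"
proof (rule wp_fits)
  assume "fits B s"
  then have "simulates K i (sim_com c) s t v'"
    using assms by (intro simulates_sim_com) (auto simp: sim_context_def)
  then show ?thesis by (auto simp: wp_def simulates_def sim_result_def)
qed

end

section \<open>Tournament trees\<close>

definition tree_index :: "aexp \<Rightarrow> aexp \<Rightarrow> aexp" where
  "tree_index r h = r \<boxtimes> (R r_cols \<boxplus> R r_cols) \<boxplus> h"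

definition tree_at :: "aexp \<Rightarrow> aexp \<Rightarrow> aexp" where
  "tree_at r h = Rd a_trees (tree_index r h)"

definition matrix_at :: "aexp \<Rightarrow> aexp \<Rightarrow> aexp" where
  "matrix_at i k = Rd a_matrix (i \<boxtimes> R r_cols \<boxplus> k)"

lemma leaves_at [simp]:
  "leaves (tree_index r h) = leaves r + 2 + leaves h" "leaves (tree_at r h) = leaves r + 2 + leaves h"
  "leaves (matrix_at r h) = leaves r + 1 + leaves h"
  by (simp_all add: tree_index_def tree_at_def matrix_at_def)

definition halve :: "nat \<Rightarrow> com" where
  "halve x = Assign x (Bin Div (R x) (N 2))"

definition climb :: com where
  "climb = While (Less (N 0) (R r_path))
    (If (Less (tree_at (R r_tree) (R r_path \<boxplus> R r_path)) (tree_at (R r_tree) (R r_path \<boxplus> R r_path \<boxplus> N 1)))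
      (Store a_trees (tree_index (R r_tree) (R r_path)) (tree_at (R r_tree) (R r_path \<boxplus> R r_path)))
      (Store a_trees (tree_index (R r_tree) (R r_path)) (tree_at (R r_tree) (R r_path \<boxplus> R r_path \<boxplus> N 1)));;
     halve r_path)"

definition update_leaf :: com where
  "update_leaf =
    (Assign r_path (R r_cols \<boxplus> R r_leaf) ;;
     Store a_trees (tree_index (R r_tree) (R r_path)) (R r_val) ;; halve r_path) ;; climb"

lemma mod_update_leaf [simp]:
  "mod_regs (halve x) = {x}" "mod_arrs (halve x) = {}" "mod_regs climb = {r_path}" "mod_arrs climb = {a_trees}"
  "mod_regs update_leaf = {r_path}" "mod_arrs update_leaf = {a_trees}"
  by (auto simp: update_leaf_def climb_def halve_def)

lemmas index_simps = nat_add_distrib nat_mult_distrib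

locale padded = word_ram +
  fixes n L :: nat
  assumes n_pos: "0 < n" and n_le: "n \<le> 2 ^ L" and less_2n: "2 ^ L < 2 * n"
    and B_large: "int (1000 * (n + 2) ^ 4) \<le> B"
begin

definition cols :: nat where "cols = 2 ^ L"
definition levels :: nat where "levels = Suc L"

lemma cols_pos [simp]: "0 < cols"
  by (simp add: cols_def)

lemma n_le_cols: "n \<le> cols" and cols_less: "cols < 2 * n"
  using n_le less_2n by (simp_all add: cols_def)

lemma L_le: "L \<le> n"
proof (rule ccontr)
  assume "\<not> L \<le> n"
  then have "(2::nat) ^ Suc n \<le> 2 ^ L" by (intro power_increasing) auto
  then show False using less_2n less_exp[of n] by simp
qed

lemma le_B: "m \<le> 1000 * (n + 2) ^ 4 \<Longrightarrow> int m \<le> B"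
  using B_large by linarith

lemma le_B_quadratic:
  assumes "m \<le> 1000 * (n + 2)^2"
  shows "int m \<le> B"
proof -
  have "(n + 2)^2 \<le> (n + 2) ^ 4" by (rule power_increasing) auto
  then show ?thesis using assms by (intro le_B) linarith
qed

lemma le_B_linear:
  assumes "m \<le> 1000 * (n + 2)"
  shows "int m \<le> B"
proof -
  have "n + 2 \<le> (n + 2)^2" by (simp add: power2_eq_square)
  then show ?thesis using assms mult_le_mono2[of "n + 2" "(n + 2)^2" 1000]
    by (intro le_B_quadratic) simp
qed

lemma B_bounds: "2000 \<le> B" "int n + 2 \<le> B" "16 * int cols + 16 \<le> B"
  using le_B_linear[of 2000] le_B_linear[of "n + 2"] le_B_linear[of "16 * cols + 16"] cols_less by auto

definition node :: "state \<Rightarrow> nat \<Rightarrow> nat \<Rightarrow> int" where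
  "node s r h = arrs s a_trees (r * (2 * cols) + h)"

definition entry :: "state \<Rightarrow> nat \<Rightarrow> nat \<Rightarrow> int" where
  "entry s i k = arrs s a_matrix (i * cols + k)"

lemma aeval_tree [simp]:
  assumes "regs s r_cols = int cols"
  shows "aeval s (tree_index r h) = aeval s r * (2 * int cols) + aeval s h"
    and "0 \<le> aeval s r \<Longrightarrow> 0 \<le> aeval s h \<Longrightarrow>
      aeval s (tree_at r h) = node s (nat (aeval s r)) (nat (aeval s h))"
    and "0 \<le> aeval s r \<Longrightarrow> 0 \<le> aeval s h \<Longrightarrow>
      aeval s (matrix_at r h) = entry s (nat (aeval s r)) (nat (aeval s h))"
  using assms by (simp_all add: tree_index_def tree_at_def matrix_at_def node_def entry_def index_simps)

lemma asafe_tree [simp]: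
  assumes "regs s r_cols = int cols" "0 \<le> aeval s r" "0 \<le> aeval s h"
  shows "asafe B s (tree_index r h) = (asafe B s r \<and> asafe B s h)"
    and "asafe B s (tree_at r h) = (asafe B s r \<and> asafe B s h)"
    and "asafe B s (matrix_at r h) = (asafe B s r \<and> asafe B s h)"
  using assms by (simp_all add: tree_index_def tree_at_def matrix_at_def)

lemma node_entry_update [simp]:
  "node (s\<lparr>regs := f\<rparr>) = node s" "entry (s\<lparr>regs := f\<rparr>) = entry s"
  "a \<noteq> a_trees \<Longrightarrow> node (s\<lparr>arrs := A(a := g)\<rparr>) = node (s\<lparr>arrs := A\<rparr>)"
  "a \<noteq> a_matrix \<Longrightarrow> entry (s\<lparr>arrs := A(a := g)\<rparr>) = entry (s\<lparr>arrs := A\<rparr>)"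
  "node (s\<lparr>arrs := arrs s\<rparr>) = node s" "entry (s\<lparr>arrs := arrs s\<rparr>) = entry s"
  "node (s\<lparr>arrs := A(a_trees := arrs s a_trees)\<rparr>) = node s"
  by (simp_all add: node_def entry_def fun_eq_iff)

lemma node_update [simp]:
  assumes "h < 2 * cols" "h' < 2 * cols"
  shows "node (s\<lparr>arrs := A(a_trees := g(r * (2 * cols) + h := x))\<rparr>) r' h' =
    (if r' = r \<and> h' = h then x else node (s\<lparr>arrs := A(a_trees := g)\<rparr>) r' h')"
  using assms by (auto simp: node_def interleave_inj)

lemma abs_node_le: "fits B s \<Longrightarrow> \<bar>node s r h\<bar> \<le> B"
  by (simp add: node_def fits_arrs)

definition heap_at :: "state \<Rightarrow> nat \<Rightarrow> nat \<Rightarrow> bool" where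
  "heap_at s r h \<longleftrightarrow> node s r h = min (node s r (2 * h)) (node s r (2 * h + 1))"

definition tree :: "state \<Rightarrow> nat \<Rightarrow> (nat \<Rightarrow> int) \<Rightarrow> bool" where
  "tree s r f \<longleftrightarrow> (\<forall>h. 1 \<le> h \<and> h < cols \<longrightarrow> heap_at s r h) \<and> (\<forall>k<cols. node s r (cols + k) = f k)"

definition trees_agree :: "nat set \<Rightarrow> state \<Rightarrow> state \<Rightarrow> bool" where
  "trees_agree X s s' \<longleftrightarrow> (\<forall>r h. r \<in> X \<longrightarrow> h < 2 * cols \<longrightarrow> node s' r h = node s r h)"

lemma trees_agree_refl [simp]: "trees_agree X s s"
  by (simp add: trees_agree_def)

lemma trees_agree_trans: "trees_agree X s s1 \<Longrightarrow> trees_agree Y s1 s2 \<Longrightarrow> trees_agree (X \<inter> Y) s s2"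
  by (simp add: trees_agree_def)

lemma trees_agree_mono: "trees_agree X s s' \<Longrightarrow> Y \<subseteq> X \<Longrightarrow> trees_agree Y s s'"
  by (auto simp: trees_agree_def)

lemma tree_agree: "tree s r f \<Longrightarrow> trees_agree X s s' \<Longrightarrow> r \<in> X \<Longrightarrow> tree s' r f"
  by (auto simp: tree_def heap_at_def trees_agree_def)

lemma trees_agree_arrs: "arrs s' a_trees = arrs s a_trees \<Longrightarrow> trees_agree X s s'"
  by (simp add: trees_agree_def node_def)

lemma tree_cong: "tree s r f \<Longrightarrow> (\<And>k. k < cols \<Longrightarrow> f k = g k) \<Longrightarrow> tree s r g"
  by (auto simp: tree_def)

lemma wp_climb:
  assumes s: "regs s r_cols = int cols" "regs s r_tree = int r" "regs s r_path = int h0" "h0 < cols"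
    and heap: "\<And>h. 1 \<le> h \<Longrightarrow> h < cols \<Longrightarrow> h \<noteq> h0 \<Longrightarrow> heap_at s r h"
    and leaf: "\<And>k. k < cols \<Longrightarrow> node s r (cols + k) = f k"
  shows "wp climb s (\<lambda>s' t. t \<le> 5 * L + 1 \<and> tree s' r f \<and> trees_agree (- {r}) s s')"
proof -
  define I where "I s' k \<longleftrightarrow> (\<exists>h m. regs s' r_path = int h \<and> h < 2 ^ m \<and> h < cols \<and>
      k + 5 * m \<le> 5 * L \<and> (\<forall>h'. 1 \<le> h' \<and> h' < cols \<and> h' \<noteq> h \<longrightarrow> heap_at s' r h') \<and>
      (\<forall>k<cols. node s' r (cols + k) = f k) \<and> trees_agree (- {r}) s s')" for s' k
  have init: "I s 0"
    unfolding I_def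
    by (intro exI[of _ h0] exI[of _ L]) (use s heap leaf in \<open>auto simp: cols_def\<close>)
  let ?body = "If (Less (tree_at (R r_tree) (R r_path \<boxplus> R r_path))
                        (tree_at (R r_tree) (R r_path \<boxplus> R r_path \<boxplus> N 1)))
      (Store a_trees (tree_index (R r_tree) (R r_path)) (tree_at (R r_tree) (R r_path \<boxplus> R r_path)))
      (Store a_trees (tree_index (R r_tree) (R r_path))
        (tree_at (R r_tree) (R r_path \<boxplus> R r_path \<boxplus> N 1)));;
     halve r_path"
  have body: "wp ?body s' (\<lambda>s'' t. I s'' (Suc (k + t)) \<and> nat (regs s'' r_path) < nat (regs s' r_path))"
    if inv: "I s' k" and fits: "fits B s'" and framed: "framed ?body s s'"
      and pos: "beval s' (Less (N 0) (R r_path))" for s' k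
  proof -
    obtain h m where h: "regs s' r_path = int h" "h < 2 ^ m" "h < cols" "k + 5 * m \<le> 5 * L" "0 < h"
      and heap': "\<And>h'. 1 \<le> h' \<Longrightarrow> h' < cols \<Longrightarrow> h' \<noteq> h \<Longrightarrow> heap_at s' r h'"
      and leaf': "\<And>k. k < cols \<Longrightarrow> node s' r (cols + k) = f k" and agree: "trees_agree (- {r}) s s'"
      using inv pos unfolding I_def by fastforce
    obtain m' where m: "m = Suc m'" using h(2,5) by (cases m) auto
    have r: "regs s' r_cols = int cols" "regs s' r_tree = int r"
      using frame_regs[OF framed] s by simp_all
    let ?v = "min (node s' r (2 * h)) (node s' r (2 * h + 1))"
    let ?s = "set_reg (set_cell s' a_trees (r * (2 * cols) + h) ?v) r_path (int (h div 2))"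
    have "heap_at ?s r h'" if "1 \<le> h'" "h' < cols" "h' \<noteq> h div 2" for h'
    proof -
      have "2 * h' \<noteq> h" "2 * h' + 1 \<noteq> h" using that(3) by auto
      then show ?thesis using that h(3,5) heap'[of h'] by (auto simp: heap_at_def)
    qed
    moreover have "\<forall>k<cols. node ?s r (cols + k) = f k" "trees_agree (- {r}) s ?s"
      using h(3) leaf' agree by (auto simp: trees_agree_def)
    ultimately have "I ?s (Suc (k + 4))"
      unfolding I_def using h m by (intro exI[of _ "h div 2"] exI[of _ m']) auto
    let ?left = "tree_at (R r_tree) (R r_path \<boxplus> R r_path)"
      and ?right = "tree_at (R r_tree) (R r_path \<boxplus> R r_path \<boxplus> N 1)"
    have index: "nat (int h + int h) = 2 * h" "nat (int h + int h + 1) = 2 * h + 1"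
      "nat (int r * (2 * int cols) + int h) = r * (2 * cols) + h"
      by (simp_all add: index_simps)
    have vals: "aeval s' ?left = node s' r (2 * h)" "aeval s' ?right = node s' r (2 * h + 1)"
      "aeval s' (tree_index (R r_tree) (R r_path)) = int r * (2 * int cols) + int h"
      using r h(1) index by simp_all
    have "\<bar>int h div 2\<bar> \<le> B" using h(3) B_bounds(3) by simp
    then have safe: "safe B ?body s'"
      using r h(1) B_ge_2 abs_node_le[OF fits] by (simp add: halve_def vals)
    have effect: "effect ?body s' = ?s"
      using r h(1) by (cases "node s' r (2 * h) < node s' r (2 * h + 1)")
        (simp_all add: halve_def vals index zdiv_int min_def)
    show ?thesis
      by (rule wp_straightI[OF safe effect, where t = 4])
        (use \<open>I ?s (Suc (k + 4))\<close> h(1,5) in \<open>simp_all add: halve_def\<close>)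
  qed
  show ?thesis
    unfolding climb_def
    by (rule wp_While[where I = I and \<mu> = "\<lambda>s'. nat (regs s' r_path)", OF init _ body])
      (use B_ge_2 in \<open>auto simp: I_def tree_def\<close>)
qed

lemma wp_update_leaf:
  assumes s: "regs s r_cols = int cols" "regs s r_tree = int r" "regs s r_leaf = int k" "k < cols"
    and tree: "tree s r f"
  shows "wp update_leaf s (\<lambda>s' t. t \<le> 7 * levels \<and> tree s' r (f(k := regs s r_val)) \<and>
    trees_agree (- {r}) s s')"
    (is "wp _ _ ?Q")
  unfolding update_leaf_def
proof (rule wp_fits)
  assume fits: "fits B s"
  let ?start = "Assign r_path (R r_cols \<boxplus> R r_leaf) ;;
    Store a_trees (tree_index (R r_tree) (R r_path)) (R r_val) ;; halve r_path"
  let ?s = "set_reg (set_cell (set_reg s r_path (int (cols + k))) a_trees (r * (2 * cols) + (cols + k))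
    (regs s r_val)) r_path (int ((cols + k) div 2))"
  have effect: "effect ?start s = ?s"
    using s by (simp add: halve_def index_simps zdiv_int algebra_simps)
  have cost: "cost ?start s = 5"
    by (simp add: halve_def)
  have safe: "safe B ?start s"
    using s fits_regs[OF fits, of r_val] B_bounds by (auto simp: halve_def)
  have "wp climb ?s (\<lambda>s' t. t \<le> 5 * L + 1 \<and> tree s' r (f(k := regs s r_val)) \<and> trees_agree (- {r}) ?s s')"
  proof (rule wp_climb)
    fix h assume h: "1 \<le> h" "h < cols" "h \<noteq> (cols + k) div 2"
    then have "2 * h \<noteq> cols + k" "2 * h + 1 \<noteq> cols + k" by auto
    then show "heap_at ?s r h" using h s(4) tree by (auto simp: heap_at_def tree_def)
  qed (use s tree in \<open>auto simp: tree_def\<close>)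
  then have "wp climb ?s (\<lambda>s' t. Suc (5 + t) \<le> 7 * levels \<and> tree s' r (f(k := regs s r_val)) \<and>
      trees_agree (- {r}) s s')"
    by (rule wp_conseq) (use s(4) in \<open>auto simp: levels_def trees_agree_def\<close>)
  then show "wp (?start ;; climb) s (\<lambda>s' t. ?Q s' t)"
    by (rule wp_straight_Seq[OF safe effect cost])
qed

definition below :: "nat \<Rightarrow> nat set" where
  "below h = {k. k < cols \<and> (\<exists>d. (cols + k) div 2 ^ d = h)}"

abbreviation least :: "(nat \<Rightarrow> int) \<Rightarrow> nat \<Rightarrow> int" where
  "least f h \<equiv> Min (f ` below h)"

lemma below_less: "k \<in> below h \<Longrightarrow> k < cols"
  by (simp add: below_def)

lemma finite_below [simp]: "finite (below h)"
  by (rule finite_subset[of _ "{..<cols}"]) (auto simp: below_def)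

lemma div_power_Suc: "m div 2 ^ Suc d = m div 2 ^ d div (2::nat)"
  by (metis div_mult2_eq mult.commute power_Suc)

lemma below_leaf:
  assumes "k < cols"
  shows "below (cols + k) = {k}"
proof -
  have "k' = k" if "k' < cols" "(cols + k') div 2 ^ d = cols + k" for k' d
  proof (cases d)
    case (Suc d')
    have "(cols + k') div 2 ^ d \<le> (cols + k') div 2"
      unfolding Suc div_power_Suc by (intro div_le_mono) simp
    then show ?thesis using that by linarith
  qed (use that in simp)
  moreover have "k \<in> below (cols + k)"
    using assms unfolding below_def by (intro CollectI conjI exI[of _ 0]) auto
  ultimately show ?thesis by (auto simp: below_def)
qed

lemma below_inner:
  assumes "h < cols"
  shows "below h = below (2 * h) \<union> below (2 * h + 1)"
proof -
  have "k \<in> below h \<longleftrightarrow> k \<in> below (2 * h) \<union> below (2 * h + 1)" if k: "k < cols" for k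
  proof
    assume "k \<in> below h"
    then obtain d where d: "(cols + k) div 2 ^ d = h" by (auto simp: below_def)
    then obtain d' where "d = Suc d'" using assms by (cases d) auto
    then have "(cols + k) div 2 ^ d' \<in> {2 * h, 2 * h + 1}"
      using d div_power_Suc[of "cols + k" d'] by auto
    then show "k \<in> below (2 * h) \<union> below (2 * h + 1)" using k by (auto simp: below_def)
  next
    assume "k \<in> below (2 * h) \<union> below (2 * h + 1)"
    then obtain d where "(cols + k) div 2 ^ d \<in> {2 * h, 2 * h + 1}" by (auto simp: below_def)
    then have "(cols + k) div 2 ^ Suc d = h" unfolding div_power_Suc by auto
    then show "k \<in> below h" using k unfolding below_def by blast
  qed
  then show ?thesis using below_less by blast
qed

lemma below_nonempty: "1 \<le> h \<Longrightarrow> h < 2 * cols \<Longrightarrow> below h \<noteq> {}"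
proof (induction "2 * cols - h" arbitrary: h rule: less_induct)
  case less
  show ?case
  proof (cases "h < cols")
    case True
    then show ?thesis using below_inner less.hyps[of "2 * h"] less.prems by simp
  next
    case False
    then show ?thesis using below_leaf[of "h - cols"] less.prems by simp
  qed
qed

lemma least_le: "k \<in> below h \<Longrightarrow> least f h \<le> f k"
  by (rule Min_le) auto

lemma least_attained: "1 \<le> h \<Longrightarrow> h < 2 * cols \<Longrightarrow> \<exists>k\<in>below h. f k = least f h"
  using Min_in[of "f ` below h"] below_nonempty by fastforce

lemma tree_node:
  assumes "tree s r f"
  shows "1 \<le> h \<Longrightarrow> h < 2 * cols \<Longrightarrow> node s r h = least f h"
proof (induction "2 * cols - h" arbitrary: h rule: less_induct)
  case less
  show ?case
  proof (cases "h < cols")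
    case True
    then have "node s r h = min (least f (2 * h)) (least f (2 * h + 1))"
      using assms less.hyps less.prems by (simp add: tree_def heap_at_def)
    also have "\<dots> = least f h"
      unfolding below_inner[OF True] image_Un
      using True less.prems below_nonempty by (intro Min_Un[symmetric]) auto
    finally show ?thesis .
  next
    case False
    then have "h - cols < cols" using less.prems by simp
    then have "node s r (cols + (h - cols)) = f (h - cols)"
      using assms unfolding tree_def by blast
    then show ?thesis using False less.prems below_leaf[of "h - cols"] by simp
  qed
qed

lemma below_level:
  assumes "k \<in> below h" "2 ^ l \<le> h" "h < 2 ^ Suc l"
  shows "h = (cols + k) div 2 ^ (L - l)"
proof -
  obtain d where d: "(cols + k) div 2 ^ d = h" and k: "k < cols"
    using assms(1) by (auto simp: below_def)
  have "d \<le> L"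
  proof (rule ccontr)
    assume "\<not> d \<le> L"
    then have "(2::nat) ^ Suc L \<le> 2 ^ d" by (intro power_increasing) auto
    then show False using d assms(2) k by (simp add: cols_def)
  qed
  then have split: "(2::nat) ^ (L - d) * 2 ^ d = cols"
    by (simp add: cols_def power_add[symmetric])
  have "2 ^ (L - d) = cols div 2 ^ d" unfolding split[symmetric] by simp
  also have "\<dots> \<le> h" unfolding d[symmetric] by (intro div_le_mono) simp
  finally have "(2::nat) ^ (L - d) < 2 ^ Suc l" using assms(3) by simp
  moreover have "h < 2 ^ Suc (L - d)"
    using split k unfolding d[symmetric] by (intro less_mult_imp_div_less) simp
  then have "(2::nat) ^ l < 2 ^ Suc (L - d)" using assms(2) by simp
  ultimately have "L - d < Suc l" "l < Suc (L - d)"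
    by (simp_all only: power_strict_increasing_iff one_less_numeral_iff semiring_norm)
  then have "L - l = d" using \<open>d \<le> L\<close> by simp
  then show ?thesis using d by simp
qed

end

section \<open>Breadth-first search\<close>

definition bfs :: "bexp \<Rightarrow> com \<Rightarrow> com" where
  "bfs tst els =
    (Store a_queue (N 0) (N 1) ;; Assign r_head (N 0) ;; Assign r_tail (N 1)) ;;
    While (Conj (Less (R r_head) (R r_tail)) (Less (R r_head) (R r_cap)))
      (Assign r_node (Rd a_queue (R r_head)) ;; Assign r_head (R r_head \<boxplus> N 1) ;;
       If tst
         (Store a_queue (R r_tail) (R r_node \<boxplus> R r_node) ;;
          Store a_queue (R r_tail \<boxplus> N 1) (R r_node \<boxplus> R r_node \<boxplus> N 1) ;;
          Assign r_tail (R r_tail \<boxplus> N 2))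
         els)"

lemma mod_bfs [simp]:
  "mod_regs (bfs tst els) = {r_head, r_tail, r_node} \<union> mod_regs els"
  "mod_arrs (bfs tst els) = {a_queue} \<union> mod_arrs els"
  by (auto simp: bfs_def)

inductive_set visited :: "(nat \<Rightarrow> bool) \<Rightarrow> nat set" for P where
  root: "1 \<in> visited P"
| left: "h \<in> visited P \<Longrightarrow> P h \<Longrightarrow> 2 * h \<in> visited P"
| right: "h \<in> visited P \<Longrightarrow> P h \<Longrightarrow> Suc (2 * h) \<in> visited P"

definition queue_inv :: "(nat \<Rightarrow> bool) \<Rightarrow> nat list \<Rightarrow> nat \<Rightarrow> bool" where
  "queue_inv P qs pos \<longleftrightarrow> sorted_wrt (<) qs \<and> set qs \<subseteq> visited P \<and> 1 \<in> set qs \<and>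
     pos \<le> length qs \<and> length qs \<le> 2 * pos + 1 \<and>
     (\<forall>h\<in>set (take pos qs). P h \<longrightarrow> 2 * h \<in> set qs \<and> Suc (2 * h) \<in> set qs) \<and>
     (\<forall>h\<in>set (drop pos qs). \<forall>y\<in>set qs. y < 2 * h)"

lemma queue_inv_init: "queue_inv P [1] 0"
  by (simp add: queue_inv_def visited.root[simplified])

lemma queue_inv_step:
  assumes inv: "queue_inv P qs pos" and pos: "pos < length qs"
  defines "h \<equiv> qs ! pos"
  shows "P h \<Longrightarrow> queue_inv P (qs @ [2 * h, Suc (2 * h)]) (Suc pos)"
    and "\<not> P h \<Longrightarrow> queue_inv P qs (Suc pos)"
proof -
  have drop: "drop pos qs = h # drop (Suc pos) qs"
    unfolding h_def using pos by (rule Cons_nth_drop_Suc[symmetric])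
  have take: "set (take (Suc pos) qs) = insert h (set (take pos qs))"
    unfolding h_def using pos by (simp add: take_Suc_conv_app_nth)
  have below: "y < 2 * h" if "y \<in> set qs" for y
    using inv drop that by (auto simp: queue_inv_def)
  have later: "h < h'" if "h' \<in> set (drop (Suc pos) qs)" for h'
  proof -
    have "sorted_wrt (<) (drop pos qs)" using inv by (simp add: queue_inv_def sorted_wrt_drop)
    then show ?thesis using that unfolding drop by simp
  qed
  have "h \<in> visited P" using inv pos nth_mem by (auto simp: queue_inv_def h_def)
  then show "queue_inv P (qs @ [2 * h, Suc (2 * h)]) (Suc pos)" if "P h"
    using that inv pos drop take below later visited.left[of h P] visited.right[of h P]
    by (auto simp: queue_inv_def sorted_wrt_append) (fastforce dest: below later)+
  show "queue_inv P qs (Suc pos)" if "\<not> P h"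
    using that inv pos drop take by (auto simp: queue_inv_def)
qed

lemma queue_inv_complete:
  assumes "queue_inv P qs (length qs)"
  shows "set qs = visited P"
proof -
  have "h \<in> set qs" if "h \<in> visited P" for h
    using that by induction (use assms in \<open>auto simp: queue_inv_def\<close>)
  then show ?thesis using assms by (auto simp: queue_inv_def)
qed

lemma queue_inv_length:
  assumes "queue_inv P qs pos" "finite (visited P)"
  shows "length qs \<le> card (visited P)"
proof -
  have "distinct qs" using assms(1) by (auto simp: queue_inv_def strict_sorted_iff)
  then have "length qs = card (set qs)" by (simp add: distinct_card)
  then show ?thesis using assms card_mono[of "visited P" "set qs"] by (simp add: queue_inv_def)
qed

definition min_with :: "int \<Rightarrow> (nat \<Rightarrow> int) \<Rightarrow> nat set \<Rightarrow> int" where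
  "min_with x f S = Min (insert x (f ` S))"

lemma min_with_empty [simp]: "min_with x f {} = x"
  by (simp add: min_with_def)

lemma min_with_insert: "finite S \<Longrightarrow> min_with x f (insert h S) = min (min_with x f S) (f h)"
  by (simp add: min_with_def Min_insert2 insert_commute[of x] min.commute)

lemma min_with_le: "finite S \<Longrightarrow> min_with x f S \<le> x" "finite S \<Longrightarrow> h \<in> S \<Longrightarrow> min_with x f S \<le> f h"
  by (auto simp: min_with_def)

lemma min_with_attained: "finite S \<Longrightarrow> min_with x f S = x \<or> (\<exists>h\<in>S. min_with x f S = f h)"
  using Min_in[of "insert x (f ` S)"] by (auto simp: min_with_def)

context padded
begin

lemma visited_subset:
  assumes "\<And>h. P h \<Longrightarrow> h < cols"
  shows "visited P \<subseteq> {1..<2 * cols}"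
proof
  have "1 < 2 * cols" using cols_pos by linarith
  fix h assume "h \<in> visited P"
  then show "h \<in> {1..<2 * cols}"
    by induction (use \<open>1 < 2 * cols\<close> in \<open>auto dest!: assms\<close>)
qed

lemma finite_visited: "(\<And>h. P h \<Longrightarrow> h < cols) \<Longrightarrow> finite (visited P)"
  using visited_subset finite_subset by blast

context
  fixes tst :: bexp and els :: com and s :: state and x cap :: nat
    and P acc :: "nat \<Rightarrow> bool" and val :: "nat \<Rightarrow> int"
  assumes x: "x \<notin> {r_head, r_tail, r_node, r_cap}" "mod_regs els \<subseteq> {x}"
    and cap: "regs s r_cap = int cap" "int (2 * cap + 8) \<le> B"
    and inner: "\<And>h. P h \<Longrightarrow> h < cols"
    and tst: "\<And>s' h. framed (bfs tst els) s s' \<Longrightarrow> regs s' r_node = int h \<Longrightarrow> 1 \<le> h \<Longrightarrow> h < 2 * cols \<Longrightarrow>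
      fits B s' \<Longrightarrow> bsafe B s' tst \<and> beval s' tst = P h"
    and els: "\<And>s' h. framed (bfs tst els) s s' \<Longrightarrow> regs s' r_node = int h \<Longrightarrow> 1 \<le> h \<Longrightarrow> h < 2 * cols \<Longrightarrow>
      fits B s' \<Longrightarrow> \<not> P h \<Longrightarrow> safe B els s' \<and> cost els s' \<le> 4 \<and>
        effect els s' = set_reg s' x (if acc h then min (regs s' x) (val h) else regs s' x)"
begin

definition bfs_inv :: "state \<Rightarrow> nat \<Rightarrow> nat list \<Rightarrow> nat \<Rightarrow> bool" where
  "bfs_inv s' t qs pos \<longleftrightarrow> queue_inv P qs pos \<and> pos \<le> cap \<and> t \<le> 11 * pos \<and>
     regs s' r_head = int pos \<and> regs s' r_tail = int (length qs) \<and>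
     (\<forall>y<length qs. arrs s' a_queue y = int (qs ! y)) \<and>
     regs s' x = min_with (regs s x) val {h \<in> set (take pos qs). \<not> P h \<and> acc h}"

private abbreviation bfs_body :: com where
  "bfs_body \<equiv> Assign r_node (Rd a_queue (R r_head)) ;; Assign r_head (R r_head \<boxplus> N 1) ;;
     If tst
       (Store a_queue (R r_tail) (R r_node \<boxplus> R r_node) ;;
        Store a_queue (R r_tail \<boxplus> N 1) (R r_node \<boxplus> R r_node \<boxplus> N 1) ;;
        Assign r_tail (R r_tail \<boxplus> N 2))
       els"

lemma wp_bfs_body:
  assumes inv: "bfs_inv s' t qs pos" and fits: "fits B s'" and framed: "framed (bfs tst els) s s'"
    and pos: "pos < length qs" "pos < cap"
  shows "wp bfs_body s' (\<lambda>s'' t'. \<exists>qs'. bfs_inv s'' (Suc (t + t')) qs' (Suc pos))"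
proof -
  define h where "h = qs ! pos"
  have h: "h \<in> visited P" "1 \<le> h" "h < 2 * cols"
  proof -
    show "h \<in> visited P" using inv pos(1) nth_mem by (auto simp: bfs_inv_def queue_inv_def h_def)
    then show "1 \<le> h" "h < 2 * cols" using visited_subset[of P, OF inner] by auto
  qed
  have bounds: "2 * int h + 1 \<le> B" "int (length qs) + 2 \<le> B" "int pos + 1 \<le> B"
    using h(3) B_bounds cap(2) inv pos by (auto simp: bfs_inv_def queue_inv_def)
  have head: "regs s' r_head = int pos" "regs s' r_tail = int (length qs)" "arrs s' a_queue pos = int h"
    using inv pos(1) by (auto simp: bfs_inv_def h_def)
  let ?s = "s'\<lparr>regs := (regs s')(r_node := int h, r_head := int pos + 1)\<rparr>"
  have fits': "fits B ?s"
    using fits bounds by (auto simp: fits_def)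
  have framed': "framed (bfs tst els) s ?s"
    using framed by (auto simp: frame_def)
  have tst': "bsafe B ?s tst" "beval ?s tst = P h"
    using tst[OF framed' _ h(2,3) fits'] by simp_all
  note step = queue_inv_step[OF _ pos(1), of P, folded h_def]
  have take: "set (take (Suc pos) qs) = insert h (set (take pos qs))"
    unfolding h_def using pos(1) by (simp add: take_Suc_conv_app_nth)
  show ?thesis
  proof (cases "P h")
    case True
    let ?s' = "(set_cell (set_cell ?s a_queue (length qs) (2 * int h)) a_queue (Suc (length qs))
        (2 * int h + 1))\<lparr>regs := (regs ?s)(r_tail := int (length qs) + 2)\<rparr>"
    have "{h' \<in> set (take (Suc pos) qs). \<not> P h' \<and> acc h'} = {h' \<in> set (take pos qs). \<not> P h' \<and> acc h'}"
      using take True by auto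
    then have "bfs_inv ?s' (Suc (t + 10)) (qs @ [2 * h, Suc (2 * h)]) (Suc pos)"
      using inv x(1) pos True step(1) by (auto simp: bfs_inv_def nth_append less_Suc_eq)
    then have "\<exists>qs'. bfs_inv ?s' (Suc (t + 10)) qs' (Suc pos)"
      by (rule exI)
    moreover have "effect bfs_body s' = ?s'" "cost bfs_body s' = 10" "safe B bfs_body s'"
      using head tst' True bounds B_ge_2 by (simp_all add: nat_add_distrib)
    ultimately show ?thesis by (intro wp_straightI)
  next
    case False
    let ?v = "if acc h then min (regs s' x) (val h) else regs s' x"
    have els': "safe B els ?s" "cost els ?s \<le> 4" "effect els ?s = set_reg ?s x ?v"
      using els[OF framed' _ h(2,3) fits' False] x(1) by auto
    have "{h' \<in> set (take (Suc pos) qs). \<not> P h' \<and> acc h'} =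
        (if acc h then insert h {h' \<in> set (take pos qs). \<not> P h' \<and> acc h'}
         else {h' \<in> set (take pos qs). \<not> P h' \<and> acc h'})"
      using take False by auto
    then have "bfs_inv (set_reg ?s x ?v) (Suc (t + (5 + cost els ?s))) qs (Suc pos)"
      using inv x(1) pos False step(2) els'(2) by (auto simp: bfs_inv_def min_with_insert)
    then have "\<exists>qs'. bfs_inv (set_reg ?s x ?v) (Suc (t + (5 + cost els ?s))) qs' (Suc pos)"
      by (rule exI)
    moreover have "effect bfs_body s' = set_reg ?s x ?v" "cost bfs_body s' = 5 + cost els ?s"
      "safe B bfs_body s'"
      using head tst' False els' bounds B_ge_2 by simp_all
    ultimately show ?thesis by (intro wp_straightI)
  qed
qed

lemma wp_bfs:
  "wp (bfs tst els) s (\<lambda>s' t. t \<le> 11 * cap + 8 \<and>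
     (\<exists>V \<subseteq> visited P. (card (visited P) \<le> cap \<longrightarrow> V = visited P) \<and>
        regs s' x = min_with (regs s x) val {h \<in> V. \<not> P h \<and> acc h}))"
  unfolding bfs_def
proof (rule wp_straight_Seq)
  let ?init = "Store a_queue (N 0) (N 1) ;; Assign r_head (N 0) ;; Assign r_tail (N 1)"
  let ?guard = "Conj (Less (R r_head) (R r_tail)) (Less (R r_head) (R r_cap))"
  let ?s = "s\<lparr>arrs := (arrs s)(a_queue := (arrs s a_queue)(0 := 1)), regs := (regs s)(r_head := 0, r_tail := 1)\<rparr>"
  show "safe B ?init s" "effect ?init s = ?s" "cost ?init s = 5"
    using B_ge_2 by simp_all
  have framed: "framed (bfs tst els) s s'" if "framed bfs_body ?s s'" for s'
    using that by (auto simp: frame_def)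
  have r_cap: "regs s' r_cap = int cap" if "framed bfs_body ?s s'" for s'
    using frame_regs[OF framed[OF that], of r_cap] cap x by auto
  show "wp (While ?guard bfs_body) ?s (\<lambda>s' t. Suc (5 + t) \<le> 11 * cap + 8 \<and>
      (\<exists>V \<subseteq> visited P. (card (visited P) \<le> cap \<longrightarrow> V = visited P) \<and>
        regs s' x = min_with (regs s x) val {h \<in> V. \<not> P h \<and> acc h}))"
  proof (rule wp_While[where I = "\<lambda>s' t. \<exists>qs pos. bfs_inv s' t qs pos" and
        \<mu> = "\<lambda>s'. cap - nat (regs s' r_head)"])
    show "\<exists>qs pos. bfs_inv ?s 0 qs pos"
      by (intro exI[of _ "[1]"] exI[of _ 0]) (use x queue_inv_init in \<open>auto simp: bfs_inv_def\<close>)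
  next
    fix s' t assume "\<exists>qs pos. bfs_inv s' t qs pos" "fits B s'" and fr: "framed bfs_body ?s s'"
      and "beval s' ?guard"
    then obtain qs pos where inv: "bfs_inv s' t qs pos" "pos < length qs" "pos < cap"
      using r_cap[OF fr] by (auto simp: bfs_inv_def)
    from wp_bfs_body[OF inv(1) \<open>fits B s'\<close> framed[OF fr] inv(2,3)]
    show "wp bfs_body s' (\<lambda>s'' t'. (\<exists>qs pos. bfs_inv s'' (Suc (t + t')) qs pos) \<and>
        cap - nat (regs s'' r_head) < cap - nat (regs s' r_head))"
    proof (rule wp_conseq)
      fix s'' t' assume "\<exists>qs'. bfs_inv s'' (Suc (t + t')) qs' (Suc pos)"
      moreover from this have "regs s'' r_head = int (Suc pos)" by (auto simp: bfs_inv_def)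
      moreover have "regs s' r_head = int pos" using inv(1) by (simp add: bfs_inv_def)
      ultimately show "(\<exists>qs pos. bfs_inv s'' (Suc (t + t')) qs pos) \<and>
          cap - nat (regs s'' r_head) < cap - nat (regs s' r_head)"
        using inv(3) by (auto simp: nat_add_distrib)
    qed
  next
    fix s' t assume "\<exists>qs pos. bfs_inv s' t qs pos" and fr: "framed bfs_body ?s s'"
      and "\<not> beval s' ?guard"
    then obtain qs pos where inv: "bfs_inv s' t qs pos" by blast
    then have q: "queue_inv P qs pos" by (simp add: bfs_inv_def)
    have stop: "pos = length qs \<or> pos = cap"
      using inv q r_cap[OF fr] \<open>\<not> beval s' ?guard\<close> by (auto simp: bfs_inv_def queue_inv_def)
    have "set (take pos qs) = visited P" if "card (visited P) \<le> cap"
    proof -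
      have "length qs \<le> cap" using queue_inv_length[OF q finite_visited[of P, OF inner]] that by simp
      then have "pos = length qs" using stop q by (auto simp: queue_inv_def)
      then show ?thesis using q queue_inv_complete by simp
    qed
    moreover have "set (take pos qs) \<subseteq> visited P"
      using q set_take_subset[of pos qs] by (auto simp: queue_inv_def)
    ultimately show "Suc (5 + Suc t) \<le> 11 * cap + 8 \<and>
        (\<exists>V \<subseteq> visited P. (card (visited P) \<le> cap \<longrightarrow> V = visited P) \<and>
          regs s' x = min_with (regs s x) val {h \<in> V. \<not> P h \<and> acc h})"
      using inv by (auto simp: bfs_inv_def)
  qed (use B_ge_2 in auto)
qed

end

lemma visited_cover:
  assumes inner: "\<And>h. P h \<Longrightarrow> h < cols" and k: "k < cols"
  shows "\<exists>h\<in>visited P. \<not> P h \<and> k \<in> below h"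
proof -
  have "(cols + k) div 2 ^ d \<in> visited P \<Longrightarrow> \<exists>h\<in>visited P. \<not> P h \<and> k \<in> below h" for d
  proof (induction d)
    case 0
    then show ?case using inner[of "cols + k"] below_leaf[OF k] by force
  next
    case (Suc d)
    let ?h = "(cols + k) div 2 ^ Suc d" and ?h' = "(cols + k) div 2 ^ d"
    show ?case
    proof (cases "P ?h")
      case True
      have "m = 2 * (m div 2) \<or> m = Suc (2 * (m div 2))" for m :: nat by presburger
      then have "?h' \<in> visited P"
        using visited.left[OF Suc.prems True] visited.right[OF Suc.prems True]
        unfolding div_power_Suc by metis
      then show ?thesis by (rule Suc.IH)
    next
      case False
      have "k \<in> below ?h" unfolding below_def using k by blast
      then show ?thesis using False Suc.prems by blast
    qed
  qed
  moreover have "(cols + k) div 2 ^ L = 1" using k by (auto simp: cols_def div_nat_eqI)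
  ultimately show ?thesis using visited.root by metis
qed

lemma card_visited:
  assumes inner: "\<And>h. P h \<Longrightarrow> h < cols"
    and level: "\<And>l. l \<le> L \<Longrightarrow> card {h. P h \<and> h \<in> visited P \<and> 2 ^ l \<le> h \<and> h < 2 ^ Suc l} \<le> c"
  shows "card (visited P) \<le> 2 * levels * c + 1"
proof -
  let ?S = "{h \<in> visited P. P h}"
  let ?level = "\<lambda>l. {h. P h \<and> h \<in> visited P \<and> 2 ^ l \<le> h \<and> h < 2 ^ Suc l}"
  note finite = finite_visited[of P, OF inner]
  have "?S \<subseteq> (\<Union>l\<le>L. ?level l)"
  proof
    fix h assume h: "h \<in> ?S"
    then have "1 \<le> h" "h < 2 ^ Suc L" using visited_subset[of P, OF inner] by (auto simp: cols_def)
    then obtain l where l: "2 ^ l \<le> h" "h < 2 ^ Suc l" using ex_power_ivl1[of 2 h] by auto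
    then have "(2::nat) ^ l < 2 ^ Suc L" using \<open>h < 2 ^ Suc L\<close> by simp
    then have "l \<le> L" using power_less_imp_less_exp[of "2::nat" l "Suc L"] by simp
    then show "h \<in> (\<Union>l\<le>L. ?level l)" using h l by blast
  qed
  then have "card ?S \<le> card (\<Union>l\<le>L. ?level l)"
    by (intro card_mono) (use finite in auto)
  also have "\<dots> \<le> (\<Sum>l\<le>L. card (?level l))" by (rule card_UN_le) simp
  also have "\<dots> \<le> (\<Sum>l\<le>L. c)" using level by (intro sum_mono) auto
  finally have S: "card ?S \<le> levels * c" by (simp add: levels_def)
  have "h \<in> {1} \<union> (*) 2 ` ?S \<union> (\<lambda>h. Suc (2 * h)) ` ?S" if "h \<in> visited P" for h
    using that by cases auto
  then have "card (visited P) \<le> card ({1} \<union> (*) 2 ` ?S \<union> (\<lambda>h. Suc (2 * h)) ` ?S)"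
    using finite by (intro card_mono) auto
  also have "\<dots> \<le> card ({1} \<union> (*) 2 ` ?S) + card ((\<lambda>h. Suc (2 * h)) ` ?S)"
    by (rule card_Un_le)
  also have "\<dots> \<le> 1 + card ((*) 2 ` ?S) + card ((\<lambda>h. Suc (2 * h)) ` ?S)"
    using card_Un_le[of "{1}" "(*) 2 ` ?S"] by simp
  also have "\<dots> = 1 + 2 * card ?S"
    by (simp add: card_image inj_on_def)
  finally show ?thesis using S by simp
qed

end

section \<open>Branch and bound\<close>

context padded
begin

definition search_result :: "nat \<Rightarrow> (nat \<Rightarrow> int) \<Rightarrow> int \<Rightarrow> int \<Rightarrow> bool" where
  "search_result D f x x' \<longleftrightarrow> x' \<le> x \<and> (x' = x \<or> (\<exists>k<cols. x' = f k)) \<and>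
     (card {k. k < cols \<and> f k \<le> Min (f ` {..<cols}) + 2 * int D} \<le> cols div D \<longrightarrow>
       x' \<le> Min (f ` {..<cols}))"

abbreviation row_answered :: "nat \<Rightarrow> (nat \<Rightarrow> int) \<Rightarrow> nat \<Rightarrow> state \<Rightarrow> state \<Rightarrow> bool" where
  "row_answered D f i s s' \<equiv> (\<forall>p. p \<noteq> i \<longrightarrow> arrs s' a_answer p = arrs s a_answer p) \<and>
     search_result D f (arrs s a_answer i) (arrs s' a_answer i)"

end

locale branch_and_bound = padded +
  fixes lb f :: "nat \<Rightarrow> int" and high :: "nat \<Rightarrow> bool" and D :: nat
  assumes lb: "1 \<le> h \<Longrightarrow> k \<in> below h \<Longrightarrow> lb h \<le> f k"
    and low: "1 \<le> h \<Longrightarrow> h < 2 * cols \<Longrightarrow> \<not> high h \<Longrightarrow> \<exists>k\<in>below h. f k \<le> lb h + int D"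
    and high_inner: "high h \<Longrightarrow> h < cols"
    and few_high: "l \<le> L \<Longrightarrow> card {h. high h \<and> 2 ^ l \<le> h \<and> h < 2 ^ Suc l} \<le> cols div D"
begin

definition opt :: int where "opt = Min (f ` {..<cols})"
definition near :: "nat set" where "near = {k. k < cols \<and> f k \<le> opt + 2 * int D}"

lemma opt_le: "k < cols \<Longrightarrow> opt \<le> f k"
  unfolding opt_def by (intro Min_le) auto

lemma opt_attained: "\<exists>k<cols. f k = opt"
proof -
  have "{..<cols} \<noteq> {}" using cols_pos by blast
  then have "opt \<in> f ` {..<cols}" unfolding opt_def by (intro Min_in) auto
  then show ?thesis by auto
qed

lemma card_visited_high: "card (visited high) \<le> 4 * levels * (cols div D) + 1"
proof -
  have "card {h. high h \<and> h \<in> visited high \<and> 2 ^ l \<le> h \<and> h < 2 ^ Suc l} \<le> cols div D" if "l \<le> L" for l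
  proof -
    have "card {h. high h \<and> h \<in> visited high \<and> 2 ^ l \<le> h \<and> h < 2 ^ Suc l}
        \<le> card {h. high h \<and> 2 ^ l \<le> h \<and> h < 2 ^ Suc l}"
      by (intro card_mono finite_subset[of "{h. high h \<and> 2 ^ l \<le> h \<and> h < 2 ^ Suc l}" "{..<2 ^ Suc l}"])
        auto
    then show ?thesis using few_high[OF that] by simp
  qed
  from card_visited[of high, OF high_inner this] show ?thesis by simp
qed

lemma upper_bound:
  assumes "opt \<le> ub0"
  defines "ub \<equiv> min_with ub0 (\<lambda>h. lb h + int D) {h \<in> visited high. \<not> high h}"
  shows "opt \<le> ub" "ub \<le> opt + int D"
proof -
  note finite = finite_visited[of high, OF high_inner]
  have node: "1 \<le> h" "h < 2 * cols" if "h \<in> visited high" for h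
    using visited_subset[of high, OF high_inner] that by auto
  have "opt \<le> lb h + int D" if "h \<in> visited high" "\<not> high h" for h
    using low[OF node[OF that(1)] that(2)] opt_le below_less by (meson order_trans)
  then show "opt \<le> ub"
    using assms(1) finite by (simp add: ub_def min_with_def)
  obtain k where k: "k < cols" "f k = opt" using opt_attained by blast
  obtain h where h: "h \<in> visited high" "\<not> high h" "k \<in> below h"
    using visited_cover[of high, OF high_inner k(1)] by blast
  then have "ub \<le> lb h + int D"
    unfolding ub_def using finite by (intro min_with_le) auto
  then show "ub \<le> opt + int D" using lb[OF node(1) h(3)] h(1) k(2) by simp
qed

definition candidate :: "int \<Rightarrow> nat \<Rightarrow> bool" where
  "candidate ub h \<longleftrightarrow> h < cols \<and> lb h \<le> ub"

lemma candidate_less: "candidate ub h \<Longrightarrow> h < cols"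
  by (simp add: candidate_def)

lemma card_visited_candidate:
  assumes ub: "ub \<le> opt + int D" and few: "card near \<le> cols div D"
  shows "card (visited (candidate ub)) \<le> 4 * levels * (cols div D) + 1"
proof -
  let ?P = "candidate ub"
  have finite: "finite near" by (simp add: near_def)
  have "card {h. ?P h \<and> h \<in> visited ?P \<and> 2 ^ l \<le> h \<and> h < 2 ^ Suc l} \<le> 2 * (cols div D)"
    if l: "l \<le> L" for l
  proof -
    let ?H = "{h. high h \<and> 2 ^ l \<le> h \<and> h < 2 ^ Suc l}"
      and ?A = "{h. ?P h \<and> h \<in> visited ?P \<and> 2 ^ l \<le> h \<and> h < 2 ^ Suc l}"
      and ?ancestor = "\<lambda>k. (cols + k) div 2 ^ (L - l)"
    have "?A \<subseteq> ?H \<union> ?ancestor ` near"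
    proof
      fix h assume h: "h \<in> ?A"
      show "h \<in> ?H \<union> ?ancestor ` near"
      proof (cases "high h")
        case False
        have "1 \<le> h" using h visited_subset[of ?P, OF candidate_less[of ub]] by auto
        then obtain k where k: "k \<in> below h" "f k \<le> lb h + int D"
          using low[of h] False h by (auto simp: candidate_def)
        then have "k \<in> near" using ub h below_less by (auto simp: near_def candidate_def)
        moreover have "h = ?ancestor k" using below_level[OF k(1)] h by blast
        ultimately show ?thesis by blast
      qed (use h in blast)
    qed
    moreover have "finite ?H" by (rule finite_subset[of _ "{..<2 ^ Suc l}"]) auto
    ultimately have "card ?A \<le> card (?H \<union> ?ancestor ` near)"
      using finite by (intro card_mono) auto
    also have "\<dots> \<le> card ?H + card (?ancestor ` near)" by (rule card_Un_le)
    also have "\<dots> \<le> cols div D + cols div D"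
      using few_high[OF l] few card_image_le[OF finite, of ?ancestor] by linarith
    finally show ?thesis by simp
  qed
  from card_visited[of ?P, OF candidate_less[of ub] this] show ?thesis by simp
qed

lemma opt_leaf_visited:
  assumes "opt \<le> ub" "k < cols" "f k = opt"
  shows "cols + k \<in> visited (candidate ub)"
proof -
  obtain h where h: "h \<in> visited (candidate ub)" "\<not> candidate ub h" "k \<in> below h"
    using visited_cover[of "candidate ub", OF candidate_less[of ub] assms(2)] by blast
  have "1 \<le> h" "h < 2 * cols"
    using h(1) visited_subset[of "candidate ub", OF candidate_less[of ub]] by auto
  moreover from this have "cols \<le> h" using lb[OF _ h(3)] assms h(2) by (fastforce simp: candidate_def)
  ultimately show ?thesis using h(1,3) below_leaf[of "h - cols"] by simp
qed

lemma search_result_leaves: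
  assumes ub: "opt \<le> ub" "ub \<le> opt + int D" and V: "V \<subseteq> visited (candidate ub)"
    "card (visited (candidate ub)) \<le> 4 * levels * (cols div D) + 1 \<longrightarrow> V = visited (candidate ub)"
  shows "search_result D f x
    (min_with x (\<lambda>h. f (h - cols)) {h \<in> V. \<not> candidate ub h \<and> cols \<le> h})"
proof -
  let ?S = "{h \<in> V. \<not> candidate ub h \<and> cols \<le> h}" and ?leaf = "\<lambda>h. f (h - cols)"
  have sub: "V \<subseteq> {1..<2 * cols}"
    using V(1) visited_subset[of "candidate ub", OF candidate_less[of ub]] by blast
  then have finite: "finite ?S" using finite_subset by fastforce
  have "min_with x ?leaf ?S \<le> opt" if "card near \<le> cols div D"
  proof -
    obtain k where k: "k < cols" "f k = opt" using opt_attained by blast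
    have "V = visited (candidate ub)" using V(2) card_visited_candidate[OF ub(2) that] by blast
    then have "cols + k \<in> ?S" using opt_leaf_visited[OF ub(1) k] by (simp add: candidate_def)
    then show ?thesis using min_with_le(2)[OF finite, of "cols + k" x ?leaf] k(2) by simp
  qed
  moreover have "h - cols < cols" if "h \<in> ?S" for h using sub that by fastforce
  then have "min_with x ?leaf ?S = x \<or> (\<exists>k<cols. min_with x ?leaf ?S = f k)"
    using min_with_attained[OF finite, of x ?leaf] by metis
  ultimately show ?thesis
    using min_with_le(1)[OF finite, of x ?leaf] by (simp add: search_result_def near_def opt_def)
qed

end

context padded
begin

definition wide :: "nat \<Rightarrow> (nat \<Rightarrow> int) \<Rightarrow> (nat \<Rightarrow> int) \<Rightarrow> nat \<Rightarrow> bool" where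
  "wide D f g h \<longleftrightarrow> 1 \<le> h \<and> h < 2 * cols \<and> least f h + least g h + int D < 0"

lemma card_wide:
  assumes mono: "\<And>k. k + 1 < cols \<Longrightarrow> f k \<le> f (k + 1)"
    and range: "\<And>k. k < cols \<Longrightarrow> 1 \<le> f k \<and> f k \<le> int n" and D: "0 < D"
    and H: "H \<subseteq> {h. wide D f (\<lambda>k. - f k) h \<and> 2 ^ l \<le> h \<and> h < 2 ^ Suc l}"
  shows "card H \<le> cols div D"
proof -
  define hi where "hi h = - least (\<lambda>k. - f k) h" for h
  have mono': "f a \<le> f b" if "a \<le> b" "b < cols" for a b
    using that
  proof (induction b rule: dec_induct)
    case (step m)
    then show ?case using mono[of m] by force
  qed simp
  have H: "2 ^ l \<le> h" "h < 2 ^ Suc l" "1 \<le> h" "h < 2 * cols" "least f h + int D < hi h"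
    if "h \<in> H" for h
    using H that by (auto simp: wide_def hi_def)
  have attained: "\<exists>k\<in>below h. f k = least f h" "\<exists>k\<in>below h. f k = hi h" if "h \<in> H" for h
    using least_attained[OF H(3,4)[OF that], of f] least_attained[OF H(3,4)[OF that], of "\<lambda>k. - f k"]
    by (auto simp: hi_def minus_equation_iff[of _ "Min _"])
  have finite: "finite H" by (rule finite_subset[of _ "{..<2 ^ Suc l}"]) (use H(2) in auto)
  have "hi h \<le> least f h'" if h: "h \<in> H" "h' \<in> H" "h < h'" for h h'
  proof -
    obtain b a where b: "b \<in> below h" "f b = hi h" and a: "a \<in> below h'" "f a = least f h'"
      using attained(2)[OF h(1)] attained(1)[OF h(2)] by blast
    have "h = (cols + b) div 2 ^ (L - l)" "h' = (cols + a) div 2 ^ (L - l)"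
      using below_level[OF b(1)] below_level[OF a(1)] H h by blast+
    then have "b < a"
      using h(3) div_le_mono[of "cols + a" "cols + b" "2 ^ (L - l)"] by (meson add_le_cancel_left leI leD)
    then show ?thesis using mono'[of b a] below_less[OF a(1)] a b by simp
  qed
  then have disjoint: "{least f h<..hi h} \<inter> {least f h'<..hi h'} = {}"
    if "h \<in> H" "h' \<in> H" "h \<noteq> h'" for h h'
    using that by (cases h h' rule: linorder_cases) fastforce+
  have "card H * D = (\<Sum>h\<in>H. D)" by simp
  also have "\<dots> \<le> (\<Sum>h\<in>H. card {least f h<..hi h})"
    by (rule sum_mono) (use H(5) in fastforce)
  also have "\<dots> = card (\<Union>h\<in>H. {least f h<..hi h})"
    using disjoint finite by (intro card_UN_disjoint[symmetric]) auto
  also have "\<dots> \<le> card {1..int n}"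
  proof (rule card_mono)
    have "1 \<le> least f h \<and> hi h \<le> int n" if "h \<in> H" for h
      using attained[OF that] range below_less by metis
    then show "(\<Union>h\<in>H. {least f h<..hi h}) \<subseteq> {1..int n}" by fastforce
  qed simp
  also have "\<dots> \<le> cols" using n_le_cols by simp
  finally show ?thesis using D by (simp add: less_eq_div_iff_mult_less_eq)
qed

lemma branch_and_bound_monotone:
  fixes f v :: "nat \<Rightarrow> int"
  assumes range: "\<And>k. k < cols \<Longrightarrow> 1 \<le> f k \<and> f k \<le> int n" "\<And>k. k < cols \<Longrightarrow> 1 \<le> v k \<and> v k \<le> int n"
    and mono: "(\<forall>k. k + 1 < cols \<longrightarrow> f k \<le> f (k + 1)) \<or> (\<forall>k. k + 1 < cols \<longrightarrow> v k \<le> v (k + 1))"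
    and D: "0 < D"
  shows "branch_and_bound W B n L (\<lambda>h. least f h + least v h) (\<lambda>k. f k + v k)
    (\<lambda>h. wide D f (\<lambda>k. - f k) h \<and> wide D v (\<lambda>k. - v k) h) D"
proof
  show "least f h + least v h \<le> f k + v k" if "k \<in> below h" for h k
    using least_le[OF that] by (intro add_mono)
next
  fix h assume h: "1 \<le> h" "h < 2 * cols" "\<not> (wide D f (\<lambda>k. - f k) h \<and> wide D v (\<lambda>k. - v k) h)"
  have near: "\<exists>k\<in>below h. f k + v k \<le> least f h + least v h + int D"
    if "\<not> wide D f (\<lambda>k. - f k) h" for f v :: "nat \<Rightarrow> int"
  proof -
    obtain k where k: "k \<in> below h" "v k = least v h" using least_attained[OF h(1,2)] by blast
    moreover have "f k \<le> least f h + int D"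
      using least_le[OF k(1), of "\<lambda>k. - f k"] that h(1,2) by (simp add: wide_def)
    ultimately show ?thesis by (intro bexI[of _ k]) auto
  qed
  show "\<exists>k\<in>below h. f k + v k \<le> least f h + least v h + int D"
    using h(3) near[of f v] near[of v f] by (auto simp: add_ac)
next
  fix h assume "wide D f (\<lambda>k. - f k) h \<and> wide D v (\<lambda>k. - v k) h"
  then show "h < cols"
    using below_leaf[of "h - cols"] D by (cases "h < cols") (auto simp: wide_def)
next
  fix l
  let ?H = "{h. (wide D f (\<lambda>k. - f k) h \<and> wide D v (\<lambda>k. - v k) h) \<and> 2 ^ l \<le> h \<and> h < 2 ^ Suc l}"
  show "card ?H \<le> cols div D"
    using mono card_wide[of f D ?H l, OF _ range(1) D] card_wide[of v D ?H l, OF _ range(2) D] by blast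
qed

lemma branch_and_bound_stale:
  fixes f g :: "nat \<Rightarrow> int"
  assumes stale: "\<And>k. k < cols \<Longrightarrow> g k \<le> f k \<and> f k \<le> g k + int D"
  shows "branch_and_bound W B n L (\<lambda>h. least g h + least (\<lambda>_. 0) h) f
    (\<lambda>h. wide D (\<lambda>_. 0) (\<lambda>_. 0) h \<and> wide D v v' h) D"
proof
  have zero: "least (\<lambda>_. 0) h = 0" if "below h \<noteq> {}" for h
    using that by (simp add: image_constant_conv)
  show "least g h + least (\<lambda>_. 0) h \<le> f k" if "k \<in> below h" for h k
  proof -
    have "below h \<noteq> {}" using that by blast
    then show ?thesis using least_le[OF that, of g] stale[OF below_less[OF that]] zero by simp
  qed
  show "\<exists>k\<in>below h. f k \<le> least g h + least (\<lambda>_. 0) h + int D" if h: "1 \<le> h" "h < 2 * cols" for h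
  proof -
    obtain k where "k \<in> below h" "g k = least g h" using least_attained[OF h, of g] by blast
    then show ?thesis
      using zero[OF below_nonempty[OF h]] stale[of k] below_less by (intro bexI[of _ k]) auto
  qed
  have not_wide: "\<not> wide D (\<lambda>_. 0) (\<lambda>_. 0) h" for h
    using zero below_nonempty by (auto simp: wide_def)
  show "h < cols" if "wide D (\<lambda>_. 0) (\<lambda>_. 0) h \<and> wide D v v' h" for h
    using that not_wide by blast
  show "card {h. (wide D (\<lambda>_. 0) (\<lambda>_. 0) h \<and> wide D v v' h) \<and> 2 ^ l \<le> h \<and> h < 2 ^ Suc l} \<le> cols div D" for l
    using not_wide by simp
qed

end

definition gap_test :: bexp where
  "gap_test = Conj
    (Less (tree_at (R r_gap1) (R r_node) \<boxplus> tree_at (R r_gap2) (R r_node) \<boxplus> R r_radius) (N 0))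
    (Less (tree_at (R r_dim \<boxplus> R r_dim) (R r_node) \<boxplus> tree_at (R r_dim \<boxplus> R r_dim \<boxplus> N 1) (R r_node)
       \<boxplus> R r_radius) (N 0))"

definition relax_bound :: com where
  "relax_bound =
    If (Less (tree_at (R r_low1) (R r_node) \<boxplus> tree_at (R r_low2) (R r_node) \<boxplus> R r_radius) (R r_bound))
      (Assign r_bound (tree_at (R r_low1) (R r_node) \<boxplus> tree_at (R r_low2) (R r_node) \<boxplus> R r_radius))
      SKIP"

definition bound_test :: bexp where
  "bound_test = Conj (Less (R r_node) (R r_cols))
    (Neg (Less (R r_bound) (tree_at (R r_low1) (R r_node) \<boxplus> tree_at (R r_low2) (R r_node))))"

definition relax_best :: com where
  "relax_best = If (Less (R r_node) (R r_cols)) SKIP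
    (If (Less (matrix_at (R r_row) (R r_node \<boxminus> R r_cols) \<boxplus> Rd a_vec (R r_node \<boxminus> R r_cols)) (R r_best))
      (Assign r_best (matrix_at (R r_row) (R r_node \<boxminus> R r_cols) \<boxplus> Rd a_vec (R r_node \<boxminus> R r_cols)))
      SKIP)"

definition search :: com where
  "search =
    (Assign r_cap (N 4 \<boxtimes> R r_levels \<boxtimes> Bin Div (R r_cols) (R r_radius) \<boxplus> N 1) ;;
     Assign r_bound (N 8 \<boxtimes> R r_cols)) ;;
    bfs gap_test relax_bound ;; Assign r_best (Rd a_answer (R r_row)) ;;
    bfs bound_test relax_best ;; Store a_answer (R r_row) (R r_best)"

lemma mod_search [simp]:
  "mod_regs relax_bound = {r_bound}" "mod_arrs relax_bound = {}"
  "mod_regs relax_best = {r_best}" "mod_arrs relax_best = {}"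
  "mod_regs search = {r_head, r_tail, r_node, r_bound, r_best, r_cap}"
  "mod_arrs search = {a_answer, a_queue}"
  by (auto simp: search_def relax_bound_def relax_best_def)

context padded
begin

definition base :: "state \<Rightarrow> nat \<Rightarrow> bool" where
  "base s D \<longleftrightarrow> regs s r_dim = int n \<and> regs s r_cols = int cols \<and> regs s r_levels = int levels \<and>
     regs s r_radius = int D \<and> 0 < D \<and> D \<le> cols"

definition tree_in :: "state \<Rightarrow> nat \<Rightarrow> (nat \<Rightarrow> int) \<Rightarrow> bool" where
  "tree_in s r f \<longleftrightarrow> 0 \<le> regs s r \<and> tree s (nat (regs s r)) f"

definition search_trees ::
  "state \<Rightarrow> (nat \<Rightarrow> int) \<Rightarrow> (nat \<Rightarrow> int) \<Rightarrow> (nat \<Rightarrow> int) \<Rightarrow> (nat \<Rightarrow> int) \<Rightarrow> (nat \<Rightarrow> int) \<Rightarrow> (nat \<Rightarrow> int) \<Rightarrow> bool" where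
  "search_trees s F1 F2 G1 G2 U1 U2 \<longleftrightarrow> tree_in s r_low1 F1 \<and> tree_in s r_low2 F2 \<and>
     tree_in s r_gap1 G1 \<and> tree_in s r_gap2 G2 \<and> tree s (2 * n) U1 \<and> tree s (2 * n + 1) U2"

lemma search_trees_frame:
  assumes "search_trees s F1 F2 G1 G2 U1 U2" "frame X Y s s'"
    "X \<inter> {r_low1, r_low2, r_gap1, r_gap2} = {}" "a_trees \<notin> Y"
  shows "search_trees s' F1 F2 G1 G2 U1 U2"
proof -
  have "trees_agree UNIV s s'" using assms(2,4) by (simp add: trees_agree_arrs frame_arrs)
  moreover have "regs s' r = regs s r" if "r \<in> {r_low1, r_low2, r_gap1, r_gap2}" for r
    using frame_regs[OF assms(2)] assms(3) that by blast
  ultimately show ?thesis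
    using assms(1) tree_agree[of s _ _ UNIV s'] by (simp add: search_trees_def tree_in_def)
qed

lemma base_frame: "base s D \<Longrightarrow> frame X Y s s' \<Longrightarrow> X \<inter> {r_dim, r_cols, r_levels, r_radius} = {} \<Longrightarrow> base s' D"
  by (auto simp: base_def frame_def)

lemma search_trees_eval:
  assumes "search_trees s F1 F2 G1 G2 U1 U2" "base s D"
    and "regs s r_node = int h" "1 \<le> h" "h < 2 * cols"
  shows "aeval s (tree_at (R r_low1) (R r_node)) = least F1 h"
    "aeval s (tree_at (R r_low2) (R r_node)) = least F2 h"
    "aeval s (tree_at (R r_gap1) (R r_node)) = least G1 h"
    "aeval s (tree_at (R r_gap2) (R r_node)) = least G2 h"
    "aeval s (tree_at (R r_dim \<boxplus> R r_dim) (R r_node)) = least U1 h"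
    "aeval s (tree_at (R r_dim \<boxplus> R r_dim \<boxplus> N 1) (R r_node)) = least U2 h"
    "r \<in> {r_low1, r_low2, r_gap1, r_gap2} \<Longrightarrow> asafe B s (tree_at (R r) (R r_node))"
    "asafe B s (tree_at (R r_dim \<boxplus> R r_dim) (R r_node))"
    "asafe B s (tree_at (R r_dim \<boxplus> R r_dim \<boxplus> N 1) (R r_node))"
proof -
  have index: "nat (2 * int n) = 2 * n" "nat (2 * int n + 1) = 2 * n + 1" by simp_all
  show "aeval s (tree_at (R r_low1) (R r_node)) = least F1 h"
    "aeval s (tree_at (R r_low2) (R r_node)) = least F2 h"
    "aeval s (tree_at (R r_gap1) (R r_node)) = least G1 h"
    "aeval s (tree_at (R r_gap2) (R r_node)) = least G2 h"
    "aeval s (tree_at (R r_dim \<boxplus> R r_dim) (R r_node)) = least U1 h"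
    "aeval s (tree_at (R r_dim \<boxplus> R r_dim \<boxplus> N 1) (R r_node)) = least U2 h"
    using assms tree_node[OF _ assms(4,5)]
    by (simp_all add: search_trees_def tree_in_def base_def index)
qed (use assms B_ge_2 in \<open>auto simp: search_trees_def tree_in_def base_def\<close>)

lemma wp_relax_bounds:
  fixes F1 F2 G1 G2 U1 U2 D
  defines "high \<equiv> \<lambda>h. wide D G1 G2 h \<and> wide D U1 U2 h"
  assumes base: "base s D" and trees: "search_trees s F1 F2 G1 G2 U1 U2"
    and cap: "regs s r_cap = int cap" "int (2 * cap + 8) \<le> B" "card (visited high) \<le> cap"
    and inner: "\<And>h. high h \<Longrightarrow> h < cols"
    and F: "\<And>k. k < cols \<Longrightarrow> \<bar>F1 k\<bar> \<le> 2 * int n \<and> \<bar>F2 k\<bar> \<le> 2 * int n"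
  shows "wp (bfs gap_test relax_bound) s (\<lambda>s' t. t \<le> 11 * cap + 8 \<and> regs s' r_bound =
    min_with (regs s r_bound) (\<lambda>h. least F1 h + least F2 h + int D) {h \<in> visited high. \<not> high h})"
proof (rule wp_conseq, rule wp_bfs[where x = r_bound and P = high and acc = "\<lambda>_. True" and
      val = "\<lambda>h. least F1 h + least F2 h + int D", OF _ _ cap(1,2) inner])
  fix s' h assume framed: "framed (bfs gap_test relax_bound) s s'"
    and h: "regs s' r_node = int h" "1 \<le> h" "h < 2 * cols"
  have base': "base s' D" and trees': "search_trees s' F1 F2 G1 G2 U1 U2"
    using base_frame[OF base framed] search_trees_frame[OF trees framed] by simp_all
  note eval = search_trees_eval[OF trees' base' h]
  have "regs s' r_radius = int D" using base' by (simp add: base_def)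
  then show "bsafe B s' gap_test \<and> beval s' gap_test = high h"
    using eval h(2,3) B_ge_2 by (simp add: gap_test_def high_def wide_def del: aeval_tree asafe_tree)
next
  fix s' h assume framed: "framed (bfs gap_test relax_bound) s s'"
    and h: "regs s' r_node = int h" "1 \<le> h" "h < 2 * cols"
  have base': "base s' D" and trees': "search_trees s' F1 F2 G1 G2 U1 U2"
    using base_frame[OF base framed] search_trees_frame[OF trees framed] by simp_all
  have "\<bar>least F1 h\<bar> \<le> 2 * int n" "\<bar>least F2 h\<bar> \<le> 2 * int n"
    using least_attained[OF h(2,3)] F below_less by metis+
  then have "\<bar>least F1 h + least F2 h + int D\<bar> \<le> B"
    using base B_bounds n_le_cols unfolding base_def by linarith
  then show "safe B relax_bound s' \<and> cost relax_bound s' \<le> 4 \<and> effect relax_bound s' =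
      set_reg s' r_bound (if True then min (regs s' r_bound) (least F1 h + least F2 h + int D)
        else regs s' r_bound)"
    using search_trees_eval[OF trees' base' h] base' B_ge_2
    by (auto simp: relax_bound_def base_def min_def simp del: aeval_tree asafe_tree)
qed (use cap in auto)

lemma wp_relax_best:
  fixes F1 F2 ub
  defines "P \<equiv> \<lambda>h. h < cols \<and> least F1 h + least F2 h \<le> ub"
  assumes base: "base s D" and trees: "search_trees s F1 F2 G1 G2 U1 U2"
    and row: "regs s r_row = int i" and ub: "regs s r_bound = ub"
    and cap: "regs s r_cap = int cap" "int (2 * cap + 8) \<le> B"
    and f: "\<And>k. k < cols \<Longrightarrow> f k = entry s i k + arrs s a_vec k" "\<And>k. k < cols \<Longrightarrow> \<bar>f k\<bar> \<le> 2 * int n"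
  shows "wp (bfs bound_test relax_best) s (\<lambda>s' t. t \<le> 11 * cap + 8 \<and>
    (\<exists>V \<subseteq> visited P. (card (visited P) \<le> cap \<longrightarrow> V = visited P) \<and>
      regs s' r_best = min_with (regs s r_best) (\<lambda>h. f (h - cols)) {h \<in> V. \<not> P h \<and> cols \<le> h}))"
proof (rule wp_bfs[OF _ _ cap])
  fix s' h assume framed: "framed (bfs bound_test relax_best) s s'"
    and h: "regs s' r_node = int h" "1 \<le> h" "h < 2 * cols"
  have base': "base s' D" and trees': "search_trees s' F1 F2 G1 G2 U1 U2"
    using base_frame[OF base framed] search_trees_frame[OF trees framed] by simp_all
  have "regs s' r_bound = ub" using frame_regs[OF framed] ub by simp
  then show "bsafe B s' bound_test \<and> beval s' bound_test = P h"
    using search_trees_eval[OF trees' base' h] base' h(1) B_ge_2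
    by (auto simp: bound_test_def P_def base_def simp del: aeval_tree asafe_tree)
next
  fix s' h assume framed: "framed (bfs bound_test relax_best) s s'"
    and h: "regs s' r_node = int h" "1 \<le> h" "h < 2 * cols"
  have regs: "regs s' r_cols = int cols" "regs s' r_row = int i"
    using frame_regs[OF framed] base row by (simp_all add: base_def)
  have arrs: "entry s' = entry s" "arrs s' a_vec = arrs s a_vec"
    using frame_arrs[OF framed] by (simp_all add: entry_def fun_eq_iff)
  show "safe B relax_best s' \<and> cost relax_best s' \<le> 4 \<and> effect relax_best s' =
      set_reg s' r_best (if cols \<le> h then min (regs s' r_best) (f (h - cols)) else regs s' r_best)"
  proof (cases "h < cols")
    case True
    then show ?thesis using regs h(1) by (simp add: relax_best_def)
  next
    case False
    have k: "h - cols < cols" using False h(3) by simp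
    have index: "nat (int h - int cols) = h - cols" using False by simp
    have "\<bar>f (h - cols)\<bar> \<le> B" using f(2)[OF k] B_bounds n_le_cols by linarith
    then show ?thesis
      using False regs h(1) arrs
      by (cases "f (h - cols) < regs s' r_best")
        (simp_all add: relax_best_def index f(1)[OF k, symmetric] min_def)
  qed
qed (auto simp: P_def)

lemma wp_search:
  fixes F1 F2 G1 G2 U1 U2 D
  assumes base: "base s D" and row: "regs s r_row = int i"
    and trees: "search_trees s F1 F2 G1 G2 U1 U2"
    and f: "\<And>k. k < cols \<Longrightarrow> f k = entry s i k + arrs s a_vec k" "\<And>k. k < cols \<Longrightarrow> \<bar>f k\<bar> \<le> 2 * int n"
    and F: "\<And>k. k < cols \<Longrightarrow> \<bar>F1 k\<bar> \<le> 2 * int n \<and> \<bar>F2 k\<bar> \<le> 2 * int n"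
    and bb: "branch_and_bound W B n L (\<lambda>h. least F1 h + least F2 h) f
      (\<lambda>h. wide D G1 G2 h \<and> wide D U1 U2 h) D"
  shows "wp search s (\<lambda>s' t. t \<le> 88 * levels * (cols div D) + 60 \<and>
    row_answered D f i s s')"
proof (rule wp_fits)
  assume fits: "fits B s"
  let ?high = "\<lambda>h. wide D G1 G2 h \<and> wide D U1 U2 h"
  interpret bb: branch_and_bound W B n L "\<lambda>h. least F1 h + least F2 h" f ?high D
    by (rule bb)
  define cap where "cap = 4 * levels * (cols div D) + 1"
  have cap_bound: "int (2 * cap + 8) \<le> B"
  proof (rule le_B_quadratic)
    have "levels \<le> n + 1" using L_le by (simp add: levels_def)
    moreover have "cols div D \<le> 2 * n" using cols_less div_le_dividend[of cols D] by linarith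
    ultimately have "levels * (cols div D) \<le> (n + 1) * (2 * n)" by (rule mult_le_mono)
    then show "2 * cap + 8 \<le> 1000 * (n + 2)^2"
      by (simp add: cap_def power2_eq_square algebra_simps)
  qed
  let ?s1 = "s\<lparr>regs := (regs s)(r_cap := int cap, r_bound := 8 * int cols)\<rparr>"
  have opt: "bb.opt \<le> 8 * int cols"
    using bb.opt_le[OF cols_pos] f(2)[OF cols_pos] n_le_cols by linarith
  have base1: "base ?s1 D" and trees1: "search_trees ?s1 F1 F2 G1 G2 U1 U2"
    using base_frame[OF base, of "{r_cap, r_bound}" "{}" ?s1]
      search_trees_frame[OF trees, of "{r_cap, r_bound}" "{}" ?s1] by (simp_all add: frame_def)
  have first: "wp (bfs gap_test relax_bound) ?s1 (\<lambda>s' t. t \<le> 11 * cap + 8 \<and>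
      bb.opt \<le> regs s' r_bound \<and> regs s' r_bound \<le> bb.opt + int D)"
    by (rule wp_conseq, rule wp_relax_bounds[OF base1 trees1, where cap = cap])
      (use cap_bound bb.card_visited_high bb.high_inner F bb.upper_bound[OF opt] in
        \<open>auto simp: cap_def\<close>)
  let ?res = "\<lambda>s'. row_answered D f i s s'"
  let ?third = "bfs bound_test relax_best ;; Store a_answer (R r_row) (R r_best)"
  let ?second = "Assign r_best (Rd a_answer (R r_row)) ;; ?third"
  have second: "wp ?second s3 (\<lambda>s' t. t \<le> 11 * cap + 12 \<and> ?res s')"
    if fr3: "framed (bfs gap_test relax_bound) ?s1 s3"
      and ub: "bb.opt \<le> regs s3 r_bound" "regs s3 r_bound \<le> bb.opt + int D" for s3
  proof -
    let ?s4 = "set_reg s3 r_best (arrs s a_answer i)"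
    have fr4: "frame {r_cap, r_bound, r_head, r_tail, r_node, r_best} {a_queue} s ?s4"
      using fr3 by (auto simp: frame_def)
    have row4: "regs s3 r_row = int i" "arrs s3 a_answer = arrs s a_answer"
      using frame_regs[OF fr3] frame_arrs[OF fr3] row by simp_all
    have "wp (bfs bound_test relax_best) ?s4 (\<lambda>s' t. t \<le> 11 * cap + 8 \<and>
        search_result D f (arrs s a_answer i) (regs s' r_best))" (is "wp _ _ ?R")
    proof (rule wp_conseq, rule wp_relax_best[where ub = "regs s3 r_bound" and cap = cap])
      show "base ?s4 D" "search_trees ?s4 F1 F2 G1 G2 U1 U2"
        using base_frame[OF base fr4] search_trees_frame[OF trees fr4] by simp_all
      show "f k = entry ?s4 i k + arrs ?s4 a_vec k" if "k < cols" for k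
        using f(1)[OF that] frame_arrs[OF fr4] by (simp add: entry_def)
      fix s' t
      assume "t \<le> 11 * cap + 8 \<and>
        (\<exists>V \<subseteq> visited (\<lambda>h. h < cols \<and> least F1 h + least F2 h \<le> regs s3 r_bound).
          (card (visited (\<lambda>h. h < cols \<and> least F1 h + least F2 h \<le> regs s3 r_bound)) \<le> cap \<longrightarrow>
            V = visited (\<lambda>h. h < cols \<and> least F1 h + least F2 h \<le> regs s3 r_bound)) \<and>
          regs s' r_best = min_with (regs ?s4 r_best) (\<lambda>h. f (h - cols))
            {h \<in> V. \<not> (h < cols \<and> least F1 h + least F2 h \<le> regs s3 r_bound) \<and> cols \<le> h})"
      then show "t \<le> 11 * cap + 8 \<and> search_result D f (arrs s a_answer i) (regs s' r_best)"
        using bb.search_result_leaves[OF ub]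
        unfolding bb.candidate_def[abs_def] cap_def by fastforce
    qed (use row4 cap_bound f(2) frame_regs[OF fr3] in auto)
    then have "wp ?third ?s4 (\<lambda>s' t. Suc (1 + t) \<le> 11 * cap + 12 \<and> ?res s')"
    proof (rule wp_Seq_conseq)
      fix s5 t5
      assume "?R s5 t5"
        and fr5: "framed (bfs bound_test relax_best) ?s4 s5" and "fits B s5"
      moreover have "regs s5 r_row = int i" "arrs s5 a_answer = arrs s a_answer"
        using frame_regs[OF fr5] frame_arrs[OF fr5] row4 by simp_all
      ultimately show "wp (Store a_answer (R r_row) (R r_best)) s5
          (\<lambda>s' t. Suc (1 + Suc (t5 + t)) \<le> 11 * cap + 12 \<and> ?res s')"
        using fits_regs[of B s5 r_best] by (intro wp_straight) auto
    qed
    then show ?thesis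
      by (rule wp_straight_Seq[rotated 3]) (use row4 fits_arrs[OF fits] in auto)
  qed
  have cap_eq: "4 * int levels * (int cols div int D) + 1 = int cap"
    by (simp add: cap_def zdiv_int)
  show ?thesis
    unfolding search_def
  proof (rule wp_straight_Seq)
    let ?init = "Assign r_cap (N 4 \<boxtimes> R r_levels \<boxtimes> Bin Div (R r_cols) (R r_radius) \<boxplus> N 1) ;;
      Assign r_bound (N 8 \<boxtimes> R r_cols)"
    show "safe B ?init s" "effect ?init s = ?s1" "cost ?init s = 3"
      using base cap_bound B_bounds by (auto simp: base_def cap_eq)
    show "wp (bfs gap_test relax_bound ;; ?second) ?s1 (\<lambda>s' t.
        Suc (3 + t) \<le> 88 * levels * (cols div D) + 60 \<and> ?res s')"
    proof (rule wp_Seq_conseq[OF first], elim conjE)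
      fix s3 t3 assume "t3 \<le> 11 * cap + 8" "bb.opt \<le> regs s3 r_bound" "regs s3 r_bound \<le> bb.opt + int D"
        "framed (bfs gap_test relax_bound) ?s1 s3"
      then show "wp ?second s3 (\<lambda>s' t. Suc (3 + Suc (t3 + t)) \<le> 88 * levels * (cols div D) + 60 \<and> ?res s')"
        by (intro wp_conseq[OF second]) (auto simp: cap_def algebra_simps)
    qed
  qed
qed

end

section \<open>One row of the answer\<close>

text \<open>
  Trees \<open>i\<close>, \<open>n + i\<close>, \<open>2n\<close>, \<open>2n + 1\<close>, \<open>2n + 2\<close> hold row \<open>i\<close>, its negation, the query, its negation, and 0.
  Mode 1 searches row and query, one of which is monotone. Modes 2 (monotone columns) and 3 (queries monotone
  in time) search an outdated copy of the sums, in tree \<open>2n + 3\<close> or \<open>2n + 4 + i\<close>, after refreshing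
  it at a list of columns.
\<close>

definition refresh :: com where
  "refresh = While (Less (R r_from) (R r_to))
    ((Assign r_leaf (Rd a_refresh (R r_from)) ;;
      Assign r_val (matrix_at (R r_row) (R r_leaf) \<boxplus> Rd a_vec (R r_leaf))) ;;
     update_leaf ;; Assign r_from (R r_from \<boxplus> N 1))"

abbreviation offset_index :: "aexp \<Rightarrow> aexp \<Rightarrow> aexp" where
  "offset_index e i \<equiv> e \<boxtimes> (R r_dim \<boxplus> N 1) \<boxplus> i"

definition select_trees :: com where
  "select_trees = If (Equal (R r_mode) (N 1))
    (Assign r_low1 (R r_row) ;; Assign r_low2 (R r_dim \<boxplus> R r_dim) ;;
     Assign r_gap1 (R r_row) ;; Assign r_gap2 (R r_dim \<boxplus> R r_row) ;;
     Assign r_from (N 0) ;; Assign r_to (N 0))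
    (Assign r_low2 (R r_dim \<boxplus> R r_dim \<boxplus> N 2) ;; Assign r_gap1 (R r_low2) ;; Assign r_gap2 (R r_low2) ;;
     If (Equal (R r_mode) (N 2))
      (Assign r_low1 (R r_dim \<boxplus> R r_dim \<boxplus> N 3) ;;
       Assign r_from (Rd a_offsets (offset_index (R r_radius) (R r_row))) ;;
       Assign r_to (Rd a_offsets (offset_index (R r_radius) (R r_row \<boxplus> N 1))))
      (Assign r_low1 (R r_dim \<boxplus> R r_dim \<boxplus> N 4 \<boxplus> R r_row) ;;
       Assign r_from (R r_end) ;; Assign r_to (R r_last)))"

definition refresh_search :: com where
  "refresh_search = Assign r_tree (R r_low1) ;; refresh ;; search"

definition row :: com where
  "row = select_trees ;; refresh_search"

lemma mod_row [simp]:
  "mod_regs refresh = {r_leaf, r_val, r_path, r_from}" "mod_arrs refresh = {a_trees}"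
  "mod_regs select_trees = {r_low1, r_low2, r_gap1, r_gap2, r_from, r_to}" "mod_arrs select_trees = {}"
  "mod_regs row = {r_low1, r_low2, r_gap1, r_gap2, r_from, r_to, r_tree, r_leaf, r_val, r_path,
    r_head, r_tail, r_node, r_bound, r_best, r_cap}"
  "mod_arrs row = {a_answer, a_trees, a_queue}"
  by (auto simp: refresh_def select_trees_def row_def refresh_search_def)

context padded
begin

lemma tree_update [simp]: "tree (s\<lparr>regs := x\<rparr>) = tree s"
  by (simp add: tree_def heap_at_def fun_eq_iff)

lemma trees_agree_update [simp]:
  "trees_agree X (s\<lparr>regs := x\<rparr>) s' = trees_agree X s s'" "trees_agree X s (s'\<lparr>regs := x\<rparr>) = trees_agree X s s'"
  by (simp_all add: trees_agree_def)

lemma wp_refresh: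
  assumes s: "regs s r_cols = int cols" "regs s r_row = int i" "regs s r_tree = int r"
    "regs s r_from = int lo" "regs s r_to = int (lo + length ks)"
    and ks: "\<And>x. x < length ks \<Longrightarrow> arrs s a_refresh (lo + x) = int (ks ! x)" "set ks \<subseteq> {..<cols}"
    and tree: "tree s r g"
    and f: "\<And>k. k < cols \<Longrightarrow> f k = entry s i k + arrs s a_vec k" "\<And>k. k < cols \<Longrightarrow> \<bar>f k\<bar> \<le> B"
  shows "wp refresh s (\<lambda>s' t. t \<le> length ks * (7 * levels + 8) + 1 \<and>
    tree s' r (\<lambda>k. if k \<in> set ks then f k else g k) \<and> trees_agree (- {r}) s s')"
proof -
  define g' where "g' x k = (if k \<in> set (take x ks) then f k else g k)" for x k
  define I where "I s' t \<longleftrightarrow> (\<exists>x\<le>length ks. regs s' r_from = int (lo + x) \<and> t \<le> x * (7 * levels + 8) \<and>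
    tree s' r (g' x) \<and> trees_agree (- {r}) s s')" for s' t
  let ?load = "Assign r_leaf (Rd a_refresh (R r_from)) ;;
    Assign r_val (matrix_at (R r_row) (R r_leaf) \<boxplus> Rd a_vec (R r_leaf))"
  let ?body = "?load ;; update_leaf ;; Assign r_from (R r_from \<boxplus> N 1)"
  have init: "I s 0"
    unfolding I_def using s tree by (intro exI[of _ 0]) (simp add: g'_def[abs_def])
  have body: "wp ?body s' (\<lambda>s'' t'. I s'' (Suc (t + t')) \<and>
      lo + length ks - nat (regs s'' r_from) < lo + length ks - nat (regs s' r_from))"
    if inv: "I s' t" and fits: "fits B s'" and framed: "framed ?body s s'"
      and guard: "beval s' (Less (R r_from) (R r_to))" for s' t
  proof -
    have same: "regs s' r_cols = int cols" "regs s' r_row = int i" "regs s' r_tree = int r"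
      "regs s' r_to = int (lo + length ks)" "entry s' = entry s"
      "arrs s' a_vec = arrs s a_vec" "arrs s' a_refresh = arrs s a_refresh"
      using s frame_regs[OF framed] frame_arrs[OF framed] by (simp_all add: entry_def fun_eq_iff)
    then obtain x where x: "x < length ks" "regs s' r_from = int (lo + x)"
      "t \<le> x * (7 * levels + 8)" "tree s' r (g' x)" "trees_agree (- {r}) s s'"
      using inv guard by (auto simp: I_def)
    have step: "(g' x)(ks ! x := f (ks ! x)) = g' (Suc x)"
      using x(1) by (auto simp: g'_def take_Suc_conv_app_nth fun_eq_iff)
    have k: "ks ! x < cols" using ks(2) x(1) nth_mem by blast
    let ?s = "s'\<lparr>regs := (regs s')(r_leaf := int (ks ! x), r_val := f (ks ! x))\<rparr>"
    have "wp update_leaf ?s (\<lambda>s1 t1. t1 \<le> 7 * levels \<and> tree s1 r (g' (Suc x)) \<and> trees_agree (- {r}) s s1)"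
    proof (rule wp_conseq, rule wp_update_leaf[where r = r and k = "ks ! x" and f = "g' x"])
      fix s1 t1 assume "t1 \<le> 7 * levels \<and> tree s1 r ((g' x)(ks ! x := regs ?s r_val)) \<and>
        trees_agree (- {r}) ?s s1"
      then show "t1 \<le> 7 * levels \<and> tree s1 r (g' (Suc x)) \<and> trees_agree (- {r}) s s1"
        using trees_agree_trans[OF x(5), of "- {r}" s1] by (simp add: step)
    qed (use same x k in auto)
    then have rest: "wp (update_leaf ;; Assign r_from (R r_from \<boxplus> N 1)) ?s (\<lambda>s'' t'.
        I s'' (Suc (t + Suc (3 + t'))) \<and>
        lo + length ks - nat (regs s'' r_from) < lo + length ks - nat (regs s' r_from))"
    proof (rule wp_Seq_conseq)
      fix s1 t1 assume res: "t1 \<le> 7 * levels \<and> tree s1 r (g' (Suc x)) \<and> trees_agree (- {r}) s s1"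
        and fr: "framed update_leaf ?s s1"
      have cursor: "regs s1 r_from = int (lo + x)" using frame_regs[OF fr] x(2) by simp
      have "I (set_reg s1 r_from (int (lo + Suc x))) (Suc (t + Suc (3 + Suc (t1 + 1))))"
        unfolding I_def using res x by (intro exI[of _ "Suc x"]) simp
      moreover have "int (lo + Suc x) \<le> B"
        using fits_regs[OF fits, of r_to] same(4) x(1) by simp
      ultimately show "wp (Assign r_from (R r_from \<boxplus> N 1)) s1 (\<lambda>s'' t'.
          I s'' (Suc (t + Suc (3 + Suc (t1 + t')))) \<and>
          lo + length ks - nat (regs s'' r_from) < lo + length ks - nat (regs s' r_from))"
        using cursor x B_ge_2 by (intro wp_straightI) (auto simp: add_ac)
    qed
    have "int (ks ! x) \<le> B" using k B_bounds by simp
    then have "safe B ?load s'" "effect ?load s' = ?s" "cost ?load s' = 3"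
      using same x(2) ks(1)[OF x(1)] f[OF k] by (simp_all del: of_nat_add)
    then show ?thesis using rest by (rule wp_straight_Seq)
  qed
  show ?thesis
    unfolding refresh_def
  proof (rule wp_While[where I = I and \<mu> = "\<lambda>s'. lo + length ks - nat (regs s' r_from)", OF init _ body])
    fix s' t assume "I s' t" "framed ?body s s'" "\<not> beval s' (Less (R r_from) (R r_to))"
    then obtain x where "x = length ks" "t \<le> x * (7 * levels + 8)" "tree s' r (g' x)"
      "trees_agree (- {r}) s s'"
      using frame_regs[of _ _ s s' r_to] s(5) by (force simp: I_def)
    then show "Suc t \<le> length ks * (7 * levels + 8) + 1 \<and>
        tree s' r (\<lambda>k. if k \<in> set ks then f k else g k) \<and> trees_agree (- {r}) s s'"
      by (simp add: g'_def[abs_def])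
  qed auto
qed

lemma wp_refresh_search:
  fixes f g :: "nat \<Rightarrow> int" and ks :: "nat list"
  defines "g' \<equiv> \<lambda>k. if k \<in> set ks then f k else g k"
  assumes base: "base s D" and s: "regs s r_row = int i" "regs s r_low1 = int r"
    "regs s r_from = int lo" "regs s r_to = int (lo + length ks)"
    and ks: "\<And>x. x < length ks \<Longrightarrow> arrs s a_refresh (lo + x) = int (ks ! x)" "set ks \<subseteq> {..<cols}"
    and tree: "tree s r g"
    and trees: "\<And>s'. tree s' r g' \<Longrightarrow> trees_agree (- {r}) s s' \<Longrightarrow>
      (\<forall>x\<in>{r_low1, r_low2, r_gap1, r_gap2}. regs s' x = regs s x) \<Longrightarrow>
      search_trees s' g' F2 G1 G2 U1 U2"
    and f: "\<And>k. k < cols \<Longrightarrow> f k = entry s i k + arrs s a_vec k" "\<And>k. k < cols \<Longrightarrow> \<bar>f k\<bar> \<le> 2 * int n"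
    and F: "\<And>k. k < cols \<Longrightarrow> \<bar>g' k\<bar> \<le> 2 * int n \<and> \<bar>F2 k\<bar> \<le> 2 * int n"
    and bb: "branch_and_bound W B n L (\<lambda>h. least g' h + least F2 h) f
      (\<lambda>h. wide D G1 G2 h \<and> wide D U1 U2 h) D"
  shows "wp refresh_search s (\<lambda>s' t. t \<le> length ks * (7 * levels + 8) + 88 * levels * (cols div D) + 66 \<and>
    row_answered D f i s s' \<and>
    tree s' r g' \<and> trees_agree (- {r}) s s')"
    (is "wp _ _ ?Q")
  unfolding refresh_search_def
proof (rule wp_fits, rule wp_straight_Seq)
  assume fits: "fits B s"
  let ?s = "set_reg s r_tree (int r)"
  show "safe B (Assign r_tree (R r_low1)) s" "effect (Assign r_tree (R r_low1)) s = ?s"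
    "cost (Assign r_tree (R r_low1)) s = 1"
    using s(2) fits_regs[OF fits, of r_low1] by simp_all
  have "\<bar>f k\<bar> \<le> B" if "k < cols" for k using f(2)[OF that] B_bounds n_le_cols by linarith
  then have "wp refresh ?s (\<lambda>s' t. t \<le> length ks * (7 * levels + 8) + 1 \<and> tree s' r g' \<and>
      trees_agree (- {r}) ?s s')" (is "wp _ _ ?R")
    unfolding g'_def using base s ks tree f by (intro wp_refresh[where i = i]) (auto simp: base_def)
  then show "wp (refresh ;; search) ?s (\<lambda>s' t. ?Q s' (Suc (1 + t)))"
  proof (rule wp_Seq_conseq)
    fix s1 t1 assume res: "?R s1 t1"
      and fr: "framed refresh ?s s1"
    have "wp search s1 (\<lambda>s' t. t \<le> 88 * levels * (cols div D) + 60 \<and>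
      row_answered D f i s1 s')" (is "wp _ _ ?R")
    proof (rule wp_search[OF _ _ _ _ f(2) F bb])
      show "base s1 D" "regs s1 r_row = int i" "search_trees s1 g' F2 G1 G2 U1 U2"
        using base s(1) frame_regs[OF fr] res by (auto simp: base_def intro!: trees)
      show "f k = entry s1 i k + arrs s1 a_vec k" if "k < cols" for k
        using f(1)[OF that] frame_arrs[OF fr] by (simp add: entry_def)
    qed
    then show "wp search s1 (\<lambda>s' t. ?Q s' (Suc (1 + Suc (t1 + t))))"
    proof (rule wp_conseq)
      fix s' t assume "framed search s1 s'"
      then have "trees_agree UNIV s1 s'" by (intro trees_agree_arrs) (simp add: frame_arrs)
      then have "tree s' r g'" "trees_agree (- {r}) s s'"
        using res tree_agree[of s1 r g' UNIV s'] trees_agree_trans[of "- {r}" s s1 UNIV s'] by auto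
      moreover assume "?R s' t"
      moreover have "arrs s1 a_answer = arrs s a_answer" using frame_arrs[OF fr] by simp
      ultimately show "?Q s' (Suc (1 + Suc (t1 + t)))"
        using res by simp
    qed
  qed
qed

definition monotone_on_cols :: "(nat \<Rightarrow> int) \<Rightarrow> bool" where
  "monotone_on_cols f \<longleftrightarrow> (\<forall>k. k + 1 < cols \<longrightarrow> f k \<le> f (k + 1))"

lemma wp_row_exact:
  fixes f v :: "nat \<Rightarrow> int"
  assumes base: "base s D" and s: "regs s r_mode = 1" "regs s r_row = int i" "i < n"
    and trees: "tree s i f" "tree s (n + i) (\<lambda>k. - f k)" "tree s (2 * n) v" "tree s (2 * n + 1) (\<lambda>k. - v k)"
    and data: "\<And>k. k < cols \<Longrightarrow> entry s i k = f k" "\<And>k. k < cols \<Longrightarrow> arrs s a_vec k = v k"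
    and range: "\<And>k. k < cols \<Longrightarrow> 1 \<le> f k \<and> f k \<le> int n" "\<And>k. k < cols \<Longrightarrow> 1 \<le> v k \<and> v k \<le> int n"
    and mono: "monotone_on_cols f \<or> monotone_on_cols v"
  shows "wp row s (\<lambda>s' t. t \<le> 88 * levels * (cols div D) + 90 \<and>
    row_answered D (\<lambda>k. f k + v k) i s s' \<and>
    tree s' i f \<and> trees_agree (- {i}) s s')"
    (is "wp _ _ ?Q")
  unfolding row_def
proof (rule wp_straight_Seq)
  let ?s = "s\<lparr>regs := (regs s)(r_low1 := int i, r_low2 := 2 * int n, r_gap1 := int i,
    r_gap2 := int n + int i, r_from := 0, r_to := 0)\<rparr>"
  show "safe B select_trees s" "effect select_trees s = ?s" "cost select_trees s = 12"
    using base s B_bounds n_le_cols by (auto simp: select_trees_def base_def)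
  have 0: "(\<lambda>k. if k \<in> set ([] :: nat list) then f k + v k else f k) = f" by simp
  show "wp refresh_search ?s (\<lambda>s' t. ?Q s' (Suc (12 + t)))"
  proof (rule wp_conseq, rule wp_refresh_search[where D = D and i = i and r = i and lo = 0 and ks = "[]" and
        f = "\<lambda>k. f k + v k" and g = f and ?F2.0 = v and ?G1.0 = f and ?G2.0 = "\<lambda>k. - f k" and
        ?U1.0 = v and ?U2.0 = "\<lambda>k. - v k", unfolded 0])
    fix s' assume "tree s' i f" and agree: "trees_agree (- {i}) ?s s'"
      and regs: "\<forall>x\<in>{r_low1, r_low2, r_gap1, r_gap2}. regs s' x = regs ?s x"
    moreover have "tree s' (n + i) (\<lambda>k. - f k)" "tree s' (2 * n) v" "tree s' (Suc (2 * n)) (\<lambda>k. - v k)"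
      using trees(2-4) tree_agree[OF _ agree, unfolded tree_update] s(3) n_pos by auto
    ultimately show "search_trees s' f v f (\<lambda>k. - f k) v (\<lambda>k. - v k)"
      by (simp add: search_trees_def tree_in_def nat_add_distrib nat_mult_distrib)
  next
    show "branch_and_bound W B n L (\<lambda>h. least f h + least v h) (\<lambda>k. f k + v k)
      (\<lambda>h. wide D f (\<lambda>k. - f k) h \<and> wide D v (\<lambda>k. - v k) h) D"
      using branch_and_bound_monotone[OF range, where D = D] mono base
      by (simp add: monotone_on_cols_def base_def)
    show "base ?s D" using base by (simp add: base_def)
  qed (use s trees data range in \<open>fastforce+\<close>)
qed

definition refresh_range :: "state \<Rightarrow> nat \<Rightarrow> nat \<Rightarrow> nat \<Rightarrow> nat \<Rightarrow> nat \<Rightarrow> bool" where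
  "refresh_range s D i r lo hi \<longleftrightarrow>
     regs s r_mode = 2 \<and> r = 2 * n + 3 \<and> arrs s a_offsets (D * (n + 1) + i) = int lo \<and>
       arrs s a_offsets (D * (n + 1) + i + 1) = int hi \<or>
     regs s r_mode = 3 \<and> r = 2 * n + 4 + i \<and> regs s r_end = int lo \<and> regs s r_last = int hi"

lemma wp_row_stale:
  fixes f g :: "nat \<Rightarrow> int" and ks :: "nat list"
  defines "g' \<equiv> \<lambda>k. if k \<in> set ks then f k else g k"
  assumes base: "base s D" and s: "regs s r_row = int i" "i < n" "refresh_range s D i r lo (lo + length ks)"
    and ks: "\<And>x. x < length ks \<Longrightarrow> arrs s a_refresh (lo + x) = int (ks ! x)" "set ks \<subseteq> {..<cols}"
    and trees: "tree s r g" "tree s (2 * n) v" "tree s (2 * n + 1) v'" "tree s (2 * n + 2) (\<lambda>_. 0)"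
    and f: "\<And>k. k < cols \<Longrightarrow> f k = entry s i k + arrs s a_vec k"
      "\<And>k. k < cols \<Longrightarrow> 1 \<le> f k \<and> f k \<le> 2 * int n"
    and stale: "\<And>k. k < cols \<Longrightarrow> \<bar>g' k\<bar> \<le> 2 * int n \<and> g' k \<le> f k \<and> f k \<le> g' k + int D"
  shows "wp row s (\<lambda>s' t. t \<le> length ks * (7 * levels + 8) + 88 * levels * (cols div D) + 90 \<and>
    row_answered D f i s s' \<and>
    tree s' r g' \<and> trees_agree (- {r}) s s')"
    (is "wp _ _ ?Q")
  unfolding row_def
proof (rule wp_fits, rule wp_straight_Seq)
  assume fits: "fits B s"
  let ?s = "s\<lparr>regs := (regs s)(r_low2 := 2 * int n + 2, r_gap1 := 2 * int n + 2, r_gap2 := 2 * int n + 2,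
    r_low1 := int r, r_from := int lo, r_to := int (lo + length ks))\<rparr>"
  have offset: "nat (int D * (int n + 1) + int i) = D * (n + 1) + i"
    "nat (int D * (int n + 1) + (int i + 1)) = D * (n + 1) + i + 1"
    by (simp_all add: nat_add_distrib nat_mult_distrib)
  have r: "2 * n + 3 \<le> r" "r \<le> 3 * n + 4" using s(2,3) by (auto simp: refresh_range_def)
  have "int lo \<le> B" "int (lo + length ks) \<le> B"
    using s(3) fits_regs[OF fits, of r_end] fits_regs[OF fits, of r_last]
      fits_arrs[OF fits, of a_offsets "D * (n + 1) + i"]
      fits_arrs[OF fits, of a_offsets "D * (n + 1) + i + 1"]
    unfolding refresh_range_def by (elim disjE conjE; simp)+
  moreover have "5 * int n + 10 \<le> B" using B_bounds n_le_cols by linarith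
  ultimately show "safe B select_trees s" "effect select_trees s = ?s" "cost select_trees s = 13"
    using base s r offset by (auto simp: select_trees_def base_def refresh_range_def)
  show "wp refresh_search ?s (\<lambda>s' t. ?Q s' (Suc (13 + t)))"
  proof (rule wp_conseq, rule wp_refresh_search[where D = D and i = i and r = r and lo = lo and ks = ks and
        f = f and g = g and ?F2.0 = "\<lambda>_. 0" and ?G1.0 = "\<lambda>_. 0" and ?G2.0 = "\<lambda>_. 0" and
        ?U1.0 = v and ?U2.0 = v', folded g'_def])
    fix s' assume "tree s' r g'" and agree: "trees_agree (- {r}) ?s s'"
      and regs: "\<forall>x\<in>{r_low1, r_low2, r_gap1, r_gap2}. regs s' x = regs ?s x"
    moreover have "tree s' (2 * n) v" "tree s' (Suc (2 * n)) v'" "tree s' (2 * n + 2) (\<lambda>_. 0)"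
      using trees(2-4) tree_agree[OF _ agree, unfolded tree_update] r by auto
    ultimately show "search_trees s' g' (\<lambda>_. 0) (\<lambda>_. 0) (\<lambda>_. 0) v v'"
      by (simp add: search_trees_def tree_in_def nat_add_distrib nat_mult_distrib)
  next
    show "branch_and_bound W B n L (\<lambda>h. least g' h + least (\<lambda>_. 0) h) f
      (\<lambda>h. wide D (\<lambda>_. 0) (\<lambda>_. 0) h \<and> wide D v v' h) D"
      by (rule branch_and_bound_stale) (use stale in auto)
    show "base ?s D" using base by (simp add: base_def)
    show "\<bar>f k\<bar> \<le> 2 * int n" "\<bar>if k \<in> set ks then f k else g k\<bar> \<le> 2 * int n \<and> \<bar>0 :: int\<bar> \<le> 2 * int n"
      if "k < cols" for k
      using f(2)[OF that] stale[OF that] by (auto simp: g'_def)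
  qed (use s trees ks f(1) in auto)
qed

lemma wp_rows:
  assumes base: "base s D" and init: "J 0 s"
    and reg: "\<And>i s' x. J i s' \<Longrightarrow> J i (set_reg s' r_row x)"
    and step: "\<And>i s'. i < n \<Longrightarrow> J i s' \<Longrightarrow> base s' D \<Longrightarrow> regs s' r_row = int i \<Longrightarrow>
      framed (for_loop r_row (R r_dim) row) s s' \<Longrightarrow>
      wp row s' (\<lambda>s'' t. t \<le> e i * (7 * levels + 8) + K \<and>
        row_answered D (f i) i s' s'' \<and> J (Suc i) s'')"
  shows "wp (for_loop r_row (R r_dim) row) s (\<lambda>s' t.
    t \<le> (\<Sum>i<n. e i) * (7 * levels + 8) + n * (K + 3) + 3 \<and>
    (\<forall>i<n. search_result D (f i) (arrs s a_answer i) (arrs s' a_answer i)) \<and> J n s')"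
proof (rule wp_for[where m = n and I = "\<lambda>i s' t. t \<le> (\<Sum>i<i. e i) * (7 * levels + 8) + i * (K + 3) \<and>
    (\<forall>p<i. search_result D (f p) (arrs s a_answer p) (arrs s' a_answer p)) \<and>
    (\<forall>p\<ge>i. arrs s' a_answer p = arrs s a_answer p) \<and> J i s'"])
  fix i s' t assume i: "i < n" "regs s' r_row = int i" and fr: "framed (for_loop r_row (R r_dim) row) s s'"
    and inv: "t \<le> (\<Sum>i<i. e i) * (7 * levels + 8) + i * (K + 3) \<and>
      (\<forall>p<i. search_result D (f p) (arrs s a_answer p) (arrs s' a_answer p)) \<and>
      (\<forall>p\<ge>i. arrs s' a_answer p = arrs s a_answer p) \<and> J i s'"
  have "base s' D" using base_frame[OF base fr] by simp
  then show "wp row s' (\<lambda>s'' t'.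
      t + t' + 3 \<le> (\<Sum>i<Suc i. e i) * (7 * levels + 8) + Suc i * (K + 3) \<and>
      (\<forall>p<Suc i. search_result D (f p) (arrs s a_answer p)
        (arrs (set_reg s'' r_row (int (Suc i))) a_answer p)) \<and>
      (\<forall>p\<ge>Suc i. arrs (set_reg s'' r_row (int (Suc i))) a_answer p = arrs s a_answer p) \<and>
      J (Suc i) (set_reg s'' r_row (int (Suc i))))"
    using inv i fr reg
    by (intro wp_conseq[OF step]) (auto simp: less_Suc_eq algebra_simps)
next
  fix s' assume "framed (for_loop r_row (R r_dim) row) s s'"
  from base_frame[OF base this]
  show "asafe B s' (R r_dim) \<and> leaves (R r_dim) \<le> 16 \<and> aeval s' (R r_dim) = int n"
    by (simp add: base_def)
qed (use init reg B_bounds in auto)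

end

section \<open>Running the equality algorithms in parallel\<close>

text \<open>
  The radius is halved whenever the simulated steps for its current value \<open>D\<close> exceed the budget
  \<open>4 (L + 1) N\<^sup>3 / D\<close>. This balances the two parts of the running time without knowing the exponent of
  the equality algorithm, which need not be a computable number.
\<close>

definition check_budget :: com where
  "check_budget =
    If (Conj (Less (N 4 \<boxtimes> R r_levels \<boxtimes> R r_cols \<boxtimes> R r_cols \<boxtimes> R r_cols) (R r_steps \<boxtimes> R r_radius))
         (Less (N 1) (R r_radius)))
      (halve r_radius ;; Assign r_steps (N 0)) SKIP"

definition active_test :: bexp where
  "active_test = Conj (Less (R r_pos) (R r_radius \<boxtimes> (N 4 \<boxtimes> R r_levels)))
     (Less (R r_shift) (N 2 \<boxtimes> R r_radius \<boxplus> N 1))"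

definition copy_body :: "com \<Rightarrow> com" where
  "copy_body c =
    (Assign r_pos (Bin Div (R r_copy) (R r_shifts)) ;; Assign r_shift (Bin Mod (R r_copy) (R r_shifts))) ;;
    If active_test (Assign r_col (Rd a_sample (R r_pos)) ;; c ;; check_budget) SKIP"

definition copy_loop :: "com \<Rightarrow> com" where
  "copy_loop c = for_loop r_copy (R r_copies) (copy_body c)"

lemma mod_copy_loop [simp]:
  "mod_regs check_budget = {r_radius, r_steps}" "mod_arrs check_budget = {}"
  "mod_regs (copy_body c) = {r_radius, r_steps, r_pos, r_shift, r_col} \<union> mod_regs c"
  "mod_arrs (copy_body c) = mod_arrs c"
  "mod_regs (copy_loop c) = {r_radius, r_steps, r_copy, r_pos, r_shift, r_col} \<union> mod_regs c"
  "mod_arrs (copy_loop c) = mod_arrs c"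
  by (auto simp: copy_loop_def copy_body_def check_budget_def)

definition loop_regs :: "nat set" where
  "loop_regs = {r_radius, r_steps, r_copy, r_row, r_idx, r_pos, r_tmp, r_col, r_shift, r_cell}"

definition loop_arrs :: "nat set" where
  "loop_arrs = {a_answer} \<union> {a_copy_regs..}"

definition zero_state :: state where
  "zero_state = \<lparr>regs = (\<lambda>_. 0), arrs = (\<lambda>_ _. 0)\<rparr>"

definition progress :: "nat \<Rightarrow> nat \<Rightarrow> nat \<Rightarrow> nat" where
  "progress r p i = (if i < p then Suc r else r)"

lemma progress_le: "r \<le> n \<Longrightarrow> progress r p i \<le> Suc n"
  by (simp add: progress_def)

locale parallel_copies = padded +
  fixes e0 t_eq :: nat and copy_state :: "nat \<Rightarrow> nat \<Rightarrow> state" and copy_time :: "nat \<Rightarrow> nat \<Rightarrow> nat"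
  assumes e0_le: "e0 \<le> L" and cube_le: "(2 ^ e0) ^ 3 \<le> n" and less_cube: "n < 8 * (2 ^ e0) ^ 3"
    and copy_state_0: "copy_state i 0 = zero_state"
    and copy_time_sum: "i < 2 ^ e0 * (4 * levels) * (2 * 2 ^ e0 + 1) \<Longrightarrow> (\<Sum>r\<le>n. copy_time i r) \<le> t_eq"
    and copies_large: "int (2 ^ e0 * (4 * levels) * (2 * 2 ^ e0 + 1) * Suc t_eq) \<le> B"
begin

definition shifts :: nat where "shifts = 2 * 2 ^ e0 + 1"
definition density :: nat where "density = 4 * levels"
definition copies :: nat where "copies = 2 ^ e0 * density * shifts"

definition active :: "nat \<Rightarrow> nat \<Rightarrow> bool" where
  "active D i \<longleftrightarrow> i < copies \<and> i div shifts < D * density \<and> i mod shifts \<le> 2 * D"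

definition spent :: "nat \<Rightarrow> (nat \<Rightarrow> nat) \<Rightarrow> nat" where
  "spent D f = (\<Sum>i | active D i. \<Sum>r<f i. copy_time i r)"

definition radius_ok :: "nat \<Rightarrow> bool" where
  "radius_ok D \<longleftrightarrow> n < 8 * D ^ 3 \<or> cols ^ 3 < 24 * D ^ 3 * t_eq"

text \<open>Every simulated step increases the potential, and halving the radius does not decrease it.\<close>

definition potential :: "nat \<Rightarrow> nat \<Rightarrow> nat" where
  "potential e cnt = cnt + cols ^ 3 * density div 2 ^ e + (e0 - e) * t_eq"

definition copy_regs :: "state \<Rightarrow> nat \<Rightarrow> nat \<Rightarrow> bool" where
  "copy_regs s e cnt \<longleftrightarrow> regs s r_dim = int n \<and> regs s r_cols = int cols \<and> regs s r_levels = int levels \<and>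
     regs s r_radius = 2 ^ e \<and> regs s r_steps = int cnt \<and> regs s r_copies = int copies \<and>
     regs s r_shifts = int shifts"

definition copies_at :: "nat \<Rightarrow> nat \<Rightarrow> state \<Rightarrow> nat \<Rightarrow> nat \<Rightarrow> bool" where
  "copies_at r p s e cnt \<longleftrightarrow> copy_regs s e cnt \<and> e \<le> e0 \<and>
     (\<forall>i. active (2 ^ e) i \<longrightarrow> view copies i s = copy_state i (progress r p i)) \<and>
     cnt \<le> spent (2 ^ e) (progress r p) \<and> (1 \<le> e \<longrightarrow> cnt * 2 ^ e \<le> cols ^ 3 * density) \<and> radius_ok (2 ^ e)"

lemma copies_at_cong:
  assumes "copies_at r p s e cnt"
    "\<And>x. x \<in> {r_dim, r_cols, r_levels, r_radius, r_steps, r_copies, r_shifts} \<Longrightarrow> regs s' x = regs s x"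
    "\<And>a. a_copy_regs \<le> a \<Longrightarrow> arrs s' a = arrs s a"
  shows "copies_at r p s' e cnt"
  using assms view_cong[of s' s copies] by (auto simp: copies_at_def copy_regs_def)

lemma shifts_pos [simp]: "0 < shifts"
  by (simp add: shifts_def)

lemma active_less: "active D i \<Longrightarrow> i < copies"
  by (simp add: active_def)

lemma finite_active: "finite {i. active D i}"
  by (rule finite_subset[of _ "{..<copies}"]) (auto simp: active_def)

lemma active_mono: "active D i \<Longrightarrow> D \<le> D' \<Longrightarrow> active D' i"
  unfolding active_def using mult_le_mono1[of D D' density] by linarith

lemma card_active: "card {i. active D i} \<le> D * density * (2 * D + 1)"
proof -
  have "inj_on (\<lambda>i. (i div shifts, i mod shifts)) {i. active D i}"
    by (rule inj_onI) (metis prod.inject div_mult_mod_eq)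
  moreover have "(\<lambda>i. (i div shifts, i mod shifts)) ` {i. active D i} \<subseteq> {..<D * density} \<times> {..2 * D}"
    by (auto simp: active_def)
  ultimately have "card {i. active D i} \<le> card ({..<D * density} \<times> {..2 * D})"
    by (rule card_inj_on_le) simp
  then show ?thesis by simp
qed

lemma copy_time_prefix_le:
  assumes "active D i" "r \<le> Suc n"
  shows "(\<Sum>q<r. copy_time i q) \<le> t_eq"
proof -
  have "(\<Sum>q<r. copy_time i q) \<le> (\<Sum>q\<le>n. copy_time i q)" using assms(2) by (intro sum_mono2) auto
  also have "\<dots> \<le> t_eq"
    using copy_time_sum[of i] assms(1) by (simp add: active_def copies_def density_def shifts_def)
  finally show ?thesis .
qed

lemma copy_time_le: "active D i \<Longrightarrow> r \<le> n \<Longrightarrow> copy_time i r \<le> t_eq"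
  using copy_time_prefix_le[of D i "Suc r"] by simp

lemma spent_le:
  assumes "\<And>i. f i \<le> Suc n"
  shows "spent D f \<le> D * density * (2 * D + 1) * t_eq" "spent D f \<le> copies * t_eq"
proof -
  have le: "spent D f \<le> card {i. active D i} * t_eq"
    unfolding spent_def using copy_time_prefix_le assms
      sum_bounded_above[of "{i. active D i}" "\<lambda>i. \<Sum>r<f i. copy_time i r" t_eq] by auto
  then show "spent D f \<le> D * density * (2 * D + 1) * t_eq"
    using card_active[of D] by (meson le_trans mult_le_mono1)
  have "card {i. active D i} \<le> card {..<copies}" by (rule card_mono) (auto simp: active_def)
  then show "spent D f \<le> copies * t_eq" using le by (metis card_lessThan le_trans mult_le_mono1)
qed

lemma copies_le_B: "int (copies * t_eq) \<le> B" "int copies \<le> B"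
proof -
  have "int (copies * Suc t_eq) \<le> B"
    using copies_large by (simp add: copies_def density_def shifts_def)
  moreover have "copies * t_eq \<le> copies * Suc t_eq" "copies \<le> copies * Suc t_eq" by simp_all
  ultimately show "int (copies * t_eq) \<le> B" "int copies \<le> B" by linarith+
qed

lemma spent_active:
  assumes "active D p"
  shows "spent D (progress r (Suc p)) = spent D (progress r p) + copy_time p r"
proof -
  let ?A = "{i. active D i}"
  have "(\<Sum>i\<in>?A - {p}. \<Sum>q<progress r (Suc p) i. copy_time i q) =
      (\<Sum>i\<in>?A - {p}. \<Sum>q<progress r p i. copy_time i q)"
    by (intro sum.cong) (auto simp: progress_def)
  then show ?thesis
    unfolding spent_def using assms finite_active[of D] by (simp add: sum.remove[of ?A p] progress_def)
qed

lemma spent_inactive: "\<not> active D p \<Longrightarrow> spent D (progress r (Suc p)) = spent D (progress r p)"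
  unfolding spent_def by (intro sum.cong) (auto simp: progress_def less_Suc_eq)

lemma power_e_le_cols: "e \<le> e0 \<Longrightarrow> (2::nat) ^ e \<le> cols"
  using e0_le power_increasing[of e L "2::nat"] by (simp add: cols_def)

lemma potential_halve:
  assumes "Suc e \<le> e0" "cnt * 2 ^ Suc e \<le> cols ^ 3 * density" "x \<le> t_eq"
  shows "potential (Suc e) cnt + x \<le> potential e 0"
proof -
  have "(2::nat) ^ Suc e dvd 2 ^ L" using assms(1) e0_le by (intro le_imp_power_dvd) auto
  then have "2 ^ Suc e dvd cols ^ 3 * density" by (simp add: cols_def power3_eq_cube dvd_mult2)
  then obtain c where c: "cols ^ 3 * density = 2 ^ Suc e * c" by (elim dvdE)
  then have "cols ^ 3 * density div 2 ^ Suc e = c" "cols ^ 3 * density div 2 ^ e = 2 * c" by simp_all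
  moreover have "cnt \<le> c" using assms(2) unfolding c by (simp add: mult.commute)
  moreover have "e0 - e = Suc (e0 - Suc e)" using assms(1) by simp
  ultimately show ?thesis using assms(3) by (simp add: potential_def)
qed

lemma radius_ok_halve:
  assumes "cnt \<le> spent (2 ^ Suc e) (progress r p)" "r \<le> n" "cols ^ 3 * density < cnt * 2 ^ Suc e"
  shows "radius_ok (2 ^ e)"
proof -
  let ?D = "2 ^ Suc e :: nat"
  have "cnt \<le> ?D * density * (2 * ?D + 1) * t_eq"
    using assms(1) spent_le(1)[of "progress r p", OF progress_le[OF assms(2)]] by (rule le_trans)
  also have "\<dots> \<le> ?D * density * (3 * ?D) * t_eq" by (intro mult_le_mono) auto
  finally have "cnt * ?D \<le> ?D * density * (3 * ?D) * t_eq * ?D" by (rule mult_le_mono1)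
  also have "\<dots> = (24 * (2 ^ e) ^ 3 * t_eq) * density" by (simp add: power3_eq_cube mult_ac)
  finally have "cols ^ 3 * density < (24 * (2 ^ e) ^ 3 * t_eq) * density" using assms(3) by linarith
  then have "cols ^ 3 < 24 * (2 ^ e) ^ 3 * t_eq" by (rule mult_right_less_imp_less) simp
  then show ?thesis by (simp add: radius_ok_def)
qed

lemma wp_check_budget:
  assumes regs: "copy_regs s e (cnt + copy_time p r)" and r: "r \<le> n" and p: "active (2 ^ e) p"
    and views: "\<And>i. active (2 ^ e) i \<Longrightarrow> view copies i s = copy_state i (progress r (Suc p) i)"
    and before: "e \<le> e0" "cnt \<le> spent (2 ^ e) (progress r p)" "1 \<le> e \<longrightarrow> cnt * 2 ^ e \<le> cols ^ 3 * density"
      "radius_ok (2 ^ e)"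
  shows "wp check_budget s (\<lambda>s' t. t \<le> 5 \<and> (\<exists>e' cnt'. copies_at r (Suc p) s' e' cnt' \<and> e' \<le> e \<and>
    potential e cnt + copy_time p r \<le> potential e' cnt'))"
proof -
  let ?cnt = "cnt + copy_time p r"
  have cnt_le: "?cnt \<le> spent (2 ^ e) (progress r (Suc p))" using before(2) spent_active[OF p] by simp
  have exceeded: "4 * int levels * int cols * int cols * int cols < int ?cnt * 2 ^ e \<longleftrightarrow>
      cols ^ 3 * density < ?cnt * 2 ^ e"
  proof -
    have "4 * int levels * int cols * int cols * int cols = int (cols ^ 3 * density)"
      by (simp add: density_def power3_eq_cube mult_ac)
    moreover have "int ?cnt * 2 ^ e = int (?cnt * 2 ^ e)" by simp
    ultimately show ?thesis by (simp only: of_nat_less_iff)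
  qed
  have pos: "(1::int) < 2 ^ e \<longleftrightarrow> 1 \<le> e" using one_less_power[of "2::int" e] by (cases e) auto
  have regs': "regs s r_levels = int levels" "regs s r_cols = int cols" "regs s r_steps = int ?cnt"
    "regs s r_radius = 2 ^ e"
    using regs by (auto simp: copy_regs_def)
  define Q where "Q s' \<longleftrightarrow> (\<exists>e' cnt'. copies_at r (Suc p) s' e' cnt' \<and> e' \<le> e \<and>
      potential e cnt + copy_time p r \<le> potential e' cnt')" for s'
  have "wp check_budget s (\<lambda>s' t. t \<le> 5 \<and> Q s')"
  proof (cases "cols ^ 3 * density < ?cnt * 2 ^ e \<and> 1 \<le> e")
    case True
    then obtain e' where e: "e = Suc e'" by (cases e) auto
    let ?s = "s\<lparr>regs := (regs s)(r_radius := 2 ^ e', r_steps := 0)\<rparr>"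
    have "(2::nat) ^ e' \<le> 2 ^ e" using e by simp
    then have "copies_at r (Suc p) ?s e' 0"
      using regs views before(1) e radius_ok_halve[OF _ r] cnt_le True active_mono
      by (auto simp: copies_at_def copy_regs_def)
    moreover have "potential e cnt + copy_time p r \<le> potential e' 0"
      using potential_halve[of e' cnt] copy_time_le[OF p r] before(1,3) e by simp
    ultimately have "Q ?s" unfolding Q_def using e by (intro exI[of _ e'] exI[of _ 0]) simp
    moreover have "int ((2::nat) ^ e') \<le> B"
      using power_e_le_cols[of e'] e before(1) B_bounds by linarith
    ultimately show ?thesis
      using True regs' exceeded pos B_bounds e
      by (intro wp_straightI[of _ _ ?s 4]) (auto simp: check_budget_def halve_def simp del: of_nat_add)
  next
    case False
    then have "copies_at r (Suc p) s e ?cnt"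
      using regs before views cnt_le by (auto simp: copies_at_def)
    moreover have "potential e cnt + copy_time p r \<le> potential e ?cnt" by (simp add: potential_def)
    ultimately have "Q s" unfolding Q_def by (intro exI[of _ e] exI[of _ ?cnt]) simp
    then show ?thesis
      using False regs' exceeded pos B_bounds
      by (intro wp_straightI[of _ _ s 2]) (auto simp: check_budget_def simp del: of_nat_add)
  qed
  then show ?thesis by (simp add: Q_def)
qed

lemma active_test:
  assumes "copy_regs s e cnt" "regs s r_pos = int (p div shifts)" "regs s r_shift = int (p mod shifts)"
    "p < copies"
  shows "beval s active_test \<longleftrightarrow> active (2 ^ e) p"
proof -
  have "2 ^ e * (4 * int levels) = int (2 ^ e * density)" by (simp add: density_def)
  moreover have "2 * 2 ^ e + 1 = int (2 * 2 ^ e + 1)" by simp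
  ultimately show ?thesis
    using assms by (simp add: active_test_def active_def copy_regs_def less_Suc_eq_le del: of_nat_mult of_nat_add)
qed

text \<open>
  One round runs one phase of every active copy. The commands \<open>c\<close> load the input of copy \<open>p\<close>, simulate
  the phase, and collect its answers; \<open>X\<close> and \<open>OI\<close> are invariants of the unmodified part of the memory
  and of the answer array.
\<close>

context
  fixes r C :: nat and c :: com and X :: "state \<Rightarrow> bool" and OI :: "nat \<Rightarrow> nat \<Rightarrow> (nat \<Rightarrow> int) \<Rightarrow> bool"
    and col :: "nat \<Rightarrow> nat"
  assumes r: "r \<le> n"
    and mods: "mod_regs c \<subseteq> {r_steps, r_row, r_idx, r_tmp, r_cell}" "mod_arrs c \<subseteq> loop_arrs"
    and X: "\<And>s s'. X s \<Longrightarrow> frame loop_regs loop_arrs s s' \<Longrightarrow> X s'"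
    and sample: "\<And>s p. X s \<Longrightarrow> p < copies \<Longrightarrow> arrs s a_sample (p div shifts) = int (col p)"
    and OI_skip: "\<And>e p a. OI e p a \<Longrightarrow> \<not> active (2 ^ e) p \<Longrightarrow> OI e (Suc p) a"
    and OI_mono: "\<And>e e' p a. OI e p a \<Longrightarrow> e' \<le> e \<Longrightarrow> OI e' p a"
    and phase: "\<And>s e cnt p. X s \<Longrightarrow> copy_regs s e cnt \<Longrightarrow> active (2 ^ e) p \<Longrightarrow> OI e p (arrs s a_answer) \<Longrightarrow>
      regs s r_copy = int p \<Longrightarrow> regs s r_col = int (col p) \<Longrightarrow> regs s r_shift = int (p mod shifts) \<Longrightarrow>
      view copies p s = copy_state p r \<Longrightarrow> int (cnt + copy_time p r) \<le> B \<Longrightarrow>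
      wp c s (\<lambda>s' t. t \<le> C + 5 * copy_time p r \<and> OI e (Suc p) (arrs s' a_answer) \<and>
        view copies p s' = copy_state p (Suc r) \<and>
        (\<forall>i<copies. i \<noteq> p \<longrightarrow> view copies i s' = view copies i s) \<and>
        regs s' r_steps = int (cnt + copy_time p r))"
begin

definition round_inv :: "nat \<Rightarrow> state \<Rightarrow> nat \<Rightarrow> nat \<Rightarrow> bool" where
  "round_inv p s e cnt \<longleftrightarrow> X s \<and> copies_at r p s e cnt \<and> OI e p (arrs s a_answer)"

definition copy_post :: "nat \<Rightarrow> nat \<Rightarrow> nat \<Rightarrow> state \<Rightarrow> nat \<Rightarrow> bool" where
  "copy_post p e cnt s' t \<longleftrightarrow> (\<exists>e' cnt'. round_inv (Suc p) s' e' cnt' \<and> e' \<le> e \<and>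
     t + 5 * potential e cnt \<le> C + 10 + 5 * potential e' cnt')"

lemma wp_active_copy:
  assumes inv: "round_inv p s e cnt" and act: "active (2 ^ e) p"
    and regs: "regs s r_copy = int p" "regs s r_col = int (col p)" "regs s r_shift = int (p mod shifts)"
  shows "wp (c ;; check_budget) s (copy_post p e cnt)"
proof -
  have at: "X s" "copy_regs s e cnt" "e \<le> e0" "OI e p (arrs s a_answer)"
    "cnt \<le> spent (2 ^ e) (progress r p)" "1 \<le> e \<longrightarrow> cnt * 2 ^ e \<le> cols ^ 3 * density" "radius_ok (2 ^ e)"
    "\<And>i. active (2 ^ e) i \<Longrightarrow> view copies i s = copy_state i (progress r p i)"
    using inv by (auto simp: round_inv_def copies_at_def)
  have "cnt + copy_time p r \<le> copies * t_eq"
    using at(5) spent_active[OF act, of r] spent_le(2)[of "progress r (Suc p)" "2 ^ e", OF progress_le[OF r]]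
    by simp
  then have bound: "int (cnt + copy_time p r) \<le> B" using copies_le_B(1) by linarith
  have "view copies p s = copy_state p r" using at(8)[OF act] by (simp add: progress_def)
  from phase[OF at(1,2) act at(4) regs this bound] show ?thesis
  proof (rule wp_Seq_conseq, elim conjE)
    fix s1 t1 assume res: "t1 \<le> C + 5 * copy_time p r" "OI e (Suc p) (arrs s1 a_answer)"
      "view copies p s1 = copy_state p (Suc r)"
      "\<forall>i<copies. i \<noteq> p \<longrightarrow> view copies i s1 = view copies i s"
      "regs s1 r_steps = int (cnt + copy_time p r)"
      and "framed c s s1"
    then have fr: "frame {r_steps, r_row, r_idx, r_tmp, r_cell} loop_arrs s s1"
      using frame_mono mods by blast
    have "copy_regs s1 e (cnt + copy_time p r)"
      using at(2) res(5) frame_regs[OF fr] by (simp add: copy_regs_def)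
    moreover have "view copies i s1 = copy_state i (progress r (Suc p) i)" if "active (2 ^ e) i" for i
      using that at(8)[OF that] res(3,4) active_less[OF that]
      by (cases "i = p") (auto simp: progress_def less_Suc_eq)
    ultimately have "wp check_budget s1 (\<lambda>s' t. t \<le> 5 \<and> (\<exists>e' cnt'. copies_at r (Suc p) s' e' cnt' \<and>
        e' \<le> e \<and> potential e cnt + copy_time p r \<le> potential e' cnt'))"
      using wp_check_budget r act at by blast
    then show "wp check_budget s1 (\<lambda>s' t. copy_post p e cnt s' (Suc (t1 + t)))"
    proof (rule wp_conseq, elim conjE exE)
      fix s2 e' cnt' and t :: nat
      assume next_round: "t \<le> 5" "copies_at r (Suc p) s2 e' cnt'" "e' \<le> e"
        "potential e cnt + copy_time p r \<le> potential e' cnt'" and "framed check_budget s1 s2"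
      then have fr2: "frame {r_radius, r_steps} {} s1 s2" by simp
      have "frame loop_regs loop_arrs s s2"
        using fr fr2 by (auto simp: frame_def loop_regs_def)
      then have "round_inv (Suc p) s2 e' cnt'"
        using X[OF at(1)] next_round(2,3) OI_mono[OF res(2)] frame_arrs[OF fr2]
        by (simp add: round_inv_def)
      then show "copy_post p e cnt s2 (Suc (t1 + t))"
        unfolding copy_post_def using next_round res(1) by (intro exI[of _ e'] exI[of _ cnt']) simp
    qed
  qed
qed

lemma round_inv_regs:
  assumes "round_inv p s e cnt" "\<forall>x. x \<notin> {r_copy, r_pos, r_shift, r_col} \<longrightarrow> f x = regs s x"
  shows "round_inv p (s\<lparr>regs := f\<rparr>) e cnt"
proof -
  have "frame loop_regs loop_arrs s (s\<lparr>regs := f\<rparr>)" using assms(2) by (auto simp: frame_def loop_regs_def)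
  moreover have "copies_at r p (s\<lparr>regs := f\<rparr>) e cnt"
    by (rule copies_at_cong[of r p s]) (use assms in \<open>auto simp: round_inv_def\<close>)
  ultimately show ?thesis using assms(1) X[of s "s\<lparr>regs := f\<rparr>"] by (simp add: round_inv_def)
qed

lemma copy_post_regs:
  assumes "copy_post p e cnt s t" "\<forall>x. x \<notin> {r_copy, r_pos, r_shift, r_col} \<longrightarrow> f x = regs s x" "t' \<le> t"
  shows "copy_post p e cnt (s\<lparr>regs := f\<rparr>) t'"
proof -
  obtain e' cnt' where "round_inv (Suc p) s e' cnt'" "e' \<le> e"
    "t + 5 * potential e cnt \<le> C + 10 + 5 * potential e' cnt'"
    using assms(1) by (auto simp: copy_post_def)
  then show ?thesis
    unfolding copy_post_def using assms(3) round_inv_regs[OF _ assms(2)]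
    by (intro exI[of _ e'] exI[of _ cnt']) simp
qed

lemma wp_copy_body:
  assumes inv: "round_inv p s e cnt" and p: "p < copies" "regs s r_copy = int p" and fits: "fits B s"
  shows "wp (copy_body c) s (\<lambda>s' t. copy_post p e cnt (set_reg s' r_copy (int (Suc p))) (t - 9))"
    (is "wp _ _ ?Q")
  unfolding copy_body_def
proof (rule wp_straight_Seq)
  let ?init = "Assign r_pos (Bin Div (R r_copy) (R r_shifts)) ;; Assign r_shift (Bin Mod (R r_copy) (R r_shifts))"
  let ?s = "s\<lparr>regs := (regs s)(r_pos := int (p div shifts), r_shift := int (p mod shifts))\<rparr>"
  let ?s' = "s\<lparr>regs := (regs ?s)(r_col := int (col p))\<rparr>"
  have regs: "copy_regs s e cnt" "copy_regs ?s e cnt"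
    using inv by (auto simp: round_inv_def copies_at_def copy_regs_def)
  have "p div shifts \<le> p" "p mod shifts \<le> p" by simp_all
  then have "int (p div shifts) \<le> B" "int (p mod shifts) \<le> B"
    using p(1) copies_le_B(2) by linarith+
  then show "safe B ?init s" "effect ?init s = ?s" "cost ?init s = 3"
    using p(2) regs(1) by (simp_all add: copy_regs_def flip: zdiv_int zmod_int)
  have test: "beval ?s active_test \<longleftrightarrow> active (2 ^ e) p"
    using active_test[OF regs(2)] p(1) by simp
  have col: "arrs s a_sample (p div shifts) = int (col p)"
    using sample inv p(1) by (auto simp: round_inv_def)
  show "wp (If active_test (Assign r_col (Rd a_sample (R r_pos)) ;; c ;; check_budget) SKIP) ?s
      (\<lambda>s' t. ?Q s' (Suc (3 + t)))"
  proof (rule wp_If)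
    show "bsafe B ?s active_test" using B_bounds by (simp add: active_test_def)
  next
    assume "beval ?s active_test"
    then have act: "active (2 ^ e) p" using test by simp
    have inv': "round_inv p ?s' e cnt" by (rule round_inv_regs[OF inv]) simp
    have "wp (c ;; check_budget) ?s' (\<lambda>s' t.
        copy_post p e cnt (set_reg s' r_copy (int (Suc p))) (Suc (3 + Suc (Suc (1 + t))) - 9))"
      by (rule wp_conseq[OF wp_active_copy[OF inv' act]]) (use p(2) in \<open>auto intro: copy_post_regs\<close>)
    then show "wp (Assign r_col (Rd a_sample (R r_pos)) ;; c ;; check_budget) ?s (\<lambda>s' t. ?Q s' (Suc (3 + Suc t)))"
      by (rule wp_straight_Seq[rotated 3]) (use col fits_arrs[OF fits, of a_sample "p div shifts"] in auto)
  next
    assume "\<not> beval ?s active_test"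
    then have act: "\<not> active (2 ^ e) p" using test by simp
    then have "progress r (Suc p) i = progress r p i" if "active (2 ^ e) i" for i
      using that by (auto simp: progress_def less_Suc_eq)
    then have "round_inv (Suc p) s e cnt"
      using inv OI_skip[OF _ act] spent_inactive[OF act] by (simp add: round_inv_def copies_at_def)
    then have "round_inv (Suc p) (set_reg ?s r_copy (int (Suc p))) e cnt"
      using round_inv_regs[of "Suc p" s e cnt "(regs ?s)(r_copy := int (Suc p))"] by simp
    then show "wp SKIP ?s (\<lambda>s' t. ?Q s' (Suc (3 + Suc t)))"
      unfolding copy_post_def by (intro wp_straight exI[of _ e] exI[of _ cnt]) simp_all
  qed
qed

lemma wp_copy_loop:
  assumes s: "X s" "copies_at r 0 s e cnt" "OI e 0 (arrs s a_answer)"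
  shows "wp (copy_loop c) s (\<lambda>s' t. \<exists>e' cnt'. X s' \<and> copies_at (Suc r) 0 s' e' cnt' \<and>
    OI e' copies (arrs s' a_answer) \<and> e' \<le> e \<and>
    t + 5 * potential e cnt \<le> copies * (C + 22) + 3 + 5 * potential e' cnt')"
proof -
  define I where "I p s' t \<longleftrightarrow> (\<exists>e' cnt'. round_inv p s' e' cnt' \<and> e' \<le> e \<and>
      t + 5 * potential e cnt \<le> p * (C + 22) + 5 * potential e' cnt')" for p s' t
  show ?thesis
    unfolding copy_loop_def
  proof (rule wp_for[where I = I and m = copies])
    show "r_copy \<notin> mod_regs (copy_body c)" using mods(1) by auto
    show "int copies \<le> B" by (rule copies_le_B)
    show "I 0 (set_reg s r_copy 0) 0"
      unfolding I_def using s round_inv_regs[of 0 s e cnt]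
        by (intro exI[of _ e] exI[of _ cnt]) (simp add: round_inv_def)
  next
    fix s' assume "framed (for_loop r_copy (R r_copies) (copy_body c)) s s'"
    then have "regs s' r_copies = regs s r_copies" using mods(1) by (intro frame_regs) auto
    then show "asafe B s' (R r_copies) \<and> leaves (R r_copies) \<le> 16 \<and> aeval s' (R r_copies) = int copies"
      using s(2) by (simp add: copies_at_def copy_regs_def)
  next
    fix p s' t assume p: "p < copies" "regs s' r_copy = int p" and "I p s' t" and fits: "fits B s'"
    then obtain e' cnt' where inv: "round_inv p s' e' cnt'" "e' \<le> e"
      "t + 5 * potential e cnt \<le> p * (C + 22) + 5 * potential e' cnt'"
      by (auto simp: I_def)
    show "wp (copy_body c) s' (\<lambda>s'' t'. I (Suc p) (set_reg s'' r_copy (int (Suc p))) (t + t' + 3))"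
    proof (rule wp_conseq[OF wp_copy_body[OF inv(1) p fits]])
      fix s'' t' assume "copy_post p e' cnt' (set_reg s'' r_copy (int (Suc p))) (t' - 9)"
      then obtain e'' cnt'' where "round_inv (Suc p) (set_reg s'' r_copy (int (Suc p))) e'' cnt''" "e'' \<le> e'"
        "t' - 9 + 5 * potential e' cnt' \<le> C + 10 + 5 * potential e'' cnt''"
        by (auto simp: copy_post_def)
      then show "I (Suc p) (set_reg s'' r_copy (int (Suc p))) (t + t' + 3)"
        unfolding I_def using inv by (intro exI[of _ e''] exI[of _ cnt'']) auto
    qed
  next
    fix s' t assume "I copies s' t"
    then obtain e' cnt' where inv: "round_inv copies s' e' cnt'" "e' \<le> e"
      "t + 5 * potential e cnt \<le> copies * (C + 22) + 5 * potential e' cnt'"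
      by (auto simp: I_def)
    have completed: "progress r copies i = progress (Suc r) 0 i" if "active (2 ^ e') i" for i
      using active_less[OF that] by (simp add: progress_def)
    then have "spent (2 ^ e') (progress r copies) = spent (2 ^ e') (progress (Suc r) 0)"
      unfolding spent_def by (intro sum.cong) auto
    then have "copies_at (Suc r) 0 s' e' cnt'"
      using inv(1) completed by (simp add: round_inv_def copies_at_def)
    then show "\<exists>e' cnt'. X s' \<and> copies_at (Suc r) 0 s' e' cnt' \<and> OI e' copies (arrs s' a_answer) \<and> e' \<le> e \<and>
        t + 3 + 5 * potential e cnt \<le> copies * (C + 22) + 3 + 5 * potential e' cnt'"
      using inv by (intro exI[of _ e'] exI[of _ cnt']) (simp add: round_inv_def)
  qed
qed

end

end

definition prep_copy :: "com \<Rightarrow> com" where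
  "prep_copy c = Store a_copy_regs (R r_copy) (R r_dim) ;;
     for_loop r_cell (R r_dim \<boxtimes> R r_dim)
       (Store (a_copy a_input) (copy_index (R r_cell))
         (Rd a_input (R r_cell) \<boxminus> matrix_at (Bin Div (R r_cell) (R r_dim)) (R r_col))) ;;
     sim_com c"

definition load_query :: com where
  "load_query = for_loop r_idx (R r_dim)
     (Store (a_copy a_query) (copy_index (R r_idx)) (Rd a_vec (R r_col) \<boxminus> Rd a_vec (R r_idx) \<boxminus> R r_shift))"

definition collect :: com where
  "collect = for_loop r_row (R r_dim)
     (If (Equal (Rd (a_copy a_answer) (copy_index (R r_row))) (N 1))
       (Assign r_tmp (matrix_at (R r_row) (R r_col) \<boxplus> Rd a_vec (R r_col) \<boxminus> R r_shift) ;;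
        If (Less (R r_tmp) (Rd a_answer (R r_row))) (Store a_answer (R r_row) (R r_tmp)) SKIP)
       SKIP)"

definition query_copy :: "com \<Rightarrow> com" where
  "query_copy c = load_query ;; sim_com c ;; collect"

lemma view_store_range:
  assumes "p < K" "j < K" "frame {x} {a_copy a} s s'" "\<And>q. q < m \<Longrightarrow> arrs s' (a_copy a) (q * K + p) = f q"
    and "\<And>i. i \<notin> (\<lambda>q. q * K + p) ` {..<m} \<Longrightarrow> arrs s' (a_copy a) i = arrs s (a_copy a) i"
  shows "view K j s' = (if j = p then (view K p s)\<lparr>arrs := (arrs (view K p s))
    (a := (\<lambda>q. if q < m then f q else arrs (view K p s) a q))\<rparr> else view K j s)"
proof -
  have notin: "q * K + i \<notin> (\<lambda>q. q * K + p) ` {..<m}" if "i < K" "i \<noteq> p \<or> \<not> q < m" for q i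
    using assms(1) that by (auto simp: interleave_inj)
  have "arrs s' b (q * K + i) = (if b = a_copy a \<and> i = p \<and> q < m then f q else arrs s b (q * K + i))"
    if "i < K" for b q i
    using frame_arrs[OF assms(3), of b] assms(4)[of q] assms(5)[OF notin[OF that, of q]]
    by (cases "b = a_copy a") auto
  then show ?thesis
    using assms(1,2) by (auto simp: view_def fun_eq_iff)
qed

definition equality_run :: "int \<Rightarrow> online_alg \<Rightarrow> nat \<Rightarrow> nat \<Rightarrow> (nat \<Rightarrow> nat \<Rightarrow> int) \<Rightarrow> (nat \<Rightarrow> nat \<Rightarrow> int) \<Rightarrow>
    (nat \<Rightarrow> state) \<Rightarrow> (nat \<Rightarrow> nat) \<Rightarrow> bool" where
  "equality_run W A n t M v st \<tau> \<longleftrightarrow>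
     big_step W (prep A) (init_state n (mat n n (\<lambda>(i, k). M i k))) (st 0) (\<tau> 0) \<and>
     (\<forall>j<n. big_step W (query A) (put_query n (vec n (v j)) (st j)) (st (Suc j)) (\<tau> (Suc j))) \<and>
     (\<forall>j<n. \<forall>i<n. arrs (st (Suc j)) a_answer i = (if \<exists>k<n. M i k = v j k then 1 else 0)) \<and>
     (\<Sum>r\<le>n. \<tau> r) \<le> t"

locale equality_copies = padded +
  fixes e0 t_eq :: nat and M V :: "nat \<Rightarrow> nat \<Rightarrow> int" and A :: online_alg and W_eq :: int
    and eq_state :: "nat \<Rightarrow> nat \<Rightarrow> nat \<Rightarrow> state" and eq_time :: "nat \<Rightarrow> nat \<Rightarrow> nat \<Rightarrow> nat" and samples :: "nat list"
  assumes e0_le: "e0 \<le> L" and cube_le: "(2 ^ e0) ^ 3 \<le> n" and less_cube: "n < 8 * (2 ^ e0) ^ 3"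
    and copies_large: "int (2 ^ e0 * (4 * levels) * (2 * 2 ^ e0 + 1) * Suc t_eq) \<le> B"
    and run: "c < cols \<Longrightarrow> d \<le> 2 * 2 ^ e0 \<Longrightarrow>
      equality_run W_eq A n t_eq (\<lambda>i k. M i k - M i c) (\<lambda>j k. V j c - V j k - int d)
        (eq_state c d) (eq_time c d)"
    and W_eq: "W_eq \<le> B" and deterministic: "deterministic (prep A)" "deterministic (query A)"
    and reg_sum: "int (reg_sum (prep A)) \<le> B" "int (reg_sum (query A)) \<le> B"
    and samples: "length samples = 2 ^ e0 * (4 * levels)" "set samples \<subseteq> {..<cols}"
    and M_range: "i < n \<Longrightarrow> k < cols \<Longrightarrow> 1 \<le> M i k \<and> M i k \<le> int n"
    and V_range: "j < n \<Longrightarrow> k < cols \<Longrightarrow> 1 \<le> V j k \<and> V j k \<le> int n"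
    and M_pad: "M i k = M i (min k (n - 1))" and V_pad: "V j k = V j (min k (n - 1))"
begin

definition copy_col :: "nat \<Rightarrow> nat" where "copy_col i = samples ! (i div (2 * 2 ^ e0 + 1))"
definition copy_shift :: "nat \<Rightarrow> nat" where "copy_shift i = i mod (2 * 2 ^ e0 + 1)"

lemma copy_shift_le: "copy_shift i \<le> 2 * 2 ^ e0"
  using mod_less_divisor[of "2 * 2 ^ e0 + 1" i] unfolding copy_shift_def by linarith

lemma copy_col_less:
  assumes "i < 2 ^ e0 * (4 * levels) * (2 * 2 ^ e0 + 1)"
  shows "copy_col i < cols"
proof -
  have "i div (2 * 2 ^ e0 + 1) < length samples"
    unfolding samples(1) using assms by (rule less_mult_imp_div_less)
  then show ?thesis using samples(2) nth_mem by (auto simp: copy_col_def)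
qed

sublocale parallel_copies W B n L e0 t_eq
  "\<lambda>i r. if r = 0 then zero_state else eq_state (copy_col i) (copy_shift i) (r - 1)"
  "\<lambda>i. eq_time (copy_col i) (copy_shift i)"
  by unfold_locales
    (use e0_le cube_le less_cube copies_large run copy_col_less copy_shift_le in
      \<open>auto simp: equality_run_def\<close>)

lemma copy_less:
  assumes "i < copies"
  shows "copy_col i < cols" "copy_shift i \<le> 2 * 2 ^ e0"
  using copy_col_less[of i] copy_shift_le assms by (simp_all add: copies_def density_def shifts_def)

lemma radius_le_n: "2 ^ e0 \<le> n"
proof -
  have "(2::nat) ^ e0 * 1 \<le> 2 ^ e0 * (2 ^ e0 * 2 ^ e0)" by (intro mult_le_mono) simp_all
  also have "\<dots> = (2 ^ e0) ^ 3" by (simp add: power3_eq_cube)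
  finally show ?thesis using cube_le by simp
qed

lemma copy_run: "i < copies \<Longrightarrow> equality_run W_eq A n t_eq (\<lambda>i' k. M i' k - M i' (copy_col i))
    (\<lambda>j k. V j (copy_col i) - V j k - int (copy_shift i))
    (eq_state (copy_col i) (copy_shift i)) (eq_time (copy_col i) (copy_shift i))"
  using run copy_less by blast

definition copy_loaded :: "state \<Rightarrow> nat \<Rightarrow> bool" where
  "copy_loaded s p \<longleftrightarrow> p < copies \<and> regs s r_copy = int p \<and> regs s r_col = int (copy_col p) \<and>
     regs s r_shift = int (copy_shift p)"

lemma entry_frame: "frame X Y s s' \<Longrightarrow> a_matrix \<notin> Y \<Longrightarrow> entry s' = entry s"
  by (simp add: entry_def frame_arrs fun_eq_iff)

lemma wp_prep_copy:
  assumes regs: "copy_regs s e cnt" "copy_loaded s p"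
    and zero: "view copies p s = zero_state"
    and bound: "int (cnt + eq_time (copy_col p) (copy_shift p) 0) \<le> B"
    and input: "\<And>q. q < n * n \<Longrightarrow> arrs s a_input q = M (q div n) (q mod n)"
    and matrix: "\<And>i k. i < n \<Longrightarrow> k < cols \<Longrightarrow> entry s i k = M i k"
  shows "wp (prep_copy (prep A)) s (\<lambda>s' t. t \<le> 4 * n * n + 10 + 5 * eq_time (copy_col p) (copy_shift p) 0 \<and>
    view copies p s' = eq_state (copy_col p) (copy_shift p) 0 \<and>
    (\<forall>i<copies. i \<noteq> p \<longrightarrow> view copies i s' = view copies i s) \<and>
    regs s' r_steps = int (cnt + eq_time (copy_col p) (copy_shift p) 0))"
    (is "wp _ _ ?Q")
  unfolding prep_copy_def
proof (rule wp_straight_Seq)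
  let ?diff = "Rd a_input (R r_cell) \<boxminus> matrix_at (Bin Div (R r_cell) (R r_dim)) (R r_col)"
  let ?fill = "for_loop r_cell (R r_dim \<boxtimes> R r_dim) (Store (a_copy a_input) (copy_index (R r_cell)) ?diff)"
  let ?c = "copy_col p" and ?\<tau> = "eq_time (copy_col p) (copy_shift p) 0"
  let ?f = "\<lambda>q. M (q div n) (q mod n) - M (q div n) ?c"
  let ?s = "set_cell s a_copy_regs p (int n)"
  have p: "p < copies" "regs s r_copy = int p" "regs s r_col = int ?c" "?c < cols"
    using regs(2) copy_less(1)[of p] by (auto simp: copy_loaded_def)
  have r: "regs s r_dim = int n" "regs s r_cols = int cols" "regs s r_copies = int copies"
    "regs s r_steps = int cnt"
    using regs(1) by (auto simp: copy_regs_def)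
  show "safe B (Store a_copy_regs (R r_copy) (R r_dim)) s" "effect (Store a_copy_regs (R r_copy) (R r_dim)) s = ?s"
    "cost (Store a_copy_regs (R r_copy) (R r_dim)) s = 1"
    using p r B_bounds by simp_all
  have "wp ?fill ?s
    (\<lambda>s' t. t \<le> n * n * 4 + 3 \<and> frame {r_cell} {a_copy a_input} ?s s' \<and>
      (\<forall>q<n * n. arrs s' (a_copy a_input) (q * copies + p) = ?f q) \<and>
      (\<forall>i. i \<notin> (\<lambda>q. q * copies + p) ` {..<n * n} \<longrightarrow> arrs s' (a_copy a_input) i = arrs ?s (a_copy a_input) i))"
  proof (rule wp_for_Store[where m = "n * n" and idx = "\<lambda>q. q * copies + p" and f = ?f])
    show "int (n * n) \<le> B" by (rule le_B_quadratic) (simp add: power2_eq_square)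
    show "inj_on (\<lambda>q. q * copies + p) {..<n * n}" using p(1) by (auto simp: inj_on_def interleave_inj)
    fix s' q assume q: "q < n * n" "regs s' r_cell = int q" and fr: "frame {r_cell} {a_copy a_input} ?s s'"
    have q': "q div n < n" "q mod n < n" using q(1) n_pos by (auto simp: less_mult_imp_div_less)
    then have "1 \<le> M (q div n) (q mod n) \<and> M (q div n) (q mod n) \<le> int n"
      using less_le_trans[OF q'(2) n_le_cols] by (intro M_range)
    moreover have "1 \<le> M (q div n) ?c \<and> M (q div n) ?c \<le> int n" using q'(1) p(4) by (rule M_range)
    ultimately have "\<bar>?f q\<bar> \<le> B" using B_bounds(2) by linarith
    moreover have "entry s' = entry s" "arrs s' a_input = arrs s a_input"
      using entry_frame[OF fr] frame_arrs[OF fr] by simp_all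
    ultimately show "asafe B s' (copy_index (R r_cell)) \<and> leaves (copy_index (R r_cell)) \<le> 16 \<and>
        aeval s' (copy_index (R r_cell)) = int (q * copies + p) \<and>
        asafe B s' ?diff \<and>
        leaves ?diff \<le> 16 \<and>
        aeval s' ?diff = ?f q \<and> \<bar>?f q\<bar> \<le> B"
      using q(2) frame_regs[OF fr] p r n_pos input[OF q(1)] matrix[OF q'(1) p(4)]
      by (simp flip: zdiv_int)
  qed (use r n_pos in \<open>auto simp: frame_regs\<close>)
  then show "wp (?fill ;; sim_com (prep A)) ?s
      (\<lambda>s' t. ?Q s' (Suc (1 + t)))"
  proof (rule wp_Seq_conseq, elim conjE)
    fix s1 t1 assume t1: "t1 \<le> n * n * 4 + 3" and fr: "frame {r_cell} {a_copy a_input} ?s s1"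
      and cells: "\<forall>q<n * n. arrs s1 (a_copy a_input) (q * copies + p) = ?f q"
        "\<forall>i. i \<notin> (\<lambda>q. q * copies + p) ` {..<n * n} \<longrightarrow> arrs s1 (a_copy a_input) i = arrs ?s (a_copy a_input) i"
    have view1: "view copies j s1 = (if j = p then init_state n (mat n n (\<lambda>(i, k). M i k - M i ?c))
        else view copies j s)" if "j < copies" for j
    proof -
      have "view copies j ?s = (if j = p then zero_state\<lparr>regs := (regs zero_state)(0 := int n)\<rparr> else view copies j s)"
        if "j < copies" for j
        using view_set_cell(2)[OF p(1) that, of s 0 "int n"] zero by simp
      moreover have "q div n < n" "q mod n < n" if "q < n * n" for q
        using that n_pos by (simp_all add: less_mult_imp_div_less)
      ultimately show ?thesis
        using view_store_range[OF p(1) that fr, of "n * n" ?f] cells that p(1)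
        by (auto simp: zero_state_def init_state_def fun_eq_iff)
    qed
    have "wp (sim_com (prep A)) s1 (\<lambda>s' t. t \<le> 5 * ?\<tau> \<and>
        sim_result copies p s1 s' ?\<tau> (eq_state ?c (copy_shift p) 0))"
      using copy_run[OF p(1)] p r frame_regs[OF fr] view1[OF p(1)] copies_le_B(2) bound
      by (intro wp_sim_com[OF _ W_eq deterministic(1) reg_sum(1)]) (auto simp: equality_run_def)
    then show "wp (sim_com (prep A)) s1 (\<lambda>s' t. ?Q s' (Suc (1 + Suc (t1 + t))))"
      by (rule wp_conseq) (use t1 view1 r frame_regs[OF fr] in \<open>auto simp: sim_result_def\<close>)
  qed
qed

lemma wp_load_query:
  assumes regs: "copy_regs s e cnt" "copy_loaded s p"
    and j: "j < n" and vec: "\<And>k. k < cols \<Longrightarrow> arrs s a_vec k = V j k"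
  shows "wp load_query s (\<lambda>s' t. t \<le> n * 4 + 3 \<and> view copies p s' =
      put_query n (vec n (\<lambda>k. V j (copy_col p) - V j k - int (copy_shift p))) (view copies p s) \<and>
    (\<forall>i<copies. i \<noteq> p \<longrightarrow> view copies i s' = view copies i s))"
    (is "wp _ _ ?Q")
  unfolding load_query_def
proof (rule wp_for_Store[where m = n and idx = "\<lambda>k. k * copies + p" and
      f = "\<lambda>k. V j (copy_col p) - V j k - int (copy_shift p)"])
  let ?diff = "Rd a_vec (R r_col) \<boxminus> Rd a_vec (R r_idx) \<boxminus> R r_shift"
  let ?f = "\<lambda>k. V j (copy_col p) - V j k - int (copy_shift p)"
  have p: "p < copies" "regs s r_copy = int p" "regs s r_col = int (copy_col p)"
    "regs s r_shift = int (copy_shift p)" "copy_col p < cols"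
    using regs(2) copy_less(1)[of p] by (auto simp: copy_loaded_def)
  show "inj_on (\<lambda>k. k * copies + p) {..<n}" using p(1) by (auto simp: inj_on_def interleave_inj)
  show "int n \<le> B" using B_bounds by linarith
  {
    fix s' k assume k: "k < n" "regs s' r_idx = int k" and fr: "frame {r_idx} {a_copy a_query} s s'"
    have "k < cols" using k(1) n_le_cols by simp
    then have "\<bar>?f k\<bar> \<le> B"
      using V_range[OF j, of k] V_range[OF j p(5)] copy_shift_le[of p] radius_le_n B_bounds n_le_cols
      by linarith
    then show "asafe B s' (copy_index (R r_idx)) \<and> leaves (copy_index (R r_idx)) \<le> 16 \<and>
        aeval s' (copy_index (R r_idx)) = int (k * copies + p) \<and>
        asafe B s' ?diff \<and>
        leaves ?diff \<le> 16 \<and>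
        aeval s' ?diff = ?f k \<and> \<bar>?f k\<bar> \<le> B"
      using k(2) frame_regs[OF fr] frame_arrs[OF fr] p regs(1) vec[OF p(5)] vec[OF \<open>k < cols\<close>]
      by (simp add: copy_regs_def)
  next
    fix s' t assume "t \<le> n * 4 + 3" and fr: "frame {r_idx} {a_copy a_query} s s'"
      and cells: "\<And>k. k < n \<Longrightarrow> arrs s' (a_copy a_query) (k * copies + p) = ?f k"
        "\<And>i. i \<notin> (\<lambda>k. k * copies + p) ` {..<n} \<Longrightarrow> arrs s' (a_copy a_query) i = arrs s (a_copy a_query) i"
    have "(\<lambda>q. if q < n then vec n ?f $ q else arrs (view copies p s) a_query q) =
        (\<lambda>q. if q < n then ?f q else arrs (view copies p s) a_query q)" by auto
    then have "put_query n (vec n ?f) (view copies p s) = (view copies p s)\<lparr>arrs := (arrs (view copies p s))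
        (a_query := \<lambda>q. if q < n then ?f q else arrs (view copies p s) a_query q)\<rparr>"
      unfolding put_query_def by simp
    then show "?Q s' t"
      using view_store_range[OF p(1) _ fr cells] p(1) \<open>t \<le> n * 4 + 3\<close> by simp
  }
qed (use regs(1) in \<open>auto simp: copy_regs_def frame_regs\<close>)

definition hit_value :: "nat \<Rightarrow> nat \<Rightarrow> nat \<Rightarrow> int" where
  "hit_value j q i = M i (copy_col q) + V j (copy_col q) - int (copy_shift q)"

definition hit :: "nat \<Rightarrow> nat \<Rightarrow> nat \<Rightarrow> bool" where
  "hit j q i \<longleftrightarrow> (\<exists>k<n. M i k + V j k = hit_value j q i)"

definition collected_at :: "nat \<Rightarrow> nat \<Rightarrow> nat \<Rightarrow> nat \<Rightarrow> int \<Rightarrow> bool" where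
  "collected_at j e p i x \<longleftrightarrow> (x = 8 * int cols \<or> (\<exists>k<cols. x = M i k + V j k)) \<and>
     (\<forall>q<p. active (2 ^ e) q \<longrightarrow> hit j q i \<longrightarrow> x \<le> hit_value j q i)"

definition collected :: "nat \<Rightarrow> nat \<Rightarrow> nat \<Rightarrow> (nat \<Rightarrow> int) \<Rightarrow> bool" where
  "collected j e p a \<longleftrightarrow> (\<forall>i<n. collected_at j e p i (a i))"

lemma collected_at_step:
  assumes "collected_at j e p i x"
  shows "collected_at j e (Suc p) i (if hit j p i then min x (hit_value j p i) else x)"
proof -
  have "\<exists>k<cols. hit_value j p i = M i k + V j k" if "hit j p i"
    using that n_le_cols unfolding hit_def by (metis less_le_trans)
  then show ?thesis using assms by (auto simp: collected_at_def less_Suc_eq min_def)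
qed

lemma collected_skip: "collected j e p a \<Longrightarrow> \<not> active (2 ^ e) p \<Longrightarrow> collected j e (Suc p) a"
  by (auto simp: collected_def collected_at_def less_Suc_eq)

lemma collected_mono: "collected j e p a \<Longrightarrow> e' \<le> e \<Longrightarrow> collected j e' p a"
  using active_mono[of "2 ^ e'" _ "2 ^ e"] power_increasing[of e' e "2::nat"]
  unfolding collected_def collected_at_def by simp

lemma copy_answer:
  assumes "view copies p s = eq_state (copy_col p) (copy_shift p) (Suc j)" "p < copies" "j < n" "i < n"
  shows "arrs s (a_copy a_answer) (i * copies + p) = (if hit j p i then 1 else 0)"
proof -
  have "arrs s (a_copy a_answer) (i * copies + p) = arrs (view copies p s) a_answer i"
    by (simp add: view_def)
  also have "\<dots> = (if \<exists>k<n. M i k - M i (copy_col p) =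
      V j (copy_col p) - V j k - int (copy_shift p) then 1 else 0)"
    unfolding assms(1) using copy_run[OF assms(2)] assms(3,4) by (simp add: equality_run_def)
  also have "(\<exists>k<n. M i k - M i (copy_col p) = V j (copy_col p) - V j k - int (copy_shift p)) = hit j p i"
    unfolding hit_def hit_value_def by (intro ex_cong1) (auto simp: algebra_simps)
  finally show ?thesis .
qed

lemma wp_collect:
  assumes regs: "copy_regs s e' cnt" "copy_loaded s p"
    and j: "j < n" and vec: "\<And>k. k < cols \<Longrightarrow> arrs s a_vec k = V j k"
    and matrix: "\<And>i k. i < n \<Longrightarrow> k < cols \<Longrightarrow> entry s i k = M i k"
    and view: "view copies p s = eq_state (copy_col p) (copy_shift p) (Suc j)"
    and before: "collected j e p (arrs s a_answer)"
  shows "wp collect s (\<lambda>s' t. t \<le> n * 9 + 3 \<and> collected j e (Suc p) (arrs s' a_answer))"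
  unfolding collect_def
proof (rule wp_for_const[where m = n and K = 6 and I = "\<lambda>q s'. \<forall>i<n.
      collected_at j e (if i < q then Suc p else p) i (arrs s' a_answer i)"])
  let ?body = "If (Equal (Rd (a_copy a_answer) (copy_index (R r_row))) (N 1))
    (Assign r_tmp (matrix_at (R r_row) (R r_col) \<boxplus> Rd a_vec (R r_col) \<boxminus> R r_shift) ;;
     If (Less (R r_tmp) (Rd a_answer (R r_row))) (Store a_answer (R r_row) (R r_tmp)) SKIP) SKIP"
  have p: "p < copies" "regs s r_copy = int p" "regs s r_col = int (copy_col p)"
    "regs s r_shift = int (copy_shift p)" "copy_col p < cols"
    using regs(2) copy_less(1)[of p] by (auto simp: copy_loaded_def)
  fix q s' assume q: "q < n" "regs s' r_row = int q" and fr: "framed (for_loop r_row (R r_dim) ?body) s s'"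
    and inv: "\<forall>i<n. collected_at j e (if i < q then Suc p else p) i (arrs s' a_answer i)"
  have same: "regs s' r_dim = int n" "regs s' r_cols = int cols" "regs s' r_copies = int copies"
    "regs s' r_copy = int p" "regs s' r_col = int (copy_col p)" "regs s' r_shift = int (copy_shift p)"
    "arrs s' a_vec (copy_col p) = V j (copy_col p)" "entry s' q (copy_col p) = M q (copy_col p)"
    "arrs s' (a_copy a_answer) (q * copies + p) = (if hit j p q then 1 else 0)"
    using regs(1) p q(1) frame_regs[OF fr] frame_arrs[OF fr] entry_frame[OF fr] vec matrix
      copy_answer[OF view p(1) j q(1)] by (simp_all add: copy_regs_def)
  have index: "nat (int q * int copies + int p) = q * copies + p" by (simp add: nat_add_distrib nat_mult_distrib)
  have bound: "\<bar>hit_value j p q\<bar> \<le> B"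
    using M_range[OF q(1) p(5)] V_range[OF j p(5)] copy_shift_le[of p] radius_le_n B_bounds n_le_cols
    unfolding hit_value_def by linarith
  let ?x = "if hit j p q then min (arrs s' a_answer q) (hit_value j p q) else arrs s' a_answer q"
  let ?s = "s'\<lparr>regs := (regs s')(r_tmp := if hit j p q then hit_value j p q else regs s' r_tmp),
    arrs := (arrs s')(a_answer := (arrs s' a_answer)(q := ?x))\<rparr>"
  have "M q (copy_col p) + V j (copy_col p) - int (copy_shift p) = hit_value j p q"
    by (simp add: hit_value_def)
  note eval = same q(2) index bound B_ge_2 this
  consider "\<not> hit j p q" | "hit j p q" "hit_value j p q < arrs s' a_answer q"
    | "hit j p q" "\<not> hit_value j p q < arrs s' a_answer q" by blast
  then have "effect ?body s' = ?s \<and> safe B ?body s'"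
    by cases (use eval in \<open>simp_all add: min_def\<close>)
  moreover have "cost ?body s' \<le> 6" by simp
  moreover have "\<forall>i<n. collected_at j e (if i < Suc q then Suc p else p) i (arrs ?s a_answer i)"
    using inv collected_at_step[of j e p q "arrs s' a_answer q"] q(1) by (auto simp: less_Suc_eq)
  ultimately show "wp ?body s' (\<lambda>s'' t. t \<le> 6 \<and> (\<forall>i<n. collected_at j e (if i < Suc q then Suc p else p) i
      (arrs (set_reg s'' r_row (int (Suc q))) a_answer i)))"
    by (intro wp_straight) auto
qed (use regs(1) before B_bounds in \<open>auto simp: copy_regs_def frame_regs collected_def\<close>)

lemma wp_query_copy:
  assumes regs: "copy_regs s e cnt" "copy_loaded s p"
    and j: "j < n" and vec: "\<And>k. k < cols \<Longrightarrow> arrs s a_vec k = V j k"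
    and matrix: "\<And>i k. i < n \<Longrightarrow> k < cols \<Longrightarrow> entry s i k = M i k"
    and view: "view copies p s = eq_state (copy_col p) (copy_shift p) j"
    and before: "collected j e p (arrs s a_answer)"
    and bound: "int (cnt + eq_time (copy_col p) (copy_shift p) (Suc j)) \<le> B"
  shows "wp (query_copy (query A)) s (\<lambda>s' t.
    t \<le> 13 * n + 8 + 5 * eq_time (copy_col p) (copy_shift p) (Suc j) \<and>
    collected j e (Suc p) (arrs s' a_answer) \<and>
    view copies p s' = eq_state (copy_col p) (copy_shift p) (Suc j) \<and>
    (\<forall>i<copies. i \<noteq> p \<longrightarrow> view copies i s' = view copies i s) \<and>
    regs s' r_steps = int (cnt + eq_time (copy_col p) (copy_shift p) (Suc j)))"
    (is "wp _ _ ?Q")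
  unfolding query_copy_def
proof (rule wp_Seq_conseq, rule wp_load_query[OF regs j], erule vec, elim conjE)
  let ?\<tau> = "eq_time (copy_col p) (copy_shift p) (Suc j)" and ?st = "eq_state (copy_col p) (copy_shift p)"
  fix s1 t1 assume t1: "t1 \<le> n * 4 + 3" and fr: "framed load_query s s1"
    and view1: "view copies p s1 = put_query n (vec n (\<lambda>k. V j (copy_col p) - V j k - int (copy_shift p)))
      (view copies p s)"
      "\<forall>i<copies. i \<noteq> p \<longrightarrow> view copies i s1 = view copies i s"
  have p: "p < copies" using regs(2) by (simp add: copy_loaded_def)
  have fr1: "frame {r_idx} {a_copy a_query} s s1" using fr by (simp add: load_query_def)
  have "wp (sim_com (query A)) s1 (\<lambda>s' t. t \<le> 5 * ?\<tau> \<and> sim_result copies p s1 s' ?\<tau> (?st (Suc j)))"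
    using copy_run[OF p] view1(1) view j regs frame_regs[OF fr1] copies_le_B(2) bound
    by (intro wp_sim_com[OF _ W_eq deterministic(2) reg_sum(2)])
      (auto simp: equality_run_def copy_regs_def copy_loaded_def)
  then show "wp (sim_com (query A) ;; collect) s1 (\<lambda>s' t. ?Q s' (Suc (t1 + t)))"
  proof (rule wp_Seq_conseq, elim conjE)
    fix s2 t2 assume t2: "t2 \<le> 5 * ?\<tau>" and res: "sim_result copies p s1 s2 ?\<tau> (?st (Suc j))"
    have arrs: "arrs s2 a = arrs s a" if "a < a_copy_regs" for a
      using res frame_arrs[OF fr1] that by (simp add: sim_result_def)
    have steps1: "regs s1 r_steps = int cnt"
      using regs(1) frame_regs[OF fr1] by (simp add: copy_regs_def)
    then have steps: "regs s2 = (regs s1)(r_steps := int (cnt + ?\<tau>))"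
      using res by (simp add: sim_result_def)
    have "copy_regs s2 e (cnt + ?\<tau>)" "copy_loaded s2 p"
      using regs frame_regs[OF fr1] by (simp_all add: copy_regs_def copy_loaded_def steps)
    moreover have "entry s2 = entry s" using arrs by (simp add: entry_def fun_eq_iff)
    ultimately have "wp collect s2 (\<lambda>s' t. t \<le> n * 9 + 3 \<and> collected j e (Suc p) (arrs s' a_answer))" (is "wp _ _ ?R")
      using vec matrix arrs before res j by (intro wp_collect) (auto simp: sim_result_def)
    then show "wp collect s2 (\<lambda>s' t. ?Q s' (Suc (t1 + Suc (t2 + t))))"
    proof (rule wp_conseq)
      fix s3 t3 assume "?R s3 t3"
        and "framed collect s2 s3"
      then have fr3: "frame {r_row, r_tmp} {a_answer} s2 s3" by (simp add: collect_def)
      then have "view copies i s3 = view copies i s2" for i by (intro view_cong) (simp add: frame_arrs)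
      then show "?Q s3 (Suc (t1 + Suc (t2 + t3)))"
        using \<open>t3 \<le> n * 9 + 3 \<and> _\<close> t1 t2 res view1(2) frame_regs[OF fr3] steps steps1
        by (simp add: sim_result_def)
    qed
  qed
qed

end

section \<open>Loading matrices and queries\<close>

definition pad :: "nat \<Rightarrow> nat \<Rightarrow> aexp \<Rightarrow> com" where
  "pad src dst num_rows = for_loop r_idx (num_rows \<boxtimes> R r_cols)
    (If (Less (Bin Mod (R r_idx) (R r_cols)) (R r_dim))
      (Store dst (R r_idx) (Rd src (Bin Div (R r_idx) (R r_cols) \<boxtimes> R r_dim \<boxplus> Bin Mod (R r_idx) (R r_cols))))
      (Store dst (R r_idx) (Rd src (Bin Div (R r_idx) (R r_cols) \<boxtimes> R r_dim \<boxplus> (R r_dim \<boxminus> N 1)))))"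

definition flag_test :: "nat \<Rightarrow> aexp \<Rightarrow> bexp \<Rightarrow> com" where
  "flag_test flag e violation =
    Assign flag (N 1) ;; for_loop r_idx e (If violation (Assign flag (N 0)) SKIP)"

definition row_descent :: "nat \<Rightarrow> bexp" where
  "row_descent a = Conj (Less (N 0) (Bin Mod (R r_idx \<boxplus> N 1) (R r_cols)))
     (Less (Rd a (R r_idx \<boxplus> N 1)) (Rd a (R r_idx)))"

definition col_descent :: "nat \<Rightarrow> bexp" where
  "col_descent a = Conj (Less (R r_idx \<boxplus> R r_cols) (R r_dim \<boxtimes> R r_cols))
     (Less (Rd a (R r_idx \<boxplus> R r_cols)) (Rd a (R r_idx)))"

definition load_trees :: "aexp \<Rightarrow> aexp \<Rightarrow> aexp \<Rightarrow> com" where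
  "load_trees num_rows first val = for_loop r_idx (num_rows \<boxtimes> R r_cols)
    ((Assign r_leaf (Bin Mod (R r_idx) (R r_cols)) ;;
      Assign r_tree (first \<boxplus> Bin Div (R r_idx) (R r_cols)) ;; Assign r_val val) ;; update_leaf)"

lemma mod_loading [simp]:
  "mod_regs (pad src dst num_rows) = {r_idx}" "mod_arrs (pad src dst num_rows) = {dst}"
  "mod_regs (flag_test flag e b) = {r_idx, flag}" "mod_arrs (flag_test flag e b) = {}"
  "mod_regs (load_trees num_rows first val) = {r_idx, r_leaf, r_tree, r_val, r_path}"
  "mod_arrs (load_trees num_rows first val) = {a_trees}"
  by (auto simp: pad_def flag_test_def load_trees_def)

context padded
begin

definition grid :: "state \<Rightarrow> nat \<Rightarrow> nat \<Rightarrow> (nat \<Rightarrow> nat \<Rightarrow> int) \<Rightarrow> bool" where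
  "grid s a m f \<longleftrightarrow> (\<forall>i<m. \<forall>k<cols. arrs s a (i * cols + k) = f i k)"

lemma grid_entry: "grid s a_matrix n f \<longleftrightarrow> (\<forall>i<n. \<forall>k<cols. entry s i k = f i k)"
  by (simp add: grid_def entry_def)

lemma cell_less:
  assumes "i < m" "k < cols"
  shows "i * cols + k < m * cols"
  using mult_le_mono1[of "Suc i" m cols] assms by simp

lemma split_index:
  assumes "p < m * cols"
  shows "p div cols < m" "p mod cols < cols" "p div cols * cols + p mod cols = p"
  using assms by (auto simp: less_mult_imp_div_less)

lemma grid_index: "grid s a m f \<Longrightarrow> p < m * cols \<Longrightarrow> arrs s a p = f (p div cols) (p mod cols)"
  using split_index[of p m] unfolding grid_def by metis

lemma gridI:
  assumes "\<forall>p<m * cols. arrs s a p = f (p div cols) (p mod cols)"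
  shows "grid s a m f"
  unfolding grid_def
proof (intro allI impI)
  fix i k assume "i < m" "k < cols"
  moreover from this have "i * cols + k < m * cols" by (rule cell_less)
  ultimately show "arrs s a (i * cols + k) = f i k" using assms by simp
qed

definition dims :: "state \<Rightarrow> aexp \<Rightarrow> nat \<Rightarrow> bool" where
  "dims s num_rows m \<longleftrightarrow> regs s r_dim = int n \<and> regs s r_cols = int cols \<and> m \<le> n \<and>
     (num_rows = N (int m) \<or> num_rows = R r_dim \<and> m = n)"

lemma dims_rows:
  assumes "dims s num_rows m" "frame X Y s s'" "r_dim \<notin> X" "r_cols \<notin> X"
  shows "asafe B s' num_rows" "leaves num_rows = 1" "aeval s' num_rows = int m"
    "regs s' r_dim = int n" "regs s' r_cols = int cols"
proof -
  have "int m \<le> B" using assms(1) B_bounds by (simp add: dims_def)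
  then show "asafe B s' num_rows" "leaves num_rows = 1" "aeval s' num_rows = int m"
    "regs s' r_dim = int n" "regs s' r_cols = int cols"
    using assms by (auto simp: dims_def frame_regs)
qed

lemma cells_le_B:
  assumes "dims s num_rows m"
  shows "int (m * cols + cols + 1) \<le> B"
proof (rule le_B_quadratic)
  have "m * cols \<le> n * (2 * n)" using assms cols_less by (intro mult_le_mono) (auto simp: dims_def)
  then show "m * cols + cols + 1 \<le> 1000 * (n + 2)^2"
    using cols_less by (simp add: power2_eq_square algebra_simps)
qed

lemma wp_pad:
  assumes dims: "dims s num_rows m" and ne: "src \<noteq> dst"
    and src: "\<And>i k. i < m \<Longrightarrow> k < n \<Longrightarrow> arrs s src (i * n + k) = f i k"
    and padded: "\<And>i k. f i k = f i (min k (n - 1))"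
  shows "wp (pad src dst num_rows) s (\<lambda>s' t. t \<le> m * cols * 5 + 3 \<and> grid s' dst m f)"
  unfolding pad_def
proof (rule wp_for_const[where m = "m * cols" and K = 2 and
      I = "\<lambda>p s'. \<forall>q<p. arrs s' dst q = f (q div cols) (q mod cols)"])
  let ?src = "\<lambda>e. Rd src (Bin Div (R r_idx) (R r_cols) \<boxtimes> R r_dim \<boxplus> e)"
  let ?body = "If (Less (Bin Mod (R r_idx) (R r_cols)) (R r_dim))
      (Store dst (R r_idx) (?src (Bin Mod (R r_idx) (R r_cols)))) (Store dst (R r_idx) (?src (R r_dim \<boxminus> N 1)))"
  fix p s' assume p: "p < m * cols" "regs s' r_idx = int p" and fits: "fits B s'"
    and fr: "framed (for_loop r_idx (num_rows \<boxtimes> R r_cols) ?body) s s'"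
    and inv: "\<forall>q<p. arrs s' dst q = f (q div cols) (q mod cols)"
  have fr': "frame {r_idx} {dst} s s'" using fr by simp
  define i k where "i = p div cols" and "k = min (p mod cols) (n - 1)"
  have ik: "i < m" "k < n" using split_index[OF p(1)] n_pos by (auto simp: i_def k_def)
  have cell: "arrs s' src (i * n + k) = f i (p mod cols)"
    using src[OF ik] padded[of i "p mod cols"] ne frame_arrs[OF fr'] by (simp add: k_def)
  have index: "nat (int i * int n + int (p mod cols)) = i * n + p mod cols"
    "nat (int i * int n + (int n - 1)) = i * n + (n - 1)"
    using n_pos by (auto simp: nat_add_distrib nat_mult_distrib nat_diff_distrib)
  have "\<bar>f i (p mod cols)\<bar> \<le> B" using fits_arrs[OF fits, of src "i * n + k"] cell by simp
  moreover have "int p div int cols = int i" "int p mod int cols = int (p mod cols)"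
    by (simp_all add: i_def zdiv_int zmod_int)
  moreover have "k = (if p mod cols < n then p mod cols else n - 1)" by (simp add: k_def)
  ultimately have "safe B ?body s' \<and> effect ?body s' = set_cell s' dst p (f i (p mod cols))"
    using dims_rows[OF dims fr'] p(2) cell n_pos index B_ge_2 by (cases "p mod cols < n") simp_all
  moreover have "cost ?body s' = 2" by simp
  ultimately show "wp ?body s' (\<lambda>s'' t. t \<le> 2 \<and>
      (\<forall>q<Suc p. arrs (set_reg s'' r_idx (int (Suc p))) dst q = f (q div cols) (q mod cols)))"
    using inv by (intro wp_straightI) (auto simp: less_Suc_eq i_def)
next
  show "int (m * cols) \<le> B" using cells_le_B[OF dims] by simp
qed (use dims_rows[OF dims] in \<open>auto intro: gridI\<close>)

lemma wp_flag_test: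
  assumes flag: "flag \<noteq> r_idx" and m: "int m \<le> B"
    and bound: "\<And>s'. frame {r_idx, flag} {} s s' \<Longrightarrow> asafe B s' e \<and> leaves e \<le> 16 \<and> aeval s' e = int m"
    and violation: "\<And>s' p. p < m \<Longrightarrow> frame {r_idx, flag} {} s s' \<Longrightarrow> regs s' r_idx = int p \<Longrightarrow>
      bsafe B s' b \<and> beval s' b = (\<not> P p)"
  shows "wp (flag_test flag e b) s (\<lambda>s' t. t \<le> m * 5 + 5 \<and> regs s' flag = (if \<forall>p<m. P p then 1 else 0))"
    (is "wp _ _ ?Q")
  unfolding flag_test_def
proof (rule wp_straight_Seq)
  let ?s = "set_reg s flag 1"
  show "wp (for_loop r_idx e (If b (Assign flag (N 0)) SKIP)) ?s (\<lambda>s' t. ?Q s' (Suc (1 + t)))"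
  proof (rule wp_for_const[where m = m and K = 2 and
        I = "\<lambda>q s'. regs s' flag = (if \<forall>p<q. P p then 1 else 0)"])
    have fr: "frame {r_idx, flag} {} s s'"
      if "framed (for_loop r_idx e (If b (Assign flag (N 0)) SKIP)) ?s s'" for s'
      using that by (auto simp: frame_def)
    fix s' assume "framed (for_loop r_idx e (If b (Assign flag (N 0)) SKIP)) ?s s'"
    then show "asafe B s' e \<and> leaves e \<le> 16 \<and> aeval s' e = int m" using bound fr by blast
    fix q assume q: "q < m" "regs s' r_idx = int q" "regs s' flag = (if \<forall>p<q. P p then 1 else 0)"
    from fr[OF \<open>framed _ _ _\<close>] q show "wp (If b (Assign flag (N 0)) SKIP) s' (\<lambda>s'' t. t \<le> 2 \<and>
        regs (set_reg s'' r_idx (int (Suc q))) flag = (if \<forall>p<Suc q. P p then 1 else 0))"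
      using violation[OF q(1) _ q(2)] flag B_ge_2
      by (intro wp_straight) (auto simp: less_Suc_eq)
  qed (use flag m in auto)
qed (use B_ge_2 in auto)

lemma all_rows_monotone:
  "(\<forall>p<m * cols. 0 < (p + 1) mod cols \<longrightarrow> f (p div cols) (p mod cols) \<le> f ((p + 1) div cols) ((p + 1) mod cols))
    \<longleftrightarrow> (\<forall>i<m. monotone_on_cols (f i))" (is "?L \<longleftrightarrow> ?R")
proof
  assume L: ?L
  have "f i k \<le> f i (k + 1)" if "i < m" "k + 1 < cols" for i k
  proof -
    have "i * cols + k < m * cols" using that by (intro cell_less) auto
    moreover have "(i * cols + k + 1) div cols = i" "(i * cols + k + 1) mod cols = k + 1"
      using that(2) by (simp_all only: add.assoc div_mult_self3 mod_mult_self3) auto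
    ultimately show ?thesis using L[rule_format, of "i * cols + k"] that(2) by simp
  qed
  then show ?R by (simp add: monotone_on_cols_def)
next
  assume R: ?R
  have "f (p div cols) (p mod cols) \<le> f ((p + 1) div cols) ((p + 1) mod cols)"
    if "p < m * cols" "0 < (p + 1) mod cols" for p
  proof -
    have "(p + 1) mod cols = p mod cols + 1" "(p + 1) div cols = p div cols"
      using that(2) mod_Suc[of p cols] div_Suc[of p cols] by (simp_all split: if_splits)
    then show ?thesis
      using R split_index[OF that(1)] mod_less_divisor[OF cols_pos, of "p + 1"]
      by (simp add: monotone_on_cols_def)
  qed
  then show ?L by blast
qed

lemma wp_row_flag:
  assumes dims: "dims s num_rows m" and flag: "flag \<notin> {r_dim, r_cols, r_idx}" and grid: "grid s a m f"
  shows "wp (flag_test flag (num_rows \<boxtimes> R r_cols) (row_descent a)) s (\<lambda>s' t. t \<le> m * cols * 5 + 5 \<and>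
    regs s' flag = (if \<forall>i<m. monotone_on_cols (f i) then 1 else 0))"
proof -
  have eval: "bsafe B s' (row_descent a) \<and> beval s' (row_descent a) = (\<not> (0 < (p + 1) mod cols \<longrightarrow>
      f (p div cols) (p mod cols) \<le> f ((p + 1) div cols) ((p + 1) mod cols)))"
    if p: "p < m * cols" "regs s' r_idx = int p" and fr: "frame {r_idx, flag} {} s s'" for s' p
  proof -
    have mod: "(int p + 1) mod int cols = int ((p + 1) mod cols)" by (simp add: zmod_int add.commute)
    have Suc_p: "nat (int p + 1) = p + 1" by simp
    have a: "arrs s' a = arrs s a" by (rule frame_arrs[OF fr]) simp
    have "p + 1 < m * cols" if "0 < (p + 1) mod cols"
      using p(1) that by (metis Suc_eq_plus1 Suc_lessI less_irrefl mod_mult_self2_is_0)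
    then show ?thesis
      using p(2) dims_rows[OF dims fr] flag grid_index[OF grid p(1)] grid_index[OF grid, of "p + 1"] B_ge_2
      by (auto simp: row_descent_def mod a Suc_p)
  qed
  show ?thesis
    unfolding all_rows_monotone[symmetric]
    by (rule wp_flag_test) (use flag eval dims_rows[OF dims] cells_le_B[OF dims] in auto)
qed

lemma all_cols_monotone:
  "(\<forall>p<m * cols. p + cols < m * cols \<longrightarrow> f (p div cols) (p mod cols) \<le>
      f ((p + cols) div cols) ((p + cols) mod cols))
    \<longleftrightarrow> (\<forall>k<cols. \<forall>i. i + 1 < m \<longrightarrow> f i k \<le> f (i + 1) k)" (is "?L \<longleftrightarrow> ?R")
proof
  assume L: ?L
  have "f i k \<le> f (i + 1) k" if "i + 1 < m" "k < cols" for i k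
  proof -
    have "(i + 1) * cols + k < m * cols" using that by (intro cell_less)
    moreover have "i * cols + k + cols = (i + 1) * cols + k" by simp
    ultimately show ?thesis using L[rule_format, of "i * cols + k"] that(2) by (simp add: div_add1_eq)
  qed
  then show ?R by blast
next
  assume R: ?R
  have "f (p div cols) (p mod cols) \<le> f ((p + cols) div cols) ((p + cols) mod cols)"
    if "p + cols < m * cols" for p
    using R split_index[of p m] split_index[OF that] that by simp
  then show ?L by blast
qed

lemma wp_col_flag:
  assumes dims: "dims s (R r_dim) n" and flag: "flag \<notin> {r_dim, r_cols, r_idx}" and grid: "grid s a n f"
  shows "wp (flag_test flag (R r_dim \<boxtimes> R r_cols) (col_descent a)) s (\<lambda>s' t. t \<le> n * cols * 5 + 5 \<and>
    regs s' flag = (if \<forall>k<cols. \<forall>i. i + 1 < n \<longrightarrow> f i k \<le> f (i + 1) k then 1 else 0))"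
proof -
  have eval: "bsafe B s' (col_descent a) \<and> beval s' (col_descent a) = (\<not> (p + cols < n * cols \<longrightarrow>
      f (p div cols) (p mod cols) \<le> f ((p + cols) div cols) ((p + cols) mod cols)))"
    if p: "p < n * cols" "regs s' r_idx = int p" and fr: "frame {r_idx, flag} {} s s'" for s' p
  proof -
    have below: "int p + int cols < int n * int cols \<longleftrightarrow> p + cols < n * cols"
      by (simp flip: of_nat_add of_nat_mult)
    have a: "arrs s' a = arrs s a" by (rule frame_arrs[OF fr]) simp
    have index: "nat (int p + int cols) = p + cols" by simp
    show ?thesis
      using p(2) dims_rows[OF dims fr] flag grid_index[OF grid p(1)] grid_index[OF grid, of "p + cols"]
      by (auto simp: col_descent_def below a index)
  qed
  show ?thesis
    unfolding all_cols_monotone[symmetric]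
    by (rule wp_flag_test) (use flag eval dims_rows[OF dims] cells_le_B[OF dims] in auto)
qed

abbreviation trees_loaded :: "nat \<Rightarrow> nat \<Rightarrow> (nat \<Rightarrow> nat \<Rightarrow> int) \<Rightarrow> state \<Rightarrow> state \<Rightarrow> nat \<Rightarrow> bool" where
  "trees_loaded m b f s s' t \<equiv> t \<le> m * cols * (7 * levels + 9) + 3 \<and>
     (\<forall>i<m. tree s' (b + i) (f i)) \<and> trees_agree (- {b..<b + m}) s s'"

lemma wp_load_trees:
  assumes dims: "dims s num_rows m" and trees: "\<And>i. i < m \<Longrightarrow> \<exists>g. tree s (b + i) g" and b: "b \<le> 2 * n + 4"
    and first: "\<And>s'. regs s' r_dim = int n \<Longrightarrow> asafe B s' first \<and> leaves first \<le> 3 \<and> aeval s' first = int b"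
    and val: "\<And>s' p. p < m * cols \<Longrightarrow> regs s' r_idx = int p \<Longrightarrow> regs s' r_cols = int cols \<Longrightarrow>
      (\<And>a. a \<noteq> a_trees \<Longrightarrow> arrs s' a = arrs s a) \<Longrightarrow>
      asafe B s' val \<and> leaves val \<le> 16 \<and> aeval s' val = f (p div cols) (p mod cols)"
    and f: "\<And>i k. i < m \<Longrightarrow> k < cols \<Longrightarrow> \<bar>f i k\<bar> \<le> B"
  shows "wp (load_trees num_rows first val) s (trees_loaded m b f s)"
    (is "wp _ _ ?Q")
proof -
  obtain g where g: "\<And>i. i < m \<Longrightarrow> tree s (b + i) (g i)" using trees by metis
  define mixed where "mixed p i k = (if i * cols + k < p then f i k else g i k)" for p i k
  let ?load = "Assign r_leaf (Bin Mod (R r_idx) (R r_cols)) ;;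
    Assign r_tree (first \<boxplus> Bin Div (R r_idx) (R r_cols)) ;; Assign r_val val"
  show ?thesis
    unfolding load_trees_def
  proof (rule wp_for_const[where m = "m * cols" and K = "7 * levels + 6" and
        I = "\<lambda>p s'. (\<forall>i<m. tree s' (b + i) (mixed p i)) \<and> trees_agree (- {b..<b + m}) s s'"])
    fix p s' assume p: "p < m * cols" "regs s' r_idx = int p"
      and fr: "framed (for_loop r_idx (num_rows \<boxtimes> R r_cols) (?load ;; update_leaf)) s s'"
      and inv: "(\<forall>i<m. tree s' (b + i) (mixed p i)) \<and> trees_agree (- {b..<b + m}) s s'"
    have fr': "frame {r_idx, r_leaf, r_tree, r_val, r_path} {a_trees} s s'" using fr by (auto simp: insert_commute)
    define i k where "i = p div cols" and "k = p mod cols"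
    have ik: "i < m" "k < cols" "i * cols + k = p" using split_index[OF p(1)] by (auto simp: i_def k_def)
    let ?s = "s'\<lparr>regs := (regs s')(r_leaf := int k, r_tree := int (b + i), r_val := f i k)\<rparr>"
    have other: "arrs s' a = arrs s a" if "a \<noteq> a_trees" for a using frame_arrs[OF fr'] that by simp
    have m: "m \<le> n" using dims by (simp add: dims_def)
    show "wp (?load ;; update_leaf) s' (\<lambda>s'' t. t \<le> 7 * levels + 6 \<and>
        (\<forall>i<m. tree (set_reg s'' r_idx (int (Suc p))) (b + i) (mixed (Suc p) i)) \<and>
        trees_agree (- {b..<b + m}) s (set_reg s'' r_idx (int (Suc p))))"
    proof (rule wp_straight_Seq)
      have "int k \<le> B" "int (b + i) \<le> B" using ik m b B_bounds n_le_cols by linarith+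
      then show "safe B ?load s'" "effect ?load s' = ?s" "cost ?load s' = 5"
        using dims_rows[OF dims fr'] p first[of "set_reg s' r_leaf (int k)"] f[OF ik(1,2)]
          val[of p "s'\<lparr>regs := (regs s')(r_leaf := int k, r_tree := int (b + i))\<rparr>"] other
        by (auto simp: i_def k_def simp flip: zdiv_int zmod_int)
      show "wp update_leaf ?s (\<lambda>s'' t. Suc (5 + t) \<le> 7 * levels + 6 \<and>
        (\<forall>i<m. tree (set_reg s'' r_idx (int (Suc p))) (b + i) (mixed (Suc p) i)) \<and>
        trees_agree (- {b..<b + m}) s (set_reg s'' r_idx (int (Suc p))))"
      proof (rule wp_conseq, rule wp_update_leaf[where r = "b + i" and k = k and f = "mixed p i"])
        fix s'' t assume res: "t \<le> 7 * levels \<and> tree s'' (b + i) ((mixed p i)(k := regs ?s r_val)) \<and>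
          trees_agree (- {b + i}) ?s s''"
        have "tree s'' (b + i') (mixed (Suc p) i')" if i': "i' < m" for i'
        proof (cases "i' = i")
          case True
          then show ?thesis
            using res ik by (auto simp: mixed_def less_Suc_eq elim!: tree_cong)
        next
          case False
          have "tree s'' (b + i') (mixed p i')"
            by (rule tree_agree[of s' _ _ "- {b + i}"]) (use inv i' False res in auto)
          moreover have "i' * cols + k' \<noteq> p" if "k' < cols" for k'
            using ik interleave_inj[OF that ik(2)] False by metis
          ultimately show ?thesis by (elim tree_cong) (auto simp: mixed_def less_Suc_eq)
        qed
        moreover have "trees_agree (- {b..<b + m}) s s''"
          using trees_agree_trans[of "- {b..<b + m}" s s' "- {b + i}" s''] inv res ik(1)
          by (auto elim!: trees_agree_mono)
        ultimately show "Suc (5 + t) \<le> 7 * levels + 6 \<and>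
          (\<forall>i<m. tree (set_reg s'' r_idx (int (Suc p))) (b + i) (mixed (Suc p) i)) \<and>
          trees_agree (- {b..<b + m}) s (set_reg s'' r_idx (int (Suc p)))"
          using res by simp
      qed (use dims_rows[OF dims fr'] ik inv in auto)
    qed
  next
    fix s' t assume inv: "(\<forall>i<m. tree s' (b + i) (mixed (m * cols) i)) \<and> trees_agree (- {b..<b + m}) s s'"
      and t: "t \<le> m * cols * (7 * levels + 6 + 3) + 3"
    then have "tree s' (b + i) (f i)" if "i < m" for i
      using that cell_less[OF that] by (auto simp: mixed_def elim!: tree_cong)
    then show "?Q s' t"
      using inv t by (simp add: algebra_simps)
  qed (use g dims_rows[OF dims] cells_le_B[OF dims] in \<open>auto simp: mixed_def[abs_def]\<close>)
qed

end

section \<open>Refreshing outdated columns\<close>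

definition init_outdated :: "nat \<Rightarrow> com" where
  "init_outdated a = for_loop r_idx (R r_cols) (Store a (R r_idx) (N (- 2) \<boxtimes> R r_cols))"

definition scan :: "nat \<Rightarrow> aexp \<Rightarrow> nat \<Rightarrow> nat \<Rightarrow> com" where
  "scan a new ptr threshold = for_loop r_idx (R r_cols)
    (If (Less (Rd a (R r_idx) \<boxplus> R threshold) new)
      (Store a (R r_idx) new ;; Store a_refresh (R ptr) (R r_idx) ;; Assign ptr (R ptr \<boxplus> N 1)) SKIP)"

lemma mod_scan [simp]:
  "mod_regs (init_outdated a) = {r_idx}" "mod_arrs (init_outdated a) = {a}"
  "mod_regs (scan a new ptr threshold) = {r_idx, ptr}" "mod_arrs (scan a new ptr threshold) = {a, a_refresh}"
  by (auto simp: init_outdated_def scan_def)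

definition listed :: "state \<Rightarrow> nat \<Rightarrow> nat list \<Rightarrow> bool" where
  "listed s p ks \<longleftrightarrow> (\<forall>x<length ks. arrs s a_refresh (p + x) = int (ks ! x))"

lemma listed_snoc: "listed s p (ks @ [k]) \<longleftrightarrow> listed s p ks \<and> arrs s a_refresh (p + length ks) = int k"
  by (auto simp: listed_def nth_append less_Suc_eq)

lemma listed_cong:
  "listed s p ks \<Longrightarrow> (\<And>q. q < p + length ks \<Longrightarrow> arrs s' a_refresh q = arrs s a_refresh q) \<Longrightarrow> listed s' p ks"
  by (simp add: listed_def)

lemma listed_regs [simp]: "listed (s\<lparr>regs := f\<rparr>) = listed s"
  by (simp add: listed_def fun_eq_iff)

context padded
begin

lemma wp_init_outdated:
  assumes "regs s r_cols = int cols"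
  shows "wp (init_outdated a) s (\<lambda>s' t. t \<le> cols * 4 + 3 \<and> (\<forall>k<cols. arrs s' a k = - 2 * int cols))"
  unfolding init_outdated_def
  by (rule wp_for_Store[where m = cols and idx = "\<lambda>k. k" and f = "\<lambda>_. - 2 * int cols"])
    (use assms B_bounds in \<open>auto simp: frame_regs\<close>)

definition refreshed :: "(nat \<Rightarrow> int) \<Rightarrow> nat \<Rightarrow> (nat \<Rightarrow> int) \<Rightarrow> nat \<Rightarrow> int" where
  "refreshed c E w k = (if c k + int E < w k then w k else c k)"

definition due :: "(nat \<Rightarrow> int) \<Rightarrow> nat \<Rightarrow> (nat \<Rightarrow> int) \<Rightarrow> nat list" where
  "due c E w = filter (\<lambda>k. c k + int E < w k) [0..<cols]"

lemma set_due: "set (due c E w) = {k. k < cols \<and> c k + int E < w k}"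
  by (auto simp: due_def)

lemma length_due_le: "length (due c E w) \<le> cols"
  unfolding due_def by (rule le_trans[OF length_filter_le]) simp

lemma due_gain: "int (length (due c E w)) * int E + (\<Sum>k<cols. c k) \<le> (\<Sum>k<cols. refreshed c E w k)"
proof -
  have "int (length (filter (\<lambda>k. c k + int E < w k) [0..<m])) * int E + (\<Sum>k<m. c k)
      \<le> (\<Sum>k<m. refreshed c E w k)" for m
    by (induction m) (auto simp: refreshed_def algebra_simps)
  then show ?thesis by (simp add: due_def)
qed

abbreviation scan_result :: "nat \<Rightarrow> nat \<Rightarrow> nat \<Rightarrow> nat list \<Rightarrow> (nat \<Rightarrow> int) \<Rightarrow> state \<Rightarrow> state \<Rightarrow> bool" where
  "scan_result a ptr p ks g s s' \<equiv> regs s' ptr = int (p + length ks) \<and> listed s' p ks \<and>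
     (\<forall>q<p. arrs s' a_refresh q = arrs s a_refresh q) \<and> (\<forall>k<cols. arrs s' a k = g k)"

lemma wp_scan:
  fixes s :: state and a E p :: nat and w :: "nat \<Rightarrow> int"
  defines "ks \<equiv> due (arrs s a) E w"
  assumes s: "regs s r_cols = int cols" "regs s threshold = int E" "regs s ptr = int p"
    and distinct: "ptr \<notin> {r_idx, r_cols}" "threshold \<notin> {r_idx, ptr}" "a \<noteq> a_refresh"
    and p: "int (p + cols) \<le> B"
    and new: "\<And>s' k. k < cols \<Longrightarrow> regs s' r_idx = int k \<Longrightarrow> frame {r_idx, ptr} {a, a_refresh} s s' \<Longrightarrow>
      asafe B s' new \<and> leaves new \<le> 16 \<and> aeval s' new = w k"
    and w: "\<And>k. k < cols \<Longrightarrow> \<bar>w k\<bar> \<le> B"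
  shows "wp (scan a new ptr threshold) s (\<lambda>s' t. t \<le> cols * 9 + 3 \<and>
    scan_result a ptr p ks (refreshed (arrs s a) E w) s s')"
    (is "wp _ _ ?Q")
proof -
  let ?due = "\<lambda>k. arrs s a k + int E < w k"
  define part where "part k = filter ?due [0..<k]" for k
  have part: "part 0 = []" "part (Suc k) = (if ?due k then part k @ [k] else part k)" "part cols = ks"
    "length (part k) \<le> k" for k
    using length_filter_le[of ?due "[0..<k]"] by (simp_all add: part_def ks_def due_def)
  define I where "I k s' \<longleftrightarrow> regs s' ptr = int (p + length (part k)) \<and> listed s' p (part k) \<and>
    (\<forall>q<p. arrs s' a_refresh q = arrs s a_refresh q) \<and>
    (\<forall>k'. arrs s' a k' = (if k' < k then refreshed (arrs s a) E w k' else arrs s a k'))" for k s'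
  let ?body = "If (Less (Rd a (R r_idx) \<boxplus> R threshold) new)
    (Store a (R r_idx) new ;; Store a_refresh (R ptr) (R r_idx) ;; Assign ptr (R ptr \<boxplus> N 1)) SKIP"
  show ?thesis
    unfolding scan_def
  proof (rule wp_for_const[where m = cols and K = 6 and I = I])
    fix k s' assume k: "k < cols" and inv: "I k s'" and idx: "regs s' r_idx = int k"
      and "framed (for_loop r_idx (R r_cols) ?body) s s'"
    then have fr: "frame {r_idx, ptr} {a, a_refresh} s s'" by (simp add: insert_commute)
    have ptr: "regs s' ptr = int (p + length (part k))" and cell: "arrs s' a k = arrs s a k"
      using inv by (auto simp: I_def)
    have bound: "int (p + length (part k)) + 1 \<le> B" "int k \<le> B"
      using p part(4)[of k] k B_bounds by linarith+
    let ?s1 = "set_cell s' a k (w k)"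
    let ?s = "if ?due k then set_reg (set_cell ?s1 a_refresh (p + length (part k)) (int k)) ptr
      (int (p + length (part k)) + 1) else s'"
    have thr: "regs s' threshold = int E" using frame_regs[OF fr] s(2) distinct(2) by simp
    have "aeval s' new = w k" "asafe B s' new" "leaves new \<le> 16" using new[OF k idx fr] by auto
    then have safe: "safe B ?body s'" and effect: "effect ?body s' = ?s"
      using idx ptr cell thr bound w[OF k] distinct B_ge_2 by (simp_all flip: of_nat_add)
    moreover have "cost ?body s' \<le> 6" by simp
    moreover have "I (Suc k) (set_reg ?s r_idx (int (Suc k)))"
    proof (cases "?due k")
      case True
      have "listed (set_cell ?s1 a_refresh (p + length (part k)) (int k)) p (part k)"
        by (rule listed_cong[of s']) (use inv distinct in \<open>auto simp: I_def\<close>)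
      then show ?thesis
        using True inv distinct(1,3) part(2)[of k]
        by (auto simp: I_def listed_snoc refreshed_def less_Suc_eq)
    next
      case False
      then show ?thesis
        using inv distinct(1) part(2)[of k] by (auto simp: I_def refreshed_def less_Suc_eq)
    qed
    ultimately show "wp ?body s' (\<lambda>s'' t. t \<le> 6 \<and> I (Suc k) (set_reg s'' r_idx (int (Suc k))))"
      by (intro conjI wp_straightI[OF safe effect refl])
  next
    fix s' t assume "I cols s'" "t \<le> cols * (6 + 3) + 3"
    then show "?Q s' t"
      by (simp add: I_def part(3))
  next
    show "I 0 (set_reg s r_idx 0)"
      using s distinct part(1) by (auto simp: I_def listed_def)
  qed (use s distinct B_bounds in \<open>auto simp: frame_regs\<close>)
qed

primrec outdated :: "(nat \<Rightarrow> nat \<Rightarrow> int) \<Rightarrow> nat \<Rightarrow> nat \<Rightarrow> nat \<Rightarrow> int" where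
  "outdated M E 0 = (\<lambda>_. - 2 * int cols)"
| "outdated M E (Suc i) = refreshed (outdated M E i) E (M i)"

definition events :: "(nat \<Rightarrow> nat \<Rightarrow> int) \<Rightarrow> nat \<Rightarrow> nat \<Rightarrow> nat list" where
  "events M E i = due (outdated M E i) E (M i)"

lemma outdated_le:
  "(\<And>i. i < m \<Longrightarrow> M i k \<le> x) \<Longrightarrow> - 2 * int cols \<le> x \<Longrightarrow> outdated M E m k \<le> x"
  by (induction m) (auto simp: refreshed_def)

lemma sum_length_events:
  "int (\<Sum>i<m. length (events M E i)) * int E + (\<Sum>k<cols. outdated M E 0 k) \<le> (\<Sum>k<cols. outdated M E m k)"
proof (induction m)
  case (Suc m)
  then show ?case
    using due_gain[of "outdated M E m" E "M m"] by (simp add: events_def distrib_right)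
qed simp

lemma total_events:
  assumes nu: "cols \<le> nu * E" and M: "\<And>i k. i < n \<Longrightarrow> k < cols \<Longrightarrow> M i k \<le> int n"
  shows "(\<Sum>i<n. length (events M E i)) \<le> 3 * nu * cols"
proof -
  let ?S = "\<Sum>i<n. length (events M E i)"
  have "M i k \<le> int cols" if "i < n" "k < cols" for i k
    using M[OF that] n_le_cols by simp
  then have "(\<Sum>k<cols. outdated M E n k) \<le> (\<Sum>k<cols. int cols)"
    by (intro sum_mono outdated_le) auto
  moreover have "int ?S * int E \<le> (\<Sum>k<cols. outdated M E n k) + 2 * int cols * int cols"
    using sum_length_events[where m = n and M = M and E = E] by (simp add: mult_ac)
  ultimately have "int (?S * E) \<le> int (3 * cols * cols)" by simp
  then have "?S * E \<le> 3 * cols * cols" by (simp only: of_nat_le_iff)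
  then have "nu * (?S * E) \<le> nu * (3 * cols * cols)" by (rule mult_le_mono2)
  moreover have "?S * cols \<le> ?S * (nu * E)" using nu by (rule mult_le_mono2)
  moreover have "?S * (nu * E) = nu * (?S * E)" "nu * (3 * cols * cols) = 3 * nu * cols * cols" by simp_all
  ultimately have "?S * cols \<le> (3 * nu * cols) * cols" by linarith
  then show ?thesis using cols_pos by (simp only: mult_le_cancel2)
qed

lemma outdated_near:
  assumes "\<And>i k. i + 1 < n \<Longrightarrow> k < cols \<Longrightarrow> M i k \<le> M (i + 1) k" "\<And>k. k < cols \<Longrightarrow> - 2 * int cols \<le> M 0 k"
  shows "i < n \<Longrightarrow> k < cols \<Longrightarrow> outdated M E (Suc i) k \<le> M i k \<and> M i k \<le> outdated M E (Suc i) k + int E"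
proof (induction i)
  case 0
  then show ?case using assms(2)[of k] by (simp add: refreshed_def)
next
  case (Suc i)
  then show ?case using assms(1)[of i k] by (simp add: refreshed_def)
qed

end

context equality_copies
begin

definition stored_events :: "nat \<Rightarrow> nat" where
  "stored_events m = (\<Sum>e = m..e0. \<Sum>i<n. length (events M (2 ^ e) i))"

abbreviation num_events :: nat where
  "num_events \<equiv> stored_events 0"

definition row_events :: "state \<Rightarrow> nat \<Rightarrow> nat \<Rightarrow> nat \<Rightarrow> bool" where
  "row_events s P E i \<longleftrightarrow> (\<exists>lo. arrs s a_offsets (E * (n + 1) + i) = int lo \<and>
     arrs s a_offsets (E * (n + 1) + i + 1) = int (lo + length (events M E i)) \<and>
     lo + length (events M E i) \<le> P \<and> listed s lo (events M E i))"

lemma row_events_cong: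
  assumes "row_events s P E i"
      "\<And>i'. i' \<le> n \<Longrightarrow> arrs s' a_offsets (E * (n + 1) + i') = arrs s a_offsets (E * (n + 1) + i')"
    "i < n" "\<And>q. q < P \<Longrightarrow> arrs s' a_refresh q = arrs s a_refresh q" "P \<le> P'"
  shows "row_events s' P' E i"
proof -
  obtain lo where "arrs s a_offsets (E * (n + 1) + i) = int lo" "listed s lo (events M E i)"
    "arrs s a_offsets (E * (n + 1) + (i + 1)) = int (lo + length (events M E i))"
    "lo + length (events M E i) \<le> P"
    using assms(1) by (auto simp: row_events_def)
  then show ?thesis
    unfolding row_events_def using assms(2)[of i] assms(2)[of "i + 1"] assms(3-)
      listed_cong[of s lo "events M E i" s']
    by (intro exI[of _ lo]) simp
qed

lemma length_events_le: "(\<Sum>i<n. length (events M E i)) \<le> n * cols"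
  using sum_bounded_above[of "{..<n}" "\<lambda>i. length (events M E i)" cols] length_due_le by (simp add: events_def)

lemma stored_events_le: "int (stored_events m + n * cols + cols + 1) \<le> B"
proof (rule le_B)
  have "stored_events m \<le> card {m..e0} * (n * cols)"
    using sum_bounded_above[of "{m..e0}" "\<lambda>e. \<Sum>i<n. length (events M (2 ^ e) i)" "n * cols"] length_events_le
    by (simp add: stored_events_def)
  also have "\<dots> \<le> (n + 2) * (n * (2 * n))"
    using e0_le L_le cols_less by (intro mult_le_mono) auto
  finally have "stored_events m + n * cols + cols + 1 \<le> (n + 2) * (n * (2 * n)) + n * (2 * n) + 2 * n + 1"
    using cols_less mult_le_mono2[of cols "2 * n" n] by linarith
  also have "\<dots> \<le> 1000 * (n + 2) ^ 4" by (simp add: power4_eq_xxxx algebra_simps)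
  finally show "stored_events m + n * cols + cols + 1 \<le> 1000 * (n + 2) ^ 4" .
qed

lemma num_events_cols_le: "int num_events + int cols \<le> B"
proof -
  have "int (num_events + cols) \<le> B"
    by (rule order_trans[OF _ stored_events_le[of 0]]) (simp only: of_nat_le_iff)
  then show ?thesis by simp
qed

definition query_loaded :: "state \<Rightarrow> nat \<Rightarrow> bool" where
  "query_loaded s j \<longleftrightarrow> (\<forall>i<n. \<forall>k<cols. entry s i k = M i k) \<and> (\<forall>k<cols. arrs s a_vec k = V j k) \<and>
     tree s (2 * n) (V j) \<and> tree s (2 * n + 1) (\<lambda>k. - V j k) \<and> tree s (2 * n + 2) (\<lambda>_. 0)"

abbreviation (input) row_sum :: "nat \<Rightarrow> nat \<Rightarrow> nat \<Rightarrow> int" where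
  "row_sum j i k \<equiv> M i k + V j k"

abbreviation search_results :: "nat \<Rightarrow> nat \<Rightarrow> state \<Rightarrow> state \<Rightarrow> bool" where
  "search_results D j s s' \<equiv>
     (\<forall>i<n. search_result D (row_sum j i) (arrs s a_answer i) (arrs s' a_answer i))"

lemma row_loop_frame:
  assumes "framed (for_loop r_row (R r_dim) row) s s'"
  shows "arrs s' a_vec = arrs s a_vec" "arrs s' a_offsets = arrs s a_offsets"
    "arrs s' a_refresh = arrs s a_refresh" "entry s' = entry s" "regs s' r_mode = regs s r_mode"
    "regs s' r_end = regs s r_end" "regs s' r_last = regs s r_last"
  using frame_arrs[OF assms] frame_regs[OF assms] entry_frame[OF assms] by simp_all

lemma wp_rows_exact:
  assumes base: "base s D" and mode: "regs s r_mode = 1" and j: "j < n" and query: "query_loaded s j"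
    and trees: "\<And>i. i < n \<Longrightarrow> tree s i (M i)" "\<And>i. i < n \<Longrightarrow> tree s (n + i) (\<lambda>k. - M i k)"
    and mono: "(\<forall>i<n. monotone_on_cols (M i)) \<or> monotone_on_cols (V j)"
  shows "wp (for_loop r_row (R r_dim) row) s (\<lambda>s' t. t \<le> n * (88 * levels * (cols div D) + 93) + 3 \<and>
    search_results D j s s' \<and> (\<forall>i<n. tree s' i (M i)) \<and> trees_agree (- {..<n}) s s')"
proof -
  define J where "J s' \<longleftrightarrow> (\<forall>i<n. tree s' i (M i)) \<and> trees_agree (- {..<n}) s s'" for s'
  have "wp (for_loop r_row (R r_dim) row) s (\<lambda>s' t.
      t \<le> (\<Sum>i<n. 0) * (7 * levels + 8) + n * (88 * levels * (cols div D) + 90 + 3) + 3 \<and>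
      search_results D j s s' \<and> J s')"
  proof (rule wp_rows[OF base])
    fix i s' assume i: "i < n" and inv: "J s'" and base': "base s' D" and row: "regs s' r_row = int i"
      and fr: "framed (for_loop r_row (R r_dim) row) s s'"
    have other: "tree s' r f" if "tree s r f" "n \<le> r" for r f
      using tree_agree[OF that(1), of "- {..<n}"] inv that(2) by (simp add: J_def)
    have step: "J s''" if "tree s'' i (M i)" "trees_agree (- {i}) s' s''" for s''
    proof -
      have "tree s'' i' (M i')" if i': "i' < n" for i'
        using \<open>tree s'' i _\<close> inv i' tree_agree[OF _ \<open>trees_agree _ s' s''\<close>]
          by (cases "i' = i") (auto simp: J_def)
      moreover have "trees_agree (- {..<n}) s s''"
        by (rule trees_agree_mono[OF trees_agree_trans[OF _ that(2), of "- {..<n}" s]])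
          (use inv i in \<open>auto simp: J_def\<close>)
      ultimately show ?thesis by (simp add: J_def)
    qed
    have "wp row s' (\<lambda>s'' t. t \<le> 88 * levels * (cols div D) + 90 \<and> row_answered D (row_sum j i) i s' s'' \<and>
        tree s'' i (M i) \<and> trees_agree (- {i}) s' s'')"
      using base' row i inv other trees(2)[OF i] query mode mono M_range[OF i] V_range[OF j] row_loop_frame[OF fr]
      by (intro wp_row_exact) (auto simp: J_def query_loaded_def)
    then show "wp row s' (\<lambda>s'' t. t \<le> 0 * (7 * levels + 8) + (88 * levels * (cols div D) + 90) \<and>
        row_answered D (row_sum j i) i s' s'' \<and> J s'')"
      by (rule wp_conseq) (simp add: step)
  qed (use trees in \<open>auto simp: J_def\<close>)
  then show ?thesis by (rule wp_conseq) (simp add: J_def add_ac)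
qed

lemma wp_rows_columns:
  assumes base: "base s D" and mode: "regs s r_mode = 2" and j: "j < n" and query: "query_loaded s j"
    and tree: "tree s (2 * n + 3) g" and events: "\<And>i. i < n \<Longrightarrow> row_events s P D i"
    and mono: "\<And>i k. i + 1 < n \<Longrightarrow> k < cols \<Longrightarrow> M i k \<le> M (i + 1) k"
  shows "wp (for_loop r_row (R r_dim) row) s (\<lambda>s' t. t \<le> (\<Sum>i<n. length (events M D i)) * (7 * levels + 8) +
      n * (88 * levels * (cols div D) + 93) + 3 \<and>
    search_results D j s s' \<and> (\<exists>g. tree s' (2 * n + 3) g) \<and> trees_agree (- {2 * n + 3}) s s')"
proof -
  let ?K = "88 * levels * (cols div D) + 90" and ?r = "2 * n + 3"
  define J where "J i s' \<longleftrightarrow> (\<exists>g. tree s' ?r g \<and> (0 < i \<longrightarrow> (\<forall>k<cols. g k = outdated M D i k + V j k))) \<and>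
    trees_agree (- {?r}) s s'" for i s'
  have D: "D \<le> cols" using base by (simp add: base_def)
  have near: "outdated M D (Suc i) k \<le> M i k \<and> M i k \<le> outdated M D (Suc i) k + int D" if "i < n"
    "k < cols" for i k
    using that by (intro outdated_near mono) (use M_range[of 0] n_pos in fastforce)+
  have "wp (for_loop r_row (R r_dim) row) s (\<lambda>s' t.
      t \<le> (\<Sum>i<n. length (events M D i)) * (7 * levels + 8) + n * (?K + 3) + 3 \<and>
      search_results D j s s' \<and> J n s')"
  proof (rule wp_rows[OF base])
    fix i s' assume i: "i < n" and inv: "J i s'" and base': "base s' D" and row: "regs s' r_row = int i"
      and fr: "framed (for_loop r_row (R r_dim) row) s s'"
    obtain lo where lo: "arrs s a_offsets (D * (n + 1) + i) = int lo" "listed s lo (events M D i)"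
      "arrs s a_offsets (D * (n + 1) + i + 1) = int (lo + length (events M D i))"
      using events[OF i] by (auto simp: row_events_def)
    obtain g where g: "tree s' ?r g" "0 < i \<longrightarrow> (\<forall>k<cols. g k = outdated M D i k + V j k)"
      and agree: "trees_agree (- {?r}) s s'"
      using inv by (auto simp: J_def)
    let ?g' = "\<lambda>k. if k \<in> set (events M D i) then row_sum j i k else g k"
    have g': "?g' k = outdated M D (Suc i) k + V j k" if k: "k < cols" for k
    proof -
      have "outdated M D i k + int D < M i k" if "i = 0"
        using that D M_range[OF i k] n_pos n_le_cols by simp
      then show ?thesis using g(2) k by (auto simp: events_def set_due refreshed_def)
    qed
    have step: "J (Suc i) s''" if "tree s'' ?r ?g'" "trees_agree (- {?r}) s' s''" for s''
      unfolding J_def using g' that(1) trees_agree_trans[OF agree that(2)] by (intro conjI exI[of _ ?g']) simp_all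
    have "wp row s' (\<lambda>s'' t. t \<le> length (events M D i) * (7 * levels + 8) + 88 * levels * (cols div D) + 90 \<and>
        row_answered D (row_sum j i) i s' s'' \<and> tree s'' ?r ?g' \<and> trees_agree (- {?r}) s' s'')"
    proof (rule wp_row_stale[OF base' row i])
      show "refresh_range s' D i ?r lo (lo + length (events M D i))"
        using lo mode row_loop_frame[OF fr] by (simp add: refresh_range_def)
      show "set (events M D i) \<subseteq> {..<cols}" by (auto simp: events_def set_due)
      show "tree s' (2 * n) (V j)" "tree s' (2 * n + 1) (\<lambda>k. - V j k)" "tree s' (2 * n + 2) (\<lambda>_. 0)"
        using query tree_agree[OF _ agree] by (auto simp: query_loaded_def)
      fix k assume k: "k < cols"
      show "row_sum j i k = entry s' i k + arrs s' a_vec k" "1 \<le> row_sum j i k \<and> row_sum j i k \<le> 2 * int n"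
        using query row_loop_frame[OF fr] M_range[OF i k] V_range[OF j k] i k by (auto simp: query_loaded_def)
      then show "\<bar>?g' k\<bar> \<le> 2 * int n \<and> ?g' k \<le> row_sum j i k \<and> row_sum j i k \<le> ?g' k + int D"
        unfolding g'[OF k] using near[OF i k] V_range[OF j k] M_range[OF i k] D cols_less by linarith
    qed (use lo(2) g(1) row_loop_frame[OF fr] in \<open>auto simp: listed_def\<close>)
    then show "wp row s' (\<lambda>s'' t. t \<le> length (events M D i) * (7 * levels + 8) + ?K \<and>
        row_answered D (row_sum j i) i s' s'' \<and> J (Suc i) s'')"
      by (rule wp_conseq) (simp add: step)
  qed (use tree in \<open>auto simp: J_def\<close>)
  then show ?thesis by (rule wp_conseq) (auto simp: J_def add_ac)
qed

lemma wp_rows_time: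
  fixes c :: "nat \<Rightarrow> int" and D j :: nat
  defines "ks \<equiv> due c D (V j)"
  assumes base: "base s D" and mode: "regs s r_mode = 3" and j: "j < n" and query: "query_loaded s j"
    and range: "regs s r_end = int lo" "regs s r_last = int (lo + length ks)" "listed s lo ks"
    and trees: "\<And>i. i < n \<Longrightarrow> tree s (2 * n + 4 + i) (\<lambda>k. M i k + c k)"
    and c: "\<And>k. k < cols \<Longrightarrow> c k \<le> V j k"
  shows "wp (for_loop r_row (R r_dim) row) s (\<lambda>s' t. t \<le> n * (length ks * (7 * levels + 8)) +
      n * (88 * levels * (cols div D) + 93) + 3 \<and>
    search_results D j s s' \<and> (\<forall>i<n. tree s' (2 * n + 4 + i) (\<lambda>k. M i k + refreshed c D (V j) k)) \<and>
    trees_agree {..<2 * n + 4} s s')"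
proof -
  let ?K = "88 * levels * (cols div D) + 90" and ?r = "\<lambda>i. 2 * n + 4 + i"
  define f where "f i i' k = M i' k + (if i' < i then refreshed c D (V j) k else c k)" for i i' k
  define J where "J i s' \<longleftrightarrow> (\<forall>i'<n. tree s' (?r i') (f i i')) \<and> trees_agree {..<2 * n + 4} s s'" for i s'
  have D: "D \<le> cols" using base by (simp add: base_def)
  have "wp (for_loop r_row (R r_dim) row) s (\<lambda>s' t.
      t \<le> (\<Sum>i<n. length ks) * (7 * levels + 8) + n * (?K + 3) + 3 \<and> search_results D j s s' \<and> J n s')"
  proof (rule wp_rows[OF base])
    fix i s' assume i: "i < n" and inv: "J i s'" and base': "base s' D" and row: "regs s' r_row = int i"
      and fr: "framed (for_loop r_row (R r_dim) row) s s'"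
    have agree: "trees_agree {..<2 * n + 4} s s'" using inv by (simp add: J_def)
    let ?g' = "\<lambda>k. if k \<in> set ks then row_sum j i k else M i k + c k"
    have g': "?g' k = f (Suc i) i k" if k: "k < cols" for k
      using k by (auto simp: f_def refreshed_def ks_def set_due)
    have step: "J (Suc i) s''" if tree: "tree s'' (?r i) ?g'" and agree': "trees_agree (- {?r i}) s' s''" for s''
    proof -
      have "tree s'' (?r i') (f (Suc i) i')" if i': "i' < n" for i'
      proof (cases "i' = i")
        case True
        then show ?thesis using tree_cong[OF tree g'] by simp
      next
        case False
        then have "tree s'' (?r i') (f i i')" using tree_agree[OF _ agree'] inv i' by (auto simp: J_def)
        then show ?thesis using False by (simp add: f_def[abs_def] less_Suc_eq)
      qed
      moreover have "trees_agree {..<2 * n + 4} s s''"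
        using trees_agree_trans[OF agree agree'] by (rule trees_agree_mono) auto
      ultimately show ?thesis by (simp add: J_def)
    qed
    have "wp row s' (\<lambda>s'' t. t \<le> length ks * (7 * levels + 8) + 88 * levels * (cols div D) + 90 \<and>
        row_answered D (row_sum j i) i s' s'' \<and> tree s'' (?r i) ?g' \<and> trees_agree (- {?r i}) s' s'')"
    proof (rule wp_row_stale[OF base' row i])
      show "refresh_range s' D i (?r i) lo (lo + length ks)"
        using range mode row_loop_frame[OF fr] by (simp add: refresh_range_def)
      show "set ks \<subseteq> {..<cols}" by (auto simp: ks_def set_due)
      show "tree s' (2 * n) (V j)" "tree s' (2 * n + 1) (\<lambda>k. - V j k)" "tree s' (2 * n + 2) (\<lambda>_. 0)"
        using query tree_agree[OF _ agree] by (auto simp: query_loaded_def)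
      have "tree s' (?r i) (f i i)" using inv i by (simp add: J_def)
      then show "tree s' (?r i) (\<lambda>k. M i k + c k)" by (simp add: f_def[abs_def])
      fix k assume k: "k < cols"
      show "row_sum j i k = entry s' i k + arrs s' a_vec k" "1 \<le> row_sum j i k \<and> row_sum j i k \<le> 2 * int n"
        using query row_loop_frame[OF fr] M_range[OF i k] V_range[OF j k] i k by (auto simp: query_loaded_def)
      then show "\<bar>?g' k\<bar> \<le> 2 * int n \<and> ?g' k \<le> row_sum j i k \<and> row_sum j i k \<le> ?g' k + int D"
        using c[OF k] D cols_less V_range[OF j k] M_range[OF i k] k by (auto simp: ks_def set_due)
    qed (use range(3) row_loop_frame[OF fr] in \<open>auto simp: listed_def\<close>)
    then show "wp row s' (\<lambda>s'' t. t \<le> length ks * (7 * levels + 8) + ?K \<and>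
        row_answered D (row_sum j i) i s' s'' \<and> J (Suc i) s'')"
      by (rule wp_conseq) (simp add: step)
  qed (use trees in \<open>auto simp: J_def f_def[abs_def]\<close>)
  then show ?thesis by (rule wp_conseq) (auto simp: J_def f_def[abs_def] algebra_simps)
qed

end

section \<open>The query program\<close>

definition load_vector :: com where
  "load_vector = pad a_query a_vec (N 1) ;;
    flag_test r_query_mono (N 1 \<boxtimes> R r_cols) (row_descent a_vec) ;;
    load_trees (N 1) (R r_dim \<boxplus> R r_dim) (Rd a_vec (R r_idx)) ;;
    load_trees (N 1) (R r_dim \<boxplus> R r_dim \<boxplus> N 1) (N 0 \<boxminus> Rd a_vec (R r_idx))"

definition init_answer :: com where
  "init_answer = for_loop r_row (R r_dim) (Store a_answer (R r_row) (N 8 \<boxtimes> R r_cols))"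

definition choose_mode :: com where
  "choose_mode = If (Equal (R r_rows_mono) (N 1)) (Assign r_mode (N 1))
    (If (Equal (R r_cols_mono) (N 1)) (Assign r_mode (N 2))
      (If (Equal (R r_query_mono) (N 1)) (Assign r_mode (N 1)) (Assign r_mode (N 3))))"

definition refresh_stale :: com where
  "refresh_stale = Assign r_last (R r_end) ;;
    If (Equal (R r_mode) (N 3)) (scan a_stale (Rd a_vec (R r_idx)) r_last r_radius) SKIP"

definition answer_rows :: com where
  "answer_rows = choose_mode ;; refresh_stale ;; for_loop r_row (R r_dim) row"

definition query_prog :: "com \<Rightarrow> com" where
  "query_prog c = load_vector ;; init_answer ;; copy_loop (query_copy c) ;; answer_rows"

lemma mod_query_prog [simp]:
  "mod_regs load_vector = {r_idx, r_query_mono, r_leaf, r_tree, r_val, r_path}"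
  "mod_arrs load_vector = {a_vec, a_trees}"
  "mod_regs init_answer = {r_row}" "mod_arrs init_answer = {a_answer}"
  "mod_regs refresh_stale = {r_last, r_idx}" "mod_arrs refresh_stale = {a_stale, a_refresh}"
  "mod_regs choose_mode = {r_mode}" "mod_arrs choose_mode = {}"
  by (auto simp: load_vector_def init_answer_def refresh_stale_def choose_mode_def)

context equality_copies
begin

definition rows_mono :: bool where
  "rows_mono \<longleftrightarrow> (\<forall>i<n. monotone_on_cols (M i))"

definition cols_mono :: bool where
  "cols_mono \<longleftrightarrow> (\<forall>k<cols. \<forall>i. i + 1 < n \<longrightarrow> M i k \<le> M (i + 1) k)"

definition time_mono :: bool where
  "time_mono \<longleftrightarrow> (\<forall>k<cols. \<forall>j. j + 1 < n \<longrightarrow> V j k \<le> V (j + 1) k)"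

definition mode :: "nat \<Rightarrow> int" where
  "mode j = (if rows_mono then 1 else if cols_mono then 2 else if monotone_on_cols (V j) then 1 else 3)"

definition static :: "state \<Rightarrow> bool" where
  "static s \<longleftrightarrow> regs s r_rows_mono = (if rows_mono then 1 else 0) \<and>
     regs s r_cols_mono = (if cols_mono then 1 else 0) \<and> regs s r_end = int num_events \<and>
     (\<forall>i<n. \<forall>k<cols. entry s i k = M i k) \<and> (\<forall>x<length samples. arrs s a_sample x = int (samples ! x)) \<and>
     (\<forall>e\<le>e0. \<forall>i<n. row_events s num_events (2 ^ e) i)"

definition matrix_trees :: "state \<Rightarrow> bool" where
  "matrix_trees s \<longleftrightarrow> (\<forall>i<n. tree s i (M i) \<and> tree s (n + i) (\<lambda>k. - M i k)) \<and> tree s (2 * n + 2) (\<lambda>_. 0) \<and>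
     (\<exists>g. tree s (2 * n) g) \<and> (\<exists>g. tree s (2 * n + 1) g) \<and> (\<exists>g. tree s (2 * n + 3) g)"

definition stale_trees :: "state \<Rightarrow> nat \<Rightarrow> bool" where
  "stale_trees s j \<longleftrightarrow> (\<forall>k<cols. - 2 * int cols \<le> arrs s a_stale k \<and> arrs s a_stale k \<le> int n \<and>
       (time_mono \<longrightarrow> j < n \<longrightarrow> arrs s a_stale k \<le> V j k)) \<and>
     (\<forall>i<n. tree s (2 * n + 4 + i) (\<lambda>k. M i k + arrs s a_stale k))"

definition memory :: "state \<Rightarrow> nat \<Rightarrow> bool" where
  "memory s j \<longleftrightarrow> static s \<and> matrix_trees s \<and> stale_trees s j"

abbreviation stale_sum :: "state \<Rightarrow> int" where
  "stale_sum s \<equiv> (\<Sum>k<cols. arrs s a_stale k)"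

lemma static_frame:
  assumes "static s" "frame X Y s s'" "X \<inter> {r_rows_mono, r_cols_mono, r_end} = {}"
    "Y \<inter> {a_matrix, a_sample, a_offsets} = {}" "\<And>q. q < num_events \<Longrightarrow> arrs s' a_refresh q = arrs s a_refresh q"
  shows "static s'"
proof -
  have "entry s' = entry s" using entry_frame[OF assms(2)] assms(4) by auto
  moreover have "regs s' r_rows_mono = regs s r_rows_mono" "regs s' r_cols_mono = regs s r_cols_mono"
    "regs s' r_end = regs s r_end" "arrs s' a_sample = arrs s a_sample" "arrs s' a_offsets = arrs s a_offsets"
    using frame_regs[OF assms(2)] frame_arrs[OF assms(2)] assms(3,4) by auto
  ultimately show ?thesis
    using assms(1,5) row_events_cong[of s num_events _ _ s'] by (auto simp: static_def)
qed

lemma copy_sample: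
  assumes "static s" "p < copies"
  shows "arrs s a_sample (p div shifts) = int (copy_col p)"
proof -
  have "p div shifts < length samples"
    unfolding samples(1) using assms(2) less_mult_imp_div_less by (simp add: copies_def density_def)
  then show ?thesis using assms(1) by (simp add: static_def copy_col_def shifts_def)
qed

lemma matrix_trees_agree:
  assumes "matrix_trees s" "trees_agree (- X) s s'" "X \<inter> ({n..<2 * n} \<union> {2 * n + 2}) = {}"
    and "\<And>i. i < n \<Longrightarrow> tree s' i (M i)"
    and "\<And>r. r \<in> {2 * n, 2 * n + 1, 2 * n + 3} \<Longrightarrow> r \<in> X \<Longrightarrow> \<exists>g. tree s' r g"
  shows "matrix_trees s'"
proof -
  have keep: "tree s' r f" if "tree s r f" "r \<notin> X" for r f
    using tree_agree[OF that(1) assms(2)] that(2) by simp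
  have "\<exists>g. tree s' r g" if "r \<in> {2 * n, 2 * n + 1, 2 * n + 3}" for r
    using that assms(1,5) keep by (cases "r \<in> X") (auto simp: matrix_trees_def)
  moreover have "2 * n + 2 \<notin> X" "\<And>i. i < n \<Longrightarrow> n + i \<notin> X" using assms(3) by auto
  ultimately show ?thesis using assms(1,4) keep by (simp add: matrix_trees_def)
qed

lemma stale_trees_agree:
  assumes "stale_trees s j" "trees_agree {2 * n + 4..} s s'" "arrs s' a_stale = arrs s a_stale"
  shows "stale_trees s' j"
  using assms(1,3) tree_agree[OF _ assms(2)] by (simp add: stale_trees_def)

lemma time_mono_step: "time_mono \<Longrightarrow> Suc j < n \<Longrightarrow> k < cols \<Longrightarrow> V j k \<le> V (Suc j) k"
  by (simp add: time_mono_def)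

lemma stale_trees_Suc: "stale_trees s j \<Longrightarrow> stale_trees s (Suc j)"
  unfolding stale_trees_def using time_mono_step by (meson Suc_lessD order_trans)

lemma memory_frame:
  assumes "memory s j" "frame X Y s s'" "X \<inter> {r_rows_mono, r_cols_mono, r_end} = {}"
    "Y \<inter> {a_matrix, a_sample, a_offsets, a_refresh, a_stale, a_trees} = {}"
  shows "memory s' j"
proof -
  have "trees_agree Z s s'" for Z using assms(4) by (intro trees_agree_arrs frame_arrs[OF assms(2)]) auto
  moreover have "arrs s' a_refresh = arrs s a_refresh" "arrs s' a_stale = arrs s a_stale"
    using assms(4) by (auto intro!: frame_arrs[OF assms(2)])
  ultimately show ?thesis
    using assms(1) static_frame[OF _ assms(2,3), unfolded disjoint_iff] assms(4)
      matrix_trees_agree[of s "{}" s'] stale_trees_agree[of s j s'] tree_agree[of s _ _ UNIV s']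
    by (auto simp: memory_def matrix_trees_def)
qed

lemma wp_load_vector:
  assumes s: "regs s r_dim = int n" "regs s r_cols = int cols" and j: "j < n"
    and query: "\<And>k. k < n \<Longrightarrow> arrs s a_query k = V j k" and mem: "memory s j"
  shows "wp load_vector s (\<lambda>s' t. t \<le> cols * (14 * levels + 28) + 17 \<and> memory s' j \<and> query_loaded s' j \<and>
    regs s' r_query_mono = (if monotone_on_cols (V j) then 1 else 0))"
    (is "wp _ _ ?Q")
  unfolding load_vector_def
proof (rule wp_Seq_conseq[OF wp_pad[where m = 1 and f = "\<lambda>_. V j"]])
  let ?load1 = "load_trees (N 1) (R r_dim \<boxplus> R r_dim) (Rd a_vec (R r_idx))"
    and ?load2 = "load_trees (N 1) (R r_dim \<boxplus> R r_dim \<boxplus> N 1) (N 0 \<boxminus> Rd a_vec (R r_idx))"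
    and ?test = "flag_test r_query_mono (N 1 \<boxtimes> R r_cols) (row_descent a_vec)"
  show "dims s (N 1) 1" using s n_pos by (simp add: dims_def)
  fix s1 t1 assume res1: "t1 \<le> 1 * cols * 5 + 3 \<and> grid s1 a_vec 1 (\<lambda>_. V j)"
    and "framed (pad a_query a_vec (N 1)) s s1"
  then have fr1: "frame {r_idx} {a_vec} s s1" by simp
  have dims1: "dims s1 (N 1) 1" using s n_pos frame_regs[OF fr1] by (simp add: dims_def)
  show "wp (?test ;;
      ?load1 ;;
      ?load2) s1
      (\<lambda>s' t. ?Q s' (Suc (t1 + t)))"
  proof (rule wp_Seq_conseq[OF wp_row_flag[OF dims1 _ conjunct2[OF res1]]])
    fix s2 t2 assume res2: "t2 \<le> 1 * cols * 5 + 5 \<and>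
        regs s2 r_query_mono = (if \<forall>i<1::nat. monotone_on_cols (V j) then 1 else 0)"
      and "framed ?test s1 s2"
    then have fr2: "frame {r_idx, r_query_mono} {} s1 s2" by simp
    have dims2: "dims s2 (N 1) 1" using dims1 frame_regs[OF fr2] by (simp add: dims_def)
    have vec: "arrs s2 a_vec k = V j k" if "k < cols" for k
      using res1 frame_arrs[OF fr2] that by (simp add: grid_def)
    have "frame {r_idx, r_query_mono} {a_vec} s s2" using fr1 fr2 by (auto simp: frame_def)
    then have mem2: "memory s2 j" by (rule memory_frame[OF mem]) auto
    have range: "\<bar>V j k\<bar> \<le> B" if "k < cols" for k using V_range[OF j that] B_bounds by linarith
    have dim: "asafe B s' (R r_dim \<boxplus> R r_dim) \<and> leaves (R r_dim \<boxplus> R r_dim) \<le> 3 \<and>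
        aeval s' (R r_dim \<boxplus> R r_dim) = int (2 * n)" if "regs s' r_dim = int n" for s'
      using that by simp
    have "wp ?load1 s2 (trees_loaded 1 (2 * n) (\<lambda>_. V j) s2)" (is "wp _ _ ?R")
      using mem2 vec range
      by (intro wp_load_trees[OF dims2 _ _ dim]) (auto simp: memory_def matrix_trees_def)
    then show "wp (?load1 ;;
        ?load2) s2
        (\<lambda>s' t. ?Q s' (Suc (t1 + Suc (t2 + t))))"
    proof (rule wp_Seq_conseq)
      fix s3 t3 assume res3: "?R s3 t3"
        and "framed ?load1 s2 s3"
      then have fr3: "frame {r_idx, r_leaf, r_tree, r_val, r_path} {a_trees} s2 s3" by simp
      have dims3: "dims s3 (N 1) 1" using dims2 frame_regs[OF fr3] by (simp add: dims_def)
      have dim: "asafe B s' (R r_dim \<boxplus> R r_dim \<boxplus> N 1) \<and> leaves (R r_dim \<boxplus> R r_dim \<boxplus> N 1) \<le> 3 \<and>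
          aeval s' (R r_dim \<boxplus> R r_dim \<boxplus> N 1) = int (2 * n + 1)" if "regs s' r_dim = int n" for s'
        using that B_ge_2 by simp
      have "\<exists>g. tree s3 (2 * n + 1) g"
        using mem2 res3 tree_agree[of s2 "2 * n + 1" _ "- {2 * n..<2 * n + 1}" s3]
        by (auto simp: memory_def matrix_trees_def)
      then have "wp ?load2 s3 (trees_loaded 1 (2 * n + 1) (\<lambda>_ k. - V j k) s3)" (is "wp _ _ ?R")
        using vec range frame_arrs[OF fr3] B_ge_2 by (intro wp_load_trees[OF dims3 _ _ dim]) auto
      then show "wp ?load2 s3
          (\<lambda>s' t. ?Q s' (Suc (t1 + Suc (t2 + Suc (t3 + t)))))"
      proof (rule wp_conseq)
        fix s4 t4 assume res4: "?R s4 t4"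
          and "framed ?load2 s3 s4"
        then have fr: "frame {r_idx, r_leaf, r_tree, r_val, r_path} {a_trees} s2 s4"
          using frame_trans[OF fr3] by simp
        have agree: "trees_agree (- {2 * n, 2 * n + 1}) s2 s4"
          using trees_agree_trans[of _ s2 s3 _ s4] res3 res4 by (fastforce elim: trees_agree_mono)
        have tree0: "tree s4 (2 * n) (V j)"
          using res3 res4 tree_agree[of s3 "2 * n" _ "- {2 * n + 1..<2 * n + 1 + 1}" s4] by simp
        have tree1: "tree s4 (2 * n + 1) (\<lambda>k. - V j k)" using res4 by simp
        have "static s4" using mem2 frame_arrs[OF fr] by (intro static_frame[OF _ fr]) (auto simp: memory_def)
        moreover have "matrix_trees s4"
          using mem2 tree0 tree1 tree_agree[OF _ agree]
          by (intro matrix_trees_agree[OF _ agree]) (auto simp: memory_def matrix_trees_def)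
        moreover have "trees_agree {2 * n + 4..} s2 s4" using agree by (rule trees_agree_mono) auto
        then have "stale_trees s4 j"
          using mem2 frame_arrs[OF fr] stale_trees_agree[of s2 j s4] by (simp add: memory_def)
        ultimately have mem4: "memory s4 j" by (simp add: memory_def)
        then have "query_loaded s4 j"
          using vec tree0 tree1 frame_arrs[OF fr]
          by (simp add: query_loaded_def memory_def static_def matrix_trees_def)
        moreover have "regs s4 r_query_mono = (if monotone_on_cols (V j) then 1 else 0)"
          using res2 frame_regs[OF fr] by simp
        ultimately show "?Q s4 (Suc (t1 + Suc (t2 + Suc (t3 + t4))))"
          using mem4 res1 res2 res3 res4 by (simp add: algebra_simps)
      qed
    qed
  qed simp
qed (use query V_pad[of j] in auto)

lemma wp_init_answer:
  assumes "regs s r_dim = int n" "regs s r_cols = int cols"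
  shows "wp init_answer s (\<lambda>s' t. t \<le> n * 4 + 3 \<and> (\<forall>i<n. arrs s' a_answer i = 8 * int cols))"
  unfolding init_answer_def
  by (rule wp_for_Store[where m = n and idx = "\<lambda>i. i" and f = "\<lambda>_. 8 * int cols"])
    (use assms B_bounds in \<open>auto simp: frame_regs\<close>)

lemma wp_query_round:
  assumes j: "j < n" and s: "static s" "query_loaded s j" "copies_at (Suc j) 0 s e cnt"
    and ans: "\<And>i. i < n \<Longrightarrow> arrs s a_answer i = 8 * int cols"
  shows "wp (copy_loop (query_copy (query A))) s (\<lambda>s' t. \<exists>e' cnt'. frame loop_regs loop_arrs s s' \<and>
    copies_at (Suc (Suc j)) 0 s' e' cnt' \<and> collected j e' copies (arrs s' a_answer) \<and> e' \<le> e \<and>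
    t + 5 * potential e cnt \<le> copies * (13 * n + 30) + 3 + 5 * potential e' cnt')"
proof -
  have "wp (copy_loop (query_copy (query A))) s (\<lambda>s' t. \<exists>e' cnt'. frame loop_regs loop_arrs s s' \<and>
    copies_at (Suc (Suc j)) 0 s' e' cnt' \<and> collected j e' copies (arrs s' a_answer) \<and> e' \<le> e \<and>
    t + 5 * potential e cnt \<le> copies * (13 * n + 8 + 22) + 3 + 5 * potential e' cnt')"
  proof (rule wp_copy_loop[where col = copy_col])
    show "mod_regs (query_copy (query A)) \<subseteq> {r_steps, r_row, r_idx, r_tmp, r_cell}"
      "mod_arrs (query_copy (query A)) \<subseteq> loop_arrs"
      using mod_sim_com[of "query A"]
      by (auto simp: query_copy_def load_query_def collect_def loop_arrs_def)
    show "frame loop_regs loop_arrs s s2" if "frame loop_regs loop_arrs s s1"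
      "frame loop_regs loop_arrs s1 s2" for s1 s2
      using that by (rule frame_trans)
    show "collected j e 0 (arrs s a_answer)" using ans by (simp add: collected_def collected_at_def)
    show "arrs s1 a_sample (p div shifts) = int (copy_col p)" if "frame loop_regs loop_arrs s s1"
      "p < copies" for s1 p
      using copy_sample[OF s(1) that(2)] frame_arrs[OF that(1), of a_sample] by (simp add: loop_arrs_def)
  next
    fix s1 e1 cnt1 p
    assume fr: "frame loop_regs loop_arrs s s1" and regs: "copy_regs s1 e1 cnt1" "active (2 ^ e1) p"
      "collected j e1 p (arrs s1 a_answer)" "regs s1 r_copy = int p" "regs s1 r_col = int (copy_col p)"
      "regs s1 r_shift = int (p mod shifts)"
      "view copies p s1 = (if Suc j = 0 then zero_state else eq_state (copy_col p) (copy_shift p) (Suc j - 1))"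
      "int (cnt1 + eq_time (copy_col p) (copy_shift p) (Suc j)) \<le> B"
    have "arrs s1 a_vec = arrs s a_vec" "entry s1 = entry s"
      using frame_arrs[OF fr] entry_frame[OF fr] by (auto simp: loop_arrs_def)
    then show "wp (query_copy (query A)) s1 (\<lambda>s' t.
        t \<le> 13 * n + 8 + 5 * eq_time (copy_col p) (copy_shift p) (Suc j) \<and>
        collected j e1 (Suc p) (arrs s' a_answer) \<and>
        view copies p s' = (if Suc (Suc j) = 0 then zero_state
          else eq_state (copy_col p) (copy_shift p) (Suc (Suc j) - 1)) \<and>
        (\<forall>i<copies. i \<noteq> p \<longrightarrow> view copies i s' = view copies i s1) \<and>
        regs s' r_steps = int (cnt1 + eq_time (copy_col p) (copy_shift p) (Suc j)))"
      using wp_query_copy[OF regs(1) _ j, of p] regs s(2) active_less[OF regs(2)]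
      by (simp add: copy_loaded_def copy_shift_def shifts_def query_loaded_def)
  qed (use s j collected_skip collected_mono in auto)
  then show ?thesis by (rule wp_conseq) (simp add: add.assoc)
qed

lemma wp_choose_mode:
  assumes "static s" "regs s r_query_mono = (if monotone_on_cols (V j) then 1 else 0)"
  shows "wp choose_mode s (\<lambda>s' t. t \<le> 4 \<and> s' = set_reg s r_mode (mode j))"
  unfolding choose_mode_def
  by (rule wp_straight) (use assms B_bounds in \<open>auto simp: static_def mode_def\<close>)

end

context padded
begin

definition near_optimal :: "(nat \<Rightarrow> int) \<Rightarrow> nat \<Rightarrow> nat set" where
  "near_optimal f e = {k. k < cols \<and> f k \<le> Min (f ` {..<cols}) + 2 * 2 ^ e}"

definition good_samples :: "(nat \<Rightarrow> nat \<Rightarrow> nat \<Rightarrow> int) \<Rightarrow> nat \<Rightarrow> nat list \<Rightarrow> bool" where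
  "good_samples f e0 ks \<longleftrightarrow> (\<forall>j<n. \<forall>i<n. \<forall>e\<le>e0. cols div 2 ^ e < card (near_optimal (f j i) e) \<longrightarrow>
     (\<exists>b<2 ^ e * (4 * levels). ks ! b \<in> near_optimal (f j i) e))"

end

locale reduction = equality_copies +
  fixes nu :: nat
  assumes nu: "e \<le> e0 \<Longrightarrow> radius_ok (2 ^ e) \<Longrightarrow> cols \<le> nu * 2 ^ e"
    and mono: "rows_mono \<or> cols_mono \<or> (\<forall>j<n. monotone_on_cols (V j)) \<or> time_mono"
begin

definition rows_cost :: nat where
  "rows_cost = 3 * nu * cols * (7 * levels + 8) + n * (88 * levels * nu + 93) + 3"

text \<open>
  In each mode, \<open>m\<close> columns of all rows are refreshed, which increases the sum of the outdated entries
  by at least \<open>m * 2 ^ e\<close>.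
\<close>

definition rows_answered :: "nat \<Rightarrow> nat \<Rightarrow> nat \<Rightarrow> state \<Rightarrow> state \<Rightarrow> nat \<Rightarrow> bool" where
  "rows_answered j e C s s' t \<longleftrightarrow> memory s' (Suc j) \<and> search_results (2 ^ e) j s s' \<and>
     (\<exists>m. int m * 2 ^ e \<le> stale_sum s' - stale_sum s \<and> t \<le> C + rows_cost + n * (7 * levels + 8) * m)"

lemma rows_cost_le:
  assumes "e \<le> e0" "radius_ok (2 ^ e)"
  shows "n * (88 * levels * (cols div 2 ^ e) + 93) + 3 \<le> rows_cost"
    and "(\<Sum>i<n. length (events M (2 ^ e) i)) * (7 * levels + 8) +
      n * (88 * levels * (cols div 2 ^ e) + 93) + 3 \<le> rows_cost"
proof -
  have "cols div 2 ^ e \<le> nu * 2 ^ e div 2 ^ e" using nu[OF assms] by (rule div_le_mono)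
  then have "n * (88 * levels * (cols div 2 ^ e) + 93) \<le> n * (88 * levels * nu + 93)"
    by (intro mult_le_mono2 add_mono) auto
  moreover have "(\<Sum>i<n. length (events M (2 ^ e) i)) * (7 * levels + 8) \<le> 3 * nu * cols * (7 * levels + 8)"
    using nu[OF assms] M_range by (intro mult_le_mono1 total_events) auto
  ultimately show "n * (88 * levels * (cols div 2 ^ e) + 93) + 3 \<le> rows_cost"
    and "(\<Sum>i<n. length (events M (2 ^ e) i)) * (7 * levels + 8) +
      n * (88 * levels * (cols div 2 ^ e) + 93) + 3 \<le> rows_cost"
    unfolding rows_cost_def by linarith+
qed

lemma rows_answered_mono:
  assumes "rows_answered j e C s s' t" "arrs s2 = arrs s" "t' + C \<le> t + C'"
  shows "rows_answered j e C' s2 s' t'"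
proof -
  obtain m where "int m * 2 ^ e \<le> stale_sum s' - stale_sum s" "t \<le> C + rows_cost + n * (7 * levels + 8) * m"
    using assms(1) by (auto simp: rows_answered_def)
  then show ?thesis
    using assms unfolding rows_answered_def by (intro conjI exI[of _ m]) auto
qed

context
  fixes j e :: nat and s :: state
  assumes j: "j < n" and e: "e \<le> e0" "radius_ok (2 ^ e)" and base: "base s (2 ^ e)"
    and mem: "memory s j" and query: "query_loaded s j"
begin

lemma rows_frame_memory:
  assumes fr: "framed (for_loop r_row (R r_dim) row) s s'"
    and trees: "trees_agree (- ({..<n} \<union> {2 * n + 3})) s s'" "\<And>i. i < n \<Longrightarrow> tree s' i (M i)"
      "\<exists>g. tree s' (2 * n + 3) g"
  shows "memory s' (Suc j)" "stale_sum s' = stale_sum s"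
proof -
  have "static s'"
    using mem row_loop_frame(3)[OF fr] by (intro static_frame[OF _ fr]) (auto simp: memory_def)
  moreover have "matrix_trees s'"
    by (rule matrix_trees_agree[OF _ trees(1)]) (use mem trees in \<open>auto simp: memory_def\<close>)
  moreover have stale: "arrs s' a_stale = arrs s a_stale" using frame_arrs[OF fr] by simp
  moreover have "trees_agree {2 * n + 4..} s s'" using trees(1) by (rule trees_agree_mono) auto
  then have "stale_trees s' (Suc j)"
    using mem stale stale_trees_agree stale_trees_Suc by (auto simp: memory_def)
  ultimately show "memory s' (Suc j)" "stale_sum s' = stale_sum s" by (simp_all add: memory_def)
qed

lemma wp_rows_static:
  assumes mode: "regs s r_mode = mode j" "mode j \<noteq> 3"
  shows "wp (for_loop r_row (R r_dim) row) s (rows_answered j e 0 s)"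
proof (cases "mode j = 1")
  case True
  then have "rows_mono \<or> monotone_on_cols (V j)" by (auto simp: mode_def split: if_splits)
  then have "wp (for_loop r_row (R r_dim) row) s (\<lambda>s' t. t \<le> n * (88 * levels * (cols div 2 ^ e) + 93) + 3 \<and>
    search_results (2 ^ e) j s s' \<and> (\<forall>i<n. tree s' i (M i)) \<and> trees_agree (- {..<n}) s s')" (is "wp _ _ ?R")
    using mem mode True query j base
    by (intro wp_rows_exact) (auto simp: memory_def matrix_trees_def rows_mono_def)
  then show ?thesis
  proof (rule wp_conseq)
    fix s' t assume res: "?R s' t"
      and fr: "framed (for_loop r_row (R r_dim) row) s s'"
    obtain g where "tree s (2 * n + 3) g" using mem by (auto simp: memory_def matrix_trees_def)
    then have g: "tree s' (2 * n + 3) g" by (rule tree_agree[where X = "- {..<n}"]) (use res in auto)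
    have "trees_agree (- ({..<n} \<union> {2 * n + 3})) s s'"
      by (rule trees_agree_mono[of "- {..<n}"]) (use res in auto)
    from rows_frame_memory[OF fr this] g res have "memory s' (Suc j)" "stale_sum s' = stale_sum s" by auto
    then show "rows_answered j e 0 s s' t"
      using res rows_cost_le(1)[OF e] unfolding rows_answered_def by (intro conjI exI[of _ 0]) auto
  qed
next
  case False
  then have "mode j = 2" cols_mono using mode(2) by (auto simp: mode_def split: if_splits)
  moreover obtain g where "tree s (2 * n + 3) g" using mem by (auto simp: memory_def matrix_trees_def)
  ultimately have "wp (for_loop r_row (R r_dim) row) s (\<lambda>s' t.
    t \<le> (\<Sum>i<n. length (events M (2 ^ e) i)) * (7 * levels + 8) +
      n * (88 * levels * (cols div 2 ^ e) + 93) + 3 \<and>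
    search_results (2 ^ e) j s s' \<and> (\<exists>g. tree s' (2 * n + 3) g) \<and> trees_agree (- {2 * n + 3}) s s')"
      (is "wp _ _ ?R")
    using mem mode query j base e(1)
    by (intro wp_rows_columns) (auto simp: memory_def static_def cols_mono_def)
  then show ?thesis
  proof (rule wp_conseq)
    fix s' t assume res: "?R s' t"
      and fr: "framed (for_loop r_row (R r_dim) row) s s'"
    have "tree s' i (M i)" if "i < n" for i
      by (rule tree_agree[where X = "- {2 * n + 3}"])
        (use mem res that in \<open>auto simp: memory_def matrix_trees_def\<close>)
    moreover have "trees_agree (- ({..<n} \<union> {2 * n + 3})) s s'"
      by (rule trees_agree_mono[of "- {2 * n + 3}"]) (use res in auto)
    ultimately have "memory s' (Suc j)" "stale_sum s' = stale_sum s" using rows_frame_memory[OF fr] res by auto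
    then show "rows_answered j e 0 s s' t"
      using res rows_cost_le(2)[OF e] unfolding rows_answered_def by (intro conjI exI[of _ 0]) auto
  qed
qed

lemma wp_refresh_stale_rows:
  assumes mode: "regs s r_mode = 3" "mode j = 3"
  shows "wp (refresh_stale ;; for_loop r_row (R r_dim) row) s (rows_answered j e (cols * 9 + 10) s)"
proof -
  let ?c = "arrs s a_stale" and ?D = "2 ^ e :: nat"
  define ks where "ks = due ?c ?D (V j)"
  have regs: "regs s r_dim = int n" "regs s r_cols = int cols" "regs s r_radius = int ?D"
    "regs s r_end = int num_events"
    using base mem by (simp_all add: base_def memory_def static_def)
  have tm: time_mono using mode(2) mono j by (auto simp: mode_def split: if_splits)
  have stale: "- 2 * int cols \<le> ?c k" "?c k \<le> int n" "?c k \<le> V j k" if "k < cols" for k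
    using mem that tm j by (auto simp: memory_def stale_trees_def)
  let ?s = "set_reg s r_last (int num_events)"
  have "wp (scan a_stale (Rd a_vec (R r_idx)) r_last r_radius) ?s (\<lambda>s' t. t \<le> cols * 9 + 3 \<and>
      scan_result a_stale r_last num_events ks (refreshed ?c ?D (V j)) ?s s')"
  proof (rule wp_conseq[OF wp_scan[of ?s r_radius ?D r_last num_events a_stale "Rd a_vec (R r_idx)" "V j"]])
    show "\<bar>V j k\<bar> \<le> B" if "k < cols" for k using V_range[OF j that] B_bounds by linarith
    fix s' k assume k: "k < cols" "regs s' r_idx = int k"
      and fr: "frame {r_idx, r_last} {a_stale, a_refresh} ?s s'"
    have "arrs s' a_vec = arrs s a_vec" using frame_arrs[OF fr] by simp
    then show "asafe B s' (Rd a_vec (R r_idx)) \<and> leaves (Rd a_vec (R r_idx)) \<le> 16 \<and>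
        aeval s' (Rd a_vec (R r_idx)) = V j k"
      using k query by (simp add: query_loaded_def)
  qed (use regs num_events_cols_le in \<open>auto simp: ks_def\<close>)
  then have "wp refresh_stale s (\<lambda>s' t. t \<le> cols * 9 + 6 \<and>
      scan_result a_stale r_last num_events ks (refreshed ?c ?D (V j)) s s')" (is "wp _ _ ?R")
    unfolding refresh_stale_def
    by (intro wp_straight_Seq[of _ _ ?s 1] wp_If)
      (use mode(1) regs num_events_cols_le B_bounds in \<open>auto elim!: wp_conseq\<close>)
  then show ?thesis
  proof (rule wp_Seq_conseq)
    fix s1 t1 assume res1: "?R s1 t1"
      and "framed refresh_stale s s1"
    then have fr1: "frame {r_last, r_idx} {a_stale, a_refresh} s s1" by simp
    have agree1: "trees_agree X s s1" for X using frame_arrs[OF fr1] by (intro trees_agree_arrs) simp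
    have tree1: "tree s1 r f" if "tree s r f" for r f using tree_agree[OF that agree1] by blast
    have static1: "static s1"
      by (rule static_frame[OF _ fr1]) (use mem res1 in \<open>auto simp: memory_def\<close>)
    have base1: "base s1 (2 ^ e)" by (rule base_frame[OF base fr1]) simp
    have query1: "query_loaded s1 j"
      using query tree1 frame_arrs[OF fr1] entry_frame[OF fr1] by (simp add: query_loaded_def)
    have "wp (for_loop r_row (R r_dim) row) s1 (\<lambda>s' t. t \<le> n * (length ks * (7 * levels + 8)) +
        n * (88 * levels * (cols div ?D) + 93) + 3 \<and>
      search_results ?D j s1 s' \<and> (\<forall>i<n. tree s' (2 * n + 4 + i) (\<lambda>k. M i k + refreshed ?c ?D (V j) k)) \<and>
      trees_agree {..<2 * n + 4} s1 s')" (is "wp _ _ ?R")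
      unfolding ks_def
    proof (rule wp_rows_time[OF _ _ j query1 _ _ _ _ stale(3), folded ks_def])
      show "tree s1 (2 * n + 4 + i) (\<lambda>k. M i k + ?c k)" if "i < n" for i
        using mem that tree1 by (simp add: memory_def stale_trees_def)
    qed (use res1 base1 mode(1) regs frame_regs[OF fr1] in \<open>auto simp: ks_def\<close>)
    then show "wp (for_loop r_row (R r_dim) row) s1
      (\<lambda>s' t. rows_answered j e (cols * 9 + 10) s s' (Suc (t1 + t)))"
    proof (rule wp_conseq)
      fix s' t assume res: "?R s' t"
        and fr: "framed (for_loop r_row (R r_dim) row) s1 s'"
      have stale': "arrs s' a_stale k = refreshed ?c ?D (V j) k" if "k < cols" for k
        using res1 that frame_arrs[OF fr] by simp
      have "refreshed ?c ?D (V j) k \<le> V j k \<and> - 2 * int cols \<le> refreshed ?c ?D (V j) k" if "k < cols" for k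
        using stale[OF that] V_range[OF j that] by (simp add: refreshed_def)
      then have bounds: "- 2 * int cols \<le> arrs s' a_stale k \<and> arrs s' a_stale k \<le> int n \<and>
          (time_mono \<longrightarrow> Suc j < n \<longrightarrow> arrs s' a_stale k \<le> V (Suc j) k)" if "k < cols" for k
        using stale'[OF that] that V_range[OF j that] time_mono_step[of j k] by fastforce
      have "tree s' (2 * n + 4 + i) (\<lambda>k. M i k + arrs s' a_stale k)" if "i < n" for i
        by (rule tree_cong) (use res that stale' in auto)
      then have "stale_trees s' (Suc j)" using bounds by (simp add: stale_trees_def)
      moreover have "static s'"
        using static1 row_loop_frame(3)[OF fr] by (intro static_frame[OF _ fr]) auto
      moreover have agree: "trees_agree (- {2 * n + 4..}) s s'"
        by (rule trees_agree_mono[OF trees_agree_trans[OF agree1[of UNIV]]]) (use res in auto)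
      have "matrix_trees s'"
        by (rule matrix_trees_agree[OF _ agree])
          (use mem tree_agree[OF _ agree] in \<open>auto simp: memory_def matrix_trees_def\<close>)
      ultimately have "memory s' (Suc j)" by (simp add: memory_def)
      moreover have "search_results (2 ^ e) j s s'" using res frame_arrs[OF fr1] by simp
      moreover have "int (length ks) * 2 ^ e \<le> stale_sum s' - stale_sum s"
        using due_gain[of ?c ?D "V j"] stale' by (simp add: ks_def)
      moreover have "Suc (t1 + t) \<le> cols * 9 + 10 + rows_cost + n * (7 * levels + 8) * length ks"
        using res1 res rows_cost_le(1)[OF e] by (simp add: mult_ac)
      ultimately show "rows_answered j e (cols * 9 + 10) s s' (Suc (t1 + t))"
        unfolding rows_answered_def by blast
    qed
  qed
qed

end

lemma wp_answer_rows:
  assumes j: "j < n" and e: "e \<le> e0" "radius_ok (2 ^ e)" and base: "base s (2 ^ e)"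
    and mem: "memory s j" and query: "query_loaded s j"
    and flag: "regs s r_query_mono = (if monotone_on_cols (V j) then 1 else 0)"
  shows "wp answer_rows s (rows_answered j e (cols * 9 + 20) s)"
proof -
  let ?s = "set_reg s r_mode (mode j)"
  have fr: "frame {r_mode} {} s ?s" by (simp add: frame_def)
  have mem': "memory ?s j" by (rule memory_frame[OF mem fr]) auto
  have base': "base ?s (2 ^ e)" by (rule base_frame[OF base fr]) simp
  have query': "query_loaded ?s j" using query entry_frame[OF fr] by (simp add: query_loaded_def)
  have "static s" using mem by (simp add: memory_def)
  from wp_choose_mode[OF this flag] show ?thesis
    unfolding answer_rows_def
  proof (rule wp_Seq_conseq, elim conjE, hypsubst)
    fix t1 :: nat assume t1: "t1 \<le> 4"
    have "wp (refresh_stale ;; for_loop r_row (R r_dim) row) ?s (rows_answered j e (cols * 9 + 10) ?s)"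
    proof (cases "mode j = 3")
      case True
      then show ?thesis using wp_refresh_stale_rows[OF j e base' mem' query'] by simp
    next
      case False
      let ?s' = "set_reg ?s r_last (int num_events)"
      have fr': "frame {r_last} {} ?s ?s'" by (simp add: frame_def)
      have "wp (for_loop r_row (R r_dim) row) ?s' (rows_answered j e 0 ?s')"
      proof (rule wp_rows_static[OF j e _ _ _ _ False])
        show "base ?s' (2 ^ e)" by (rule base_frame[OF base' fr']) simp
        show "memory ?s' j" by (rule memory_frame[OF mem' fr']) auto
        show "query_loaded ?s' j" using query' entry_frame[OF fr'] by (simp add: query_loaded_def)
      qed simp
      moreover have "regs s r_end = int num_events" using mem by (simp add: memory_def static_def)
      ultimately show ?thesis
        using False num_events_cols_le B_bounds
        by (intro wp_straight_Seq[of _ _ ?s' 4])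
          (auto simp: refresh_stale_def elim!: wp_conseq rows_answered_mono)
    qed
    then show "wp (refresh_stale ;; for_loop r_row (R r_dim) row) ?s
        (\<lambda>s' t. rows_answered j e (cols * 9 + 20) s s' (Suc (t1 + t)))"
      by (rule wp_conseq) (use t1 in \<open>auto elim!: rows_answered_mono\<close>)
  qed
qed

abbreviation good :: bool where
  "good \<equiv> good_samples row_sum e0 samples"

lemma Min_row_sum_le: "k < cols \<Longrightarrow> Min (row_sum j i ` {..<cols}) \<le> row_sum j i k"
  by (intro Min_le) auto

lemma Min_row_sum_attained: "\<exists>k<n. row_sum j i k = Min (row_sum j i ` {..<cols})"
proof -
  have "{..<cols} \<noteq> {}" using cols_pos by blast
  then have "Min (row_sum j i ` {..<cols}) \<in> row_sum j i ` {..<cols}" by (intro Min_in) auto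
  then obtain k where "row_sum j i k = Min (row_sum j i ` {..<cols})" by auto
  then show ?thesis
    using M_pad[of i k] V_pad[of j k] n_pos by (intro exI[of _ "min k (n - 1)"]) (simp add: min_less_iff_disj)
qed

lemma near_optimal_sample_hit:
  assumes "e \<le> e0" "b < 2 ^ e * density" "samples ! b \<in> near_optimal (row_sum j i) e"
  obtains q where "q < copies" "active (2 ^ e) q" "hit j q i"
    "hit_value j q i = Min (row_sum j i ` {..<cols})"
proof -
  let ?min = "Min (row_sum j i ` {..<cols})"
  have e: "(2::nat) ^ e \<le> 2 ^ e0" using assms(1) by (intro power_increasing) auto
  define d where "d = nat (row_sum j i (samples ! b) - ?min)"
  have d: "int d = row_sum j i (samples ! b) - ?min" "d \<le> 2 * 2 ^ e"
    using assms(3) Min_row_sum_le[of "samples ! b" j i] by (auto simp: near_optimal_def d_def nat_le_iff)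
  define q where "q = b * shifts + d"
  have "d < shifts" using d(2) e unfolding shifts_def by linarith
  then have q: "q div shifts = b" "q mod shifts = d" by (simp_all add: q_def)
  have b: "b < 2 ^ e0 * density" using assms(2) mult_le_mono1[OF e, of density] by linarith
  have "q < Suc b * shifts" using \<open>d < shifts\<close> by (simp add: q_def)
  also have "\<dots> \<le> copies" unfolding copies_def using b by (intro mult_le_mono1) simp
  finally have "q < copies" .
  moreover from this have "active (2 ^ e) q" using q assms(2) d(2) by (simp add: active_def)
  moreover have min: "hit_value j q i = ?min"
    using q d(1) by (simp add: hit_value_def copy_col_def copy_shift_def shifts_def)
  moreover have "hit j q i" unfolding hit_def min by (rule Min_row_sum_attained)
  ultimately show thesis using that by blast
qed

lemma search_result_correct:
  assumes good: good and ji: "j < n" "i < n" and e: "e \<le> e0"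
    and col: "collected j e copies a" and res: "search_result (2 ^ e) (row_sum j i) (a i) x"
  shows "x = Min (row_sum j i ` {..<cols})"
proof -
  let ?min = "Min (row_sum j i ` {..<cols})"
  have a: "a i = 8 * int cols \<or> (\<exists>k<cols. a i = row_sum j i k)"
    "\<And>q. q < copies \<Longrightarrow> active (2 ^ e) q \<Longrightarrow> hit j q i \<Longrightarrow> a i \<le> hit_value j q i"
    using col ji(2) by (auto simp: collected_def collected_at_def)
  have "x \<le> ?min"
  proof (cases "card (near_optimal (row_sum j i) e) \<le> cols div 2 ^ e")
    case True
    then show ?thesis using res by (simp add: search_result_def near_optimal_def)
  next
    case False
    then obtain b where "b < 2 ^ e * density" "samples ! b \<in> near_optimal (row_sum j i) e"
      using good ji e unfolding good_samples_def density_def by (meson not_le)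
    from near_optimal_sample_hit[OF e this] obtain q where "q < copies" "active (2 ^ e) q" "hit j q i"
      "hit_value j q i = ?min" .
    then have "a i \<le> ?min" using a(2)[of q] by simp
    then show ?thesis using res by (simp add: search_result_def)
  qed
  moreover have "?min < 8 * int cols"
    using Min_row_sum_le[OF cols_pos, of i j] M_range[OF ji(2) cols_pos] V_range[OF ji(1) cols_pos]
      n_le_cols n_pos by linarith
  ultimately obtain k where "k < cols" "x = row_sum j i k"
    using a(1) res by (auto simp: search_result_def)
  then show ?thesis using \<open>x \<le> ?min\<close> Min_row_sum_le by (simp add: antisym)
qed

definition query_cost :: nat where
  "query_cost = cols * (14 * levels + 40) + copies * (13 * n + 30) + rows_cost + 4 * n + 50"

lemma wp_query_prog:
  assumes j: "j < n" and mem: "memory s j" and at: "copies_at (Suc j) 0 s e cnt"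
    and query: "\<And>k. k < n \<Longrightarrow> arrs s a_query k = V j k"
  shows "wp (query_prog (query A)) s (\<lambda>s' t. \<exists>e' cnt' m. memory s' (Suc j) \<and>
    copies_at (Suc (Suc j)) 0 s' e' cnt' \<and>
    int m * 2 ^ e' \<le> stale_sum s' - stale_sum s \<and> e' \<le> e0 \<and> radius_ok (2 ^ e') \<and>
    t + 5 * potential e cnt \<le> query_cost + 5 * potential e' cnt' + n * (7 * levels + 8) * m \<and>
    (good \<longrightarrow> (\<forall>i<n. arrs s' a_answer i = Min (row_sum j i ` {..<cols}))))"
    (is "wp _ _ ?Q")
  unfolding query_prog_def
proof (rule wp_Seq_conseq[OF wp_load_vector[OF _ _ j query mem]])
  show "regs s r_dim = int n" "regs s r_cols = int cols" using at by (simp_all add: copies_at_def copy_regs_def)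
next
  fix s1 t1 assume res1: "t1 \<le> cols * (14 * levels + 28) + 17 \<and> memory s1 j \<and> query_loaded s1 j \<and>
      regs s1 r_query_mono = (if monotone_on_cols (V j) then 1 else 0)"
    and fr1: "framed load_vector s s1"
  have at1: "copies_at (Suc j) 0 s1 e cnt"
    using frame_regs[OF fr1] frame_arrs[OF fr1] by (intro copies_at_cong[OF at]) auto
  then have "regs s1 r_dim = int n" "regs s1 r_cols = int cols" by (simp_all add: copies_at_def copy_regs_def)
  from wp_init_answer[OF this] show "wp (init_answer ;; copy_loop (query_copy (query A)) ;; answer_rows) s1
      (\<lambda>s' t. ?Q s' (Suc (t1 + t)))"
  proof (rule wp_Seq_conseq)
    fix s2 t2 assume res2: "t2 \<le> n * 4 + 3 \<and> (\<forall>i<n. arrs s2 a_answer i = 8 * int cols)"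
      and "framed init_answer s1 s2"
    then have fr2: "frame {r_row} {a_answer} s1 s2" by simp
    have at2: "copies_at (Suc j) 0 s2 e cnt"
      using frame_regs[OF fr2] frame_arrs[OF fr2] by (intro copies_at_cong[OF at1]) auto
    have mem2: "memory s2 j" "query_loaded s2 j"
      using res1 memory_frame[OF _ fr2] tree_agree[OF _ trees_agree_arrs, of s1 _ _ s2 UNIV]
        frame_arrs[OF fr2] entry_frame[OF fr2] by (auto simp: query_loaded_def)
    then have static2: "static s2" by (simp add: memory_def)
    show "wp (copy_loop (query_copy (query A)) ;; answer_rows) s2 (\<lambda>s' t. ?Q s' (Suc (t1 + Suc (t2 + t))))"
    proof (rule wp_Seq_conseq[OF wp_query_round[OF j static2 mem2(2) at2]], use res2 in blast, elim exE conjE)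
      fix s3 t3 e' cnt'
      assume fr3: "frame loop_regs loop_arrs s2 s3" and at3: "copies_at (Suc (Suc j)) 0 s3 e' cnt'"
        and col: "collected j e' copies (arrs s3 a_answer)"
        and t3: "t3 + 5 * potential e cnt \<le> copies * (13 * n + 30) + 3 + 5 * potential e' cnt'"
      have mem3: "memory s3 j" "query_loaded s3 j"
        using mem2 memory_frame[OF _ fr3] tree_agree[OF _ trees_agree_arrs, of s2 _ _ s3 UNIV]
          frame_arrs[OF fr3] entry_frame[OF fr3] by (auto simp: query_loaded_def loop_regs_def loop_arrs_def)
      have e': "e' \<le> e0" "radius_ok (2 ^ e')" "base s3 (2 ^ e')"
        using at3 power_e_le_cols[of e'] by (auto simp: copies_at_def copy_regs_def base_def)
      have stale3: "stale_sum s3 = stale_sum s"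
        using frame_arrs[OF fr1] frame_arrs[OF fr2] frame_arrs[OF fr3] by (simp add: loop_arrs_def)
      have "regs s3 r_query_mono = (if monotone_on_cols (V j) then 1 else 0)"
        using res1 frame_regs[OF fr2] frame_regs[OF fr3] by (simp add: loop_regs_def)
      from wp_answer_rows[OF j e' mem3 this] show "wp answer_rows s3
          (\<lambda>s' t. ?Q s' (Suc (t1 + Suc (t2 + Suc (t3 + t)))))"
      proof (rule wp_conseq)
        fix s4 t4 assume res4: "rows_answered j e' (cols * 9 + 20) s3 s4 t4" and fr4: "framed answer_rows s3 s4"
        obtain m where m: "int m * 2 ^ e' \<le> stale_sum s4 - stale_sum s"
          "t4 \<le> cols * 9 + 20 + rows_cost + n * (7 * levels + 8) * m"
          using res4 stale3 by (auto simp: rows_answered_def)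
        have "copies_at (Suc (Suc j)) 0 s4 e' cnt'"
          using frame_regs[OF fr4] frame_arrs[OF fr4]
          by (intro copies_at_cong[OF at3]) (auto simp: answer_rows_def)
        moreover have "good \<longrightarrow> (\<forall>i<n. arrs s4 a_answer i = Min (row_sum j i ` {..<cols}))"
          using search_result_correct[OF _ j _ e'(1) col] res4 by (auto simp: rows_answered_def)
        moreover have "Suc (t1 + Suc (t2 + Suc (t3 + t4))) + 5 * potential e cnt
            \<le> query_cost + 5 * potential e' cnt' + n * (7 * levels + 8) * m"
          using res1 res2 t3 m(2) by (simp add: query_cost_def algebra_simps)
        ultimately show "?Q s4 (Suc (t1 + Suc (t2 + Suc (t3 + t4))))"
          using res4 m(1) e' by (intro exI[of _ e'] exI[of _ cnt'] exI[of _ m]) (simp add: rows_answered_def)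
      qed
    qed
  qed
qed

end

section \<open>Preprocessing\<close>

definition row_scan :: com where
  "row_scan = Store a_offsets (offset_index (R r_cap) (R r_row)) (R r_end) ;;
     scan a_current (matrix_at (R r_row) (R r_idx)) r_end r_cap"

definition radius_events :: com where
  "radius_events = init_outdated a_current ;; for_loop r_row (R r_dim) row_scan ;;
     Store a_offsets (offset_index (R r_cap) (R r_dim)) (R r_end)"

definition all_events :: com where
  "all_events = (Assign r_end (N 0) ;; Assign r_cap (R r_radius)) ;;
     While (Less (N 0) (R r_cap)) (radius_events ;; halve r_cap)"

definition prep_trees :: com where
  "prep_trees = init_outdated a_stale ;; load_trees (R r_dim) (N 0) (Rd a_matrix (R r_idx)) ;;
     load_trees (R r_dim) (R r_dim) (N 0 \<boxminus> Rd a_matrix (R r_idx)) ;;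
     load_trees (R r_dim) (R r_dim \<boxplus> R r_dim \<boxplus> N 4)
       (Rd a_matrix (R r_idx) \<boxplus> Rd a_stale (Bin Mod (R r_idx) (R r_cols)))"

definition prep_matrix :: com where
  "prep_matrix = pad a_input a_matrix (R r_dim) ;;
     flag_test r_rows_mono (R r_dim \<boxtimes> R r_cols) (row_descent a_matrix) ;;
     flag_test r_cols_mono (R r_dim \<boxtimes> R r_cols) (col_descent a_matrix)"

definition prep_prog :: "com \<Rightarrow> com" where
  "prep_prog c = prep_matrix ;; prep_trees ;; all_events ;; copy_loop (prep_copy c)"

lemma mod_prep [simp]:
  "mod_regs row_scan = {r_idx, r_end}" "mod_arrs row_scan = {a_offsets, a_current, a_refresh}"
  "mod_regs radius_events = {r_idx, r_end, r_row}" "mod_arrs radius_events = {a_offsets, a_current, a_refresh}"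
  "mod_regs all_events = {r_idx, r_end, r_row, r_cap}" "mod_arrs all_events = {a_offsets, a_current, a_refresh}"
  "mod_regs prep_trees = {r_idx, r_leaf, r_tree, r_val, r_path}" "mod_arrs prep_trees = {a_stale, a_trees}"
  "mod_regs prep_matrix = {r_idx, r_rows_mono, r_cols_mono}" "mod_arrs prep_matrix = {a_matrix}"
  by (auto simp: row_scan_def radius_events_def all_events_def prep_trees_def prep_matrix_def)

context equality_copies
begin

definition events_before :: "nat \<Rightarrow> nat \<Rightarrow> nat" where
  "events_before E i = (\<Sum>i'<i. length (events M E i'))"

lemma events_before_le: "i \<le> n \<Longrightarrow> events_before E i \<le> n * cols"
  unfolding events_before_def using length_events_le[of E] sum_mono2[of "{..<n}" "{..<i}"
    "\<lambda>i. length (events M E i)"]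
  by (meson finite_lessThan le_trans lessThan_subset_iff zero_le)

definition scanned :: "nat \<Rightarrow> nat \<Rightarrow> nat \<Rightarrow> state \<Rightarrow> state \<Rightarrow> bool" where
  "scanned E p i s s' \<longleftrightarrow> regs s' r_end = int (p + events_before E i) \<and>
     (\<forall>i'<i. arrs s' a_offsets (E * (n + 1) + i') = int (p + events_before E i') \<and>
       listed s' (p + events_before E i') (events M E i')) \<and>
     (\<forall>q<p. arrs s' a_refresh q = arrs s a_refresh q) \<and>
     (\<forall>z. z < E * (n + 1) \<or> E * (n + 1) + n < z \<longrightarrow> arrs s' a_offsets z = arrs s a_offsets z)"

lemma wp_row_scan:
  assumes regs: "regs s' r_dim = int n" "regs s' r_cols = int cols" "regs s' r_cap = int E" "regs s' r_row = int i"
    and i: "i < n" and E: "E \<le> n" and p: "int (p + n * cols + cols) \<le> B"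
    and matrix: "\<And>k. k < cols \<Longrightarrow> entry s' i k = M i k"
    and inv: "scanned E p i s s'" "\<forall>k<cols. arrs s' a_current k = outdated M E i k"
  shows "wp row_scan s' (\<lambda>s'' t. t \<le> cols * 9 + 5 \<and> scanned E p (Suc i) s s'' \<and>
    (\<forall>k<cols. arrs s'' a_current k = outdated M E (Suc i) k))"
    (is "wp _ _ ?Q")
  unfolding row_scan_def
proof (rule wp_straight_Seq)
  let ?scan = "scan a_current (matrix_at (R r_row) (R r_idx)) r_end r_cap"
    and ?store = "Store a_offsets (offset_index (R r_cap) (R r_row)) (R r_end)"
  let ?lo = "p + events_before E i"
  let ?s = "set_cell s' a_offsets (E * (n + 1) + i) (int ?lo)"
  have lo: "regs s' r_end = int ?lo" using inv(1) by (simp add: scanned_def)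
  have "int (?lo + cols) \<le> B"
    by (rule order_trans[OF _ p])
      (use events_before_le[OF less_imp_le[OF i], of E] in \<open>simp only: of_nat_le_iff add_le_cancel_left
          add_le_cancel_right\<close>)
  then have lo_B: "int ?lo + int cols \<le> B" by simp
  have "nat (int E * (int n + 1) + int i) = E * (n + 1) + i" by (simp add: nat_add_distrib nat_mult_distrib)
  then show "safe B ?store s'"
    "effect ?store s' = ?s"
    "cost ?store s' = 1"
    using regs lo lo_B B_ge_2 by simp_all
  have due: "due (arrs ?s a_current) E (M i) = events M E i"
    unfolding events_def due_def using inv(2) by (intro filter_cong) auto
  have "wp ?scan ?s (\<lambda>s'' t. t \<le> cols * 9 + 3 \<and>
      scan_result a_current r_end ?lo (due (arrs ?s a_current) E (M i))
        (refreshed (arrs ?s a_current) E (M i)) ?s s'')"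
  proof (rule wp_scan)
    show "\<bar>M i k\<bar> \<le> B" if "k < cols" for k using M_range[OF i that] B_bounds by linarith
    fix s1 k assume k: "k < cols" "regs s1 r_idx = int k"
      and fr: "frame {r_idx, r_end} {a_current, a_refresh} ?s s1"
    have "entry s1 i k = M i k" using entry_frame[OF fr] matrix[OF k(1)] by simp
    then show "asafe B s1 (matrix_at (R r_row) (R r_idx)) \<and> leaves (matrix_at (R r_row) (R r_idx)) \<le> 16 \<and>
        aeval s1 (matrix_at (R r_row) (R r_idx)) = M i k"
      using k frame_regs[OF fr] regs by simp
  qed (use regs lo lo_B in auto)
  then show "wp ?scan ?s (\<lambda>s'' t. ?Q s'' (Suc (1 + t)))"
    unfolding due
  proof (rule wp_conseq)
    fix s'' t assume res: "t \<le> cols * 9 + 3 \<and>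
        scan_result a_current r_end ?lo (events M E i) (refreshed (arrs ?s a_current) E (M i)) ?s s''"
      and fr: "framed ?scan ?s s''"
    have offsets: "arrs s'' a_offsets = (arrs s' a_offsets)(E * (n + 1) + i := int ?lo)"
      using frame_arrs[OF fr] by simp
    have "listed s'' (p + events_before E i') (events M E i')" if "i' < i" for i'
    proof -
      have le: "events_before E i' + length (events M E i') \<le> events_before E i"
        using that sum_mono2[of "{..<i}" "{..<Suc i'}" "\<lambda>i. length (events M E i)"]
          by (simp add: events_before_def)
      show ?thesis
        by (rule listed_cong[of s']) (use inv(1) that res le in \<open>auto simp: scanned_def\<close>)
    qed
    then have "scanned E p (Suc i) s s''"
      using inv(1) res i by (auto simp: scanned_def offsets less_Suc_eq events_before_def)
    moreover have "arrs s'' a_current k = outdated M E (Suc i) k" if "k < cols" for k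
      using res inv(2) that by (simp add: refreshed_def)
    ultimately show "?Q s'' (Suc (1 + t))"
      using res by simp
  qed
qed

abbreviation radius_stored :: "nat \<Rightarrow> nat \<Rightarrow> state \<Rightarrow> state \<Rightarrow> bool" where
  "radius_stored E p s s' \<equiv> regs s' r_end = int (p + events_before E n) \<and>
     (\<forall>i<n. row_events s' (p + events_before E n) E i) \<and>
     (\<forall>q<p. arrs s' a_refresh q = arrs s a_refresh q) \<and>
     (\<forall>z. z < E * (n + 1) \<or> E * (n + 1) + n < z \<longrightarrow> arrs s' a_offsets z = arrs s a_offsets z)"

lemma wp_radius_events:
  assumes regs: "regs s r_dim = int n" "regs s r_cols = int cols" "regs s r_cap = int E" "regs s r_end = int p"
    and E: "E \<le> n" and p: "int (p + n * cols + cols) \<le> B"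
    and matrix: "\<And>i k. i < n \<Longrightarrow> k < cols \<Longrightarrow> entry s i k = M i k"
  shows "wp radius_events s (\<lambda>s' t. t \<le> n * (cols * 9 + 8) + cols * 4 + 9 \<and> radius_stored E p s s')"
    (is "wp _ _ ?Q")
  unfolding radius_events_def
proof (rule wp_Seq_conseq[OF wp_init_outdated])
  let ?scans = "for_loop r_row (R r_dim) row_scan"
    and ?store = "Store a_offsets (offset_index (R r_cap) (R r_dim)) (R r_end)"
  fix s1 t1 assume res1: "t1 \<le> cols * 4 + 3 \<and> (\<forall>k<cols. arrs s1 a_current k = - 2 * int cols)"
    and "framed (init_outdated a_current) s s1"
  then have fr1: "frame {r_idx} {a_current} s s1" by simp
  have "wp ?scans s1 (\<lambda>s' t. t \<le> n * (cols * 9 + 5 + 3) + 3 \<and> scanned E p n s s')" (is "wp _ _ ?R")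
  proof (rule wp_for_const[where m = n and K = "cols * 9 + 5" and
        I = "\<lambda>i s'. scanned E p i s s' \<and> (\<forall>k<cols. arrs s' a_current k = outdated M E i k)"])
    show "scanned E p 0 s (set_reg s1 r_row 0) \<and>
        (\<forall>k<cols. arrs (set_reg s1 r_row 0) a_current k = outdated M E 0 k)"
      using res1 frame_regs[OF fr1] frame_arrs[OF fr1] regs(4) by (simp add: scanned_def events_before_def)
  next
    fix s' assume "framed ?scans s1 s'"
    from frame_regs[OF this] show "asafe B s' (R r_dim) \<and> leaves (R r_dim) \<le> 16 \<and> aeval s' (R r_dim) = int n"
      using regs(1) frame_regs[OF fr1] by simp
  next
    fix i s' assume i: "i < n" "regs s' r_row = int i" and fr: "framed ?scans s1 s'"
      and inv: "scanned E p i s s' \<and> (\<forall>k<cols. arrs s' a_current k = outdated M E i k)"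
    have "wp row_scan s' (\<lambda>s'' t. t \<le> cols * 9 + 5 \<and> scanned E p (Suc i) s s'' \<and>
        (\<forall>k<cols. arrs s'' a_current k = outdated M E (Suc i) k))"
      using regs i E p inv matrix[OF i(1)] frame_regs[OF fr] frame_regs[OF fr1]
        entry_frame[OF fr] entry_frame[OF fr1]
      by (intro wp_row_scan) auto
    then show "wp row_scan s' (\<lambda>s'' t. t \<le> cols * 9 + 5 \<and>
        scanned E p (Suc i) s (set_reg s'' r_row (int (Suc i))) \<and>
        (\<forall>k<cols. arrs (set_reg s'' r_row (int (Suc i))) a_current k = outdated M E (Suc i) k))"
      by (rule wp_conseq) (simp add: scanned_def)
  qed (use B_bounds in auto)
  then show "wp (?scans ;;
      ?store) s1
      (\<lambda>s' t. ?Q s' (Suc (t1 + t)))"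
  proof (rule wp_Seq_conseq)
    fix s2 t2 assume res2: "?R s2 t2"
      and fr2: "framed ?scans s1 s2" and fits: "fits B s2"
    let ?P = "p + events_before E n"
    let ?s = "set_cell s2 a_offsets (E * (n + 1) + n) (int ?P)"
    have r: "regs s2 r_dim = int n" "regs s2 r_cap = int E" "regs s2 r_end = int ?P"
      using regs frame_regs[OF fr1] frame_regs[OF fr2] res2 by (simp_all add: scanned_def)
    have "nat (int E * (int n + 1) + int n) = E * (n + 1) + n" by (simp add: nat_add_distrib nat_mult_distrib)
    then have store: "safe B ?store s2"
      "effect ?store s2 = ?s"
      using r fits_regs[OF fits, of r_end] B_ge_2 by simp_all
    have offset: "arrs ?s a_offsets (E * (n + 1) + i) = int (p + events_before E i)" if "i \<le> n" for i
      using res2 that by (cases "i = n") (auto simp: scanned_def)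
    have "row_events ?s ?P E i" if i: "i < n" for i
    proof -
      have "events_before E i + length (events M E i) = events_before E (Suc i)"
        by (simp add: events_before_def)
      moreover have "events_before E (Suc i) \<le> events_before E n"
        using i unfolding events_before_def by (intro sum_mono2) auto
      moreover have "listed ?s (p + events_before E i) (events M E i)"
        by (rule listed_cong[of s2]) (use res2 i in \<open>auto simp: scanned_def\<close>)
      ultimately show ?thesis
        unfolding row_events_def using offset[of i] offset[of "Suc i"] i
        by (intro exI[of _ "p + events_before E i"]) simp
    qed
    then show "wp ?store s2
        (\<lambda>s' t. ?Q s' (Suc (t1 + Suc (t2 + t))))"
      using res1 res2 r(3) by (intro wp_straightI[OF store refl]) (auto simp: scanned_def algebra_simps)
  qed
qed (use regs in auto)

lemma stored_events_step: "m \<le> e0 \<Longrightarrow> stored_events m = stored_events (Suc m) + events_before (2 ^ m) n"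
  by (simp add: stored_events_def events_before_def sum.atLeast_Suc_atMost add.commute)

definition events_stored :: "nat \<Rightarrow> state \<Rightarrow> bool" where
  "events_stored m s \<longleftrightarrow> regs s r_end = int (stored_events m) \<and>
     (\<forall>e\<in>{m..e0}. \<forall>i<n. row_events s (stored_events m) (2 ^ e) i)"

lemma events_stored_step:
  assumes m: "m \<le> e0" and inv: "events_stored (Suc m) s"
    and new: "radius_stored (2 ^ m) (stored_events (Suc m)) s s'"
  shows "events_stored m (set_reg s' r_cap x)"
proof -
  have "row_events s' (stored_events m) (2 ^ e) i" if e: "e \<in> {Suc m..e0}" and i: "i < n" for e i
  proof (rule row_events_cong[OF _ _ i])
    show "row_events s (stored_events (Suc m)) (2 ^ e) i" using inv e i by (simp add: events_stored_def)
    have "(2::nat) ^ m < 2 ^ e" using e by (intro power_strict_increasing) auto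
    then have "2 ^ m + 1 \<le> (2::nat) ^ e" by linarith
    then have "(2 ^ m + 1) * (n + 1) \<le> 2 ^ e * (n + 1)" by (rule mult_le_mono1)
    then show "arrs s' a_offsets (2 ^ e * (n + 1) + i') = arrs s a_offsets (2 ^ e * (n + 1) + i')" for i'
      using new by simp
  qed (use new stored_events_step[OF m] in auto)
  moreover have "{m..e0} = insert m {Suc m..e0}" using m by auto
  ultimately show ?thesis
    using new stored_events_step[OF m] by (simp add: events_stored_def row_events_def)
qed

lemma wp_all_events:
  assumes regs: "regs s r_dim = int n" "regs s r_cols = int cols" "regs s r_radius = 2 ^ e0"
    and matrix: "\<And>i k. i < n \<Longrightarrow> k < cols \<Longrightarrow> entry s i k = M i k"
  shows "wp all_events s (\<lambda>s' t. t \<le> Suc e0 * (n * (cols * 9 + 8) + cols * 4 + 12) + 5 \<and>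
    regs s' r_end = int num_events \<and> (\<forall>e\<le>e0. \<forall>i<n. row_events s' num_events (2 ^ e) i))"
    (is "wp _ _ ?Q")
  unfolding all_events_def
proof (rule wp_straight_Seq)
  let ?K = "n * (cols * 9 + 8) + cols * 4 + 12"
  let ?s = "s\<lparr>regs := (regs s)(r_end := 0, r_cap := 2 ^ e0)\<rparr>"
  define J where "J m s' t \<longleftrightarrow> regs s' r_cap = 2 ^ m div 2 \<and> events_stored m s' \<and> t \<le> (Suc e0 - m) * ?K"
    for m s' t
  have power_le: "(2::int) ^ e \<le> int n" "(2::nat) ^ e \<le> n" if "e \<le> e0" for e
  proof -
    show "(2::nat) ^ e \<le> n" using power_increasing[OF that, of "2::nat"] radius_le_n by linarith
    then show "(2::int) ^ e \<le> int n" by (metis of_nat_le_iff of_nat_numeral of_nat_power)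
  qed
  then have "(2::int) ^ e0 \<le> B" using B_bounds power_le(1)[of e0] by linarith
  then show "safe B (Assign r_end (N 0) ;; Assign r_cap (R r_radius)) s"
    "effect (Assign r_end (N 0) ;; Assign r_cap (R r_radius)) s = ?s"
    "cost (Assign r_end (N 0) ;; Assign r_cap (R r_radius)) s = 3"
    using regs(3) B_bounds by simp_all
  show "wp (While (Less (N 0) (R r_cap)) (radius_events ;; halve r_cap)) ?s (\<lambda>s' t. ?Q s' (Suc (3 + t)))"
  proof (rule wp_While[where I = "\<lambda>s' t. \<exists>m\<le>Suc e0. J m s' t" and \<mu> = "\<lambda>s'. nat (regs s' r_cap)"])
    have "J (Suc e0) ?s 0" by (simp add: J_def events_stored_def stored_events_def)
    then show "\<exists>m\<le>Suc e0. J m ?s 0" by blast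
  next
    fix s' t assume "\<exists>m\<le>Suc e0. J m s' t" "\<not> beval s' (Less (N 0) (R r_cap))"
    then obtain m where m: "J m s' t" "\<not> (0::int) < 2 ^ m div 2" by (auto simp: J_def)
    then have "m = 0" by (cases m) auto
    then show "?Q s' (Suc (3 + Suc t))" using m(1) by (simp add: J_def events_stored_def)
  next
    fix s' t assume "\<exists>m\<le>Suc e0. J m s' t" and "beval s' (Less (N 0) (R r_cap))"
      and fr: "framed (radius_events ;; halve r_cap) ?s s'"
    then obtain m' where "m' \<le> Suc e0" "J m' s' t" "(0::int) < 2 ^ m' div 2" by (auto simp: J_def)
    then obtain m where m: "m \<le> e0" "J (Suc m) s' t" by (cases m') auto
    then have cap: "regs s' r_cap = int (2 ^ m)" "regs s' r_end = int (stored_events (Suc m))"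
      by (simp_all add: J_def events_stored_def)
    have "int (stored_events (Suc m) + n * cols + cols) \<le> B"
      by (rule order_trans[OF _ stored_events_le[of "Suc m"]]) (simp only: of_nat_le_iff)
    then have "wp radius_events s' (\<lambda>s1 t1. t1 \<le> n * (cols * 9 + 8) + cols * 4 + 9 \<and>
        radius_stored (2 ^ m) (stored_events (Suc m)) s' s1)"
      using regs cap power_le(2)[OF m(1)] matrix frame_regs[OF fr] entry_frame[OF fr]
      by (intro wp_radius_events) auto
    then show "wp (radius_events ;; halve r_cap) s' (\<lambda>s'' t'.
        (\<exists>m\<le>Suc e0. J m s'' (Suc (t + t'))) \<and> nat (regs s'' r_cap) < nat (regs s' r_cap))"
    proof (rule wp_Seq_conseq)
      fix s2 t2 assume fr2: "framed radius_events s' s2"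
        and res: "t2 \<le> n * (cols * 9 + 8) + cols * 4 + 9 \<and> radius_stored (2 ^ m) (stored_events (Suc m)) s' s2"
      have cap2: "regs s2 r_cap = int (2 ^ m)" using frame_regs[OF fr2] cap(1) by simp
      have "(2::int) ^ m div 2 \<le> B" "(0::int) \<le> 2 ^ m div 2"
        using power_le(1)[OF m(1)] B_bounds by linarith simp
      moreover have "nat (2 ^ m div 2) < nat (regs s' r_cap)" using cap(1) by (simp add: nat_div_distrib)
      moreover have "events_stored m (set_reg s2 r_cap (2 ^ m div 2))"
        by (rule events_stored_step[OF m(1) _ conjunct2[OF res]]) (use m(2) in \<open>simp add: J_def\<close>)
      then have "J m (set_reg s2 r_cap (2 ^ m div 2)) (Suc (t + Suc (t2 + 1)))"
        using m res by (simp add: J_def Suc_diff_le)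
      then have "\<exists>k\<le>Suc e0. J k (set_reg s2 r_cap (2 ^ m div 2)) (Suc (t + Suc (t2 + 1)))"
        using m(1) by (intro exI[of _ m] conjI) simp_all
      ultimately show "wp (halve r_cap) s2 (\<lambda>s'' t'. (\<exists>m\<le>Suc e0. J m s'' (Suc (t + Suc (t2 + t')))) \<and>
          nat (regs s'' r_cap) < nat (regs s' r_cap))"
        using cap2 B_ge_2
        by (intro wp_straightI[where s' = "set_reg s2 r_cap (2 ^ m div 2)" and t = 1]) (auto simp: halve_def)
    qed
  qed (use B_ge_2 in auto)
qed

end

context reduction
begin

lemma wp_prep_matrix:
  assumes regs: "regs s r_dim = int n" "regs s r_cols = int cols"
    and input: "\<And>q. q < n * n \<Longrightarrow> arrs s a_input q = M (q div n) (q mod n)"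
  shows "wp prep_matrix s (\<lambda>s' t. t \<le> n * cols * 15 + 15 \<and> grid s' a_matrix n M \<and>
    regs s' r_rows_mono = (if rows_mono then 1 else 0) \<and> regs s' r_cols_mono = (if cols_mono then 1 else 0))"
    (is "wp _ _ ?Q")
  unfolding prep_matrix_def
proof (rule wp_Seq_conseq[OF wp_pad[where m = n and f = M]])
  let ?rows = "flag_test r_rows_mono (R r_dim \<boxtimes> R r_cols) (row_descent a_matrix)"
    and ?cols = "flag_test r_cols_mono (R r_dim \<boxtimes> R r_cols) (col_descent a_matrix)"
  show "dims s (R r_dim) n" using regs by (simp add: dims_def)
  show "arrs s a_input (i * n + k) = M i k" if "i < n" "k < n" for i k
    using input[of "i * n + k"] that mult_le_mono1[of "Suc i" n n] by simp
  fix s1 t1 assume res1: "t1 \<le> n * cols * 5 + 3 \<and> grid s1 a_matrix n M"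
    and "framed (pad a_input a_matrix (R r_dim)) s s1"
  then have dims1: "dims s1 (R r_dim) n" using regs frame_regs[of "{r_idx}" "{a_matrix}" s s1]
    by (simp add: dims_def)
  show "wp (?rows ;;
      ?cols) s1
      (\<lambda>s' t. ?Q s' (Suc (t1 + t)))"
  proof (rule wp_Seq_conseq[OF wp_row_flag[OF dims1 _ conjunct2[OF res1]]])
    fix s2 t2 assume res2: "t2 \<le> n * cols * 5 + 5 \<and>
        regs s2 r_rows_mono = (if \<forall>i<n. monotone_on_cols (M i) then 1 else 0)"
      and "framed ?rows s1 s2"
    then have fr2: "frame {r_idx, r_rows_mono} {} s1 s2" by simp
    have dims2: "dims s2 (R r_dim) n" using dims1 frame_regs[OF fr2] by (simp add: dims_def)
    have grid2: "grid s2 a_matrix n M" using res1 frame_arrs[OF fr2] by (simp add: grid_def)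
    show "wp ?cols s2
        (\<lambda>s' t. ?Q s' (Suc (t1 + Suc (t2 + t))))"
    proof (rule wp_conseq[OF wp_col_flag[OF dims2 _ grid2]])
      fix s3 t3 assume res3: "t3 \<le> n * cols * 5 + 5 \<and>
          regs s3 r_cols_mono = (if \<forall>k<cols. \<forall>i. i + 1 < n \<longrightarrow> M i k \<le> M (i + 1) k then 1 else 0)"
        and "framed ?cols s2 s3"
      then have fr3: "frame {r_idx, r_cols_mono} {} s2 s3" by simp
      have "grid s3 a_matrix n M" using grid2 frame_arrs[OF fr3] by (simp add: grid_def)
      moreover have "regs s3 r_rows_mono = (if rows_mono then 1 else 0)"
        using res2 frame_regs[OF fr3] by (simp add: rows_mono_def)
      ultimately show "?Q s3 (Suc (t1 + Suc (t2 + t3)))"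
        using res1 res2 res3 by (simp add: cols_mono_def)
    qed simp
  qed simp
qed (use M_pad in auto)

lemma wp_prep_trees:
  assumes regs: "regs s r_dim = int n" "regs s r_cols = int cols" and matrix: "grid s a_matrix n M"
    and zero: "arrs s a_trees = (\<lambda>_. 0)"
  shows "wp prep_trees s (\<lambda>s' t. t \<le> n * cols * (21 * levels + 27) + cols * 4 + 15 \<and>
    matrix_trees s' \<and> stale_trees s' 0)"
    (is "wp _ _ ?Q")
  unfolding prep_trees_def
proof (rule wp_Seq_conseq[OF wp_init_outdated[OF regs(2)]])
  let ?load1 = "load_trees (R r_dim) (N 0) (Rd a_matrix (R r_idx))"
    and ?load2 = "load_trees (R r_dim) (R r_dim) (N 0 \<boxminus> Rd a_matrix (R r_idx))"
    and ?load3 = "load_trees (R r_dim) (R r_dim \<boxplus> R r_dim \<boxplus> N 4)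
      (Rd a_matrix (R r_idx) \<boxplus> Rd a_stale (Bin Mod (R r_idx) (R r_cols)))"
  fix s1 t1 assume res1: "t1 \<le> cols * 4 + 3 \<and> (\<forall>k<cols. arrs s1 a_stale k = - 2 * int cols)"
    and "framed (init_outdated a_stale) s s1"
  then have fr1: "frame {r_idx} {a_stale} s s1" by simp
  have dims1: "dims s1 (R r_dim) n" using regs frame_regs[OF fr1] by (simp add: dims_def)
  have zero1: "tree s1 r (\<lambda>_. 0)" for r
    using zero frame_arrs[OF fr1] by (simp add: tree_def heap_at_def node_def)
  have cell: "arrs s1 a_matrix p = M (p div cols) (p mod cols)" if "p < n * cols" for p
    using grid_index[OF matrix that] frame_arrs[OF fr1] by simp
  have stale: "arrs s1 a_stale (p mod cols) = - 2 * int cols" for p using res1 by simp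
  have range: "\<bar>M i k\<bar> \<le> B" "\<bar>M i k - 2 * int cols\<bar> \<le> B" if "i < n" "k < cols" for i k
    using M_range[OF that] B_bounds n_le_cols by linarith+
  have "wp ?load1 s1 (trees_loaded n 0 M s1)" (is "wp _ _ ?R")
    by (rule wp_load_trees[OF dims1]) (use zero1 cell range B_ge_2 in auto)
  then show "wp (?load1 ;; ?load2 ;; ?load3) s1 (\<lambda>s' t. ?Q s' (Suc (t1 + t)))"
  proof (rule wp_Seq_conseq)
    fix s2 t2 assume res2: "?R s2 t2"
      and "framed ?load1 s1 s2"
    then have fr2: "frame {r_idx, r_leaf, r_tree, r_val, r_path} {a_trees} s1 s2" by simp
    have dims2: "dims s2 (R r_dim) n" using dims1 frame_regs[OF fr2] by (simp add: dims_def)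
    have zero2: "tree s2 r (\<lambda>_. 0)" if "n \<le> r" for r
      by (rule tree_agree[OF zero1, of "- {0..<0 + n}"]) (use res2 that in auto)
    then have ex_zero2: "\<exists>g. tree s2 r g" if "n \<le> r" for r using that by blast
    have "wp ?load2 s2 (trees_loaded n n (\<lambda>i k. - M i k) s2)" (is "wp _ _ ?R")
      by (rule wp_load_trees[OF dims2])
        (use cell range(1) frame_arrs[OF fr2] B_ge_2 in \<open>auto intro: ex_zero2\<close>)
    then show "wp (?load2 ;; ?load3) s2 (\<lambda>s' t. ?Q s' (Suc (t1 + Suc (t2 + t))))"
    proof (rule wp_Seq_conseq)
      fix s3 t3 assume res3: "?R s3 t3"
        and "framed ?load2 s2 s3"
      then have fr3: "frame {r_idx, r_leaf, r_tree, r_val, r_path} {a_trees} s2 s3" by simp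
      have dims3: "dims s3 (R r_dim) n" using dims2 frame_regs[OF fr3] by (simp add: dims_def)
      have trees3: "tree s3 i (M i)" if "i < n" for i
        by (rule tree_agree[where X = "- {n..<n + n}"]) (use res2 res3 that in auto)
      have zero3: "tree s3 r (\<lambda>_. 0)" if "2 * n \<le> r" for r
        by (rule tree_agree[OF zero2, of _ "- {n..<n + n}"]) (use res3 that in auto)
      then have ex_zero3: "\<exists>g. tree s3 r g" if "2 * n \<le> r" for r using that by blast
      have dim: "asafe B s' (R r_dim \<boxplus> R r_dim \<boxplus> N 4) \<and> leaves (R r_dim \<boxplus> R r_dim \<boxplus> N 4) \<le> 3 \<and>
          aeval s' (R r_dim \<boxplus> R r_dim \<boxplus> N 4) = int (2 * n + 4)" if "regs s' r_dim = int n" for s'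
        using that B_bounds by simp
      have "wp ?load3 s3 (trees_loaded n (2 * n + 4) (\<lambda>i k. M i k - 2 * int cols) s3)"
        by (rule wp_load_trees[OF dims3 _ _ dim])
          (use cell stale range(2) frame_arrs[OF fr2] frame_arrs[OF fr3]
            in \<open>auto intro: ex_zero3 simp flip: zmod_int\<close>)
      then show "wp ?load3 s3 (\<lambda>s' t. ?Q s' (Suc (t1 + Suc (t2 + Suc (t3 + t)))))"
      proof (rule wp_conseq, elim conjE)
        fix s4 t4 assume t4: "t4 \<le> n * cols * (7 * levels + 9) + 3"
          and sums: "\<forall>i<n. tree s4 (2 * n + 4 + i) (\<lambda>k. M i k - 2 * int cols)"
          and agree: "trees_agree (- {2 * n + 4..<2 * n + 4 + n}) s3 s4" and "framed ?load3 s3 s4"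
        then have fr4: "frame {r_idx, r_leaf, r_tree, r_val, r_path} {a_trees} s3 s4" by simp
        have keep: "tree s4 r f" if "tree s3 r f" "r < 2 * n + 4" for r f
          by (rule tree_agree[OF that(1) agree]) (use that(2) in auto)
        have "\<exists>g. tree s4 r g" if "2 * n \<le> r" "r < 2 * n + 4" for r
          using keep[OF zero3[OF that(1)] that(2)] by blast
        then have mtrees: "matrix_trees s4"
          using keep trees3 res3 keep[OF zero3] by (auto simp: matrix_trees_def)
        have stale4: "arrs s4 a_stale k = - 2 * int cols" if "k < cols" for k
          using res1 that frame_arrs[OF fr2] frame_arrs[OF fr3] frame_arrs[OF fr4] by simp
        have "tree s4 (2 * n + 4 + i) (\<lambda>k. M i k + arrs s4 a_stale k)" if "i < n" for i
          by (rule tree_cong) (use sums that stale4 in auto)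
        moreover have "- (2 * int cols) \<le> V 0 k" if "k < cols" for k using V_range[OF n_pos that] by simp
        ultimately have "stale_trees s4 0" using stale4 by (simp add: stale_trees_def)
        then show "?Q s4 (Suc (t1 + Suc (t2 + Suc (t3 + t4))))"
          using mtrees res1 res2 res3 t4 by (simp add: algebra_simps)
      qed
    qed
  qed
qed

definition prep_cost :: nat where
  "prep_cost = n * cols * (21 * levels + 42) + Suc e0 * (n * (cols * 9 + 8) + cols * 4 + 12) + cols * 4 +
     copies * (4 * n * n + 32) + 50"

lemma wp_prep_round:
  assumes s: "static s" "copies_at 0 0 s e0 0"
    and input: "\<And>q. q < n * n \<Longrightarrow> arrs s a_input q = M (q div n) (q mod n)"
  shows "wp (copy_loop (prep_copy (prep A))) s (\<lambda>s' t. \<exists>e cnt. frame loop_regs loop_arrs s s' \<and>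
    copies_at (Suc 0) 0 s' e cnt \<and>
      t + 5 * potential e0 0 \<le> copies * (4 * n * n + 32) + 3 + 5 * potential e cnt)"
proof -
  have "wp (copy_loop (prep_copy (prep A))) s (\<lambda>s' t. \<exists>e cnt. frame loop_regs loop_arrs s s' \<and>
    copies_at (Suc 0) 0 s' e cnt \<and> True \<and> e \<le> e0 \<and>
    t + 5 * potential e0 0 \<le> copies * (4 * n * n + 10 + 22) + 3 + 5 * potential e cnt)"
  proof (rule wp_copy_loop[where col = copy_col and OI = "\<lambda>_ _ _. True"])
    show "mod_regs (prep_copy (prep A)) \<subseteq> {r_steps, r_row, r_idx, r_tmp, r_cell}"
      "mod_arrs (prep_copy (prep A)) \<subseteq> loop_arrs"
      using mod_sim_com[of "prep A"] by (auto simp: prep_copy_def loop_arrs_def)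
    show "frame loop_regs loop_arrs s s2" if "frame loop_regs loop_arrs s s1"
      "frame loop_regs loop_arrs s1 s2" for s1 s2
      using that by (rule frame_trans)
    show "arrs s1 a_sample (p div shifts) = int (copy_col p)" if "frame loop_regs loop_arrs s s1"
      "p < copies" for s1 p
      using copy_sample[OF s(1) that(2)] frame_arrs[OF that(1), of a_sample] by (simp add: loop_arrs_def)
  next
    fix s1 e1 cnt1 p
    assume fr: "frame loop_regs loop_arrs s s1" and regs: "copy_regs s1 e1 cnt1" "active (2 ^ e1) p"
      "regs s1 r_copy = int p" "regs s1 r_col = int (copy_col p)" "regs s1 r_shift = int (p mod shifts)"
      "view copies p s1 = (if (0::nat) = 0 then zero_state else eq_state (copy_col p) (copy_shift p) (0 - 1))"
      "int (cnt1 + eq_time (copy_col p) (copy_shift p) 0) \<le> B"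
    have "arrs s1 a_input = arrs s a_input" "entry s1 = entry s"
      using frame_arrs[OF fr] entry_frame[OF fr] by (auto simp: loop_arrs_def)
    then show "wp (prep_copy (prep A)) s1 (\<lambda>s' t.
        t \<le> 4 * n * n + 10 + 5 * eq_time (copy_col p) (copy_shift p) 0 \<and> True \<and>
        view copies p s' = (if Suc 0 = 0 then zero_state else eq_state (copy_col p) (copy_shift p) (Suc 0 - 1)) \<and>
        (\<forall>i<copies. i \<noteq> p \<longrightarrow> view copies i s' = view copies i s1) \<and>
        regs s' r_steps = int (cnt1 + eq_time (copy_col p) (copy_shift p) 0))"
      using wp_prep_copy[OF regs(1), of p] regs s(1) input active_less[OF regs(2)]
      by (simp add: copy_loaded_def copy_shift_def shifts_def static_def)
  qed (use s in auto)
  then show ?thesis by (rule wp_conseq) (auto simp: add.assoc)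
qed

lemma wp_prep_prog:
  assumes regs: "copy_regs s e0 0"
    and input: "\<And>q. q < n * n \<Longrightarrow> arrs s a_input q = M (q div n) (q mod n)"
    and sample: "\<And>x. x < length samples \<Longrightarrow> arrs s a_sample x = int (samples ! x)"
    and zero: "arrs s a_trees = (\<lambda>_. 0)" "\<And>a. a_copy_regs \<le> a \<Longrightarrow> arrs s a = (\<lambda>_. 0)"
  shows "wp (prep_prog (prep A)) s (\<lambda>s' t. \<exists>e cnt. memory s' 0 \<and> copies_at (Suc 0) 0 s' e cnt \<and>
    t + 5 * potential e0 0 \<le> prep_cost + 5 * potential e cnt)"
    (is "wp _ _ ?Q")
  unfolding prep_prog_def
proof (rule wp_Seq_conseq[OF wp_prep_matrix])
  have dims: "regs s r_dim = int n" "regs s r_cols = int cols" "regs s r_radius = 2 ^ e0"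
    using regs by (simp_all add: copy_regs_def)
  then show "regs s r_dim = int n" "regs s r_cols = int cols" by simp_all
  have "view copies i s = zero_state" for i
    using zero(2) by (simp add: view_def zero_state_def)
  then have at: "copies_at 0 0 s e0 0"
    using regs less_cube by (simp add: copies_at_def progress_def radius_ok_def)
  fix s1 t1 assume res1: "t1 \<le> n * cols * 15 + 15 \<and> grid s1 a_matrix n M \<and>
      regs s1 r_rows_mono = (if rows_mono then 1 else 0) \<and> regs s1 r_cols_mono = (if cols_mono then 1 else 0)"
    and "framed prep_matrix s s1"
  then have fr1: "frame {r_idx, r_rows_mono, r_cols_mono} {a_matrix} s s1" by simp
  have "wp prep_trees s1 (\<lambda>s' t. t \<le> n * cols * (21 * levels + 27) + cols * 4 + 15 \<and>
      matrix_trees s' \<and> stale_trees s' 0)" (is "wp _ _ ?R")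
    using dims zero(1) res1 frame_regs[OF fr1] frame_arrs[OF fr1] by (intro wp_prep_trees) auto
  then show "wp (prep_trees ;; all_events ;; copy_loop (prep_copy (prep A))) s1 (\<lambda>s' t. ?Q s' (Suc (t1 + t)))"
  proof (rule wp_Seq_conseq)
    fix s2 t2 assume res2: "?R s2 t2"
      and "framed prep_trees s1 s2"
    then have fr2: "frame {r_idx, r_leaf, r_tree, r_val, r_path} {a_stale, a_trees} s1 s2" by simp
    have matrix2: "entry s2 i k = M i k" if "i < n" "k < cols" for i k
      using res1 that entry_frame[OF fr2] by (simp add: grid_entry)
    have "wp all_events s2 (\<lambda>s' t. t \<le> Suc e0 * (n * (cols * 9 + 8) + cols * 4 + 12) + 5 \<and>
        regs s' r_end = int num_events \<and> (\<forall>e\<le>e0. \<forall>i<n. row_events s' num_events (2 ^ e) i))"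
          (is "wp _ _ ?R")
      using dims matrix2 frame_regs[OF fr1] frame_regs[OF fr2] by (intro wp_all_events) auto
    then show "wp (all_events ;; copy_loop (prep_copy (prep A))) s2 (\<lambda>s' t. ?Q s' (Suc (t1 + Suc (t2 + t))))"
    proof (rule wp_Seq_conseq)
      fix s3 t3 assume res3: "?R s3 t3"
        and "framed all_events s2 s3"
      then have fr3: "frame {r_idx, r_end, r_row, r_cap} {a_offsets, a_current, a_refresh} s2 s3" by simp
      have "static s3"
        using res1 res3 matrix2 sample frame_regs[OF fr2] frame_regs[OF fr3] frame_arrs[OF fr1]
          frame_arrs[OF fr2] frame_arrs[OF fr3] entry_frame[OF fr3] by (simp add: static_def)
      moreover have "trees_agree X s2 s3" for X using frame_arrs[OF fr3] by (intro trees_agree_arrs) simp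
      then have "matrix_trees s3" "stale_trees s3 0"
        using res2 matrix_trees_agree[of s2 "{}" s3] stale_trees_agree[of s2 0 s3] frame_arrs[OF fr3]
          tree_agree[of s2 _ _ UNIV s3] by (auto simp: matrix_trees_def)
      ultimately have mem3: "static s3" "memory s3 0" by (simp_all add: memory_def)
      have "copies_at 0 0 s3 e0 0"
        by (rule copies_at_cong[OF at])
          (use frame_regs[OF fr1] frame_regs[OF fr2] frame_regs[OF fr3] frame_arrs[OF fr1]
            frame_arrs[OF fr2] frame_arrs[OF fr3] in auto)
      moreover have "arrs s3 a_input = arrs s a_input"
        using frame_arrs[OF fr1] frame_arrs[OF fr2] frame_arrs[OF fr3] by simp
      ultimately have "wp (copy_loop (prep_copy (prep A))) s3 (\<lambda>s' t. \<exists>e cnt. frame loop_regs loop_arrs s3 s' \<and>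
          copies_at (Suc 0) 0 s' e cnt \<and>
          t + 5 * potential e0 0 \<le> copies * (4 * n * n + 32) + 3 + 5 * potential e cnt)"
        using mem3(1) input by (intro wp_prep_round) auto
      then show "wp (copy_loop (prep_copy (prep A))) s3 (\<lambda>s' t. ?Q s' (Suc (t1 + Suc (t2 + Suc (t3 + t)))))"
      proof (rule wp_conseq, elim exE conjE)
        fix s4 t4 e cnt assume fr4: "frame loop_regs loop_arrs s3 s4" and "copies_at (Suc 0) 0 s4 e cnt"
          and t4: "t4 + 5 * potential e0 0 \<le> copies * (4 * n * n + 32) + 3 + 5 * potential e cnt"
        moreover have "memory s4 0"
          by (rule memory_frame[OF mem3(2) fr4]) (auto simp: loop_regs_def loop_arrs_def)
        moreover have "Suc (t1 + Suc (t2 + Suc (t3 + t4))) + 5 * potential e0 0 \<le> prep_cost + 5 * potential e cnt"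
          using res1 res2 res3 t4 by (simp add: prep_cost_def algebra_simps)
        ultimately show "?Q s4 (Suc (t1 + Suc (t2 + Suc (t3 + t4))))"
          by blast
      qed
    qed
  qed
qed (use input in auto)

definition max_potential :: nat where
  "max_potential = 2 * (cols^2 * density * nu) + 3 * density * t_eq + e0 * t_eq"

lemma potential_le:
  assumes at: "copies_at r 0 s e cnt" and r: "r \<le> Suc n"
  shows "potential e cnt \<le> max_potential"
proof -
  have e: "e \<le> e0" "radius_ok (2 ^ e)" "cnt \<le> spent (2 ^ e) (progress r 0)"
    "1 \<le> e \<longrightarrow> cnt * 2 ^ e \<le> cols ^ 3 * density"
    using at by (auto simp: copies_at_def)
  have "cols ^ 3 * density = cols^2 * density * cols"
    by (simp add: power2_eq_square power3_eq_cube)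
  also have "\<dots> \<le> cols^2 * density * (nu * 2 ^ e)" using nu[OF e(1,2)] by (rule mult_le_mono2)
  finally have le: "cols ^ 3 * density \<le> (cols^2 * density * nu) * 2 ^ e" by (simp only: mult.assoc)
  from div_le_mono[OF this, of "2 ^ e"] have "cols ^ 3 * density div 2 ^ e \<le> cols^2 * density * nu" by simp
  moreover have "cnt \<le> cols^2 * density * nu + 3 * density * t_eq"
  proof (cases "e = 0")
    case True
    have "spent 1 (progress r 0) \<le> 1 * density * (2 * 1 + 1) * t_eq"
      using r by (intro spent_le(1)) (simp add: progress_def)
    then show ?thesis using e(3) True by (simp add: mult_ac)
  next
    case False
    then have "cnt * 2 ^ e \<le> (cols^2 * density * nu) * 2 ^ e" using e(4) le by linarith
    then have "cnt \<le> cols^2 * density * nu" by (simp only: mult_le_cancel2) simp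
    then show ?thesis by simp
  qed
  moreover have "(e0 - e) * t_eq \<le> e0 * t_eq" by simp
  ultimately show ?thesis unfolding potential_def max_potential_def by linarith
qed

lemma stale_sum_bounds:
  assumes "stale_trees s j"
  shows "- (2 * int cols * int cols) \<le> stale_sum s" "stale_sum s \<le> int cols * int cols"
proof -
  have bounds: "- (2 * int cols) \<le> arrs s a_stale k" "arrs s a_stale k \<le> int cols" if "k < cols" for k
    using assms that n_le_cols by (fastforce simp: stale_trees_def)+
  show "- (2 * int cols * int cols) \<le> stale_sum s"
    using sum_mono[of "{..<cols}" "\<lambda>_. - (2 * int cols)"] bounds(1) by (simp add: mult_ac)
  show "stale_sum s \<le> int cols * int cols"
    using sum_mono[of "{..<cols}" "arrs s a_stale" "\<lambda>_. int cols"] bounds(2) by simp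
qed

text \<open>
  The steps available for the remaining \<open>l\<close> queries: the potential pays for the simulation, and the
  sum of the outdated entries for the refreshed columns.
\<close>

definition affordable :: "nat \<Rightarrow> nat \<Rightarrow> nat \<Rightarrow> int \<Rightarrow> bool" where
  "affordable l t p S \<longleftrightarrow>
     (int l * int query_cost + 5 * int max_potential) * int cols
       + int (n * (7 * levels + 8) * nu) * (int cols * int cols - S)
     \<le> (int t + 5 * int p) * int cols"

lemma affordable_step:
  assumes aff: "affordable (Suc l) t p S" and p': "p' \<le> max_potential" and S': "S' \<le> int cols * int cols"
    and t0: "t0 + 5 * p \<le> query_cost + 5 * p' + n * (7 * levels + 8) * m"
    and m: "int m * int cols \<le> int nu * (S' - S)"
  shows "t0 \<le> t" "affordable l (t - t0) p' S'"
proof -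
  let ?c = "int (n * (7 * levels + 8))" and ?N = "int cols"
  have "int (t0 + 5 * p) \<le> int (query_cost + 5 * p' + n * (7 * levels + 8) * m)"
    using t0 by (simp only: of_nat_le_iff)
  then have "int t0 + 5 * int p \<le> int query_cost + 5 * int p' + ?c * int m" by simp
  then have "(int t0 + 5 * int p) * ?N \<le> (int query_cost + 5 * int p' + ?c * int m) * ?N"
    by (intro mult_right_mono) auto
  moreover have "?c * (int m * ?N) \<le> ?c * (int nu * (S' - S))" using m by (intro mult_left_mono) auto
  ultimately have rest: "(int l * int query_cost + 5 * int max_potential) * ?N
      + ?c * int nu * (?N * ?N - S') \<le> (int t - int t0 + 5 * int p') * ?N"
    using aff by (simp add: affordable_def algebra_simps)
  moreover have "0 \<le> ?c * int nu * (?N * ?N - S')" using S' by (intro mult_nonneg_nonneg) auto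
  moreover have "5 * int p' * ?N \<le> (int l * int query_cost + 5 * int max_potential) * ?N"
  proof (rule mult_right_mono)
    have "0 \<le> int l * int query_cost" by simp
    then show "5 * int p' \<le> int l * int query_cost + 5 * int max_potential" using p' by linarith
  qed simp
  moreover have "(int t - int t0 + 5 * int p') * ?N = (int t - int t0) * ?N + 5 * int p' * ?N"
    by (simp add: distrib_right)
  ultimately have "0 \<le> (int t - int t0) * ?N" by linarith
  then show "t0 \<le> t" using cols_pos by (simp add: zero_le_mult_iff)
  then show "affordable l (t - t0) p' S'" using rest by (simp add: affordable_def of_nat_diff)
qed

lemma serve_query_prog:
  assumes "length vs + j = n" "\<forall>i<length vs. \<forall>k<n. vs ! i $ k = V (j + i) k"
    and "memory s j" "copies_at (Suc j) 0 s e cnt" "fits B s"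
    and "affordable (length vs) t (potential e cnt) (stale_sum s)"
  shows "\<exists>as. serve W (query_prog (query A)) n t s vs = return_pmf (Some as) \<and>
    (good \<longrightarrow> as = map (\<lambda>q. vec n (\<lambda>i. Min (row_sum (j + q) i ` {..<cols}))) [0..<length vs])"
  using assms
proof (induction vs arbitrary: j s e cnt t)
  case Nil
  then show ?case by simp
next
  case (Cons v vs)
  have j: "j < n" using Cons.prems(1) by simp
  have v: "v $ k = V j k" if "k < n" for k using Cons.prems(2) that by force
  let ?s = "put_query n v s"
  have fr: "frame {} {a_query} s ?s" by (simp add: put_query_def frame_def)
  have query: "arrs ?s a_query k = V j k" if "k < n" for k using v that by (simp add: put_query_def)
  have mem: "memory ?s j" by (rule memory_frame[OF Cons.prems(3) fr]) auto
  have at: "copies_at (Suc j) 0 ?s e cnt"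
    by (rule copies_at_cong[OF Cons.prems(4)]) (use frame_regs[OF fr] frame_arrs[OF fr] in auto)
  have "\<bar>V j k\<bar> \<le> B" if "k < n" for k using V_range[OF j, of k] that n_le_cols B_bounds by simp
  then have fits: "fits B ?s" using Cons.prems(5) v by (auto simp: fits_def put_query_def)
  obtain s' t0 e' cnt' m where run: "big_step W (query_prog (query A)) ?s s' t0" "fits B s'"
    and post: "memory s' (Suc j)" "copies_at (Suc (Suc j)) 0 s' e' cnt'" "e' \<le> e0" "radius_ok (2 ^ e')"
      "int m * 2 ^ e' \<le> stale_sum s' - stale_sum ?s"
      "t0 + 5 * potential e cnt \<le> query_cost + 5 * potential e' cnt' + n * (7 * levels + 8) * m"
      "good \<longrightarrow> (\<forall>i<n. arrs s' a_answer i = Min (row_sum j i ` {..<cols}))"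
    using wp_query_prog[OF j mem at query] fits unfolding wp_def by blast
  have "int m * int cols \<le> int m * int (nu * 2 ^ e')"
    using nu[OF post(3,4)] by (intro mult_left_mono) (auto simp only: of_nat_le_iff)
  also have "\<dots> = int nu * (int m * 2 ^ e')" by simp
  also have "\<dots> \<le> int nu * (stale_sum s' - stale_sum ?s)" using post(5) by (intro mult_left_mono) auto
  finally have m: "int m * int cols \<le> int nu * (stale_sum s' - stale_sum s)"
    using frame_arrs[OF fr] by simp
  have "stale_trees s' (Suc j)" using post(1) by (simp add: memory_def)
  note step = affordable_step[OF Cons.prems(6)[simplified] potential_le[OF post(2)]
    stale_sum_bounds(2)[OF this] post(6) m]
  have "t0 \<le> t" and aff: "affordable (length vs) (t - t0) (potential e' cnt') (stale_sum s')"
    using step j by simp_all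
  have "vs ! i $ k = V (Suc j + i) k" if "i < length vs" "k < n" for i k
    using Cons.prems(2)[rule_format, of "Suc i" k] that by simp
  then have "length vs + Suc j = n" "\<forall>i<length vs. \<forall>k<n. vs ! i $ k = V (Suc j + i) k"
    using Cons.prems(1) by simp_all
  from Cons.IH[OF this post(1,2) run(2) aff] obtain as where
      as: "serve W (query_prog (query A)) n (t - t0) s' vs = return_pmf (Some as)"
    "good \<longrightarrow> as = map (\<lambda>q. vec n (\<lambda>i. Min (row_sum (Suc j + q) i ` {..<cols}))) [0..<length vs]"
    by blast
  have run_first: "serve W (query_prog (query A)) n t s (v # vs) = return_pmf (Some (get_answer n s' # as))"
    using exec_big_step_le[OF run(1) \<open>t0 \<le> t\<close>, of "[]"] as(1) by (simp add: bind_return_pmf)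
  have "get_answer n s' = vec n (\<lambda>i. Min (row_sum j i ` {..<cols}))" if good
    unfolding get_answer_def by (rule eq_vecI) (use post(7) that in auto)
  moreover have "[0..<length (v # vs)] = 0 # map Suc [0..<length vs]"
    by (simp add: upt_conv_Cons map_Suc_upt del: upt_Suc)
  ultimately have "get_answer n s' # as
      = map (\<lambda>q. vec n (\<lambda>i. Min (row_sum (j + q) i ` {..<cols}))) [0..<length (v # vs)]" if good
    using as(2) that by simp
  with run_first show ?case by (intro exI[of _ "get_answer n s' # as"] conjI impI)
qed

definition run_cost :: nat where
  "run_cost = prep_cost + n * query_cost + 5 * max_potential + n * (7 * levels + 8) * nu * (3 * cols)"

lemma prep_serve:
  assumes regs: "copy_regs s e0 0"
    and input: "\<And>q. q < n * n \<Longrightarrow> arrs s a_input q = M (q div n) (q mod n)"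
    and sample: "\<And>x. x < length samples \<Longrightarrow> arrs s a_sample x = int (samples ! x)"
    and zero: "arrs s a_trees = (\<lambda>_. 0)" "\<And>a. a_copy_regs \<le> a \<Longrightarrow> arrs s a = (\<lambda>_. 0)"
    and fits: "fits B s" and vs: "length vs = n" "\<And>j k. j < n \<Longrightarrow> k < n \<Longrightarrow> vs ! j $ k = V j k"
    and t: "run_cost \<le> t"
  obtains as where "bind_pmf (exec W t [prep_prog (prep A)] s) (\<lambda>r. case r of None \<Rightarrow> return_pmf None
      | Some (s, t') \<Rightarrow> serve W (query_prog (query A)) n t' s vs) = return_pmf (Some as)"
    "good \<Longrightarrow> as = map (\<lambda>j. vec n (\<lambda>i. Min (row_sum j i ` {..<cols}))) [0..<n]"
proof -
  obtain s' t0 e cnt where run: "big_step W (prep_prog (prep A)) s s' t0" "fits B s'"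
    and post: "memory s' 0" "copies_at (Suc 0) 0 s' e cnt"
      "t0 + 5 * potential e0 0 \<le> prep_cost + 5 * potential e cnt"
    using wp_prep_prog[OF regs input sample zero] fits unfolding wp_def by blast
  have t0: "t0 + n * query_cost + n * (7 * levels + 8) * nu * (3 * cols) + 5 * max_potential
      \<le> t + 5 * potential e cnt"
    using post(3) t by (simp add: run_cost_def)
  then have "t0 \<le> t" using potential_le[OF post(2)] by simp
  have "stale_trees s' 0" using post(1) by (simp add: memory_def)
  from stale_sum_bounds(1)[OF this] have "int (n * (7 * levels + 8) * nu) * (int cols * int cols - stale_sum s')
      \<le> int (n * (7 * levels + 8) * nu) * (3 * int cols * int cols)"
    by (intro mult_left_mono) auto
  moreover have "(int n * int query_cost + 5 * int max_potential + int (n * (7 * levels + 8) * nu) * (3 * int cols))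
      * int cols \<le> (int (t - t0) + 5 * int (potential e cnt)) * int cols"
  proof (rule mult_right_mono)
    have "n * query_cost + 5 * max_potential + n * (7 * levels + 8) * nu * (3 * cols)
        \<le> (t - t0) + 5 * potential e cnt"
      using t0 \<open>t0 \<le> t\<close> by linarith
    then have "int (n * query_cost + 5 * max_potential + n * (7 * levels + 8) * nu * (3 * cols))
        \<le> int ((t - t0) + 5 * potential e cnt)" by (simp only: of_nat_le_iff)
    then show "int n * int query_cost + 5 * int max_potential + int (n * (7 * levels + 8) * nu) * (3 * int cols)
        \<le> int (t - t0) + 5 * int (potential e cnt)" by simp
  qed simp
  ultimately have "affordable (length vs) (t - t0) (potential e cnt) (stale_sum s')"
    unfolding affordable_def vs(1) by (simp add: algebra_simps)
  from serve_query_prog[OF _ _ post(1,2) run(2) this] vs obtain as where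
    "serve W (query_prog (query A)) n (t - t0) s' vs = return_pmf (Some as)"
    "good \<longrightarrow> as = map (\<lambda>j. vec n (\<lambda>i. Min (row_sum j i ` {..<cols}))) [0..<n]"
    by auto
  then show thesis
    using exec_big_step_le[OF run(1) \<open>t0 \<le> t\<close>, of "[]"] by (intro that[of as]) (auto simp: bind_return_pmf)
qed

lemma run_cost_le:
  assumes D: "2 ^ e0 * 2 ^ e0 \<le> nu" and t: "t_eq \<le> C * (n * n * nu)" and nu1: "1 \<le> nu"
  shows "run_cost \<le> (4000 + 65 * C) * (levels * (n * n * nu))"
proof -
  define Z where "Z = levels * (n * n * nu)"
  have Z: "a * b * c * d \<le> Z" if "a \<le> levels" "b \<le> n" "c \<le> n" "d \<le> nu" for a b c d
    unfolding Z_def using that by (simp only: mult.assoc) (intro mult_le_mono)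
  have pos: "1 \<le> levels" "1 \<le> n" using n_pos by (auto simp: levels_def)
  have small: "1 \<le> Z" "levels \<le> Z" "n \<le> Z" "n * n \<le> Z" "levels * n * n * nu \<le> Z" "levels * nu \<le> Z"
    "levels * nu * n \<le> Z"
    using Z[of 1 1 1 1] Z[of levels 1 1 1] Z[of 1 n 1 1] Z[of 1 n n 1] Z[of levels n n nu] Z[of levels 1 1 nu]
      Z[of levels n 1 nu] pos nu1 by (simp_all add: mult_ac)
  have cols2: "cols \<le> 2 * n" using cols_less by simp
  have e0_levels: "Suc e0 \<le> levels" using e0_le by (simp add: levels_def)
  have "n * cols * x \<le> 2 * Z" if "n * n * x \<le> Z" for x
  proof -
    have "n * cols * x \<le> n * (2 * n) * x" using cols2 by (intro mult_le_mono) auto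
    also have "\<dots> = 2 * (n * n * x)" by simp
    also have "\<dots> \<le> 2 * Z" using that by simp
    finally show ?thesis .
  qed
  moreover have "n * n * levels \<le> Z" "n * n * (levels * nu) \<le> Z" "n * n * nu \<le> Z" "n * n * 1 \<le> Z"
    using Z[of levels n n 1] Z[of 1 n n nu] small nu1 pos by (simp_all add: mult_ac)
  ultimately have grids: "n * cols * levels \<le> 2 * Z" "n * cols * (levels * nu) \<le> 2 * Z"
    "n * cols * nu \<le> 2 * Z"
    "n * cols \<le> 2 * Z"
    by (blast, blast, blast, metis mult_1_right)
  have "copies \<le> 12 * (levels * nu)"
  proof -
    have "copies \<le> 2 ^ e0 * (4 * levels) * (3 * 2 ^ e0)"
      unfolding copies_def density_def shifts_def by (intro mult_le_mono2) simp
    also have "\<dots> = 12 * (levels * (2 ^ e0 * 2 ^ e0))" by simp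
    also have "\<dots> \<le> 12 * (levels * nu)" using D by (intro mult_le_mono2)
    finally show ?thesis .
  qed
  then have "copies * x \<le> 12 * Z" if "levels * nu * x \<le> Z" for x
  proof -
    have "copies * x \<le> 12 * (levels * nu) * x" using \<open>copies \<le> _\<close> by (rule mult_le_mono1)
    also have "\<dots> = 12 * (levels * nu * x)" by simp
    also have "\<dots> \<le> 12 * Z" using that by simp
    finally show ?thesis .
  qed
  from this[of "n * n"] this[of n] this[of 1]
  have copies: "copies * (n * n) \<le> 12 * Z" "copies * n \<le> 12 * Z" "copies \<le> 12 * Z"
    using small by (simp_all add: mult_ac)
  have prep_cost: "prep_cost = 21 * (n * cols * levels) + 42 * (n * cols)
      + Suc e0 * (n * (cols * 9 + 8) + cols * 4 + 12) + 4 * cols + 4 * (copies * (n * n)) + 32 * copies + 50"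
    unfolding prep_cost_def by (simp add: mult_ac add_mult_distrib add_mult_distrib2)
  have "Suc e0 * (n * (cols * 9 + 8) + cols * 4 + 12) \<le> levels * (n * (cols * 9 + 8) + cols * 4 + 12)"
    using e0_levels by (rule mult_le_mono1)
  also have "\<dots> = 9 * (n * cols * levels) + 8 * (levels * n) + 4 * (levels * cols) + 12 * levels"
    by (simp add: algebra_simps)
  also have "\<dots> \<le> 18 * Z + 8 * Z + 8 * Z + 12 * Z"
  proof -
    have "levels * cols \<le> levels * (2 * n)" "levels * (2 * n) = 2 * (levels * n)"
      using mult_le_mono2[OF cols2] by simp_all
    moreover have "levels * n \<le> Z" using Z[of levels n 1 1] pos nu1 by simp
    ultimately show ?thesis using grids(1) small by linarith
  qed
  finally have "prep_cost \<le> 662 * Z" unfolding prep_cost using grids copies small cols2 by linarith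
  moreover have "n * query_cost \<le> 2200 * Z"
  proof -
    have "n * query_cost = 14 * (n * cols * levels) + 40 * (n * cols) + 13 * (copies * (n * n)) + 30 * (copies * n)
        + 21 * (n * cols * (levels * nu)) + 24 * (n * cols * nu) + 88 * (levels * n * n * nu) + 97 * (n * n) + 53 * n"
      by (simp add: query_cost_def rows_cost_def algebra_simps)
    then show ?thesis using grids copies small by linarith
  qed
  moreover have "5 * max_potential \<le> 160 * Z + 65 * (C * Z)"
  proof -
    have "cols^2 * density * nu \<le> (2 * n)^2 * density * nu"
      using cols2 by (intro mult_le_mono1 power_mono) auto
    also have "\<dots> = 16 * (levels * n * n * nu)" by (simp add: density_def power2_eq_square)
    finally have "cols^2 * density * nu \<le> 16 * Z" using small by linarith
    moreover have "levels * t_eq \<le> C * Z" using mult_le_mono2[OF t, of levels] by (simp add: Z_def mult_ac)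
    moreover have "e0 * t_eq \<le> levels * t_eq" using e0_levels by (intro mult_le_mono1) simp
    moreover have "5 * max_potential = 10 * (cols^2 * density * nu) + 60 * (levels * t_eq) + 5 * (e0 * t_eq)"
      by (simp add: max_potential_def density_def)
    ultimately show ?thesis by linarith
  qed
  moreover have "n * (7 * levels + 8) * nu * (3 * cols) \<le> 90 * Z"
    using grids by (simp add: algebra_simps)
  ultimately have "run_cost \<le> 4000 * Z + 65 * (C * Z)" unfolding run_cost_def by linarith
  then show ?thesis by (simp add: Z_def algebra_simps)
qed

end

section \<open>Parameters and samples\<close>

context word_ram
begin

lemma wp_While_counted:
  assumes init: "I 0 s"
    and body: "\<And>i s'. i < m \<Longrightarrow> I i s' \<Longrightarrow> bsafe B s' b \<and> beval s' b \<and>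
      wp c s' (\<lambda>s'' t. t \<le> K \<and> I (Suc i) s'')"
    and exit: "\<And>s'. I m s' \<Longrightarrow> bsafe B s' b \<and> \<not> beval s' b"
  shows "wp (While b c) s (\<lambda>s' t. t \<le> m * (K + 1) + 1 \<and> I m s')"
proof -
  have "\<forall>s. I i s \<longrightarrow> wp (While b c) s (\<lambda>s' t. t \<le> (m - i) * (K + 1) + 1 \<and> I m s')" if "i \<le> m" for i
    using that
  proof (induction rule: inc_induct)
    case base
    show ?case using exit bval_safe unfolding wp_def by (fastforce intro: big_step.WhileFalse)
  next
    case (step i)
    show ?case unfolding wp_def
    proof (intro allI impI)
      fix s assume I: "I i s" and fits: "fits B s"
      obtain s1 t1 where first: "big_step W c s s1 t1" "fits B s1" "t1 \<le> K" "I (Suc i) s1"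
        using body[OF step.hyps(2) I] fits unfolding wp_def by blast
      then obtain s2 t2 where rest: "big_step W (While b c) s1 s2 t2" "fits B s2" "I m s2"
        "t2 \<le> (m - Suc i) * (K + 1) + 1"
        using step.IH unfolding wp_def by blast
      have "bval W s b = Some True" using body[OF step.hyps(2) I] bval_safe[OF fits] by simp
      from big_step.WhileTrue[OF this first(1) rest(1)]
      have "big_step W (While b c) s s2 (Suc (t1 + t2))" .
      moreover have "(m - i) * (K + 1) = (m - Suc i) * (K + 1) + (K + 1)"
        using step.hyps(2) Suc_diff_Suc[of i m] by (metis add.commute mult_Suc)
      then have "Suc (t1 + t2) \<le> (m - i) * (K + 1) + 1" using first(3) rest(4) by linarith
      ultimately show "\<exists>s' t. big_step W (While b c) s s' t \<and> fits B s' \<and>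
          t \<le> (m - i) * (K + 1) + 1 \<and> I m s'"
        using rest(2,3) by blast
    qed
  qed
  from this[of 0] show ?thesis using init by simp
qed

end

definition size_loop :: com where
  "size_loop = While (Less (R r_cols) (R r_dim))
     (Assign r_cols (R r_cols \<boxplus> R r_cols) ;; Assign r_levels (R r_levels \<boxplus> N 1))"

definition radius_loop :: com where
  "radius_loop = While (Less (N 8 \<boxtimes> R r_radius \<boxtimes> R r_radius \<boxtimes> R r_radius) (R r_dim \<boxplus> N 1))
     (Assign r_radius (R r_radius \<boxplus> R r_radius))"

definition params :: com where
  "params = (Assign r_cols (N 1) ;; Assign r_levels (N 1) ;; Assign r_radius (N 1)) ;; size_loop ;; radius_loop ;;
     Assign r_shifts (R r_radius \<boxplus> R r_radius \<boxplus> N 1) ;;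
     Assign r_copies (R r_radius \<boxtimes> (N 4 \<boxtimes> R r_levels) \<boxtimes> R r_shifts)"

definition sample_count :: aexp where
  "sample_count = R r_radius \<boxtimes> (N 4 \<boxtimes> R r_levels)"

definition sample_loop :: com where
  "sample_loop = While (Less (R r_pos) sample_count)
     ((Rand r_tmp (R r_cols) ;; Store a_sample (R r_pos) (R r_tmp)) ;; Assign r_pos (R r_pos \<boxplus> N 1))"

definition sample :: com where
  "sample = Assign r_pos (N 0) ;; sample_loop"

definition store_sample :: "int \<Rightarrow> state \<Rightarrow> state" where
  "store_sample y s = (set_cell s a_sample (nat (regs s r_pos)) y)
     \<lparr>regs := (regs s)(r_tmp := y, r_pos := regs s r_pos + 1)\<rparr>"

lemma mod_params [simp]:
  "mod_regs params = {r_cols, r_levels, r_radius, r_shifts, r_copies}" "mod_arrs params = {}"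
  by (auto simp: params_def size_loop_def radius_loop_def)

lemma store_samples:
  assumes "regs s r_pos = int a"
  shows "frame {r_pos, r_tmp} {a_sample} s (fold store_sample ys s)"
    and "i < length ys \<Longrightarrow> arrs (fold store_sample ys s) a_sample (a + i) = ys ! i"
proof -
  have "frame {r_pos, r_tmp} {a_sample} s (fold store_sample ys s) \<and>
      (\<forall>i<length ys. arrs (fold store_sample ys s) a_sample (a + i) = ys ! i) \<and>
      (\<forall>i<a. arrs (fold store_sample ys s) a_sample i = arrs s a_sample i)"
    using assms
  proof (induction ys arbitrary: s a)
    case (Cons y ys)
    let ?s = "store_sample y s"
    have "regs ?s r_pos = int (Suc a)" using Cons.prems by (simp add: store_sample_def)
    note IH = Cons.IH[OF this]
    have fr: "frame {r_pos, r_tmp} {a_sample} s ?s" by (simp add: store_sample_def frame_def)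
    have cell: "arrs ?s a_sample = (arrs s a_sample)(a := y)" using Cons.prems by (simp add: store_sample_def)
    have "arrs (fold store_sample ys ?s) a_sample (a + i) = (y # ys) ! i" if "i < length (y # ys)" for i
      using IH cell that by (cases i) auto
    moreover have "arrs (fold store_sample ys ?s) a_sample i = arrs s a_sample i" if "i < a" for i
      using IH cell that by simp
    moreover have "frame {r_pos, r_tmp} {a_sample} s (fold store_sample ys ?s)"
      using frame_trans[OF fr conjunct1[OF IH]] by simp
    ultimately show ?case by simp
  qed simp
  then show "frame {r_pos, r_tmp} {a_sample} s (fold store_sample ys s)"
    and "i < length ys \<Longrightarrow> arrs (fold store_sample ys s) a_sample (a + i) = ys ! i" by blast+
qed

context parallel_copies
begin

lemma wp_size_loop:
  assumes "regs s r_dim = int n" "regs s r_cols = 1" "regs s r_levels = 1"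
  shows "wp size_loop s (\<lambda>s' t. t \<le> 4 * L + 1 \<and> regs s' r_cols = int cols \<and> regs s' r_levels = int levels)"
proof -
  define I where "I l s' \<longleftrightarrow> regs s' r_dim = int n \<and> regs s' r_cols = 2 ^ l \<and> regs s' r_levels = int (Suc l)"
    for l and s' :: state
  have "wp size_loop s (\<lambda>s' t. t \<le> L * (3 + 1) + 1 \<and> I L s')"
    unfolding size_loop_def
  proof (rule wp_While_counted)
    show "I 0 s" using assms by (simp add: I_def)
    show "bsafe B s' (Less (R r_cols) (R r_dim)) \<and> \<not> beval s' (Less (R r_cols) (R r_dim))" if "I L s'" for s'
      using that n_le by (simp add: I_def)
    fix l s' assume l: "l < L" and I: "I l s'"
    have "(2::nat) ^ Suc l \<le> 2 ^ L" using l by (intro power_increasing) auto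
    then have "2 ^ l < n" "2 * 2 ^ l \<le> cols" using less_2n by (simp_all add: cols_def)
    then have l': "int (2 ^ l) < int n" "int (2 * 2 ^ l) \<le> int cols" "int (Suc (Suc l)) \<le> B"
      using l L_le B_bounds by (simp_all only: of_nat_le_iff of_nat_less_iff)
    have "wp (Assign r_cols (R r_cols \<boxplus> R r_cols) ;; Assign r_levels (R r_levels \<boxplus> N 1)) s'
        (\<lambda>s'' t. t \<le> 3 \<and> I (Suc l) s'')"
      using I l' B_bounds by (intro wp_straight) (auto simp: I_def)
    then show "bsafe B s' (Less (R r_cols) (R r_dim)) \<and> beval s' (Less (R r_cols) (R r_dim)) \<and>
        wp (Assign r_cols (R r_cols \<boxplus> R r_cols) ;; Assign r_levels (R r_levels \<boxplus> N 1)) s'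
        (\<lambda>s'' t. t \<le> 3 \<and> I (Suc l) s'')"
      using I l' by (simp add: I_def)
  qed
  then show ?thesis by (rule wp_conseq) (simp add: I_def cols_def levels_def)
qed

lemma wp_radius_loop:
  assumes "regs s r_dim = int n" "regs s r_radius = 1"
  shows "wp radius_loop s (\<lambda>s' t. t \<le> 2 * e0 + 1 \<and> regs s' r_radius = 2 ^ e0)"
proof -
  define I where "I e s' \<longleftrightarrow> regs s' r_dim = int n \<and> regs s' r_radius = int (2 ^ e)"
    for e and s' :: state
  let ?b = "Less (N 8 \<boxtimes> R r_radius \<boxtimes> R r_radius \<boxtimes> R r_radius) (R r_dim \<boxplus> N 1)"
  have test: "beval s' ?b \<longleftrightarrow> 8 * (2 ^ e) ^ 3 \<le> n" if "I e s'" for e and s' :: state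
  proof -
    have "beval s' ?b \<longleftrightarrow> int (8 * (2 ^ e) ^ 3) < int (n + 1)"
      using that by (auto simp: I_def power3_eq_cube mult.assoc)
    also have "\<dots> \<longleftrightarrow> 8 * (2 ^ e) ^ 3 < n + 1" by (rule of_nat_less_iff)
    finally show ?thesis by (simp only: less_Suc_eq_le flip: Suc_eq_plus1)
  qed
  have "wp radius_loop s (\<lambda>s' t. t \<le> e0 * (1 + 1) + 1 \<and> I e0 s')"
    unfolding radius_loop_def
  proof (rule wp_While_counted)
    show "I 0 s" using assms by (simp add: I_def)
    show "bsafe B s' ?b \<and> \<not> beval s' ?b" if "I e0 s'" for s'
      using test[OF that] less_cube B_bounds by simp
    fix e s' assume e: "e < e0" and I: "I e s'"
    then have "(2 ^ Suc e) ^ 3 \<le> ((2::nat) ^ e0) ^ 3" by (intro power_mono power_increasing) auto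
    then have "8 * (2 ^ e) ^ 3 \<le> n" using cube_le by (simp add: power_mult_distrib)
    then have "beval s' ?b" using test[OF I] by blast
    have "2 * 2 ^ e \<le> cols"
      using power_increasing[of "Suc e" L "2::nat"] e e0_le by (simp add: cols_def)
    then have "int (2 * 2 ^ e) \<le> int cols" by (simp only: of_nat_le_iff)
    then have "wp (Assign r_radius (R r_radius \<boxplus> R r_radius)) s' (\<lambda>s'' t. t \<le> 1 \<and> I (Suc e) s'')"
      using I B_bounds by (intro wp_straight) (auto simp: I_def)
    then show "bsafe B s' ?b \<and> beval s' ?b \<and>
        wp (Assign r_radius (R r_radius \<boxplus> R r_radius)) s' (\<lambda>s'' t. t \<le> 1 \<and> I (Suc e) s'')"
      using \<open>beval s' ?b\<close> B_bounds by simp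
  qed
  then show ?thesis by (rule wp_conseq) (simp add: I_def)
qed

lemma wp_params:
  assumes s: "regs s r_dim = int n" "regs s r_steps = 0"
  shows "wp params s (\<lambda>s' t. t \<le> 4 * L + 2 * e0 + 20 \<and> copy_regs s' e0 0)"
    (is "wp _ _ ?Q")
  unfolding params_def
proof (rule wp_straight_Seq)
  let ?start = "Assign r_cols (N 1) ;; Assign r_levels (N 1) ;; Assign r_radius (N 1)"
    and ?finish = "Assign r_shifts (R r_radius \<boxplus> R r_radius \<boxplus> N 1) ;;
        Assign r_copies (R r_radius \<boxtimes> (N 4 \<boxtimes> R r_levels) \<boxtimes> R r_shifts)"
  let ?s = "set_reg (set_reg (set_reg s r_cols 1) r_levels 1) r_radius 1"
  show "safe B ?start s"
    "effect ?start s = ?s"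
    "cost ?start s = 5"
    using B_bounds by simp_all
  show "wp (size_loop ;; radius_loop ;; ?finish) ?s
      (\<lambda>s' t. ?Q s' (Suc (5 + t)))"
  proof (rule wp_Seq_conseq[OF wp_size_loop])
    fix s1 t1 assume res1: "t1 \<le> 4 * L + 1 \<and> regs s1 r_cols = int cols \<and> regs s1 r_levels = int levels"
      and "framed size_loop ?s s1"
    then have fr1: "frame {r_cols, r_levels} {} ?s s1" by (simp add: size_loop_def insert_commute)
    show "wp (radius_loop ;; ?finish) s1
        (\<lambda>s' t. ?Q s' (Suc (5 + Suc (t1 + t))))"
    proof (rule wp_Seq_conseq[OF wp_radius_loop])
      fix s2 t2 assume res2: "t2 \<le> 2 * e0 + 1 \<and> regs s2 r_radius = 2 ^ e0" and "framed radius_loop s1 s2"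
      then have fr2: "frame {r_radius} {} s1 s2" by (simp add: radius_loop_def)
      have regs: "regs s2 r_dim = int n" "regs s2 r_steps = 0" "regs s2 r_cols = int cols"
        "regs s2 r_levels = int levels"
        using s res1 frame_regs[OF fr1] frame_regs[OF fr2] by simp_all
      have "1 * shifts \<le> copies" unfolding copies_def
        by (intro mult_le_mono1) (simp add: density_def levels_def)
      then have "int shifts \<le> B" using copies_le_B(2) by linarith
      moreover have "int copies = 2 ^ e0 * (4 * int levels) * int shifts"
        by (simp add: copies_def density_def)
      moreover have "int shifts = 2 * 2 ^ e0 + 1" by (simp add: shifts_def)
      ultimately show "wp ?finish s2
          (\<lambda>s' t. ?Q s' (Suc (5 + Suc (t1 + Suc (t2 + t)))))"
        using regs res1 res2 copies_le_B(2) B_bounds by (intro wp_straight) (auto simp: copy_regs_def)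
    qed (use s frame_regs[OF fr1] in auto)
  qed (use s in auto)
qed

definition num_samples :: nat where
  "num_samples = 2 ^ e0 * (4 * levels)"

definition sampling :: "state \<Rightarrow> nat \<Rightarrow> bool" where
  "sampling s a \<longleftrightarrow> fits B s \<and> regs s r_cols = int cols \<and> regs s r_radius = 2 ^ e0 \<and> regs s r_levels = int levels \<and>
     regs s r_pos = int a"

lemma num_samples_le_B: "int num_samples + 1 \<le> B"
proof -
  have "num_samples * 3 \<le> copies" unfolding copies_def num_samples_def density_def
    by (intro mult_le_mono2) (simp add: shifts_def)
  moreover have "1 \<le> num_samples" by (simp add: num_samples_def levels_def)
  ultimately show ?thesis using copies_le_B(2) by linarith
qed

lemma sampling_test:
  assumes "sampling s a"
  shows "bval W s (Less (R r_pos) sample_count) = Some (a < num_samples)"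
proof -
  have "bsafe B s (Less (R r_pos) sample_count)" using B_bounds by (simp add: sample_count_def)
  moreover have "beval s (Less (R r_pos) sample_count) \<longleftrightarrow> int a < int num_samples"
    using assms by (simp add: sampling_def sample_count_def num_samples_def)
  ultimately show ?thesis using bval_safe[of s "Less (R r_pos) sample_count"] assms
    by (simp add: sampling_def del: bval.simps)
qed

lemma sampling_store:
  assumes s: "sampling s a" and a: "a < num_samples" and y: "y \<in> {0..<int cols}"
  shows "sampling (store_sample y s) (Suc a)"
proof -
  have "\<bar>y\<bar> \<le> B" "\<bar>int a + 1\<bar> \<le> B" using y a num_samples_le_B B_bounds by auto
  then show ?thesis using s by (auto simp: sampling_def fits_def store_sample_def)
qed

lemma exec_sample_step:
  assumes s: "sampling s a" and a: "a < num_samples"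
  shows "exec W (6 + t) (sample_loop # cs) s
    = bind_pmf (pmf_of_set {0..<int cols}) (\<lambda>y. exec W t (sample_loop # cs) (store_sample y s))"
proof -
  have W: "int cols \<le> W" "1 \<le> W" "int a \<le> W" "int a + 1 \<le> W"
    using B_bounds B_le_W num_samples_le_B a by linarith+
  have test: "bval W s (Less (R r_pos) sample_count) = Some True" using sampling_test[OF s] a by simp
  have six: "6 + t = Suc (Suc (Suc (Suc (Suc (Suc t)))))" by simp
  have "exec W (6 + t) (sample_loop # cs) s = bind_pmf (pmf_of_set {0..<int cols}) (\<lambda>y. exec W (Suc (Suc t))
      (Store a_sample (R r_pos) (R r_tmp) # Assign r_pos (R r_pos \<boxplus> N 1) # sample_loop # cs) (set_reg s r_tmp y))"
    unfolding six using test s W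
    by (simp add: less_imp_neq[OF cols_pos, symmetric] sampling_def sample_loop_def
        bind_return_pmf bind_map_pmf word_def del: bval.simps)
  also have "\<dots> = bind_pmf (pmf_of_set {0..<int cols}) (\<lambda>y. exec W t (sample_loop # cs) (store_sample y s))"
  proof (rule bind_pmf_cong[OF refl])
    fix y assume "y \<in> set_pmf (pmf_of_set {0..<int cols})"
    then have "\<bar>y\<bar> \<le> W" using W by (subst (asm) set_pmf_of_set) auto
    then show "exec W (Suc (Suc t)) (Store a_sample (R r_pos) (R r_tmp) # Assign r_pos (R r_pos \<boxplus> N 1) #
        sample_loop # cs) (set_reg s r_tmp y) = exec W t (sample_loop # cs) (store_sample y s)"
      using s W by (simp add: sampling_def bind_return_pmf word_def store_sample_def add.commute)
  qed
  finally show ?thesis .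
qed

lemma exec_sample_loop:
  assumes "sampling s a" "a + k = num_samples"
  shows "exec W (6 * k + 1 + t) (sample_loop # cs) s
    = bind_pmf (replicate_pmf k (pmf_of_set {0..<int cols})) (\<lambda>ys. exec W t cs (fold store_sample ys s))"
  using assms
proof (induction k arbitrary: s a)
  case 0
  have "big_step W sample_loop s s 1"
    using sampling_test[OF 0(1)] 0(2) unfolding sample_loop_def by (intro big_step.WhileFalse) simp
  from exec_big_step[OF this, of t cs] show ?case by (simp add: bind_return_pmf)
next
  case (Suc k)
  let ?p = "pmf_of_set {0..<int cols}"
  have a: "a < num_samples" using Suc.prems(2) by simp
  have "exec W (6 * Suc k + 1 + t) (sample_loop # cs) s = exec W (6 + (6 * k + 1 + t)) (sample_loop # cs) s"
    by (simp only: mult_Suc_right add.assoc)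
  also have "\<dots> = bind_pmf ?p (\<lambda>y. exec W (6 * k + 1 + t) (sample_loop # cs) (store_sample y s))"
    using Suc.prems(1) a by (rule exec_sample_step)
  also have "\<dots> = bind_pmf ?p (\<lambda>y. bind_pmf (replicate_pmf k ?p)
      (\<lambda>ys. exec W t cs (fold store_sample ys (store_sample y s))))"
  proof (rule bind_pmf_cong[OF refl])
    fix y assume "y \<in> set_pmf ?p"
    then have "y \<in> {0..<int cols}" by (subst (asm) set_pmf_of_set) auto
    from Suc.IH[OF sampling_store[OF Suc.prems(1) a this]] Suc.prems(2)
    show "exec W (6 * k + 1 + t) (sample_loop # cs) (store_sample y s)
        = bind_pmf (replicate_pmf k ?p) (\<lambda>ys. exec W t cs (fold store_sample ys (store_sample y s)))" by simp
  qed
  also have "\<dots> = bind_pmf (replicate_pmf (Suc k) ?p) (\<lambda>ys. exec W t cs (fold store_sample ys s))"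
    by (simp add: bind_assoc_pmf bind_return_pmf)
  finally show ?case .
qed

lemma fits_store_samples:
  assumes "sampling s a" "a + length ys = num_samples" "set ys \<subseteq> {0..<int cols}"
  shows "fits B (fold store_sample ys s)"
  using assms
proof (induction ys arbitrary: s a)
  case (Cons y ys)
  then have "sampling (store_sample y s) (Suc a)" by (intro sampling_store) auto
  then show ?case using Cons by (auto intro: Cons.IH)
qed (simp add: sampling_def)

lemma exec_setup:
  assumes fits: "fits B s" and s: "regs s r_dim = int n" "regs s r_steps = 0"
    and t: "4 * L + 2 * e0 + 6 * num_samples + 30 + t' \<le> t"
  obtains s1 r where "t' \<le> r" "frame {r_cols, r_levels, r_radius, r_shifts, r_copies, r_pos} {} s s1"
    "copy_regs s1 e0 0"
    "sampling s1 0"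
    "exec W t [params ;; sample ;; c] s = bind_pmf (replicate_pmf num_samples (pmf_of_set {0..<int cols}))
      (\<lambda>ys. exec W r [c] (fold store_sample ys s1))"
proof -
  obtain s1 t1 where run: "big_step W params s s1 t1" "fits B s1"
    and res: "t1 \<le> 4 * L + 2 * e0 + 20" "copy_regs s1 e0 0"
    using wp_params[OF s] fits unfolding wp_def by blast
  let ?s = "set_reg s1 r_pos 0"
  have sampling: "sampling ?s 0"
    using run(2) res(2) B_bounds by (auto simp: sampling_def copy_regs_def fits_def)
  define r where "r = t - (t1 + 5 + 6 * num_samples)"
  have "t = Suc (t1 + Suc (Suc (Suc (6 * num_samples + 1 + r))))" using t res(1) by (simp add: r_def)
  then have "exec W t [params ;; sample ;; c] s
      = exec W (t1 + Suc (Suc (Suc (6 * num_samples + 1 + r)))) [params, sample ;; c] s"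
    by (simp add: bind_return_pmf)
  also have "\<dots> = exec W (Suc (Suc (Suc (6 * num_samples + 1 + r)))) [sample ;; c] s1"
    by (rule exec_big_step[OF run(1)])
  also have "\<dots> = exec W (6 * num_samples + 1 + r) (sample_loop # [c]) ?s"
    using B_le_W B_bounds unfolding sample_def by (simp add: bind_return_pmf word_def)
  also note exec_sample_loop[OF sampling]
  finally have "exec W t [params ;; sample ;; c] s
      = bind_pmf (replicate_pmf num_samples (pmf_of_set {0..<int cols}))
      (\<lambda>ys. exec W r [c] (fold store_sample ys ?s))" by simp
  moreover have "frame {r_cols, r_levels, r_radius, r_shifts, r_copies, r_pos} {} s ?s"
    using big_step_framed[OF run(1)] by (auto simp: frame_def)
  moreover have "copy_regs ?s e0 0" using res(2) by (simp add: copy_regs_def)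
  moreover have "t' \<le> r" using t res(1) by (simp add: r_def)
  ultimately show thesis using that sampling by blast
qed

end

section \<open>Success probability\<close>

lemma emeasure_replicate_pmf_prefix:
  "m' \<le> m \<Longrightarrow> emeasure (replicate_pmf m p) {xs. \<forall>a<m'. xs ! a \<in> X} = emeasure (measure_pmf p) X ^ m'"
proof (induction m arbitrary: m')
  case (Suc m)
  show ?case
  proof (cases m')
    case 0
    then show ?thesis by simp
  next
    case (Suc k)
    have tail: "emeasure (map_pmf ((#) x) (replicate_pmf m p)) {xs. \<forall>a<Suc k. xs ! a \<in> X}
        = indicator X x * emeasure (measure_pmf p) X ^ k" for x
    proof -
      have "(#) x -` {xs. \<forall>a<Suc k. xs ! a \<in> X} = (if x \<in> X then {xs. \<forall>a<k. xs ! a \<in> X} else {})"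
        by (auto simp: less_Suc_eq_0_disj)
      then show ?thesis using Suc.IH[of k] Suc.prems \<open>m' = Suc k\<close> by simp
    qed
    have "replicate_pmf (Suc m) p = bind_pmf p (\<lambda>x. map_pmf ((#) x) (replicate_pmf m p))"
      by (simp add: map_pmf_def)
    then have "emeasure (replicate_pmf (Suc m) p) {xs. \<forall>a<Suc k. xs ! a \<in> X}
        = (\<integral>\<^sup>+ x. indicator X x * emeasure (measure_pmf p) X ^ k \<partial>measure_pmf p)"
      by (simp only: emeasure_bind_pmf tail)
    then show ?thesis using \<open>m' = Suc k\<close> by (simp add: nn_integral_multc)
  qed
qed simp

lemma prob_replicate_pmf_prefix:
  "m' \<le> m \<Longrightarrow> measure_pmf.prob (replicate_pmf m p) {xs. \<forall>a<m'. xs ! a \<in> X} = measure_pmf.prob p X ^ m'"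
  using emeasure_replicate_pmf_prefix[of m' m p X]
  by (simp add: measure_pmf.emeasure_eq_measure ennreal_power)

lemma prob_samples_miss:
  assumes S: "finite S" "S \<noteq> {}" and T: "T \<subseteq> S" "card S \<le> card T * d" and m: "d * k \<le> m"
  shows "measure_pmf.prob (replicate_pmf m (pmf_of_set S)) {xs. \<forall>a<d * k. xs ! a \<notin> T} \<le> (1 / 2) ^ k"
proof -
  let ?p = "pmf_of_set S"
  have pos: "0 < card S" "0 < d" using S T(2) by (auto intro: Nat.gr0I simp: card_gt_0_iff)
  have "real (card S) \<le> real (card T) * real d" using T(2) by (simp flip: of_nat_mult)
  then have "1 / real d \<le> real (card T) / real (card S)" using pos by (simp add: field_simps)
  also have "\<dots> = measure_pmf.prob ?p T"
    using S T(1) by (simp add: measure_pmf_of_set Int_absorb1)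
  finally have "measure_pmf.prob ?p (- T) \<le> 1 - 1 / real d"
    using measure_pmf.prob_compl[of T ?p] by (simp add: Compl_eq_Diff_UNIV)
  also have "\<dots> \<le> exp (- (1 / real d))" using exp_ge_add_one_self[of "- (1 / real d)"] by simp
  finally have "measure_pmf.prob ?p (- T) ^ (d * k) \<le> exp (- (1 / real d)) ^ (d * k)"
    by (intro power_mono) auto
  also have "\<dots> = exp (- 1) ^ k" using pos by (simp add: power_mult flip: exp_of_nat_mult)
  also have "\<dots> \<le> (1 / 2) ^ k"
    using exp_ge_add_one_self[of 1] by (intro power_mono) (auto simp: exp_minus field_simps)
  finally show ?thesis using prob_replicate_pmf_prefix[OF m, of ?p "- T"] by simp
qed

context padded
begin

lemma prob_good_samples:
  assumes e0: "e0 \<le> L"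
  shows "1 - 1 / real n \<le> measure_pmf.prob (replicate_pmf (2 ^ e0 * (4 * levels)) (pmf_of_set {0..<int cols}))
    {ys. good_samples f e0 (map nat ys)}"
proof -
  let ?m = "2 ^ e0 * (4 * levels)" and ?S = "{0..<int cols}"
  let ?T = "\<lambda>j i e. int ` near_optimal (f j i) e"
  let ?good = "{ys. good_samples f e0 (map nat ys)}"
  define P where "P = replicate_pmf ?m (pmf_of_set ?S)"
  define Q where "Q = {(j, i, e). j < n \<and> i < n \<and> e \<le> e0 \<and> cols div 2 ^ e < card (near_optimal (f j i) e)}"
  define miss where "miss = (\<lambda>(j, i, e). {ys. \<forall>b<2 ^ e * (4 * levels). ys ! b \<notin> ?T j i e})"
  have Q_sub: "Q \<subseteq> {..<n} \<times> {..<n} \<times> {..e0}" by (auto simp: Q_def)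
  then have "finite Q" by (rule finite_subset) simp
  have "card Q \<le> n * (n * Suc e0)" using card_mono[OF _ Q_sub] by (simp add: card_cartesian_product)
  also have "\<dots> \<le> n * (n * (2 * n))" using e0 L_le n_pos by (intro mult_le_mono2) simp
  finally have card_Q: "real (card Q) \<le> 2 * real n ^ 3"
    by (simp add: power3_eq_cube mult_ac flip: of_nat_mult of_nat_le_iff)
  have "- ?good \<inter> set_pmf P \<subseteq> (\<Union>q\<in>Q. miss q)"
  proof
    fix ys assume "ys \<in> - ?good \<inter> set_pmf P"
    then have "\<not> good_samples f e0 (map nat ys)" and len: "length ys = ?m"
      unfolding P_def set_replicate_pmf by auto
    then obtain j i e where Q: "(j, i, e) \<in> Q"
      and none: "\<forall>b<2 ^ e * (4 * levels). map nat ys ! b \<notin> near_optimal (f j i) e"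
      unfolding good_samples_def Q_def by blast
    have "2 ^ e * (4 * levels) \<le> ?m" using Q by (intro mult_le_mono1 power_increasing) (auto simp: Q_def)
    then have "map nat ys ! b = nat (ys ! b)" if "b < 2 ^ e * (4 * levels)" for b
      using less_le_trans[OF that] len by simp
    then have "ys \<in> miss (j, i, e)" using none by (force simp: miss_def)
    then show "ys \<in> (\<Union>q\<in>Q. miss q)" using Q by blast
  qed
  then have "measure_pmf.prob P (- ?good) \<le> measure_pmf.prob P (\<Union>q\<in>Q. miss q)"
    using measure_Int_set_pmf[of P "- ?good"] by (metis measure_pmf.finite_measure_mono sets_measure_pmf UNIV_I)
  also have "\<dots> \<le> (\<Sum>q\<in>Q. measure_pmf.prob P (miss q))" using \<open>finite Q\<close> by (intro measure_UNION_le) auto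
  also have "\<dots> \<le> (\<Sum>q\<in>Q. 1 / (2 * real n) ^ 4)"
  proof (rule sum_mono)
    fix q assume "q \<in> Q"
    then obtain j i e where q: "q = (j, i, e)" "e \<le> e0" "cols div 2 ^ e < card (near_optimal (f j i) e)"
      by (auto simp: Q_def)
    have "cols = cols div 2 ^ e * 2 ^ e"
      using q(2) e0 le_imp_power_dvd[of e L "2::nat"] by (simp add: cols_def)
    also have "\<dots> \<le> card (near_optimal (f j i) e) * 2 ^ e" using q(3) by (intro mult_le_mono1) simp
    finally have "card ?S \<le> card (?T j i e) * 2 ^ e" by (simp add: card_image)
    moreover have "2 ^ e * (4 * levels) \<le> ?m" using q(2) by (intro mult_le_mono1 power_increasing) auto
    moreover have "?T j i e \<subseteq> ?S" by (auto simp: near_optimal_def)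
    ultimately have "measure_pmf.prob P (miss q) \<le> (1 / 2) ^ (4 * levels)"
      unfolding P_def miss_def q(1) prod.case by (intro prob_samples_miss) auto
    also have "\<dots> = ((1 / 2) ^ levels) ^ 4" by (simp only: mult.commute[of 4] power_mult)
    also have "\<dots> = 1 / (2 * real cols) ^ 4" by (simp add: levels_def cols_def power_one_over power_divide)
    also have "\<dots> \<le> 1 / (2 * real n) ^ 4"
      using n_le_cols n_pos by (intro divide_left_mono power_mono) auto
    finally show "measure_pmf.prob P (miss q) \<le> 1 / (2 * real n) ^ 4" .
  qed
  also have "\<dots> \<le> 2 * real n ^ 3 * (1 / (2 * real n) ^ 4)"
    unfolding sum_constant using card_Q by (rule mult_right_mono) simp
  also have "\<dots> \<le> 1 / real n" using n_pos by (simp add: field_simps power4_eq_xxxx power3_eq_cube)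
  finally show ?thesis
    using measure_pmf.prob_compl[of ?good P] by (simp add: Compl_eq_Diff_UNIV P_def)
qed

end

definition min_plus_alg :: "online_alg \<Rightarrow> online_alg" where
  "min_plus_alg A = \<lparr>prep = params ;; sample ;; prep_prog (prep A), query = query_prog (query A)\<rparr>"

context padded
begin

lemma fits_init_state:
  assumes "\<And>i k. i < n \<Longrightarrow> k < n \<Longrightarrow> \<bar>M $$ (i, k)\<bar> \<le> B"
  shows "fits B (init_state n M)"
proof -
  have "q div n < n" "q mod n < n" if "q < n * n" for q
    using that n_pos by (simp_all add: less_mult_imp_div_less)
  then show ?thesis using assms B_bounds by (auto simp: fits_def init_state_def)
qed

lemma min_plus_alg_run:
  assumes red: "\<And>samples. length samples = 2 ^ e0 * (4 * levels) \<Longrightarrow> set samples \<subseteq> {..<cols} \<Longrightarrow>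
      reduction W B n L e0 t_eq M V A W_eq eq_state eq_time samples nu"
    and X: "\<And>i k. i < n \<Longrightarrow> k < n \<Longrightarrow> X $$ (i, k) = M i k"
    and vs: "length vs = n" "\<And>j k. j < n \<Longrightarrow> k < n \<Longrightarrow> vs ! j $ k = V j k"
    and t: "4 * L + 2 * e0 + 6 * (2 ^ e0 * (4 * levels)) + 30 + reduction.run_cost n L e0 t_eq nu \<le> t"
  defines "P \<equiv> replicate_pmf (2 ^ e0 * (4 * levels)) (pmf_of_set {0..<int cols})"
  obtains ans where "run_online W (min_plus_alg A) n t X vs = map_pmf (\<lambda>ys. Some (ans ys)) P"
    "\<And>ys. ys \<in> set_pmf P \<Longrightarrow> good_samples (\<lambda>j i k. M i k + V j k) e0 (map nat ys) \<Longrightarrow>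
      ans ys = map (\<lambda>j. vec n (\<lambda>i. Min ((\<lambda>k. M i k + V j k) ` {..<cols}))) [0..<n]"
proof -
  interpret base: reduction W B n L e0 t_eq M V A W_eq eq_state eq_time "replicate (2 ^ e0 * (4 * levels)) 0" nu
    by (rule red) auto
  let ?s = "init_state n X"
  have "\<bar>X $$ (i, k)\<bar> \<le> B" if "i < n" "k < n" for i k
    using base.M_range[of i k] X[OF that] that n_le_cols B_bounds by simp
  then have "fits B ?s" by (rule fits_init_state)
  then obtain s r where r: "base.run_cost \<le> r"
    and s: "frame {r_cols, r_levels, r_radius, r_shifts, r_copies, r_pos} {} ?s s"
    "base.copy_regs s e0 0" "base.sampling s 0"
    and run_setup: "exec W t [params ;; sample ;; prep_prog (prep A)] ?s
      = bind_pmf P (\<lambda>ys. exec W r [prep_prog (prep A)] (fold store_sample ys s))"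
    by (rule base.exec_setup[where t = t and t' = base.run_cost and c = "prep_prog (prep A)"])
      (use t in \<open>auto simp: init_state_def base.num_samples_def P_def\<close>)
  define G where "G ys = bind_pmf (exec W r [prep_prog (prep A)] (fold store_sample ys s)) (\<lambda>r. case r of
      None \<Rightarrow> return_pmf None | Some (s, t') \<Rightarrow> serve W (query_prog (query A)) n t' s vs)" for ys
  define result where "result ys as \<longleftrightarrow> G ys = return_pmf (Some as) \<and>
      (good_samples (\<lambda>j i k. M i k + V j k) e0 (map nat ys) \<longrightarrow>
        as = map (\<lambda>j. vec n (\<lambda>i. Min ((\<lambda>k. M i k + V j k) ` {..<cols}))) [0..<n])" for ys as
  have "\<forall>ys\<in>set_pmf P. \<exists>as. result ys as"
  proof
    fix ys assume "ys \<in> set_pmf P"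
    have ys: "length ys = 2 ^ e0 * (4 * levels)" "set ys \<subseteq> {0..<int cols}"
      using \<open>ys \<in> set_pmf P\<close> cols_pos unfolding P_def set_replicate_pmf by (subst (asm) set_pmf_of_set; auto)+
    interpret reduction W B n L e0 t_eq M V A W_eq eq_state eq_time "map nat ys" nu
      by (rule red) (use ys in \<open>auto simp: nat_less_iff subset_iff\<close>)
    let ?u = "fold store_sample ys s"
    have pos: "regs s r_pos = int 0" using s(3) by (simp add: sampling_def)
    note fr = store_samples(1)[OF pos, of ys]
    have "copy_regs ?u e0 0" using s(2) frame_regs[OF fr] by (simp add: copy_regs_def)
    moreover have "q div n < n" "q mod n < n" if "q < n * n" for q
      using that n_pos by (simp_all add: less_mult_imp_div_less)
    then have "arrs ?u a_input q = M (q div n) (q mod n)" if "q < n * n" for q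
      using that X frame_arrs[OF fr] frame_arrs[OF s(1)] by (simp add: init_state_def)
    moreover have "arrs ?u a_sample x = int (map nat ys ! x)" if "x < length (map nat ys)" for x
      using store_samples(2)[OF pos, of x ys] that ys(2) nth_mem[of x ys] by force
    moreover have "arrs ?u a_trees = (\<lambda>_. 0)" "\<And>a. a_copy_regs \<le> a \<Longrightarrow> arrs ?u a = (\<lambda>_. 0)"
      using frame_arrs[OF fr] frame_arrs[OF s(1)] by (auto simp: init_state_def)
    moreover have "fits B ?u" using s(3) ys by (intro fits_store_samples) (auto simp: num_samples_def)
    ultimately obtain as where "G ys = return_pmf (Some as)"
      "good \<Longrightarrow> as = map (\<lambda>j. vec n (\<lambda>i. Min (row_sum j i ` {..<cols}))) [0..<n]"
      using prep_serve[of ?u vs r] vs r unfolding G_def by blast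
    then show "\<exists>as. result ys as" unfolding result_def by blast
  qed
  then obtain ans where ans: "\<forall>ys\<in>set_pmf P. result ys (ans ys)" by (rule bchoice[THEN exE])
  have "run_online W (min_plus_alg A) n t X vs = bind_pmf P G"
    unfolding run_online_def min_plus_alg_def online_alg.select_convs run_setup G_def by (simp add: bind_assoc_pmf)
  also have "\<dots> = bind_pmf P (\<lambda>ys. return_pmf (Some (ans ys)))"
    using ans by (intro bind_pmf_cong) (auto simp: result_def)
  finally show thesis using that ans by (auto simp: map_pmf_def result_def)
qed

lemma min_plus_alg_correct:
  assumes red: "\<And>samples. length samples = 2 ^ e0 * (4 * levels) \<Longrightarrow> set samples \<subseteq> {..<cols} \<Longrightarrow>
      reduction W B n L e0 t_eq M V A W_eq eq_state eq_time samples nu"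
    and X: "\<And>i k. i < n \<Longrightarrow> k < n \<Longrightarrow> X $$ (i, k) = M i k"
    and vs: "length vs = n" "\<And>j k. j < n \<Longrightarrow> k < n \<Longrightarrow> vs ! j $ k = V j k"
    and t: "4 * L + 2 * e0 + 6 * (2 ^ e0 * (4 * levels)) + 30 + reduction.run_cost n L e0 t_eq nu \<le> t"
  defines "D \<equiv> run_online W (min_plus_alg A) n t X vs"
  shows "None \<notin> set_pmf D"
    and "1 - 1 / real n \<le> measure_pmf.prob D
      {Some (map (\<lambda>j. vec n (\<lambda>i. Min ((\<lambda>k. M i k + V j k) ` {..<cols}))) [0..<n])}"
proof -
  let ?P = "replicate_pmf (2 ^ e0 * (4 * levels)) (pmf_of_set {0..<int cols})"
  let ?good = "{ys. good_samples (\<lambda>j i k. M i k + V j k) e0 (map nat ys)}"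
  let ?answer = "map (\<lambda>j. vec n (\<lambda>i. Min ((\<lambda>k. M i k + V j k) ` {..<cols}))) [0..<n]"
  interpret reduction W B n L e0 t_eq M V A W_eq eq_state eq_time "replicate (2 ^ e0 * (4 * levels)) 0" nu
    by (rule red) auto
  obtain ans where D: "D = map_pmf (\<lambda>ys. Some (ans ys)) ?P"
    and ans: "\<And>ys. ys \<in> set_pmf ?P \<Longrightarrow> ys \<in> ?good \<Longrightarrow> ans ys = ?answer"
    unfolding D_def by (rule min_plus_alg_run[OF red X vs t]) auto
  show "None \<notin> set_pmf D" by (auto simp: D)
  have "1 - 1 / real n \<le> measure_pmf.prob ?P (?good \<inter> set_pmf ?P)"
    using prob_good_samples[OF e0_le] by (simp add: measure_Int_set_pmf)
  also have "\<dots> \<le> measure_pmf.prob ?P ((\<lambda>ys. Some (ans ys)) -` {Some ?answer})"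
    using ans by (intro measure_pmf.finite_measure_mono) auto
  finally show "1 - 1 / real n \<le> measure_pmf.prob D {Some ?answer}" by (simp add: D)
qed

end

section \<open>Equality algorithms\<close>

lemma finite_entries:
  "finite ({int n} \<union> {\<bar>M $$ (i, k)\<bar> | i k. i < n \<and> k < n} \<union> {\<bar>vs ! j $ k\<bar> | j k. j < length vs \<and> k < n})"
  by (intro finite_UnI finite_image_set2) auto

lemma word_bound_ge: "(int n + 2) ^ c \<le> word_bound c n M vs"
  unfolding word_bound_def by (intro power_mono add_right_mono Max_ge[OF finite_entries]) auto

lemma word_bound_le:
  assumes "int n \<le> K" "\<And>i k. i < n \<Longrightarrow> k < n \<Longrightarrow> \<bar>M $$ (i, k)\<bar> \<le> K"
    "\<And>j k. j < length vs \<Longrightarrow> k < n \<Longrightarrow> \<bar>vs ! j $ k\<bar> \<le> K"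
  shows "word_bound c n M vs \<le> (K + 2) ^ c"
proof -
  let ?S = "{int n} \<union> {\<bar>M $$ (i, k)\<bar> | i k. i < n \<and> k < n} \<union> {\<bar>vs ! j $ k\<bar> | j k. j < length vs \<and> k < n}"
  have "int n \<le> Max ?S" by (rule Max_ge[OF finite_entries]) simp
  moreover have "Max ?S \<le> K" using finite_entries[of n M vs] assms by (subst Max_le_iff) auto
  ultimately show ?thesis unfolding word_bound_def by (intro power_mono) auto
qed

definition solves_equality :: "online_alg \<Rightarrow> nat \<Rightarrow> (nat \<Rightarrow> nat) \<Rightarrow> bool" where
  "solves_equality A c t \<longleftrightarrow> deterministic (prep A) \<and> deterministic (query A) \<and>
     (\<forall>n>0. \<forall>M vs. omv_instance n M vs \<longrightarrow> run_online (word_bound c n M vs) A n (t n) M vs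
        = return_pmf (Some (map (answer ex_equality_OMv n M) vs)))"

lemma solves_equality_run:
  assumes A: "solves_equality A c t" and n: "0 < n" "int n \<le> K"
    and entries: "\<And>i k. i < n \<Longrightarrow> k < n \<Longrightarrow> \<bar>M i k\<bar> \<le> K" "\<And>j k. j < n \<Longrightarrow> k < n \<Longrightarrow> \<bar>v j k\<bar> \<le> K"
  shows "\<exists>st \<tau>. equality_run ((K + 2) ^ c) A n (t n) M v st \<tau>"
proof -
  let ?M = "mat n n (\<lambda>(i, k). M i k)" and ?vs = "map (\<lambda>j. vec n (v j)) [0..<n]"
  have "omv_instance n ?M ?vs" by (auto simp: omv_instance_def)
  then have run: "run_online (word_bound c n ?M ?vs) A n (t n) ?M ?vs
      = return_pmf (Some (map (answer ex_equality_OMv n ?M) ?vs))"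
    using A n(1) by (simp add: solves_equality_def)
  have "deterministic (prep A)" "deterministic (query A)" using A by (auto simp: solves_equality_def)
  then obtain st \<tau> t0 where first: "big_step (word_bound c n ?M ?vs) (prep A) (init_state n ?M) (st 0) t0"
    and trace: "query_trace (word_bound c n ?M ?vs) (query A) n ?vs st \<tau> (map (answer ex_equality_OMv n ?M) ?vs)"
    and time: "t0 + (\<Sum>j<length ?vs. \<tau> j) \<le> t n"
    by (rule run_online_trace[OF _ _ run])
  have W: "word_bound c n ?M ?vs \<le> (K + 2) ^ c" using n entries by (intro word_bound_le) auto
  have "arrs (st (Suc j)) a_answer i = (if \<exists>k<n. M i k = v j k then 1 else 0)" if "j < n" "i < n" for j i
  proof -
    have "get_answer n (st (Suc j)) $ i = answer ex_equality_OMv n ?M (vec n (v j)) $ i"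
      using trace that by (simp add: query_trace_def)
    also have "\<dots> = (if \<exists>k<n. M i k = v j k then 1 else 0)"
      using that by (auto simp: ex_equality_OMv_def)
    finally show ?thesis using that by (simp add: get_answer_def)
  qed
  moreover have "(\<Sum>r\<le>n. case_nat t0 \<tau> r) \<le> t n"
    using time by (simp add: sum.atMost_shift)
  ultimately have "equality_run ((K + 2) ^ c) A n (t n) M v st (case_nat t0 \<tau>)"
    using big_step_mono[OF first W] trace big_step_mono[OF _ W] by (simp add: equality_run_def query_trace_def)
  then show ?thesis by blast
qed

text \<open>
  If the queries alternate between hitting all rows and none, then every answer differs everywhere
  from the previous one.
\<close>

lemma equality_time_lower_bound:
  assumes A: "solves_equality A c t" and n: "0 < n"
  shows "n * (n - 1) \<le> t n"
proof -
  have "\<exists>st \<tau>. equality_run ((int n + 2) ^ c) A n (t n) (\<lambda>_ _. 0) (\<lambda>j _. if even j then 0 else 1) st \<tau>"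
    by (rule solves_equality_run[OF A n]) (use n in auto)
  then obtain st \<tau> where
    run: "equality_run ((int n + 2) ^ c) A n (t n) (\<lambda>_ _. 0) (\<lambda>j _. if even j then 0 else 1) st \<tau>" by blast
  then have out: "arrs (st (Suc j)) a_answer i = (if even j then 1 else 0)" if "j < n" "i < n" for j i
    using that n by (auto simp: equality_run_def)
  have "n \<le> \<tau> (Suc (Suc j))" if j: "Suc j < n" for j
  proof -
    let ?s = "put_query n (vec n (\<lambda>_. if even (Suc j) then 0 else 1)) (st (Suc j))"
    have "big_step ((int n + 2) ^ c) (query A) ?s (st (Suc (Suc j))) (\<tau> (Suc (Suc j)))"
      using run j unfolding equality_run_def by blast
    from card_changed_cells[OF this, of a_answer]
    have "finite {p. arrs (st (Suc (Suc j))) a_answer p \<noteq> arrs ?s a_answer p}"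
      "card {p. arrs (st (Suc (Suc j))) a_answer p \<noteq> arrs ?s a_answer p} \<le> \<tau> (Suc (Suc j))" by auto
    moreover have "{..<n} \<subseteq> {p. arrs (st (Suc (Suc j))) a_answer p \<noteq> arrs ?s a_answer p}"
      using out[of j] out[of "Suc j"] j by (auto simp: put_query_def split: if_splits)
    ultimately show ?thesis using card_mono[of _ "{..<n}"] by fastforce
  qed
  then have "(\<Sum>j<n - 1. n) \<le> (\<Sum>j<n - 1. \<tau> (Suc (Suc j)))" by (intro sum_mono) simp
  also have "\<dots> = (\<Sum>r\<in>(\<lambda>j. Suc (Suc j)) ` {..<n - 1}. \<tau> r)" by (subst sum.reindex) (auto simp: inj_on_def)
  also have "\<dots> \<le> (\<Sum>r\<le>n. \<tau> r)" by (rule sum_mono2) auto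
  also have "\<dots> \<le> t n" using run by (simp add: equality_run_def)
  finally show ?thesis by (simp add: mult.commute)
qed

definition size_exp :: "nat \<Rightarrow> nat" where
  "size_exp n = (LEAST L. n \<le> 2 ^ L)"

definition radius_exp :: "nat \<Rightarrow> nat" where
  "radius_exp n = (LEAST e. n < 8 * (2 ^ e) ^ 3)"

lemma le_cube: "m \<le> m ^ 3" for m :: nat
  by (cases "m = 0") (simp_all add: self_le_power)

lemma size_exp:
  assumes "0 < n"
  shows "n \<le> 2 ^ size_exp n" "2 ^ size_exp n < 2 * n"
proof -
  have "n \<le> 2 ^ n" using less_exp[of n] by simp
  then show "n \<le> 2 ^ size_exp n" unfolding size_exp_def by (rule LeastI)
  show "2 ^ size_exp n < 2 * n"
    using assms not_less_Least[of _ "\<lambda>L. n \<le> 2 ^ L"] by (cases "size_exp n") (auto simp: size_exp_def not_le)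
qed

lemma radius_exp:
  assumes "0 < n"
  shows "n < 8 * (2 ^ radius_exp n) ^ 3" "(2 ^ radius_exp n) ^ 3 \<le> n"
proof -
  have "n < 8 * (2 ^ n) ^ 3" using less_exp[of n] le_cube[of "2 ^ n"] by linarith
  then show "n < 8 * (2 ^ radius_exp n) ^ 3" unfolding radius_exp_def by (rule LeastI)
  show "(2 ^ radius_exp n) ^ 3 \<le> n"
  proof (cases "radius_exp n")
    case (Suc e)
    then have "\<not> n < 8 * (2 ^ e) ^ 3"
      using not_less_Least[of e "\<lambda>e. n < 8 * (2 ^ e) ^ 3"] by (simp add: radius_exp_def)
    then show ?thesis using Suc by (simp add: power_mult_distrib)
  qed (use assms in simp)
qed

lemma radius_exp_le_size_exp: "0 < n \<Longrightarrow> radius_exp n \<le> size_exp n"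
proof -
  assume "0 < n"
  then have "(2::nat) ^ radius_exp n \<le> 2 ^ size_exp n"
    using radius_exp(2)[of n] size_exp(1)[of n] le_cube[of "2 ^ radius_exp n"] by linarith
  then show ?thesis by simp
qed

lemma le_power_base: "m \<le> b \<Longrightarrow> m \<le> (n + 2) ^ b" for m b n :: nat
  using less_exp[of b] power_mono[of 2 "n + 2" b] by linarith

section \<open>Instances of bounded monotone min-plus multiplication\<close>

locale min_plus_instance =
  fixes A :: online_alg and t :: "nat \<Rightarrow> nat" and X :: "int mat" and vs :: "int vec list"
    and W :: int and c C b n nu :: nat
  assumes solves: "solves_equality A c t" and pos: "0 < n" and inst: "bounded_monotone_instance n X vs"
    and time_cubic: "t n \<le> C * n ^ 3"
    and b: "C + 20 + 2 * c + reg_sum (prep A) + reg_sum (query A) \<le> b"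
    and W: "(int n + 2) ^ (16 * b) \<le> W"
    and nu_bound: "\<And>D. 0 < D \<Longrightarrow> n < 8 * D ^ 3 \<or> (2 ^ size_exp n) ^ 3 < 24 * D ^ 3 * t n \<Longrightarrow>
        2 ^ size_exp n \<le> nu * D"
begin

definition M :: "nat \<Rightarrow> nat \<Rightarrow> int" where "M i k = X $$ (i, min k (n - 1))"
definition V :: "nat \<Rightarrow> nat \<Rightarrow> int" where "V j k = vs ! j $ min k (n - 1)"

lemma le_word:
  assumes "m \<le> (n + 2) ^ a" "a \<le> b"
  shows "int m \<le> (int n + 2) ^ b"
proof -
  have "m \<le> (n + 2) ^ b" using assms power_increasing[of a b "n + 2"] by linarith
  then show ?thesis by (metis of_nat_add of_nat_le_iff of_nat_numeral of_nat_power)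
qed

sublocale padded W "(int n + 2) ^ b" n "size_exp n"
proof
  show "2 \<le> (int n + 2) ^ b" using le_word[of 2 1] b by simp
  show "((int n + 2) ^ b) ^ 16 \<le> W" using W by (simp add: mult.commute flip: power_mult)
  have "1000 \<le> (n + 2) ^ 10" using power_mono[of 2 "n + 2" 10] by simp
  then have "1000 * (n + 2) ^ 4 \<le> (n + 2) ^ 10 * (n + 2) ^ 4" by (rule mult_le_mono1)
  also have "\<dots> = (n + 2) ^ 14" by (simp flip: power_add)
  finally show "int (1000 * (n + 2) ^ 4) \<le> (int n + 2) ^ b" using b by (intro le_word[of _ 14]) linarith+
qed (use pos size_exp[of n] in auto)

lemma clip: "min k (n - 1) < n"
  using pos by simp

lemma M_bounds: "i < n \<Longrightarrow> 1 \<le> M i k \<and> M i k \<le> int n"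
  and V_bounds: "j < n \<Longrightarrow> 1 \<le> V j k \<and> V j k \<le> int n"
  using inst clip by (auto simp: bounded_monotone_instance_def M_def V_def)

lemma radius_le: "2 ^ radius_exp n \<le> n"
  using radius_exp(2)[OF pos] le_cube[of "2 ^ radius_exp n"] by linarith

lemma copies_fit:
  "int (2 ^ radius_exp n * (4 * levels) * (2 * 2 ^ radius_exp n + 1) * Suc (t n)) \<le> (int n + 2) ^ b"
proof (rule le_word)
  let ?N = "n + 2"
  have "C * n ^ 3 \<le> C * ?N ^ 3" by (intro mult_le_mono2 power_mono) auto
  then have t: "Suc (t n) \<le> (C + 1) * ?N ^ 3"
    using time_cubic one_le_power[of ?N 3] unfolding add_mult_distrib by linarith
  have "2 ^ radius_exp n * (4 * levels) * (2 * 2 ^ radius_exp n + 1) * Suc (t n)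
      \<le> ?N * (4 * ?N) * (2 * ?N) * ((C + 1) * ?N ^ 3)"
    using radius_le L_le t by (intro mult_le_mono) (auto simp: levels_def)
  also have "\<dots> = 8 * (C + 1) * ?N ^ 6"
  proof -
    have "x * (4 * x) * (2 * x) * (y * x ^ 3) = 8 * y * x ^ 6" for x y :: nat
      by (simp add: power_numeral_reduce)
    then show ?thesis .
  qed
  also have "\<dots> \<le> ?N ^ 3 * ?N ^ (C + 1) * ?N ^ 6"
  proof (intro mult_le_mono order_refl)
    show "8 \<le> ?N ^ 3" using power_mono[of 2 ?N 3] by simp
    show "C + 1 \<le> ?N ^ (C + 1)" by (rule le_power_base) simp
  qed
  also have "\<dots> = ?N ^ (C + 10)" by (simp only: flip: power_add) (simp add: add.commute)
  finally show "2 ^ radius_exp n * (4 * levels) * (2 * 2 ^ radius_exp n + 1) * Suc (t n) \<le> ?N ^ (C + 10)" .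
qed (use b in simp)

lemma equality_word_fits: "(3 * int n + 2) ^ c \<le> (int n + 2) ^ b"
proof -
  have "(3 * n + 2) ^ c \<le> ((n + 2)^2) ^ c" by (intro power_mono) (auto simp: power2_eq_square)
  also have "\<dots> = (n + 2) ^ (2 * c)" by (rule power_mult[symmetric])
  finally have "int ((3 * n + 2) ^ c) \<le> (int n + 2) ^ b" using b by (intro le_word[of _ "2 * c"]) auto
  then show ?thesis by (simp add: add.commute)
qed

definition copy_run_at :: "nat \<Rightarrow> nat \<Rightarrow> (nat \<Rightarrow> state) \<Rightarrow> (nat \<Rightarrow> nat) \<Rightarrow> bool" where
  "copy_run_at k0 d st \<tau> \<longleftrightarrow> equality_run ((3 * int n + 2) ^ c) A n (t n) (\<lambda>i k. M i k - M i k0)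
     (\<lambda>j k. V j k0 - V j k - int d) st \<tau>"

lemma equality_runs: "\<exists>st \<tau>. \<forall>k0 d. d \<le> 2 * 2 ^ radius_exp n \<longrightarrow> copy_run_at k0 d (st k0 d) (\<tau> k0 d)"
proof -
  have "\<exists>st \<tau>. copy_run_at k0 d st \<tau>" if d: "d \<le> 2 * 2 ^ radius_exp n" for k0 d
  proof -
    have "int d \<le> 2 * int n" using d radius_le by linarith
    then have "\<bar>V j k0 - V j k - int d\<bar> \<le> 3 * int n" if "j < n" for j k
      using V_bounds[OF that, of k] V_bounds[OF that, of k0] by linarith
    moreover have "\<bar>M i k - M i k0\<bar> \<le> 3 * int n" if "i < n" for i k
      using M_bounds[OF that, of k] M_bounds[OF that, of k0] by linarith
    ultimately show ?thesis
      unfolding copy_run_at_def by (intro solves_equality_run[OF solves pos]) auto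
  qed
  then have "\<forall>k0 d. \<exists>st \<tau>. d \<le> 2 * 2 ^ radius_exp n \<longrightarrow> copy_run_at k0 d st \<tau>" by blast
  then show ?thesis by metis
qed

lemma mono_on_clipped:
  assumes "\<forall>k. k + 1 < n \<longrightarrow> f k \<le> (f (k + 1) :: int)"
  shows "monotone_on_cols (\<lambda>k. f (min k (n - 1)))"
proof -
  have "f (min k (n - 1)) \<le> f (min (k + 1) (n - 1))" for k
  proof (cases "k + 1 < n")
    case False
    then have "min k (n - 1) = n - 1" "min (k + 1) (n - 1) = n - 1" by auto
    then show ?thesis by simp
  qed (use assms in \<open>auto simp: min_def\<close>)
  then show ?thesis by (simp add: monotone_on_cols_def)
qed

lemma reduction:
  assumes run: "\<forall>k0 d. d \<le> 2 * 2 ^ radius_exp n \<longrightarrow> copy_run_at k0 d (eq_state k0 d) (eq_time k0 d)"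
    and samples: "length samples = 2 ^ radius_exp n * (4 * levels)" "set samples \<subseteq> {..<cols}"
  shows "reduction W ((int n + 2) ^ b) n (size_exp n) (radius_exp n) (t n) M V A ((3 * int n + 2) ^ c)
    eq_state eq_time samples nu"
proof -
  have reg_sum: "int (reg_sum (prep A)) \<le> (int n + 2) ^ b" "int (reg_sum (query A)) \<le> (int n + 2) ^ b"
    using b by (auto intro!: le_word[of _ b] le_power_base)
  interpret equality_copies W "(int n + 2) ^ b" n "size_exp n" "radius_exp n" "t n" M V A "(3 * int n + 2) ^ c"
    eq_state eq_time samples
  proof
    show "deterministic (prep A)" "deterministic (query A)" using solves by (auto simp: solves_equality_def)
    show "M i k = M i (min k (n - 1))" "V j k = V j (min k (n - 1))" for i j k by (simp_all add: M_def V_def)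
  qed (use run samples M_bounds V_bounds radius_exp[OF pos] radius_exp_le_size_exp[OF pos] copies_fit
      equality_word_fits reg_sum in \<open>auto simp: levels_def copy_run_at_def\<close>)
  show ?thesis
  proof
    show "cols \<le> nu * 2 ^ e" if "radius_ok (2 ^ e)" for e
      using nu_bound[of "2 ^ e"] that by (simp add: radius_ok_def cols_def)
    show "rows_mono \<or> cols_mono \<or> (\<forall>j<n. monotone_on_cols (V j)) \<or> time_mono"
      using inst unfolding bounded_monotone_instance_def
    proof (elim conjE disjE)
      assume "rows_nondecreasing n X"
      then have "monotone_on_cols (M i)" if "i < n" for i using mono_on_clipped[of "\<lambda>k. X $$ (i, k)"] that
        by (simp add: rows_nondecreasing_def M_def[abs_def])
      then have rows_mono by (simp add: rows_mono_def)
      then show ?thesis by blast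
    next
      assume "cols_nondecreasing n X"
      then have cols_mono using clip by (simp add: cols_mono_def cols_nondecreasing_def M_def)
      then show ?thesis by blast
    next
      assume "queries_nondecreasing n vs"
      then have "monotone_on_cols (V j)" if "j < n" for j using mono_on_clipped[of "\<lambda>k. vs ! j $ k"] that
        by (simp add: queries_nondecreasing_def V_def[abs_def])
      then show ?thesis by blast
    next
      assume "queries_nondecreasing_in_time n vs"
      then have time_mono using clip by (simp add: time_mono_def queries_nondecreasing_in_time_def V_def)
      then show ?thesis by blast
    qed
  qed
qed

lemma clipped_answer:
  "map (\<lambda>j. vec n (\<lambda>i. Min ((\<lambda>k. M i k + V j k) ` {..<cols}))) [0..<n]
    = map (answer bounded_monotone_min_plus_OMv n X) vs"
proof (rule nth_equalityI)
  have vs: "length vs = n" using inst by (simp add: bounded_monotone_instance_def omv_instance_def)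
  then show "length (map (\<lambda>j. vec n (\<lambda>i. Min ((\<lambda>k. M i k + V j k) ` {..<cols}))) [0..<n])
      = length (map (answer bounded_monotone_min_plus_OMv n X) vs)" by simp
  have "(\<lambda>k. M i k + V j k) ` {..<cols} = {X $$ (i, k) + vs ! j $ k | k. k < n}" for i j
  proof (intro subset_antisym subsetI)
    fix x assume "x \<in> (\<lambda>k. M i k + V j k) ` {..<cols}"
    then show "x \<in> {X $$ (i, k) + vs ! j $ k | k. k < n}" using clip by (auto simp: M_def V_def)
  next
    fix x assume "x \<in> {X $$ (i, k) + vs ! j $ k | k. k < n}"
    then obtain k where k: "k < n" "x = M i k + V j k" by (auto simp: M_def V_def min_absorb1)
    then show "x \<in> (\<lambda>k. M i k + V j k) ` {..<cols}" using n_le_cols by auto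
  qed
  then show "map (\<lambda>j. vec n (\<lambda>i. Min ((\<lambda>k. M i k + V j k) ` {..<cols}))) [0..<n] ! j
      = map (answer bounded_monotone_min_plus_OMv n X) vs ! j"
    if "j < length (map (\<lambda>j. vec n (\<lambda>i. Min ((\<lambda>k. M i k + V j k) ` {..<cols}))) [0..<n])" for j
    using that vs by (simp add: bounded_monotone_min_plus_OMv_def)
qed

definition time_bound :: nat where
  "time_bound = (4100 + 65 * C) * (Suc (size_exp n) * (n * n * nu))"

lemma min_plus_alg_solves:
  assumes radius: "2 ^ radius_exp n * 2 ^ radius_exp n \<le> nu" and time_le: "t n \<le> C * (n * n * nu)"
  defines "D \<equiv> run_online W (min_plus_alg A) n time_bound X vs"
  shows "None \<notin> set_pmf D"
  and "1 - 1 / real n \<le> measure_pmf.prob D {Some (map (answer bounded_monotone_min_plus_OMv n X) vs)}"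
proof -
  obtain eq_state eq_time where
    run: "\<forall>k0 d. d \<le> 2 * 2 ^ radius_exp n \<longrightarrow> copy_run_at k0 d (eq_state k0 d) (eq_time k0 d)"
    using equality_runs by blast
  note red = reduction[OF run]
  interpret reduction W "(int n + 2) ^ b" n "size_exp n" "radius_exp n" "t n" M V A "(3 * int n + 2) ^ c"
      eq_state eq_time "replicate (2 ^ radius_exp n * (4 * levels)) 0" nu
    by (rule red) auto
  define Z where "Z = levels * (n * n * nu)"
  have nu1: "1 \<le> nu" using radius by (cases nu) auto
  have "4 * size_exp n + 2 * radius_exp n + 6 * (2 ^ radius_exp n * (4 * levels)) + 30 \<le> 100 * Z"
  proof -
    have "levels * n \<le> Z" "levels \<le> Z"
      unfolding Z_def using nu1 pos by simp_all
    moreover have "2 ^ radius_exp n * (4 * levels) \<le> 4 * (levels * n)"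
      using mult_le_mono1[OF radius_le, of "4 * levels"] by simp
    ultimately show ?thesis using e0_le by (simp add: levels_def)
  qed
  then have time: "4 * size_exp n + 2 * radius_exp n + 6 * (2 ^ radius_exp n * (4 * levels)) + 30
      + run_cost \<le> time_bound"
    using run_cost_le[OF radius time_le nu1] by (simp add: time_bound_def Z_def levels_def algebra_simps)
  have "length vs = n" using inst by (simp add: bounded_monotone_instance_def omv_instance_def)
  then show "None \<notin> set_pmf D"
    "1 - 1 / real n \<le> measure_pmf.prob D {Some (map (answer bounded_monotone_min_plus_OMv n X) vs)}"
    using min_plus_alg_correct[OF red, of X vs] time clipped_answer
    unfolding D_def by (auto simp: M_def V_def min_absorb1)
qed

end

section \<open>Running time\<close>

lemma bigo_imp_bound:
  fixes t :: "nat \<Rightarrow> nat"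
  assumes "(\<lambda>n. real (t n)) \<in> O(\<lambda>n. real n powr a)" and a: "0 \<le> a"
  obtains C where "1 \<le> C" "\<And>n. 0 < n \<Longrightarrow> real (t n) \<le> C * real n powr a"
proof -
  obtain c where "eventually (\<lambda>n. norm (real (t n)) \<le> c * norm (real n powr a)) sequentially"
    using landau_o.bigE[OF assms(1)] by blast
  then obtain n0 where n0: "\<And>n. n0 \<le> n \<Longrightarrow> real (t n) \<le> c * real n powr a"
    unfolding eventually_sequentially by auto
  define C where "C = max 1 (max c (real (\<Sum>n<n0. t n)))"
  have "real (t n) \<le> C * real n powr a" if n: "0 < n" for n
  proof (cases "n0 \<le> n")
    case True
    have "c * real n powr a \<le> C * real n powr a" unfolding C_def by (intro mult_right_mono) auto
    then show ?thesis using n0[OF True] by linarith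
  next
    case False
    then have "t n \<le> (\<Sum>n<n0. t n)" by (intro member_le_sum) auto
    then have "real (t n) \<le> C * 1" unfolding C_def by linarith
    also have "\<dots> \<le> C * real n powr a" using n a by (intro mult_left_mono ge_one_powr_ge_zero) (auto simp: C_def)
    finally show ?thesis .
  qed
  then show thesis using that[of C] by (simp add: C_def)
qed

lemma exponent_le_1:
  assumes A: "solves_equality A c t" and t: "(\<lambda>n. real (t n)) \<in> O(\<lambda>n. real n powr (3 - \<epsilon>))"
  shows "\<epsilon> \<le> 1"
proof (rule ccontr)
  assume "\<not> \<epsilon> \<le> 1"
  then have small: "(\<lambda>n. real n powr (3 - \<epsilon>)) \<in> o(\<lambda>n. real n * (real n - 1))" by real_asymp
  have "(\<lambda>n. real n * (real n - 1)) \<in> O(\<lambda>n. real (t n))"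
  proof (rule bigoI[of _ 1], rule eventually_mono[OF eventually_gt_at_top[of 0]])
    fix n :: nat assume n: "0 < n"
    have "real (n * (n - 1)) \<le> real (t n)" using equality_time_lower_bound[OF A n] by (simp only: of_nat_le_iff)
    then show "norm (real n * (real n - 1)) \<le> 1 * norm (real (t n))" using n by (simp add: of_nat_diff)
  qed
  then have "(\<lambda>n. real n * (real n - 1)) \<in> o(\<lambda>n. real n * (real n - 1))"
    using t small by (metis landau_o.big_trans landau_o.big_small_trans)
  then have "eventually (\<lambda>n. real n * (real n - 1) = 0) sequentially"
    by (rule landau_o.small_refl_iff[THEN iffD1])
  moreover have "eventually (\<lambda>n. real n * (real n - 1) > 0) sequentially" by real_asymp
  ultimately have "eventually (\<lambda>n::nat. False) sequentially" by eventually_elim linarith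
  then show False by simp
qed

lemma size_exp_le:
  assumes n: "3 \<le> n"
  shows "real (Suc (size_exp n)) \<le> 4 * ln (real n)"
proof -
  have "exp 1 \<le> real n" using exp_le n by linarith
  then have ln: "1 \<le> ln (real n)" using n by (simp add: ln_ge_iff)
  have "real (2 ^ size_exp n) \<le> real (2 * n)"
    using less_imp_le[OF size_exp(2)[of n]] n by (simp only: of_nat_le_iff)
  then have "ln (2 ^ size_exp n) \<le> ln (2 * real n)" using n by (subst ln_le_cancel_iff) auto
  then have "(real (size_exp n) - 1) * ln 2 \<le> ln (real n)" using n by (simp add: ln_realpow ln_mult algebra_simps)
  moreover have "(real (size_exp n) - 1) * (2 / 3) \<le> (real (size_exp n) - 1) * ln 2" if "1 \<le> size_exp n"
    using that ln2_ge_two_thirds by (intro mult_left_mono) auto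
  ultimately show ?thesis using ln by (cases "1 \<le> size_exp n") auto
qed

definition cutoff :: "real \<Rightarrow> real \<Rightarrow> nat \<Rightarrow> nat" where
  "cutoff C \<epsilon> n = nat \<lceil>(4 + 24 * C) * real n powr (1 - \<epsilon> / 3)\<rceil>"

lemma cutoff_time_bigo:
  assumes "1 \<le> C" "\<epsilon> \<le> 1"
  shows "(\<lambda>n. real (K * (Suc (size_exp n) * (n * n * cutoff C \<epsilon> n))))
    \<in> O(\<lambda>n. real n powr (3 - \<epsilon> / 3) * ln (real n))"
proof -
  have "(\<lambda>n. real (Suc (size_exp n))) \<in> O(\<lambda>n. ln (real n))"
    using size_exp_le by (intro bigoI[of _ 4] eventually_mono[OF eventually_ge_at_top[of 3]]) fastforce
  moreover have "(\<lambda>n. real (cutoff C \<epsilon> n)) \<in> O(\<lambda>n. real n powr (1 - \<epsilon> / 3))"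
  proof (rule bigoI[of _ "5 + 24 * C"], rule eventually_mono[OF eventually_gt_at_top[of 0]])
    fix n :: nat assume "0 < n"
    let ?x = "real n powr (1 - \<epsilon> / 3)"
    have "1 \<le> ?x" using \<open>0 < n\<close> assms by (intro ge_one_powr_ge_zero) auto
    moreover have "0 \<le> (4 + 24 * C) * ?x" using assms by simp
    then have "real (cutoff C \<epsilon> n) \<le> (4 + 24 * C) * ?x + 1" unfolding cutoff_def by linarith
    ultimately show "norm (real (cutoff C \<epsilon> n)) \<le> (5 + 24 * C) * norm ?x" by (simp add: distrib_right)
  qed
  ultimately have "(\<lambda>n. real K * (real (Suc (size_exp n)) * (real n * real n * real (cutoff C \<epsilon> n)))) \<in>
      O(\<lambda>n. 1 * (ln (real n) * (real n * real n * real n powr (1 - \<epsilon> / 3))))"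
    by (intro landau_o.big.mult landau_o.big_refl) simp_all
  also have "(\<lambda>n. 1 * (ln (real n) * (real n * real n * real n powr (1 - \<epsilon> / 3))))
      \<in> O(\<lambda>n. real n powr (3 - \<epsilon> / 3) * ln (real n))"
    by real_asymp
  finally show ?thesis by (simp only: of_nat_mult mult_ac)
qed

text \<open>In the next lemmas, \<open>x\<close> stands for \<open>n powr (1 - \<epsilon> / 3)\<close>, whose cube is \<open>n powr (3 - \<epsilon>)\<close>.\<close>

context
  fixes C x :: real and n tn nu :: nat
  assumes C: "1 \<le> C" and n: "0 < n" and x: "1 \<le> x" "x \<le> real n" "real n ^ 2 \<le> x ^ 3"
    and tn: "real tn \<le> C * x ^ 3" and nu: "(4 + 24 * C) * x \<le> real nu"
begin

lemma radius_bound: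
  assumes D: "0 < D" "n < 8 * D ^ 3 \<or> (2 ^ size_exp n) ^ 3 < 24 * D ^ 3 * tn"
  shows "2 ^ size_exp n \<le> nu * D"
proof -
  let ?N = "real (2 ^ size_exp n)"
  have "?N ^ 3 \<le> 64 * C * (x ^ 3 * real D ^ 3)"
    using D(2)
  proof
    assume "n < 8 * D ^ 3"
    then have "real n \<le> real (8 * D ^ 3)" by linarith
    then have "real n ^ 2 * real n \<le> x ^ 3 * (8 * real D ^ 3)" using x by (intro mult_mono) auto
    moreover have "?N \<le> real (2 * n)" using size_exp(2)[OF n] by (simp only: of_nat_le_iff)
    then have "?N ^ 3 \<le> real (2 * n) ^ 3" by (intro power_mono) auto
    moreover have "real (2 * n) ^ 3 = 8 * (real n ^ 2 * real n)" by (simp add: power_numeral_reduce)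
    moreover have "1 * (x ^ 3 * real D ^ 3) \<le> C * (x ^ 3 * real D ^ 3)" using C x by (intro mult_right_mono) auto
    ultimately show ?thesis by (simp add: mult.assoc)
  next
    assume "(2 ^ size_exp n) ^ 3 < 24 * D ^ 3 * tn"
    then have "real ((2 ^ size_exp n) ^ 3) \<le> real (24 * D ^ 3 * tn)" by (simp only: of_nat_le_iff)
    then have "?N ^ 3 \<le> 24 * real D ^ 3 * real tn" by simp
    also have "\<dots> \<le> 24 * real D ^ 3 * (C * x ^ 3)" using tn by (intro mult_left_mono) auto
    also have "\<dots> \<le> 64 * C * (x ^ 3 * real D ^ 3)" using C x by (simp add: mult_ac)
    finally show ?thesis .
  qed
  also have "\<dots> \<le> (4 + 24 * C) ^ 3 * (x ^ 3 * real D ^ 3)"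
  proof (rule mult_right_mono)
    have "4 * 4 * (24 * C) \<le> (4 + 24 * C) * (4 + 24 * C) * (4 + 24 * C)" using C by (intro mult_mono) auto
    then show "64 * C \<le> (4 + 24 * C) ^ 3" using C by (simp add: power3_eq_cube)
  qed (use x in simp)
  finally have "?N ^ 3 \<le> ((4 + 24 * C) * x * real D) ^ 3" by (simp add: power_mult_distrib mult_ac)
  then have "?N \<le> (4 + 24 * C) * x * real D" using C x by (auto intro: power_le_imp_le_base[of _ 2])
  also have "\<dots> \<le> real nu * real D" using nu by (intro mult_right_mono) auto
  finally show ?thesis by (simp flip: of_nat_mult of_nat_le_iff)
qed

lemma x_le_nu: "x \<le> real nu"
proof -
  have "1 * x \<le> (4 + 24 * C) * x" using C x by (intro mult_right_mono) auto
  then show ?thesis using nu by simp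
qed

lemma radius_square_le: "2 ^ radius_exp n * 2 ^ radius_exp n \<le> nu"
proof -
  let ?D = "2 ^ radius_exp n :: nat"
  have "(real (?D * ?D)) ^ 3 = real (?D ^ 3) ^ 2" by (simp add: power_mult_distrib power2_eq_square)
  also have "\<dots> \<le> real n ^ 2" using radius_exp(2)[OF n]
    by (intro power_mono) (simp_all only: of_nat_le_iff of_nat_0_le_iff)
  also have "\<dots> \<le> x ^ 3" by (rule x)
  finally have "real (?D * ?D) \<le> x" using x by (auto intro: power_le_imp_le_base[of _ 2])
  then have "real (?D * ?D) \<le> real nu" using x_le_nu by linarith
  then show ?thesis by (simp only: of_nat_le_iff)
qed

lemma time_le: "tn \<le> nat \<lceil>C\<rceil> * (n * n * nu)" and time_le_cubic: "tn \<le> nat \<lceil>C\<rceil> * n ^ 3"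
proof -
  have C': "C \<le> real (nat \<lceil>C\<rceil>)" by (rule of_nat_ceiling)
  have "x ^ 3 \<le> real (n * n * nu)" "x ^ 3 \<le> real (n ^ 3)"
    using x x_le_nu by (auto simp: power3_eq_cube intro!: mult_mono)
  then have "C * x ^ 3 \<le> real (nat \<lceil>C\<rceil>) * real (n * n * nu)" "C * x ^ 3 \<le> real (nat \<lceil>C\<rceil>) * real (n ^ 3)"
    using C' C x by (auto intro!: mult_mono)
  then have "real tn \<le> real (nat \<lceil>C\<rceil> * (n * n * nu))" "real tn \<le> real (nat \<lceil>C\<rceil> * n ^ 3)"
    using tn by simp_all
  then show "tn \<le> nat \<lceil>C\<rceil> * (n * n * nu)" "tn \<le> nat \<lceil>C\<rceil> * n ^ 3" by (simp_all only: of_nat_le_iff)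
qed

end

lemma power_cutoff:
  assumes "0 < \<epsilon>" "\<epsilon> \<le> 1" "0 < n"
  defines "x \<equiv> real n powr (1 - \<epsilon> / 3)"
  shows "1 \<le> x" "x \<le> real n" "real n ^ 2 \<le> x ^ 3" "x ^ 3 = real n powr (3 - \<epsilon>)"
    "(4 + 24 * C) * x \<le> real (cutoff C \<epsilon> n)"
proof -
  show "1 \<le> x" unfolding x_def using assms by (intro ge_one_powr_ge_zero) auto
  have "x \<le> real n powr 1" unfolding x_def using assms by (intro powr_mono) auto
  then show "x \<le> real n" using assms by simp
  have "x ^ 3 = x powr 3" unfolding x_def using assms by (simp add: powr_numeral)
  also have "\<dots> = real n powr (3 - \<epsilon>)" unfolding x_def powr_powr by (simp add: algebra_simps)
  finally show x3: "x ^ 3 = real n powr (3 - \<epsilon>)" .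
  have "real n ^ 2 = real n powr 2" using assms by (simp add: powr_numeral)
  also have "\<dots> \<le> real n powr (3 - \<epsilon>)" using assms by (intro powr_mono) auto
  finally show "real n ^ 2 \<le> x ^ 3" by (simp add: x3)
  show "(4 + 24 * C) * x \<le> real (cutoff C \<epsilon> n)" unfolding cutoff_def x_def by (rule of_nat_ceiling)
qed

lemma solvable_equality:
  assumes "solvable_in_time ex_equality_OMv f"
  obtains A c t where "solves_equality A c t" "(\<lambda>n. real (t n)) \<in> O(f)"
  using assms unfolding solvable_in_time_def solves_equality_def by (auto simp: ex_equality_OMv_def)

theorem theorem5p1:
  fixes \<epsilon> :: real
  assumes "\<epsilon> > 0"
    and "solvable_in_time ex_equality_OMv (\<lambda>n. real n powr (3 - \<epsilon>))"
  shows "solvable_in_time_with_prob bounded_monotone_min_plus_OMv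
           (\<lambda>n. real n powr (3 - \<epsilon> / 3) * ln (real n)) (\<lambda>n. 1 - 1 / real n)"
proof -
  obtain A c t where A: "solves_equality A c t" and t: "(\<lambda>n. real (t n)) \<in> O(\<lambda>n. real n powr (3 - \<epsilon>))"
    using solvable_equality[OF assms(2)] .
  have \<epsilon>: "\<epsilon> \<le> 1" by (rule exponent_le_1[OF A t])
  obtain C where C: "1 \<le> C" "\<And>n. 0 < n \<Longrightarrow> real (t n) \<le> C * real n powr (3 - \<epsilon>)"
    using bigo_imp_bound[OF t] \<epsilon> by auto
  define b where "b = nat \<lceil>C\<rceil> + 20 + 2 * c + reg_sum (prep A) + reg_sum (query A)"
  define T where "T n = (4100 + 65 * nat \<lceil>C\<rceil>) * (Suc (size_exp n) * (n * n * cutoff C \<epsilon> n))" for n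
  have correct: "let D = run_online (word_bound (16 * b) n M vs) (min_plus_alg A) n (T n) M vs
    in None \<notin> set_pmf D \<and>
      1 - 1 / real n \<le> measure_pmf.prob D {Some (map (answer bounded_monotone_min_plus_OMv n M) vs)}"
    if n: "0 < n" and inst: "bounded_monotone_instance n M vs" for n M vs
  proof -
    note x = power_cutoff[OF assms(1) \<epsilon> n]
    note cut = C(1) n x(1-3) C(2)[OF n, folded x(4)] x(5)
    interpret min_plus_instance A t M vs "word_bound (16 * b) n M vs" c "nat \<lceil>C\<rceil>" b n "cutoff C \<epsilon> n"
      using A n inst time_le_cubic[OF cut] radius_bound[OF cut]
      by unfold_locales (auto simp: b_def intro: word_bound_ge)
    show ?thesis using min_plus_alg_solves radius_square_le[OF cut] time_le[OF cut]
      by (simp add: Let_def T_def time_bound_def)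
  qed
  have time: "(\<lambda>n. real (T n)) \<in> O(\<lambda>n. real n powr (3 - \<epsilon> / 3) * ln (real n))"
    unfolding T_def by (rule cutoff_time_bigo[OF C(1) \<epsilon>])
  have "instances bounded_monotone_min_plus_OMv = bounded_monotone_instance"
    by (simp add: bounded_monotone_min_plus_OMv_def)
  then show ?thesis unfolding solvable_in_time_with_prob_def
    by (intro exI[of _ "min_plus_alg A"] exI[of _ "16 * b"] exI[of _ T] conjI allI impI time correct) simp_all
qed

end
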